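(* Let $\Omega=(a,b)$ be a bounded interval, $1<\alpha\le2$, $0\le p\le1$, $\lambda\ge0$, $m\in C^1(\overline\Omega)$ and $c\in C(\overline\Omega)$ with $c(x)-\frac12 m'(x)>0$ on $\overline\Omega$. For $u,v\in H_0^{\alpha/2}(\Omega)$ define $$\begin{aligned}A(u,v)={}&-(1-p)\left({}_a\mathbb{D}_x^{\frac\alpha2,\lambda}u,\ {}_x\mathbb{D}_b^{\frac\alpha2,\lambda}v\right)-p\left({}_x\mathbb{D}_b^{\frac\alpha2,\lambda}u,\ {}_a\mathbb{D}_x^{\frac\alpha2,\lambda}v\right)+(1-p)\lambda^\alpha(u,v)+p\lambda^\alpha(u,v)\\&+\alpha(1-2p)\lambda^{\alpha-1}\left({}_a\mathbb{D}_x^{\frac\alpha2,0}u,\ {}_x\mathbb{D}_b^{1-\frac\alpha2,0}v\right)+\left({}_a\mathbb{D}_x^{\frac\alpha2,0}u,\ {}_x\mathbb{D}_b^{1-\frac\alpha2,0}(mv)\right)+(cu,v).\end{aligned}$$ Then for every $f\in H^{-\alpha/2}(\Omega)$ there is a unique $u\in H_0^{\alpha/2}(\Omega)$ such that $A(u,v)=\langle f,v\rangle$ for all $v\in H_0^{\alpha/2}(\Omega)$, and it satisfies $\|u\|_{H^{\alpha/2}(\Omega)}\lesssim\|f\|_{H^{-\alpha/2}(\Omega)}$.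
   Context: $(\cdot,\cdot)$ is the $L^2(\Omega)$ inner product and $\langle\cdot,\cdot\rangle$ the duality pairing between $H^{-\alpha/2}(\Omega)$ (the dual of $H_0^{\alpha/2}(\Omega)$) and $H_0^{\alpha/2}(\Omega)$. For $n-1\le\mu<n$ ($n$ a positive integer) and $\lambda\ge0$, ${}_a\mathbb{D}_x^{\mu,\lambda}u(x)=\frac{e^{-\lambda x}}{\Gamma(n-\mu)}\frac{d^n}{dx^n}\int_a^x\frac{e^{\lambda\xi}u(\xi)}{(x-\xi)^{\mu-n+1}}d\xi$ and ${}_x\mathbb{D}_b^{\mu,\lambda}u(x)=\frac{(-1)^ne^{\lambda x}}{\Gamma(n-\mu)}\frac{d^n}{dx^n}\int_x^b\frac{e^{-\lambda\xi}u(\xi)}{(\xi-x)^{\mu-n+1}}d\xi$ (order $0$ is the identity); for $0<\mu\le1$ they are defined on $C_0^\infty(\Omega)$ and extended by continuity to bounded operators $H_0^\mu(\Omega)\to L^2(\Omega)$. Sobolev spaces: with $\mathscr{F}[u](\omega)=\int_{\mathbb R}e^{-i\omega x}u(x)dx$, $H^\mu(\Omega)$ consists of restrictions to $\Omega$ of $\tilde u\in L^2(\mathbb R)$ with $\int|\omega|^{2\mu}|\mathscr F[\tilde u]|^2d\omega<\infty$, normed by $\|u\|^2_{H^\mu(\Omega)}=\|u\|^2_{L^2(\Omega)}+\inf_{\tilde u|_\Omega=u}\int_{\mathbb R}|\omega|^{2\mu}|\mathscr F[\tilde u](\omega)|^2d\omega$; $H_0^\mu(\Omega)$ is the closure of $C_0^\infty(\Omega)$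 in this norm. $A\lesssim B$ means $A\le CB$ with $C$ independent of $f$ and $u$. *)

theory Defs
  imports "HOL-Analysis.Analysis"
begin

definition test_fun :: "real \<Rightarrow> real \<Rightarrow> (real \<Rightarrow> real) \<Rightarrow> bool" where
  "test_fun a b \<phi> \<longleftrightarrow>
     (\<forall>k x. ((deriv ^^ k) \<phi>) differentiable (at x)) \<and>
     (\<exists>c d. a < c \<and> d < b \<and> (\<forall>x. x \<notin> {c..d} \<longrightarrow> \<phi> x = 0))"

definition fourier :: "(real \<Rightarrow> real) \<Rightarrow> real \<Rightarrow> complex" where
  "fourier w \<omega> = (LINT x|lborel. cis (- \<omega> * x) * complex_of_real (w x))"

text \<open>Admissible extensions of u from (a,b) to the real line (square integrable;
  also integrable so that the Fourier integral is the Lebesgue integral).\<close>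
definition extensions :: "real \<Rightarrow> real \<Rightarrow> (real \<Rightarrow> real) \<Rightarrow> (real \<Rightarrow> real) set" where
  "extensions a b u = {w. w \<in> borel_measurable lborel \<and> integrable lborel w \<and>
      integrable lborel (\<lambda>x. (w x)\<^sup>2) \<and> (AE x in lborel. x \<in> {a<..<b} \<longrightarrow> w x = u x)}"

definition Hnorm2 :: "real \<Rightarrow> real \<Rightarrow> real \<Rightarrow> (real \<Rightarrow> real) \<Rightarrow> ennreal" where
  "Hnorm2 \<mu> a b u =
     (\<integral>\<^sup>+ x. ennreal ((u x)\<^sup>2) * indicator {a<..<b} x \<partial>lborel) +
     (INF w \<in> extensions a b u. \<integral>\<^sup>+ \<omega>. ennreal (\<bar>\<omega>\<bar> powr (2 * \<mu>) * (cmod (fourier w \<omega>))\<^sup>2) \<partial>lborel)"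

definition Hnorm :: "real \<Rightarrow> real \<Rightarrow> real \<Rightarrow> (real \<Rightarrow> real) \<Rightarrow> real" where
  "Hnorm \<mu> a b u = sqrt (enn2real (Hnorm2 \<mu> a b u))"

definition H0 :: "real \<Rightarrow> real \<Rightarrow> real \<Rightarrow> (real \<Rightarrow> real) set" where
  "H0 \<mu> a b = {u. u \<in> borel_measurable lborel \<and>
      (\<exists>\<phi>. (\<forall>n. test_fun a b (\<phi> n)) \<and>
            (\<lambda>n. Hnorm2 \<mu> a b (\<lambda>x. u x - \<phi> n x)) \<longlonglongrightarrow> 0)}"

definition L2ip :: "real \<Rightarrow> real \<Rightarrow> (real \<Rightarrow> real) \<Rightarrow> (real \<Rightarrow> real) \<Rightarrow> real" where
  "L2ip a b g h = (LINT x:{a<..<b}|lborel. g x * h x)"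

definition ord_n :: "real \<Rightarrow> nat" where
  "ord_n \<mu> = nat (\<lfloor>\<mu>\<rfloor> + 1)"

definition DL :: "real \<Rightarrow> real \<Rightarrow> real \<Rightarrow> (real \<Rightarrow> real) \<Rightarrow> real \<Rightarrow> real" where
  "DL a \<mu> lam u x =
     exp (- lam * x) / Gamma (real (ord_n \<mu>) - \<mu>) *
     (deriv ^^ ord_n \<mu>)
       (\<lambda>y. LINT \<xi>:{a..y}|lborel. exp (lam * \<xi>) * u \<xi> * (y - \<xi>) powr (real (ord_n \<mu>) - 1 - \<mu>)) x"

definition DR :: "real \<Rightarrow> real \<Rightarrow> real \<Rightarrow> (real \<Rightarrow> real) \<Rightarrow> real \<Rightarrow> real" where
  "DR b \<mu> lam u x =
     (-1) ^ ord_n \<mu> * exp (lam * x) / Gamma (real (ord_n \<mu>) - \<mu>) *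
     (deriv ^^ ord_n \<mu>)
       (\<lambda>y. LINT \<xi>:{y..b}|lborel. exp (- lam * \<xi>) * u \<xi> * (\<xi> - y) powr (real (ord_n \<mu>) - 1 - \<mu>)) x"

text \<open>Extension by continuity of an operator D defined on test functions to H_0^mu,
  with values in L^2(a,b): the L^2-limit of D phi_n for every approximating sequence.\<close>
definition ext_op :: "real \<Rightarrow> real \<Rightarrow> real \<Rightarrow> ((real \<Rightarrow> real) \<Rightarrow> real \<Rightarrow> real) \<Rightarrow>
    (real \<Rightarrow> real) \<Rightarrow> real \<Rightarrow> real" where
  "ext_op \<mu> a b D u = (SOME g. g \<in> borel_measurable lborel \<and>
      (\<forall>\<phi>. (\<forall>n. test_fun a b (\<phi> n)) \<and>
            (\<lambda>n. Hnorm2 \<mu> a b (\<lambda>x. u x - \<phi> n x)) \<longlonglongrightarrow> 0 \<longrightarrow>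
            (\<lambda>n. \<integral>\<^sup>+ x. ennreal ((D (\<phi> n) x - g x)\<^sup>2) * indicator {a<..<b} x \<partial>lborel)
              \<longlonglongrightarrow> 0))"

definition Aform :: "real \<Rightarrow> real \<Rightarrow> real \<Rightarrow> real \<Rightarrow> real \<Rightarrow> (real \<Rightarrow> real) \<Rightarrow> (real \<Rightarrow> real)
    \<Rightarrow> (real \<Rightarrow> real) \<Rightarrow> (real \<Rightarrow> real) \<Rightarrow> real" where
  "Aform a b \<alpha> p lam m c u v =
     - (1 - p) * L2ip a b (ext_op (\<alpha>/2) a b (DL a (\<alpha>/2) lam) u) (ext_op (\<alpha>/2) a b (DR b (\<alpha>/2) lam) v)
     - p * L2ip a b (ext_op (\<alpha>/2) a b (DR b (\<alpha>/2) lam) u) (ext_op (\<alpha>/2) a b (DL a (\<alpha>/2) lam) v)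
     + (1 - p) * lam powr \<alpha> * L2ip a b u v + p * lam powr \<alpha> * L2ip a b u v
     + \<alpha> * (1 - 2 * p) * lam powr (\<alpha> - 1) *
         L2ip a b (ext_op (\<alpha>/2) a b (DL a (\<alpha>/2) 0) u) (ext_op (1 - \<alpha>/2) a b (DR b (1 - \<alpha>/2) 0) v)
     + L2ip a b (ext_op (\<alpha>/2) a b (DL a (\<alpha>/2) 0) u)
         (ext_op (1 - \<alpha>/2) a b (DR b (1 - \<alpha>/2) 0) (\<lambda>x. m x * v x))
     + L2ip a b (\<lambda>x. c x * u x) v"

definition Hdual :: "real \<Rightarrow> real \<Rightarrow> real \<Rightarrow> ((real \<Rightarrow> real) \<Rightarrow> real) set" where
  "Hdual \<mu> a b = {f.
      (\<forall>u\<in>H0 \<mu> a b. \<forall>v\<in>H0 \<mu> a b. f (\<lambda>x. u x + v x) = f u + f v) \<and>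
      (\<forall>u\<in>H0 \<mu> a b. \<forall>r. f (\<lambda>x. r * u x) = r * f u) \<and>
      (\<exists>K. \<forall>v\<in>H0 \<mu> a b. \<bar>f v\<bar> \<le> K * Hnorm \<mu> a b v)}"

definition dual_norm :: "real \<Rightarrow> real \<Rightarrow> real \<Rightarrow> ((real \<Rightarrow> real) \<Rightarrow> real) \<Rightarrow> real" where
  "dual_norm \<mu> a b f = Sup {\<bar>f v\<bar> | v. v \<in> H0 \<mu> a b \<and> Hnorm \<mu> a b v \<le> 1}"

end

theory Submission
 imports Defs "HOL-Probability.Probability"
begin

text \<open>The form is treated by the Lax--Milgram lemma on \<open>H0 s a b\<close> with \<open>s = \<alpha> / 2 > 1 / 2\<close>.
 Since \<open>s \<noteq> 1 / 2\<close>, averaging over dilations yields a fractional Hardy inequality, by which the Gagliardo seminorm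
 \<open>gag\<close> of the extension by zero of a test function is controlled by its seminorm on \<open>(a,b)\<close> and its L2 norm. As Gagliardo
 and Fourier seminorms are comparable, the infimum over all extensions in \<open>Hnorm2\<close> may be replaced by the
 extension by zero, which gives the equivalent squared norm \<open>W\<close>.

 On test functions the fractional derivatives are convolutions of \<open>u'\<close> with the truncated kernel \<open>t powr (-s)\<close>, whose
 Fourier transform is \<open>O(\<bar>\<omega>\<bar> powr (s - 1))\<close>; hence they are bounded from \<open>W\<close> to L2. By the Beta integral the product of
 a left and a right derivative becomes a one-dimensional integral against the autocorrelation \<open>R\<close> of \<open>u\<close>. In the convection
 terms the orders add up to \<open>1\<close> and this integral reduces to \<open>\<integral> u' v\<close>, so on the diagonal they contribute \<open>0\<close> and
 \<open>- \<integral> m' u\<^sup>2 / 2\<close>. In the diffusion terms two integrations by parts leave a positive weight times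
 \<open>R(0) - R(z)\<close>, that is, a Gagliardo seminorm of \<open>u\<close>; this gives coercivity, and the tempering is
 compensated by the term with \<open>lam powr \<alpha>\<close>.
 Products \<open>m v\<close> with \<open>m\<close> merely \<open>C1\<close> are handled by approximating \<open>m'\<close> uniformly by polynomials.\<close>

text \<open>Plancherel's identity enters as two inequalities, each obtained by Gaussian
  regularisation and Fatou: an upper bound for integrable, square integrable functions, and a lower
  bound on a set of continuity points. The infimum in \<open>Hnorm2\<close> dictates the second
  form: its competitors are arbitrary extensions, regular only inside (a,b), where they agree with a
  test function. The order 1/2 is critical because a dilation by \<theta> multiplies the Hardy
  integral by \<theta> powr (2 s - 1), which has to be below 1 to be absorbed. The orders in play, s
  = \<alpha>/2 in (1/2,1] and 1 - s in [0,1/2), stay away from it. Elements of \<open>H0\<close> are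
  functions and \<open>ext_op\<close> selects a limit by \<open>SOME\<close>, so the extended
  operators are linear only almost everywhere. The forms, being integrals, are still exactly
  bilinear, and Lax--Milgram is stated for a set of functions with a seminorm. The coefficient lam
  powr \<alpha> is exact for the tempering: lam^2 times the integral of z powr (1 - \<alpha>) * exp
  (- lam * z) over the half line is lam powr \<alpha> * Gamma (2 - \<alpha>).\<close>

abbreviation Borel :: "('a::topological_space \<Rightarrow> 'b::topological_space) set"
 where "Borel \<equiv> borel_measurable borel"

abbreviation lb_integral :: "(real \<Rightarrow> 'a::{banach,second_countable_topology}) \<Rightarrow> 'a" (binder "LB " 10)
 where "lb_integral f \<equiv> integral\<^sup>L lborel f"

abbreviation nn_lborel :: "(real \<Rightarrow> ennreal) \<Rightarrow> ennreal" (binder "NN " 10)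
 where "nn_lborel f \<equiv> nn_integral lborel f"

section \<open>The Fourier transform in L2\<close>

lemma integrable_pair_prod:
 fixes f g :: "real \<Rightarrow> real"
 assumes f: "integrable lborel f" and g: "integrable lborel g"
 shows "integrable (lborel \<Otimes>\<^sub>M lborel) (\<lambda>(x,y). f x * g y)"
proof -
 have [measurable]: "f \<in> Borel" "g \<in> Borel" using f g by auto
 show ?thesis
 proof (rule lborel_pair.Fubini_integrable)
  show "integrable lborel (\<lambda>x. LB y. norm (case (x,y) of (x,y) \<Rightarrow> f x * g y))"
   using f g by (simp add: abs_mult)
  show "AE x in lborel. integrable lborel (\<lambda>y. case (x,y) of (x,y) \<Rightarrow> f x * g y)"
   using g by simp
 qed simp
qed

lemma integrable_pair_bound:
 fixes f g :: "real \<Rightarrow> real" and h :: "real \<times> real \<Rightarrow> 'b::{banach,second_countable_topology}"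
 assumes f: "integrable lborel f" and g: "integrable lborel g"
  and h: "h \<in> borel_measurable (lborel \<Otimes>\<^sub>M lborel)"
  and b: "\<And>x y. norm (h (x,y)) \<le> \<bar>f x\<bar> * \<bar>g y\<bar>"
 shows "integrable (lborel \<Otimes>\<^sub>M lborel) h"
 by (rule Bochner_Integration.integrable_bound[OF integrable_pair_prod[OF f g] h])
   (use b in \<open>auto simp: abs_mult\<close>)

lemma Fubini_swap_bound:
 fixes f g :: "real \<Rightarrow> real" and h :: "real \<Rightarrow> real \<Rightarrow> 'b::{banach,second_countable_topology}"
 assumes f: "integrable lborel f" and g: "integrable lborel g"
  and h: "(\<lambda>(x,y). h x y) \<in> borel_measurable (lborel \<Otimes>\<^sub>M lborel)"
  and b: "\<And>x y. norm (h x y) \<le> \<bar>f x\<bar> * \<bar>g y\<bar>"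
 shows "(LB x. LB y. h x y) = (LB y. LB x. h x y)"
 by (rule lborel_pair.Fubini_integral[symmetric], rule integrable_pair_bound[OF f g h]) (use b in auto)

text \<open>The characteristic function of the standard normal law, rescaled by x = \<epsilon>
  \<omega>. The factor 2 * pi reflects that \<open>fourier\<close> carries no normalising
  constant.\<close>

lemma gauss_fourier:
 assumes e: "\<epsilon> > 0"
 shows "integrable lborel (\<lambda>\<omega>. exp (- ((\<epsilon> * \<omega>)^2) / 2))"
  and "(LB \<omega>. complex_of_real (exp (- ((\<epsilon> * \<omega>)^2) / 2)) * cis (- \<omega> * y))
   = complex_of_real (2 * pi * normal_density 0 \<epsilon> y)"
proof -
 have std: "exp (- (x^2) / 2) = sqrt (2*pi) * std_normal_density x" for x
  by (simp add: normal_density_def)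
 have "integrable lborel (\<lambda>\<omega>. std_normal_density (0 + \<epsilon> * \<omega>))"
  using e by (intro lborel_integrable_real_affine) auto
 then show "integrable lborel (\<lambda>\<omega>. exp (- ((\<epsilon> * \<omega>)^2) / 2))"
  unfolding std by simp
 have "char std_normal_distribution (- y / \<epsilon>) = (LB x. std_normal_density x *\<^sub>R cis ((- y / \<epsilon>) * x))"
  unfolding char_def by (subst integral_density) (auto simp: cis_conv_exp)
 also have "... = \<bar>\<epsilon>\<bar> *\<^sub>R (LB \<omega>. std_normal_density (0 + \<epsilon> * \<omega>) *\<^sub>R cis ((- y / \<epsilon>) * (0 + \<epsilon> * \<omega>)))"
  using e by (intro lborel_integral_real_affine) auto
 also have "(\<lambda>\<omega>. std_normal_density (0 + \<epsilon> * \<omega>) *\<^sub>R cis ((- y / \<epsilon>) * (0 + \<epsilon> * \<omega>)))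
   = (\<lambda>\<omega>. complex_of_real (1 / sqrt (2*pi)) * (complex_of_real (exp (- ((\<epsilon> * \<omega>)^2) / 2)) * cis (- \<omega> * y)))"
  using e by (auto simp: normal_density_def scaleR_conv_of_real fun_eq_iff mult_ac power_mult_distrib)
 also have "(LB \<omega>. complex_of_real (1 / sqrt (2*pi)) * (complex_of_real (exp (- ((\<epsilon> * \<omega>)^2) / 2)) * cis (- \<omega> * y)))
   = complex_of_real (1 / sqrt (2*pi)) * (LB \<omega>. (complex_of_real (exp (- ((\<epsilon> * \<omega>)^2) / 2)) * cis (- \<omega> * y)))"
  by simp
 finally have A: "complex_of_real (exp (- ((y/\<epsilon>)^2) / 2)) = \<bar>\<epsilon>\<bar> *\<^sub>R (complex_of_real (1 / sqrt (2*pi)) * (LB \<omega>. (complex_of_real (exp (- ((\<epsilon> * \<omega>)^2) / 2)) * cis (- \<omega> * y))))"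
  by (simp add: char_std_normal_distribution)
 have "(LB \<omega>. (complex_of_real (exp (- ((\<epsilon> * \<omega>)^2) / 2)) * cis (- \<omega> * y)))
   = complex_of_real (sqrt (2*pi) / \<epsilon>) * complex_of_real (exp (- ((y/\<epsilon>)^2) / 2))"
  unfolding A using e by (simp add: scaleR_conv_of_real)
 also have "... = complex_of_real (sqrt (2*pi) / \<epsilon> * exp (- ((y/\<epsilon>)^2) / 2))" by simp
 also have "sqrt (2*pi) / \<epsilon> * exp (- ((y/\<epsilon>)^2) / 2) = 2 * pi * normal_density 0 \<epsilon> y"
  using e by (simp add: normal_density_def real_sqrt_mult power_divide field_simps real_sqrt_pow2 flip: power2_eq_square)
 finally show "(LB \<omega>. complex_of_real (exp (- ((\<epsilon> * \<omega>)^2) / 2)) * cis (- \<omega> * y))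
   = complex_of_real (2 * pi * normal_density 0 \<epsilon> y)" .
qed

lemma normal_density_le: "\<epsilon> > 0 \<Longrightarrow> normal_density 0 \<epsilon> y \<le> 1 / \<epsilon>"
proof -
 assume e: "\<epsilon> > 0"
 have "sqrt (2 * pi * \<epsilon>^2) = sqrt (2*pi) * \<epsilon>" using e by (simp add: real_sqrt_mult)
 moreover have "sqrt (2*pi) \<ge> 1" using pi_gt3 by (intro real_le_rsqrt) auto
 ultimately have s: "sqrt (2 * pi * \<epsilon>^2) \<ge> \<epsilon>" using e by (simp add: mult_le_cancel_right2 )
 have "normal_density 0 \<epsilon> y \<le> 1 / sqrt (2 * pi * \<epsilon>^2) * 1"
  unfolding normal_density_def by (intro mult_left_mono) auto
 also have "... \<le> 1 / \<epsilon>" using s e by (simp add: frac_le)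
 finally show ?thesis .
qed

lemma normal_density_sym: "normal_density 0 \<epsilon> (- y) = normal_density 0 \<epsilon> y"
 by (simp add: normal_density_def)

lemma fourier_bound:
 assumes "integrable lborel w" shows "cmod (fourier w \<omega>) \<le> (LB x. \<bar>w x\<bar>)"
 unfolding fourier_def
 by (rule order_trans[OF integral_norm_bound]) (simp add: norm_mult)

lemma integrable_fourier_kernel:
 assumes w: "integrable lborel w"
 shows "integrable lborel (\<lambda>x. cis (- \<omega> * x) * complex_of_real (w x))"
proof -
 have [measurable]: "w \<in> Borel" using w by auto
 show ?thesis
  by (rule Bochner_Integration.integrable_bound[OF w]) (auto simp: norm_mult cis_conv_exp)
qed

lemma fourier_measurable [measurable]:
 assumes [measurable]: "w \<in> Borel"
 shows "fourier w \<in> Borel"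
proof -
 have "(\<lambda>\<omega>. LB x. (\<lambda>(\<omega>,x). cis (- \<omega> * x) * complex_of_real (w x)) (\<omega>,x)) \<in> Borel"
  unfolding cis_conv_exp by measurable
 then show ?thesis by (simp add: fourier_def[abs_def])
qed

text \<open>The Gaussian weight makes the integral in \<omega>, x, y absolutely convergent for
  merely integrable w, so Fubini applies twice and the inner \<omega>-integral is
  \<open>gauss_fourier\<close>. As \<epsilon> tends to 0 the right side formally becomes 2 * pi
  times the squared L2 norm: a regularised Plancherel identity.\<close>

lemma fourier_gauss:
 assumes w: "integrable lborel w" and e: "\<epsilon> > 0"
 shows "(LB \<omega>. exp (- ((\<epsilon> * \<omega>)^2) / 2) * (cmod (fourier w \<omega>))^2)
  = 2 * pi * (LB x. w x * (LB y. w y * normal_density 0 \<epsilon> (x - y)))"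
proof -
 have [measurable]: "w \<in> Borel" using w by auto
 have [measurable]: "cnj \<in> Borel"
  by (intro borel_measurable_continuous_onI continuous_intros)
 let ?E = "\<lambda>\<omega>. exp (- ((\<epsilon> * \<omega>)^2) / 2)"
 let ?B = "LB x. \<bar>w x\<bar>"
 note E = gauss_fourier[OF e]
 have cn: "cnj (fourier w \<omega>) = (LB y. cis (\<omega> * y) * complex_of_real (w y))" for \<omega>
  unfolding fourier_def by (subst Bochner_Integration.integral_cnj[symmetric]) (simp add: cis_cnj)
 have 2: "(LB \<omega>. of_real (?E \<omega>) * cis (- \<omega> * x) * cnj (fourier w \<omega>))
   = complex_of_real (2 * pi * (LB y. w y * normal_density 0 \<epsilon> (x - y)))" for x
 proof -
  have "(LB \<omega>. of_real (?E \<omega>) * cis (- \<omega> * x) * cnj (fourier w \<omega>))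
    = (LB \<omega>. LB y. of_real (?E \<omega>) * cis (- \<omega> * x) * (cis (\<omega> * y) * complex_of_real (w y)))"
   unfolding cn by simp
  also have "... = (LB y. LB \<omega>. of_real (?E \<omega>) * cis (- \<omega> * x) * (cis (\<omega> * y) * complex_of_real (w y)))"
  proof (rule Fubini_swap_bound[OF E(1) w])
   show "(\<lambda>(\<omega>, y). of_real (?E \<omega>) * cis (- \<omega> * x) * (cis (\<omega> * y) * complex_of_real (w y))) \<in> borel_measurable (lborel \<Otimes>\<^sub>M lborel)"
    unfolding cis_conv_exp by measurable
  qed (auto simp: norm_mult)
  also have "... = (LB y. complex_of_real (w y) * (LB \<omega>. of_real (?E \<omega>) * cis (- \<omega> * (x - y))))"
   by (subst integral_mult_right_zero[symmetric])
     (auto intro!: Bochner_Integration.integral_cong simp: cis_mult algebra_simps)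
  also have "... = (LB y. complex_of_real (2 * pi * (w y * normal_density 0 \<epsilon> (x - y))))"
   unfolding E(2) by (simp add: mult_ac)
  also have "... = complex_of_real (2 * pi * (LB y. w y * normal_density 0 \<epsilon> (x - y)))"
   by (subst integral_complex_of_real) simp
  finally show ?thesis .
 qed
 have "complex_of_real (LB \<omega>. ?E \<omega> * (cmod (fourier w \<omega>))^2)
   = (LB \<omega>. of_real (?E \<omega>) * cnj (fourier w \<omega>) * fourier w \<omega>)"
  by (subst integral_complex_of_real[symmetric], rule Bochner_Integration.integral_cong, simp, subst of_real_mult, subst complex_norm_square) (simp add: mult_ac)
 also have "... = (LB \<omega>. LB x. of_real (?E \<omega>) * cnj (fourier w \<omega>) * (cis (- \<omega> * x) * complex_of_real (w x)))"
  unfolding fourier_def by simp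
 also have "... = (LB x. LB \<omega>. of_real (?E \<omega>) * cnj (fourier w \<omega>) * (cis (- \<omega> * x) * complex_of_real (w x)))"
 proof (rule Fubini_swap_bound[where f="\<lambda>\<omega>. ?E \<omega> * ?B"])
  show "integrable lborel (\<lambda>\<omega>. ?E \<omega> * ?B)" using E(1) by simp
  show "(\<lambda>(\<omega>, x). of_real (?E \<omega>) * cnj (fourier w \<omega>) * (cis (- \<omega> * x) * complex_of_real (w x))) \<in> borel_measurable (lborel \<Otimes>\<^sub>M lborel)"
   unfolding cis_conv_exp by measurable
 next
  fix \<omega> x
  show "cmod (of_real (?E \<omega>) * cnj (fourier w \<omega>) * (cis (- \<omega> * x) * complex_of_real (w x))) \<le> \<bar>?E \<omega> * ?B\<bar> * \<bar>w x\<bar>"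
   using fourier_bound[OF w, of \<omega>] by (auto simp: norm_mult intro!: mult_right_mono)
 qed (rule w)
 also have "... = (LB x. complex_of_real (w x) * (LB \<omega>. of_real (?E \<omega>) * cis (- \<omega> * x) * cnj (fourier w \<omega>)))"
  by (subst integral_mult_right_zero[symmetric])
    (auto intro!: Bochner_Integration.integral_cong simp: mult_ac)
 also have "... = (LB x. complex_of_real (2 * pi * (w x * (LB y. w y * normal_density 0 \<epsilon> (x - y)))))"
  unfolding 2 by (simp add: mult_ac)
 also have "... = complex_of_real (2 * pi * (LB x. w x * (LB y. w y * normal_density 0 \<epsilon> (x - y))))"
  by (subst integral_complex_of_real) simp
 finally show ?thesis using of_real_eq_iff by blast
qed

lemma integrable_gauss_fourier:
 assumes w: "integrable lborel w" and e: "\<epsilon> > 0"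
 shows "integrable lborel (\<lambda>\<omega>. exp (- ((\<epsilon> * \<omega>)^2) / 2) * (cmod (fourier w \<omega>))^2)"
proof -
 have [measurable]: "w \<in> Borel" using w by auto
 have "integrable lborel (\<lambda>\<omega>. exp (- ((\<epsilon> * \<omega>)^2) / 2) * (LB x. \<bar>w x\<bar>)^2)"
  using gauss_fourier(1)[OF e] by simp
 then show ?thesis
  by (rule Bochner_Integration.integrable_bound)
    (auto simp: abs_mult intro!: mult_left_mono power_mono fourier_bound[OF w])
qed

lemma integrable_normal_conv:
 assumes w: "integrable lborel w" and e: "\<epsilon> > 0"
 shows "integrable lborel (\<lambda>y. w y * normal_density 0 \<epsilon> (x - y))"
proof -
 have [measurable]: "w \<in> Borel" using w by auto
 have i: "integrable lborel (\<lambda>y. w y * (1/\<epsilon>))" using w by simp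
 show ?thesis
  by (rule Bochner_Integration.integrable_bound[OF i])
   (use e mult_left_mono[OF normal_density_le[OF e], of "\<bar>w y\<bar>" for y] in \<open>auto simp: abs_mult\<close>)
qed

lemma normal_int: "e > 0 \<Longrightarrow> (LB y. normal_density 0 e (x - y)) = 1"
 "e > 0 \<Longrightarrow> integrable lborel (\<lambda>y. normal_density 0 e (x - y))"
 using lborel_integral_real_affine[of "-1" "normal_density 0 e" x]
  lborel_integrable_real_affine[of "normal_density 0 e" "-1" x] integral_normal_density integrable_normal_density
 by auto

text \<open>Schur's test: w x * w y is at most half the sum of the squares, and the Gaussian kernel
  has mass one in either variable.\<close>

lemma normal_form_le:
 assumes w: "integrable lborel w" and w2: "integrable lborel (\<lambda>x. (w x)^2)" and e: "\<epsilon> > 0"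
 shows "(LB x. w x * (LB y. w y * normal_density 0 \<epsilon> (x - y))) \<le> (LB x. (w x)^2)"
proof -
 have [measurable]: "w \<in> Borel" using w by auto
 let ?N = "\<lambda>x y. normal_density 0 \<epsilon> (x - y)"
 have N0: "?N x y \<ge> 0" for x y by simp
 have nl: "\<bar>?N x y\<bar> \<le> 1/\<epsilon>" for x y using normal_density_le[OF e, of "x - y"] by simp
 have I1: "integrable (lborel \<Otimes>\<^sub>M lborel) (\<lambda>(x,y). w x * w y * ?N x y)"
 proof (rule integrable_pair_bound[where f=w and g="\<lambda>y. w y * (1/\<epsilon>)"])
  show "norm (case (x,y) of (x,y) \<Rightarrow> w x * w y * ?N x y) \<le> \<bar>w x\<bar> * \<bar>w y * (1/\<epsilon>)\<bar>" for x y
   using mult_left_mono[OF nl[of x y], of "\<bar>w x\<bar> * \<bar>w y\<bar>"] e by (simp add: abs_mult)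
 qed (use w in simp_all)
 have I2: "integrable (lborel \<Otimes>\<^sub>M lborel) (\<lambda>(x,y). (w x)^2 * ?N x y)"
  by (rule lborel_pair.Fubini_integrable) (use w2 e in \<open>simp_all add: abs_mult normal_int\<close>)
 have I3: "integrable (lborel \<Otimes>\<^sub>M lborel) (\<lambda>(x,y). (w y)^2 * ?N x y)"
 proof -
  have sw: "?N y x = ?N x y" for x y using normal_density_sym[of \<epsilon> "x - y"] by simp
  have "integrable (lborel \<Otimes>\<^sub>M lborel) (\<lambda>(x,y). case (y,x) of (x,y) \<Rightarrow> (w x)\<^sup>2 * ?N x y)"
   by (rule lborel_pair.integrable_product_swap[OF I2])
  moreover have "(\<lambda>(x,y). case (y,x) of (x,y) \<Rightarrow> (w x)\<^sup>2 * ?N x y) = (\<lambda>(x,y). (w y)^2 * ?N x y)"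
   unfolding fun_eq_iff using sw by simp
  ultimately show ?thesis by simp
 qed
 have F2: "(LB x. LB y. (w x)^2 * ?N x y) = (LB x. (w x)^2)"
  using e by (simp add: normal_int)
 have F3: "(LB x. LB y. (w y)^2 * ?N x y) = (LB x. (w x)^2)"
 proof -
  have "(LB x. LB y. (w y)^2 * ?N x y) = (LB y. LB x. (w y)^2 * ?N x y)"
   using lborel_pair.Fubini_integral[OF I3] by simp
  also have "... = (LB y. LB x. (w y)^2 * ?N y x)"
  proof -
   have sw: "?N x y = ?N y x" for x y using normal_density_sym[of \<epsilon> "y - x"] by simp
   show ?thesis by (intro Bochner_Integration.integral_cong refl) (rule arg_cong2[where f=times], simp, rule sw)
  qed
  finally show ?thesis using F2 by simp
 qed
 have "(LB x. w x * (LB y. w y * ?N x y)) = (LB x. LB y. w x * w y * ?N x y)"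
  by (simp add: mult.assoc)
 also have "... = integral\<^sup>L (lborel \<Otimes>\<^sub>M lborel) (\<lambda>(x,y). w x * w y * ?N x y)"
  using lborel_pair.integral_fst'[OF I1] by simp
 also have "... \<le> integral\<^sup>L (lborel \<Otimes>\<^sub>M lborel) (\<lambda>z. (1/2) * ((case z of (x,y) \<Rightarrow> (w x)\<^sup>2 * ?N x y) + (case z of (x,y) \<Rightarrow> (w y)\<^sup>2 * ?N x y)))"
 proof (rule integral_mono[OF I1])
  show "integrable (lborel \<Otimes>\<^sub>M lborel) (\<lambda>z. (1/2) * ((case z of (x,y) \<Rightarrow> (w x)\<^sup>2 * ?N x y) + (case z of (x,y) \<Rightarrow> (w y)\<^sup>2 * ?N x y)))"
   using I2 I3 by simp
  fix z :: "real \<times> real"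
  obtain x y where z: "z = (x,y)" by force
  have "w x * w y \<le> (1/2) * ((w x)^2 + (w y)^2)" using sum_squares_bound[of "w x" "w y"] by simp
  from mult_right_mono[OF this N0] show "(case z of (x,y) \<Rightarrow> w x * w y * ?N x y) \<le> (1/2) * ((case z of (x,y) \<Rightarrow> (w x)\<^sup>2 * ?N x y) + (case z of (x,y) \<Rightarrow> (w y)\<^sup>2 * ?N x y))"
   by (simp add: z algebra_simps)
 qed
 also have "... = (1/2) * (integral\<^sup>L (lborel \<Otimes>\<^sub>M lborel) (\<lambda>(x,y). (w x)^2 * ?N x y) + integral\<^sup>L (lborel \<Otimes>\<^sub>M lborel) (\<lambda>(x,y). (w y)^2 * ?N x y))"
  using I2 I3 by simp
 also have "... = (LB x. (w x)^2)"
  using lborel_pair.integral_fst'[OF I2] lborel_pair.integral_fst'[OF I3] F2 F3 by simp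
 finally show ?thesis .
qed

text \<open>The Gaussian weights tend to 1 pointwise, so Fatou's lemma removes them from any bound
  that is uniform in n.\<close>

lemma exp_seq_Fatou:
 assumes [measurable]: "g \<in> Borel" and g0: "\<And>\<omega>::real. g \<omega> \<ge> (0::real)"
  and b: "\<And>n. (NN \<omega>. ennreal (exp (- ((e n * \<omega>)^2) / 2) * g \<omega>)) \<le> B" and e0: "e \<longlonglongrightarrow> 0"
 shows "(NN \<omega>. ennreal (g \<omega>)) \<le> B"
proof -
 have lim: "(\<lambda>n. ennreal (exp (- ((e n * \<omega>)^2) / 2) * g \<omega>)) \<longlonglongrightarrow> ennreal (g \<omega>)" for \<omega>
 proof -
  have "(\<lambda>n. exp (- ((e n * \<omega>)^2) / 2) * g \<omega>) \<longlonglongrightarrow> exp (- ((0 * \<omega>)^2) / 2) * g \<omega>"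
   by (intro tendsto_intros e0) auto
  then show ?thesis by (simp add: tendsto_ennrealI)
 qed
 have "(NN \<omega>. ennreal (g \<omega>)) = (NN \<omega>. liminf (\<lambda>n. ennreal (exp (- ((e n * \<omega>)^2) / 2) * g \<omega>)))"
  by (intro nn_integral_cong) (use lim lim_imp_Liminf in \<open>metis trivial_limit_sequentially\<close>)
 also have "... \<le> liminf (\<lambda>n. NN \<omega>. ennreal (exp (- ((e n * \<omega>)^2) / 2) * g \<omega>))"
  by (rule nn_integral_liminf) simp
 also have "... \<le> liminf (\<lambda>n. B)" by (intro Liminf_mono always_eventually allI b)
 finally show ?thesis by (simp add: Liminf_const)
qed

text \<open>The upper half of Plancherel: \<open>fourier_gauss\<close> is bounded by
  \<open>normal_form_le\<close> uniformly in \<epsilon>, then \<open>exp_seq_Fatou\<close> drops the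
  weight.\<close>

lemma fourier_bessel:
 assumes w: "integrable lborel w" and w2: "integrable lborel (\<lambda>x. (w x)^2)"
 shows "(NN \<omega>. ennreal ((cmod (fourier w \<omega>))^2)) \<le> ennreal (2 * pi) * (NN x. ennreal ((w x)^2))"
proof -
 have [measurable]: "w \<in> Borel" using w by auto
 let ?e = "\<lambda>n. inverse (real (Suc n))"
 show ?thesis
 proof (rule exp_seq_Fatou[where e="?e"])
  fix n
  have e: "?e n > 0" by simp
  have "(NN \<omega>. ennreal (exp (- ((?e n * \<omega>)^2) / 2) * (cmod (fourier w \<omega>))^2))
    = ennreal (LB \<omega>. exp (- ((?e n * \<omega>)^2) / 2) * (cmod (fourier w \<omega>))^2)"
   by (rule nn_integral_eq_integral[OF integrable_gauss_fourier[OF w e]]) simp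
  also have "... \<le> ennreal (2 * pi * (LB x. (w x)^2))"
   unfolding fourier_gauss[OF w e] using normal_form_le[OF w w2 e] by (intro ennreal_leI mult_left_mono) auto
  also have "... = ennreal (2 * pi) * (NN x. ennreal ((w x)^2))"
   by (subst nn_integral_eq_integral[OF w2]) (auto simp: ennreal_mult)
  finally show "(NN \<omega>. ennreal (exp (- ((?e n * \<omega>)^2) / 2) * (cmod (fourier w \<omega>))^2)) \<le> ennreal (2 * pi) * (NN x. ennreal ((w x)^2))" .
  show "?e \<longlonglongrightarrow> 0" by (rule LIMSEQ_inverse_real_of_nat)
 qed auto
qed

lemma normal_semigroup:
 assumes e: "\<epsilon> > 0"
 shows "(LB z. normal_density 0 \<epsilon> (y - z) * normal_density 0 \<epsilon> (x - z)) = normal_density 0 (sqrt 2 * \<epsilon>) (x - y)"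
proof -
 let ?N = "normal_density 0 \<epsilon>"
 have "(\<lambda>x. NN y. ennreal (?N (x - y) * ?N y)) = (\<lambda>x. ennreal (normal_density 0 (sqrt (\<epsilon>^2 + \<epsilon>^2)) x))"
  by (rule conv_normal_density_zero_mean) (use e in auto)
 moreover have "sqrt (\<epsilon>^2 + \<epsilon>^2) = sqrt 2 * \<epsilon>" using e by (simp add: real_sqrt_mult flip: mult_2)
 ultimately have nn: "(NN t. ennreal (?N (u - t) * ?N t)) = ennreal (normal_density 0 (sqrt 2 * \<epsilon>) u)" for u by metis
 have "(LB z. ?N (y - z) * ?N (x - z)) = (LB z. ?N (y - (y + 1 * z)) * ?N (x - (y + 1 * z)))"
  using lborel_integral_real_affine[of 1 "\<lambda>z. ?N (y - z) * ?N (x - z)" y] by simp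
 also have "... = (LB t. ?N ((x - y) - t) * ?N t)"
  by (rule Bochner_Integration.integral_cong) (auto simp: normal_density_sym algebra_simps)
 also have "... = normal_density 0 (sqrt 2 * \<epsilon>) (x - y)"
  by (subst integral_eq_nn_integral) (auto simp: nn)
 finally show ?thesis .
qed

text \<open>f is the Gaussian mollification of w. Variances add under convolution, so its squared
  norm is the quadratic form of width sqrt 2 * \<epsilon>, which \<open>fourier_gauss\<close>
  expresses through the transform of w. Mollification makes f square integrable although w is only
  integrable.\<close>

lemma normal_form_square:
 assumes w: "integrable lborel w" and e: "\<epsilon> > 0"
 defines "f \<equiv> \<lambda>z. LB x. w x * normal_density 0 \<epsilon> (z - x)"
 shows "integrable lborel f" "integrable lborel (\<lambda>z. (f z)^2)"
  "(LB z. (f z)^2) = (LB x. w x * (LB y. w y * normal_density 0 (sqrt 2 * \<epsilon>) (x - y)))"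
proof -
 have [measurable]: "w \<in> Borel" using w by auto
 let ?N = "\<lambda>x y. normal_density 0 \<epsilon> (x - y)"
 let ?B = "LB x. \<bar>w x\<bar>"
 have sw: "?N x y = ?N y x" for x y using normal_density_sym[of \<epsilon> "x - y"] by simp
 have nl: "\<bar>?N x y\<bar> \<le> 1/\<epsilon>" for x y using normal_density_le[OF e, of "x - y"] by simp
 have [measurable]: "f \<in> Borel" unfolding f_def by measurable
 have I: "integrable (lborel \<Otimes>\<^sub>M lborel) (\<lambda>(x,z). w x * ?N z x)"
  by (rule lborel_pair.Fubini_integrable) (use w e in \<open>simp_all add: abs_mult normal_int sw[of _ x for x]\<close>)
 show fi: "integrable lborel f"
  using lborel_pair.integrable_fst'[OF lborel_pair.integrable_product_swap[OF I]]
  by (simp add: f_def)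
 have fb: "\<bar>f z\<bar> \<le> ?B / \<epsilon>" for z
 proof -
  have "\<bar>f z\<bar> \<le> (LB x. \<bar>w x\<bar> * (1/\<epsilon>))"
   unfolding f_def
   by (rule order_trans[OF integral_abs_bound], rule integral_mono)
    (use w integrable_abs[OF integrable_normal_conv[OF w e, of z]] mult_left_mono[OF nl abs_ge_zero] in \<open>auto simp: abs_mult\<close>)
  then show ?thesis by simp
 qed
 have "integrable lborel (\<lambda>z. f z * (?B / \<epsilon>))" using fi by simp
 then show "integrable lborel (\<lambda>z. (f z)^2)"
  by (rule Bochner_Integration.integrable_bound)
    (use mult_left_mono[OF fb abs_ge_zero, of "f z" z for z] e in \<open>auto simp: power2_eq_square abs_mult\<close>)
 have in2: "(LB z. f z * ?N y z) = (LB x. w x * normal_density 0 (sqrt 2 * \<epsilon>) (y - x))" for y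
 proof -
  have "(LB z. f z * ?N y z) = (LB z. LB x. w x * ?N z x * ?N y z)"
   unfolding f_def by simp
  also have "... = (LB x. LB z. w x * ?N z x * ?N y z)"
  proof (rule Fubini_swap_bound[where f="\<lambda>z. ?N y z" and g="\<lambda>x. w x * (1/\<epsilon>)"])
   show "norm (w x * ?N z x * ?N y z) \<le> \<bar>?N y z\<bar> * \<bar>w x * (1/\<epsilon>)\<bar>" for z x
    using mult_left_mono[OF nl[of z x], of "\<bar>w x\<bar> * \<bar>?N y z\<bar>"] e by (simp add: abs_mult mult_ac)
  qed (use w e normal_int in \<open>simp_all\<close>)
  also have "... = (LB x. w x * (LB z. ?N x z * ?N y z))"
   unfolding sw[of _ x for x] by (simp add: mult.assoc)
  also have "... = (LB x. w x * normal_density 0 (sqrt 2 * \<epsilon>) (y - x))"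
   unfolding normal_semigroup[OF e] ..
  finally show ?thesis .
 qed
 have "(LB z. (f z)^2) = (LB z. LB y. f z * (w y * ?N z y))"
  unfolding power2_eq_square by (subst (2) f_def) simp
 also have "... = (LB y. LB z. f z * (w y * ?N z y))"
 proof (rule Fubini_swap_bound[where f=f and g="\<lambda>y. w y * (1/\<epsilon>)"])
  show "norm (f z * (w y * ?N z y)) \<le> \<bar>f z\<bar> * \<bar>w y * (1/\<epsilon>)\<bar>" for z y
   using mult_left_mono[OF nl[of z y], of "\<bar>f z\<bar> * \<bar>w y\<bar>"] e by (simp add: abs_mult mult_ac)
 qed (use w fi in simp_all)
 also have "... = (LB y. w y * (LB z. f z * ?N y z))"
  unfolding sw[of _ y for y] by (subst integral_mult_right_zero[symmetric]) (simp add: mult_ac)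
 finally show "(LB z. (f z)^2) = (LB x. w x * (LB y. w y * normal_density 0 (sqrt 2 * \<epsilon>) (x - y)))"
  unfolding in2 .
qed

lemma normal_conv_tendsto:
 assumes w: "integrable lborel w" and c: "isCont w x" and e0: "\<And>n. e n > 0" and el: "e \<longlonglongrightarrow> 0"
 shows "(\<lambda>n. LB y. w y * normal_density 0 (e n) (x - y)) \<longlonglongrightarrow> w x"
proof (rule LIMSEQ_I)
 fix r :: real assume r: "r > 0"
 have [measurable]: "w \<in> Borel" using w by auto
 let ?B = "LB x. \<bar>w x\<bar>"
 obtain d where d: "d > 0" and dd: "\<And>y. \<bar>y - x\<bar> < d \<Longrightarrow> \<bar>w y - w x\<bar> < r/2"
  using c r unfolding isCont_def LIM_def dist_real_def
  by (metis abs_zero diff_self half_gt_zero)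
 \<comment> \<open>Three sources of error: the oscillation r/2 of w within distance d; the mass of
   |w| beyond d, where the density is at most 2 * \<epsilon> / d^2; and the constant w x beyond d,
   for which Chebyshev's inequality with second moment \<epsilon>^2 gives \<epsilon>^2 /
   d^2.\<close>
 define h where "h \<epsilon> = r/2 + ?B * (2 * \<epsilon> / d^2) + \<bar>w x\<bar> * (\<epsilon>^2 / d^2)" for \<epsilon>
 have key: "\<bar>(LB y. w y * normal_density 0 \<epsilon> (x - y)) - w x\<bar> \<le> h \<epsilon>" if e: "\<epsilon> > 0" for \<epsilon>
 proof -
  let ?N = "\<lambda>y. normal_density 0 \<epsilon> (x - y)"
  note i1 = integrable_normal_conv[OF w e, of x]
  note i2 = normal_int[OF e, of x]
  have m2: "integrable lborel (\<lambda>y. normal_density 0 \<epsilon> y * y^2)" "(LB y. normal_density 0 \<epsilon> y * y^2) = \<epsilon>^2"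
   using normal_moment_even[OF e, of 0 1] integrable_normal_moment[OF e, of 0 2] by (auto simp: has_bochner_integral_iff)
  have i3: "integrable lborel (\<lambda>y. ?N y * (x - y)^2)" "(LB y. ?N y * (x - y)^2) = \<epsilon>^2"
   using lborel_integral_real_affine[of "-1" "\<lambda>y. normal_density 0 \<epsilon> y * y^2" x]
     lborel_integrable_real_affine[OF m2(1), of "-1" x] m2 by auto
  have nd: "?N y \<le> 2 * \<epsilon> / d^2" if "\<bar>y - x\<bar> \<ge> d" for y
  proof -
   define u where "u = (x - y)^2 / (2 * \<epsilon>^2)"
   have "d^2 \<le> (x - y)^2" using that d by (metis abs_le_square_iff abs_minus_commute abs_of_pos)
   then have u: "u \<ge> d^2 / (2 * \<epsilon>^2)" "d^2 / (2 * \<epsilon>^2) > 0" unfolding u_def using e d by (auto intro!: divide_right_mono)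
   have "u \<le> exp u" using exp_ge_add_one_self[of u] by linarith
   moreover have u0: "u > 0" using u by linarith
   ultimately have "exp (- u) \<le> 1 / u" using u by (simp add: exp_minus field_simps)
   also have "... \<le> 1 / (d^2 / (2 * \<epsilon>^2))" by (rule divide_left_mono[OF u(1)]) (use u(2) u0 mult_pos_pos[OF u0 u(2)] in auto)
   finally have eu: "exp (-u) \<le> 2 * \<epsilon>^2 / d^2" by simp
   have s: "sqrt (2 * pi * \<epsilon>^2) \<ge> \<epsilon>"
   proof -
    have "sqrt (2*pi) \<ge> 1" using pi_gt3 by (intro real_le_rsqrt) auto
    then show ?thesis using e by (simp add: real_sqrt_mult mult_le_cancel_right2)
   qed
   have "?N y = 1 / sqrt (2 * pi * \<epsilon>^2) * exp (-u)" unfolding normal_density_def u_def by simp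
   also have "... \<le> 1 / \<epsilon> * (2 * \<epsilon>^2 / d^2)"
    by (rule mult_mono) (use s e eu in \<open>auto simp: frac_le\<close>)
   also have "... = 2 * \<epsilon> / d^2" using e by (simp add: power2_eq_square)
   finally show ?thesis .
  qed
  have "(LB y. w y * ?N y) - w x = (LB y. (w y - w x) * ?N y)"
   using i1 i2 by (simp add: algebra_simps)
  also have "\<bar>...\<bar> \<le> (LB y. \<bar>(w y - w x) * ?N y\<bar>)" by (rule integral_abs_bound)
  also have "... \<le> (LB y. r/2 * ?N y + \<bar>w y\<bar> * (2 * \<epsilon> / d^2) + \<bar>w x\<bar> / d^2 * (?N y * (x - y)^2))"
  proof (rule integral_mono)
   show "integrable lborel (\<lambda>y. \<bar>(w y - w x) * ?N y\<bar>)"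
    using i1 i2 by (intro integrable_abs) (simp add: left_diff_distrib)
   show "integrable lborel (\<lambda>y. r/2 * ?N y + \<bar>w y\<bar> * (2 * \<epsilon> / d^2) + \<bar>w x\<bar> / d^2 * (?N y * (x - y)^2))"
    using i2 i3 w by simp
   fix y
   show "\<bar>(w y - w x) * ?N y\<bar> \<le> r/2 * ?N y + \<bar>w y\<bar> * (2 * \<epsilon> / d^2) + \<bar>w x\<bar> / d^2 * (?N y * (x - y)^2)"
   proof (cases "\<bar>y - x\<bar> < d")
    case True
    have "\<bar>(w y - w x) * ?N y\<bar> \<le> r/2 * ?N y"
     using mult_right_mono[OF less_imp_le[OF dd[OF True]], of "?N y"] by (simp add: abs_mult)
    moreover have "0 \<le> \<bar>w y\<bar> * (2 * \<epsilon> / d^2)" "0 \<le> \<bar>w x\<bar> / d^2 * (?N y * (x - y)^2)" using e by auto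
    ultimately show ?thesis by linarith
   next
    case False
    have "\<bar>(w y - w x) * ?N y\<bar> \<le> \<bar>w y\<bar> * ?N y + \<bar>w x\<bar> * ?N y"
     unfolding abs_mult using abs_triangle_ineq4[of "w y" "w x"]
     by (metis abs_of_nonneg distrib_right mult_right_mono normal_density_nonneg)
    moreover have "\<bar>w y\<bar> * ?N y \<le> \<bar>w y\<bar> * (2 * \<epsilon> / d^2)" using nd False by (intro mult_left_mono) auto
    moreover have "\<bar>w x\<bar> * ?N y \<le> \<bar>w x\<bar> / d^2 * (?N y * (x - y)^2)"
    proof -
     have "1 \<le> (x - y)^2 / d^2" using False d by (simp) (metis abs_le_square_iff abs_minus_commute abs_of_pos linorder_not_le)
     from mult_left_mono[OF this, of "\<bar>w x\<bar> * ?N y"] show ?thesis by (simp add: field_simps)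
    qed
    moreover have "0 \<le> r/2 * ?N y" using r by simp
    ultimately show ?thesis by linarith
   qed
  qed
  also have "... = h \<epsilon>"
   using i2 i3 w unfolding h_def by simp
  finally show ?thesis .
 qed
 have "(\<lambda>n. h (e n)) \<longlonglongrightarrow> r/2 + ?B * (2 * 0 / d^2) + \<bar>w x\<bar> * (0^2 / d^2)"
  unfolding h_def by (intro tendsto_intros el) (use d in auto)
 then have "(\<lambda>n. h (e n)) \<longlonglongrightarrow> r/2" by simp
 from order_tendstoD(2)[OF this, of r] r have "eventually (\<lambda>n. h (e n) < r) sequentially" by simp
 then have "eventually (\<lambda>n. norm ((LB y. w y * normal_density 0 (e n) (x - y)) - w x) < r) sequentially"
  by eventually_elim (use key e0 in \<open>auto intro: le_less_trans\<close>)
 then show "\<exists>no. \<forall>n\<ge>no. norm ((LB y. w y * normal_density 0 (e n) (x - y)) - w x) < r"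
  unfolding eventually_sequentially .
qed

text \<open>The lower half of Plancherel: mollifications converge to w at every point of continuity,
  their norms are controlled by \<open>normal_form_square\<close> and \<open>fourier_gauss\<close>,
  and Fatou concludes. Working on a set J of continuity points admits extensions whose regularity is
  known only inside (a,b).\<close>

lemma fourier_lower:
 assumes w: "integrable lborel w" and c: "\<And>x. x \<in> J \<Longrightarrow> isCont w x" and J[measurable]: "J \<in> sets borel"
 shows "(NN x. ennreal ((w x)^2) * indicator J x) \<le> ennreal (1 / (2 * pi)) * (NN \<omega>. ennreal ((cmod (fourier w \<omega>))^2))"
proof -
 have [measurable]: "w \<in> Borel" using w by auto
 define e where "e n = inverse (real (Suc n))" for n
 have e0: "e n > 0" for n by (simp add: e_def)
 have el: "e \<longlonglongrightarrow> 0" unfolding e_def by (rule LIMSEQ_inverse_real_of_nat)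
 define f where "f n z = (LB x. w x * normal_density 0 (e n) (z - x))" for n z
 have [measurable]: "f n \<in> Borel" for n
  unfolding f_def by measurable
 have fi: "(NN z. ennreal ((f n z)^2)) \<le> ennreal (1 / (2 * pi)) * (NN \<omega>. ennreal ((cmod (fourier w \<omega>))^2))" for n
 proof -
  have e2: "sqrt 2 * e n > 0" using e0 by simp
  have "(NN z. ennreal ((f n z)^2)) = ennreal (LB z. (f n z)^2)"
   unfolding f_def by (rule nn_integral_eq_integral[OF normal_form_square(2)[OF w e0]]) simp
  also have "(LB z. (f n z)^2) = 1/(2*pi) * (LB \<omega>. exp (- ((sqrt 2 * e n * \<omega>)^2) / 2) * (cmod (fourier w \<omega>))^2)"
   unfolding f_def normal_form_square(3)[OF w e0] fourier_gauss[OF w e2] by simp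
  also have "ennreal ... = ennreal (1/(2*pi)) * (NN \<omega>. ennreal (exp (- ((sqrt 2 * e n * \<omega>)^2) / 2) * (cmod (fourier w \<omega>))^2))"
   by (subst nn_integral_eq_integral[OF integrable_gauss_fourier[OF w e2]], simp, subst ennreal_mult'[symmetric]) auto
  also have "... \<le> ennreal (1/(2*pi)) * (NN \<omega>. ennreal ((cmod (fourier w \<omega>))^2))"
   by (intro mult_left_mono nn_integral_mono ennreal_leI mult_left_le_one_le) auto
  finally show ?thesis .
 qed
 have "(NN x. ennreal ((w x)^2) * indicator J x) \<le> (NN x. liminf (\<lambda>n. ennreal ((f n x)^2)))"
 proof (rule nn_integral_mono)
  fix x
  show "ennreal ((w x)^2) * indicator J x \<le> liminf (\<lambda>n. ennreal ((f n x)^2))"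
  proof (cases "x \<in> J")
   case True
   have "(\<lambda>n. f n x) \<longlonglongrightarrow> w x" unfolding f_def by (rule normal_conv_tendsto[OF w c[OF True] e0 el])
   then have "(\<lambda>n. ennreal ((f n x)^2)) \<longlonglongrightarrow> ennreal ((w x)^2)" by (intro tendsto_ennrealI tendsto_power)
   then show ?thesis using lim_imp_Liminf True by (metis (no_types, lifting) indicator_simps(1) mult.right_neutral order_refl trivial_limit_sequentially)
  qed simp
 qed
 also have "... \<le> liminf (\<lambda>n. NN x. ennreal ((f n x)^2))" by (rule nn_integral_liminf) simp
 also have "... \<le> liminf (\<lambda>n. ennreal (1 / (2 * pi)) * (NN \<omega>. ennreal ((cmod (fourier w \<omega>))^2)))"
  by (intro Liminf_mono always_eventually allI fi)
 finally show ?thesis by (simp add: Liminf_const)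
qed

section \<open>Fourier and Gagliardo seminorms\<close>

lemma nn_powr_0:
 fixes e A :: real
 assumes "e > -1" "A > 0"
 shows "(NN x. ennreal (x powr e) * indicator {0<..<A} x) = ennreal (A powr (e+1) / (e+1))"
proof -
 have "(NN x. ennreal (x powr e) * indicator {0<..<A} x) = (NN x. ennreal (x powr e) * indicator {0..A} x)"
 proof (rule nn_integral_cong_AE)
  have "AE x in lborel. x \<noteq> 0" "AE x in lborel. x \<noteq> A" by (rule AE_lborel_singleton)+
  then show "AE x in lborel. ennreal (x powr e) * indicator {0<..<A} x = ennreal (x powr e) * indicator {0..A} x"
   by eventually_elim (auto simp: indicator_def)
 qed
 also have "... = ennreal (A powr (e+1) / (e+1))"
  by (rule nn_integral_has_integral_lebesgue') (use has_integral_powr_from_0[of e A] assms in auto)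
 finally show ?thesis .
qed

lemma nn_powr_inf:
 fixes e A :: real
 assumes "e < -1" "A > 0"
 shows "(NN x. ennreal (x powr e) * indicator {A..} x) = ennreal (A powr (e+1) / (- e - 1))"
proof -
 have "(NN x. ennreal (x powr e) * indicator {A ..} x) = ennreal (0 - A powr (e+1) / (e+1))"
 proof (rule nn_integral_FTC_atLeast)
  show "DERIV (\<lambda>x. x powr (e+1) / (e+1)) x :> x powr e" if "A \<le> x" for x
  proof -
   have "DERIV (\<lambda>x. x powr (e+1)) x :> (e+1) * x powr (e + 1 - 1)"
    using that assms by (intro has_real_derivative_powr) auto
   from DERIV_cdivide[OF this, of "e+1"] show ?thesis using assms by simp
  qed
  have "((\<lambda>x::real. x powr (e+1)) \<longlongrightarrow> 0) at_top"
   by (rule tendsto_neg_powr) (use assms in \<open>auto intro: filterlim_ident\<close>)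
  then show "((\<lambda>x. x powr (e+1) / (e+1)) \<longlongrightarrow> 0) at_top" by (rule tendsto_divide_zero)
 qed auto
 also have "0 - A powr (e+1) / (e+1) = A powr (e+1) / (- e - 1)" using assms by (simp add: field_simps)
 finally show ?thesis .
qed

definition FN :: "real \<Rightarrow> (real \<Rightarrow> real) \<Rightarrow> ennreal" where
 "FN s w = (NN \<omega>. ennreal (\<bar>\<omega>\<bar> powr (2 * s) * (cmod (fourier w \<omega>))^2))"

text \<open>The Gagliardo double integral over J x J in the difference variable h. Taking h > 0
  gives half of the usual symmetric expression.\<close>

definition gag :: "real \<Rightarrow> real set \<Rightarrow> (real \<Rightarrow> real) \<Rightarrow> ennreal" where
 "gag s J w = (NN h. (NN x. ennreal ((w (x + h) - w x)^2) * indicator J x * indicator J (x + h))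
   * ennreal (h powr (-1 - 2 * s)) * indicator {0<..} h)"

lemma cis_diff_norm: "(cmod (cis y - 1))^2 = 2 - 2 * cos y"
proof -
 have "(cmod (cis y - 1))^2 = (cos y - 1)^2 + (sin y)^2" by (simp add: cmod_power2)
 also have "... = 2 - 2 * cos y" using sin_squared_eq[of y] by (simp add: power2_eq_square algebra_simps)
 finally show ?thesis .
qed

lemma cis_diff_bound: "(cmod (cis y - 1))^2 \<le> y^2" "(cmod (cis y - 1))^2 \<le> 4"
proof -
 have "cos y = 1 - 2 * (sin (y/2))^2" using cos_double_sin[of "y/2"] by simp
 then have "(cmod (cis y - 1))^2 = 4 * (sin (y/2))^2" unfolding cis_diff_norm by simp
 also have "(sin (y/2))^2 \<le> (y/2)^2" by (metis abs_le_square_iff abs_sin_x_le_abs_x)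
 finally show "(cmod (cis y - 1))^2 \<le> y^2" by (simp add: power_divide)
 show "(cmod (cis y - 1))^2 \<le> 4" unfolding cis_diff_norm using cos_ge_minus_one[of y] by linarith
qed

text \<open>Near 0 the squared numerator is at most h^2, integrable against the weight as s < 1; at
  infinity it is at most 4, integrable as s > 0. Positivity is read off from the interval (1,2),
  where cos h \<le> cos 1 bounds the integrand from below.\<close>

lemma cis_kernel_const:
 assumes s: "0 < s" "s < 1"
 obtains K where "K > 0" "(NN h. ennreal ((cmod (cis h - 1))^2 * h powr (-1 - 2 * s)) * indicator {0<..} h) = ennreal K"
proof -
 let ?F = "\<lambda>h::real. ennreal ((cmod (cis h - 1))^2 * h powr (-1 - 2 * s)) * indicator {0<..} h"
 let ?I = "\<integral>\<^sup>+h. ?F h \<partial>lborel"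
 have "?I \<le> (NN h. ennreal (h powr (1 - 2 * s)) * indicator {0<..<1} h + 4 * (ennreal (h powr (-1 - 2 * s)) * indicator {1..} h))"
 proof (rule nn_integral_mono)
  fix h :: real
  consider "h \<le> 0" | "0 < h" "h < 1" | "h \<ge> 1" by linarith
  then show "?F h \<le> ennreal (h powr (1 - 2 * s)) * indicator {0<..<1} h + 4 * (ennreal (h powr (-1 - 2 * s)) * indicator {1..} h)"
  proof cases
   case 2
   have "(cmod (cis h - 1))^2 * h powr (-1 - 2 * s) \<le> h^2 * h powr (-1 - 2 * s)"
    by (intro mult_right_mono cis_diff_bound) auto
   also have "... = h powr (1 - 2 * s)"
   proof -
    have "h^2 = h powr 2" using 2 by simp
    then show ?thesis by (simp only: powr_add[symmetric]) simp
   qed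
   finally show ?thesis using 2 by (auto intro: ennreal_leI)
  next
   case 3
   have "(cmod (cis h - 1))^2 * h powr (-1 - 2 * s) \<le> 4 * h powr (-1 - 2 * s)"
    by (intro mult_right_mono cis_diff_bound) auto
   then have "ennreal ((cmod (cis h - 1))^2 * h powr (-1 - 2 * s)) \<le> ennreal (4 * h powr (-1 - 2 * s))" by (rule ennreal_leI)
   then show ?thesis using 3 by (simp add: ennreal_mult)
  qed auto
 qed
 also have "... = ennreal (1 powr (1 - 2 * s+1) / (1 - 2 * s+1)) + 4 * ennreal (1 powr (-1 - 2 * s+1) / (- (-1 - 2 * s) - 1))"
  using s by (subst nn_integral_add, simp, simp, subst nn_integral_cmult, simp, subst nn_powr_0, simp, simp, subst nn_powr_inf) auto
 also have "... < \<infinity>" by (simp add: ennreal_mult_less_top ennreal_add_eq_top less_top[symmetric] ennreal_mult_eq_top_iff)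
 finally have fin: "?I < \<infinity>" .
 have "0 < (2 - 2 * cos 1) * (2::real) powr (-1 - 2 * s)"
  using cos_monotone_0_pi[of 0 1] pi_gt3 by simp
 then have "0 < ennreal ((2 - 2 * cos 1) * (2::real) powr (-1 - 2 * s))" by simp
 also have "ennreal ((2 - 2 * cos 1) * (2::real) powr (-1 - 2 * s)) = (NN h. ennreal ((2 - 2 * cos 1) * (2::real) powr (-1 - 2 * s)) * indicator {1<..<2::real} h)"
  by (simp add: nn_integral_cmult_indicator)
 also have "... \<le> ?I"
 proof (rule nn_integral_mono)
  fix h :: real
  show "ennreal ((2 - 2 * cos 1) * 2 powr (-1 - 2 * s)) * indicator {1<..<2::real} h \<le> ?F h"
  proof (cases "h \<in> {1<..<2}")
   case True
   have "cos h \<le> cos 1" using True pi_gt3 by (intro cos_monotone_0_pi_le) auto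
   then have "2 - 2 * cos 1 \<le> (cmod (cis h - 1))^2" unfolding cis_diff_norm by simp
   moreover have "2 powr (-1 - 2 * s) \<le> h powr (-1 - 2 * s)"
    using True s by (intro powr_mono2') auto
   ultimately have "(2 - 2 * cos 1) * 2 powr (-1 - 2 * s) \<le> (cmod (cis h - 1))^2 * h powr (-1 - 2 * s)"
    by (intro mult_mono) auto
   then show ?thesis using True by (auto intro: ennreal_leI)
  qed auto
 qed
 finally have pos: "0 < ?I" .
 show ?thesis
  by (rule that[of "enn2real ?I"]) (use fin pos in \<open>auto simp: enn2real_positive_iff\<close>)
qed

text \<open>Scaling h by |\<omega>| in the integral of \<open>cis_kernel_const\<close> produces the
  multiplier |\<omega>| powr (2 s); only the modulus matters because the squared distance depends on
  the cosine.\<close>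

lemma cis_kernel:
 assumes s: "0 < s" "s < 1"
 shows "\<exists>K>0. \<forall>\<omega>. (NN h. ennreal ((cmod (cis (\<omega> * h) - 1))^2) * ennreal (h powr (-1 - 2 * s)) * indicator {0<..} h) = ennreal K * ennreal (\<bar>\<omega>\<bar> powr (2 * s))"
proof -
 obtain K where K: "K > 0" "(NN h. ennreal ((cmod (cis h - 1))^2 * h powr (-1 - 2 * s)) * indicator {0<..} h) = ennreal K"
  by (rule cis_kernel_const[OF s])
 let ?F = "\<lambda>h::real. ennreal ((cmod (cis h - 1))^2 * h powr (-1 - 2 * s)) * indicator {0<..} h"
 have "(NN h. ennreal ((cmod (cis (\<omega> * h) - 1))^2) * ennreal (h powr (-1 - 2 * s)) * indicator {0<..} h) = ennreal K * ennreal (\<bar>\<omega>\<bar> powr (2 * s))" for \<omega>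
 proof (cases "\<omega> = 0")
  case False
  let ?G = "\<lambda>h. ennreal ((cmod (cis (\<omega> * h) - 1))^2) * ennreal (h powr (-1 - 2 * s)) * indicator {0<..} h"
  have eq: "?F (0 + \<bar>\<omega>\<bar> * h) = ennreal (\<bar>\<omega>\<bar> powr (-1 - 2 * s)) * ?G h" for h
  proof (cases "h > 0")
   case True
   have "cos (\<bar>\<omega>\<bar> * h) = cos (\<omega> * h)" by (cases "\<omega> \<ge> 0") auto
   then have c: "(cmod (cis (\<bar>\<omega>\<bar> * h) - 1))^2 = (cmod (cis (\<omega> * h) - 1))^2" unfolding cis_diff_norm by simp
   have "?F (0 + \<bar>\<omega>\<bar> * h) = ennreal ((cmod (cis (\<omega> * h) - 1))^2 * (\<bar>\<omega>\<bar> powr (-1 - 2 * s) * h powr (-1 - 2 * s)))"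
    using True False by (simp add: c powr_mult)
   also have "... = ennreal (\<bar>\<omega>\<bar> powr (-1 - 2 * s)) * ?G h" using True
    by (simp add: ennreal_mult mult_ac)
   finally show ?thesis .
  qed (use False in \<open>simp add: zero_less_mult_iff\<close>)
  have "ennreal K = ennreal \<bar>\<omega>\<bar> * (NN h. ?F (0 + \<bar>\<omega>\<bar> * h))"
  proof -
   have m: "?F \<in> Borel" unfolding cis_conv_exp by measurable
   have "(NN h. ?F h) = ennreal \<bar>\<bar>\<omega>\<bar>\<bar> * (NN h. ?F (0 + \<bar>\<omega>\<bar> * h))"
    by (rule nn_integral_real_affine[OF m]) (use False in simp)
   then show ?thesis unfolding K(2) by simp
  qed
  also have "... = ennreal \<bar>\<omega>\<bar> * (ennreal (\<bar>\<omega>\<bar> powr (-1 - 2 * s)) * (NN h. ?G h))"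
   unfolding eq by (subst nn_integral_cmult) (auto simp: cis_conv_exp)
  also have "... = ennreal (\<bar>\<omega>\<bar> powr (- 2 * s)) * (NN h. ?G h)"
   using False by (simp add: mult.assoc[symmetric] ennreal_mult[symmetric] powr_mult_base)
  finally have "ennreal (\<bar>\<omega>\<bar> powr (2 * s)) * ennreal K = ennreal (\<bar>\<omega>\<bar> powr (2 * s)) * (ennreal (\<bar>\<omega>\<bar> powr (- 2 * s)) * (NN h. ?G h))" by simp
  also have "... = (NN h. ?G h)"
   using False by (simp add: mult.assoc[symmetric] ennreal_mult[symmetric] powr_add[symmetric])
  finally show ?thesis by (simp add: mult.commute)
 qed simp
 with K(1) show ?thesis by blast
qed

lemma fourier_shift_diff:
 assumes w: "integrable lborel w"
 shows "integrable lborel (\<lambda>x. w (x + h) - w x)" "fourier (\<lambda>x. w (x + h) - w x) \<omega> = (cis (\<omega> * h) - 1) * fourier w \<omega>"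
proof -
 have i: "integrable lborel (\<lambda>x. w (x + h))"
  using lborel_integrable_real_affine[OF w, of 1 h] by (simp add: add.commute)
 then show "integrable lborel (\<lambda>x. w (x + h) - w x)" using w by simp
 have "fourier w \<omega> = (LB x. cis (- \<omega> * (h + 1 * x)) * complex_of_real (w (h + 1 * x)))"
  unfolding fourier_def by (subst lborel_integral_real_affine[of 1 _ h]) simp_all
 also have "... = (LB x. cis (- \<omega> * h) * (cis (- \<omega> * x) * complex_of_real (w (x + h))))"
 proof (rule Bochner_Integration.integral_cong)
  fix x
  have "cis (- \<omega> * (h + 1 * x)) = cis (- \<omega> * h) * cis (- \<omega> * x)" by (simp add: cis_mult algebra_simps)
  then show "cis (- \<omega> * (h + 1 * x)) * complex_of_real (w (h + 1 * x)) = cis (- \<omega> * h) * (cis (- \<omega> * x) * complex_of_real (w (x + h)))"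
   by (simp add: add.commute)
 qed simp
 also have "... = cis (- \<omega> * h) * (LB x. cis (- \<omega> * x) * complex_of_real (w (x + h)))" by simp
 finally have "cis (\<omega> * h) * fourier w \<omega> = (LB x. cis (- \<omega> * x) * complex_of_real (w (x + h)))"
  by (simp add: mult.assoc[symmetric] cis_mult)
 then show "fourier (\<lambda>x. w (x + h) - w x) \<omega> = (cis (\<omega> * h) - 1) * fourier w \<omega>"
  using integrable_fourier_kernel[OF w, of \<omega>] integrable_fourier_kernel[OF i, of \<omega>]
  by (simp add: fourier_def left_diff_distrib right_diff_distrib)
qed

lemma sum_squares_le_diff: "(a - b)^2 \<le> 2 * a^2 + 2 * (b::real)^2"
 using zero_le_power2[of "a + b"] unfolding power2_diff power2_sum by linarith

lemma diff_square_integrable: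
 fixes w :: "real \<Rightarrow> real"
 assumes w: "integrable lborel w" and w2: "integrable lborel (\<lambda>x. (w x)^2)"
 shows "integrable lborel (\<lambda>x. (w (x + h) - w x)^2)"
proof -
 have [measurable]: "w \<in> Borel" using w by auto
 have "integrable lborel (\<lambda>x. (w (x + h))^2)"
  using lborel_integrable_real_affine[of "\<lambda>x. (w x)^2" 1 h, OF w2] by (simp add: add.commute)
 then have "integrable lborel (\<lambda>x. 2 * (w (x + h))^2 + 2 * (w x)^2)" using w2 by simp
 then show ?thesis
  by (rule Bochner_Integration.integrable_bound)
   (use sum_squares_le_diff in auto)
qed

text \<open>Tonelli: cis (\<omega> * h) - 1 is the multiplier of a difference with step h, and
  integrating its square in h first leaves the multiplier of \<open>cis_kernel\<close>.\<close>

lemma gag_kernel_FN: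
 assumes s: "0 < s" "s < 1"
 shows "\<exists>K>0. \<forall>w\<in>Borel.
  (NN h. (NN \<omega>. ennreal ((cmod ((cis (\<omega> * h) - 1) * fourier w \<omega>))^2)) * ennreal (h powr (-1 - 2 * s)) * indicator {0<..} h) = ennreal K * FN s w"
proof -
 obtain K where K: "K > 0" "\<And>\<omega>. (NN h. ennreal ((cmod (cis (\<omega> * h) - 1))^2) * ennreal (h powr (-1 - 2 * s)) * indicator {0<..} h) = ennreal K * ennreal (\<bar>\<omega>\<bar> powr (2 * s))"
  using cis_kernel[OF s] by blast
 have "(NN h. (NN \<omega>. ennreal ((cmod ((cis (\<omega> * h) - 1) * fourier w \<omega>))^2)) * ennreal (h powr (-1 - 2 * s)) * indicator {0<..} h) = ennreal K * FN s w"
  if [measurable]: "w \<in> Borel" for w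
 proof -
  let ?g = "\<lambda>h \<omega>. ennreal ((cmod (cis (\<omega> * h) - 1))^2) * ennreal (h powr (-1 - 2 * s)) * indicator {0<..} h * ennreal ((cmod (fourier w \<omega>))^2)"
  have [measurable]: "(\<lambda>(h,\<omega>). ?g h \<omega>) \<in> borel_measurable (lborel \<Otimes>\<^sub>M lborel)"
   unfolding cis_conv_exp by measurable
  have [measurable]: "(\<lambda>x. cis (x * h)) \<in> Borel" for h unfolding cis_conv_exp by measurable
  have [measurable]: "(\<lambda>x. cis (h * x)) \<in> Borel" for h unfolding cis_conv_exp by measurable
  have "(NN h. (NN \<omega>. ennreal ((cmod ((cis (\<omega> * h) - 1) * fourier w \<omega>))^2)) * ennreal (h powr (-1 - 2 * s)) * indicator {0<..} h)
   = (NN h. NN \<omega>. ?g h \<omega>)"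
   by (intro nn_integral_cong, subst nn_integral_multc[symmetric], simp, subst nn_integral_multc[symmetric], simp)
    (auto intro!: nn_integral_cong simp: norm_mult power_mult_distrib ennreal_mult mult_ac)
  also have "... = (NN \<omega>. NN h. ?g h \<omega>)"
   by (rule lborel_pair.Fubini'[symmetric]) measurable
  also have "... = (NN \<omega>. (ennreal K * ennreal (\<bar>\<omega>\<bar> powr (2 * s))) * ennreal ((cmod (fourier w \<omega>))^2))"
   by (intro nn_integral_cong, subst nn_integral_multc) (auto simp: K(2))
  also have "... = ennreal K * FN s w"
   unfolding FN_def by (subst nn_integral_cmult[symmetric]) (auto intro!: nn_integral_cong simp: ennreal_mult mult_ac)
  finally show ?thesis .
 qed
 with K(1) show ?thesis by blast
qed

text \<open>For each step h the two halves of Plancherel are applied to w (x + h) - w x, and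
  \<open>gag_kernel_FN\<close> collects the steps. The upper bound needs the whole line; the lower
  one holds on any J of continuity points, the form in which an arbitrary extension can be
  inserted.\<close>

lemma gag_FN:
 assumes s: "0 < s" "s < 1"
 obtains C where "C > 0"
  "\<And>w. integrable lborel w \<Longrightarrow> integrable lborel (\<lambda>x. (w x)^2) \<Longrightarrow> FN s w \<le> ennreal C * gag s UNIV w"
  "\<And>w J. integrable lborel w \<Longrightarrow> J \<in> sets borel \<Longrightarrow> (\<And>x. x \<in> J \<Longrightarrow> isCont w x) \<Longrightarrow> gag s J w \<le> ennreal C * FN s w"
proof -
 obtain K where K: "K > 0" "\<And>w. w \<in> Borel \<Longrightarrow>
  (NN h. (NN \<omega>. ennreal ((cmod ((cis (\<omega> * h) - 1) * fourier w \<omega>))^2)) * ennreal (h powr (-1 - 2 * s)) * indicator {0<..} h) = ennreal K * FN s w"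
  using gag_kernel_FN[OF s] by blast
 have 1: "ennreal K * FN s w \<le> ennreal (2*pi) * gag s UNIV w" if w: "integrable lborel w" and w2: "integrable lborel (\<lambda>x. (w x)^2)" for w
 proof -
  have [measurable]: "w \<in> Borel" using w by auto
  have "ennreal K * FN s w \<le> (NN h. (ennreal (2*pi) * (NN x. ennreal ((w (x + h) - w x)^2))) * ennreal (h powr (-1 - 2 * s)) * indicator {0<..} h)"
   unfolding K(2)[OF \<open>w \<in> Borel\<close>, symmetric] fourier_shift_diff(2)[OF w, symmetric]
   by (intro nn_integral_mono mult_right_mono fourier_bessel fourier_shift_diff w diff_square_integrable w2) auto
  also have "... = ennreal (2*pi) * gag s UNIV w"
   unfolding gag_def by (subst nn_integral_cmult[symmetric]) (auto simp: mult.assoc)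
  finally show ?thesis .
 qed
 have 2: "gag s J w \<le> ennreal (1/(2*pi)) * (ennreal K * FN s w)" if w: "integrable lborel w" and J[measurable]: "J \<in> sets borel" and c: "\<And>x. x \<in> J \<Longrightarrow> isCont w x" for w J
 proof -
  have [measurable]: "w \<in> Borel" using w by auto
  have [measurable]: "(\<lambda>x. cis (x * h)) \<in> Borel" for h unfolding cis_conv_exp by measurable
  have [measurable]: "(\<lambda>h. NN \<omega>. ennreal ((cmod ((cis (\<omega> * h) - 1) * fourier w \<omega>))^2)) \<in> Borel"
   unfolding cis_conv_exp by measurable
  have h: "(NN x. ennreal ((w (x + h) - w x)^2) * indicator J x * indicator J (x + h))
    \<le> ennreal (1/(2*pi)) * (NN \<omega>. ennreal ((cmod ((cis (\<omega> * h) - 1) * fourier w \<omega>))^2))" for h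
  proof -
   have "(NN x. ennreal ((w (x + h) - w x)^2) * indicator J x * indicator J (x + h))
    = (NN x. ennreal ((w (x + h) - w x)^2) * indicator {x \<in> space borel. x \<in> J \<and> x + h \<in> J} x)"
    by (intro nn_integral_cong) (auto simp: indicator_def)
   also have "... \<le> ennreal (1/(2*pi)) * (NN \<omega>. ennreal ((cmod (fourier (\<lambda>x. w (x + h) - w x) \<omega>))^2))"
   proof (rule fourier_lower)
    fix x assume "x \<in> {x \<in> space borel. x \<in> J \<and> x + h \<in> J}"
    then have "isCont w x" "isCont w (x + h)" using c by auto
    then show "isCont (\<lambda>x. w (x + h) - w x) x"
     by (intro continuous_intros isCont_o2[where f="\<lambda>x. x + h" and g=w]) auto
   qed (use fourier_shift_diff(1)[OF w] in simp_all)
   finally show ?thesis unfolding fourier_shift_diff(2)[OF w] .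
  qed
  have "gag s J w \<le> (NN h. (ennreal (1/(2*pi)) * (NN \<omega>. ennreal ((cmod ((cis (\<omega> * h) - 1) * fourier w \<omega>))^2))) * ennreal (h powr (-1 - 2 * s)) * indicator {0<..} h)"
   unfolding gag_def by (intro nn_integral_mono mult_right_mono h) auto
  also have "... = ennreal (1/(2*pi)) * (ennreal K * FN s w)"
   unfolding K(2)[OF \<open>w \<in> Borel\<close>, symmetric]
   by (subst nn_integral_cmult[symmetric]) (auto simp: mult.assoc)
  finally show ?thesis .
 qed
 define C where "C = max (2*pi/K) (K/(2*pi))"
 have C: "C > 0" "2*pi/K \<le> C" "K/(2*pi) \<le> C" using K(1) by (auto simp: C_def less_max_iff_disj)
 show ?thesis
 proof (rule that[OF C(1)])
  fix w :: "real \<Rightarrow> real" assume w: "integrable lborel w" and w2: "integrable lborel (\<lambda>x. (w x)^2)"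
  have "FN s w = ennreal (1/K) * (ennreal K * FN s w)" using K(1) by (simp add: mult.assoc[symmetric] ennreal_mult[symmetric])
  also have "... \<le> ennreal (1/K) * (ennreal (2*pi) * gag s UNIV w)" by (intro mult_left_mono 1 w w2) auto
  also have "... = ennreal (2*pi/K) * gag s UNIV w" using K(1) by (simp add: mult.assoc[symmetric] ennreal_mult[symmetric])
  also have "... \<le> ennreal C * gag s UNIV w" by (intro mult_right_mono ennreal_leI C) auto
  finally show "FN s w \<le> ennreal C * gag s UNIV w" .
 next
  fix w :: "real \<Rightarrow> real" and J assume w: "integrable lborel w" and J: "J \<in> sets borel" and c: "\<And>x::real. x \<in> J \<Longrightarrow> isCont w x"
  have "gag s J w \<le> ennreal (1/(2*pi)) * (ennreal K * FN s w)" by (rule 2[OF w J c])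
  also have "... = ennreal (K/(2*pi)) * FN s w" using K(1) by (simp add: mult.assoc[symmetric] ennreal_mult[symmetric])
  also have "... \<le> ennreal C * FN s w" by (intro mult_right_mono ennreal_leI C) auto
  finally show "gag s J w \<le> ennreal C * FN s w" .
 qed
qed

section \<open>Fractional Hardy inequality and extension by zero\<close>

definition sq2 :: "real \<Rightarrow> real \<Rightarrow> (real \<Rightarrow> real) \<Rightarrow> ennreal" where
 "sq2 a b u = (NN x. ennreal ((u x)^2) * indicator {a<..<b} x)"

lemma gag_alt_right:
 assumes [measurable]: "w \<in> Borel" "J \<in> sets borel"
 shows "gag s J w = (NN x. NN h. ennreal ((w (x + h) - w x)^2) * indicator J x * indicator J (x + h)
   * ennreal (h powr (-1 - 2 * s)) * indicator {0<..} h)"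
proof -
 have "gag s J w = (NN h. NN x. ennreal ((w (x + h) - w x)^2) * indicator J x * indicator J (x + h)
   * ennreal (h powr (-1 - 2 * s)) * indicator {0<..} h)"
  unfolding gag_def by (simp add: nn_integral_multc)
 also have "... = (NN x. NN h. ennreal ((w (x + h) - w x)^2) * indicator J x * indicator J (x + h)
   * ennreal (h powr (-1 - 2 * s)) * indicator {0<..} h)"
  by (rule lborel_pair.Fubini'[symmetric]) simp
 finally show ?thesis .
qed

lemma nn_shift:
 fixes f :: "real \<Rightarrow> ennreal"
 assumes "f \<in> Borel"
 shows "(NN x. f x) = (NN x. f (x - h))" "(NN x. f x) = (NN x. f (- x))"
  "(NN x. f x) = (NN x. f (x + h))"
 using nn_integral_real_affine[OF assms, of 1 "-h"] nn_integral_real_affine[OF assms, of "-1" 0] nn_integral_real_affine[OF assms, of 1 h]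
 by (simp_all add: add.commute)

text \<open>Shifting x by h replaces forward by backward differences, the form that matches
  dilations with a factor below 1 in the Hardy estimate.\<close>

lemma gag_alt_left:
 assumes [measurable]: "w \<in> Borel" "J \<in> sets borel"
 shows "gag s J w = (NN x. NN h. ennreal ((w (x - h) - w x)^2) * indicator J x * indicator J (x - h)
   * ennreal (h powr (-1 - 2 * s)) * indicator {0<..} h)"
proof -
 have e: "(NN x. ennreal ((w (x + h) - w x)^2) * indicator J x * indicator J (x + h))
   = (NN x. ennreal ((w (x - h) - w x)^2) * indicator J x * indicator J (x - h))" for h
  by (subst nn_shift(1)[of _ h], simp) (simp add: power2_commute mult_ac)
 have "gag s J w = (NN h. NN x. ennreal ((w (x - h) - w x)^2) * indicator J x * indicator J (x - h)
   * ennreal (h powr (-1 - 2 * s)) * indicator {0<..} h)"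
  unfolding gag_def e by (simp add: nn_integral_multc)
 also have "... = (NN x. NN h. ennreal ((w (x - h) - w x)^2) * indicator J x * indicator J (x - h)
   * ennreal (h powr (-1 - 2 * s)) * indicator {0<..} h)"
  by (rule lborel_pair.Fubini'[symmetric]) simp
 finally show ?thesis .
qed

lemma gag_reflect:
 assumes [measurable]: "w \<in> Borel" "J \<in> sets borel" "uminus ` J \<in> sets borel"
 shows "gag s (uminus ` J) (\<lambda>x. w (- x)) = gag s J w"
proof -
 have i: "indicator (uminus ` J) x = (indicator J (- x) :: ennreal)" for x :: real
  by (auto simp: indicator_def image_iff) (metis minus_minus)
 have "gag s (uminus ` J) (\<lambda>x. w (- x)) = (NN x. NN h. ennreal ((w (- x - h) - w (- x))^2) * indicator J (- x) * indicator J (- x - h)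
   * ennreal (h powr (-1 - 2 * s)) * indicator {0<..} h)"
  by (subst gag_alt_right) (simp_all add: i)
 also have "... = gag s J w"
  unfolding gag_alt_left[OF assms(1,2)] by (rule nn_shift(2)[symmetric]) simp
 finally show ?thesis .
qed

text \<open>Expand (u - v - e v)^2 \<ge> 0. The factor 1 + e in front of v^2 can be taken close to
  1, so that this term can later be absorbed.\<close>

lemma sq_split_eps: "0 < e \<Longrightarrow> (u::real)^2 \<le> (1 + 1/e) * (u - v)^2 + (1 + e) * v^2"
proof -
 assume e: "0 < e"
 have "0 \<le> (1/e) * ((u - v) - e * v)^2" using e by simp
 also have "... = (1/e) * (u - v)^2 - 2 * (u - v) * v + e * v^2"
  using e by (simp add: power2_eq_square field_simps)
 finally show ?thesis by (simp add: power2_eq_square algebra_simps)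
qed

text \<open>The factor \<theta> powr (2 s - 1) drives the Hardy inequality: it is below 1 for a
  contraction if s > 1/2, for an expansion if s < 1/2, and equals 1 at the critical order.\<close>

lemma nn_scale_weight:
 fixes g :: "real \<Rightarrow> real"
 assumes [measurable]: "g \<in> Borel" and t: "\<theta> > 0"
 shows "(NN x. ennreal (x powr (-2 * s) * (g (\<theta> * x))^2) * indicator {0<..<M} x)
  = ennreal (\<theta> powr (2 * s - 1)) * (NN y. ennreal (y powr (-2 * s) * (g y)^2) * indicator {0<..<\<theta>*M} y)"
proof -
 let ?f = "\<lambda>y. ennreal (y powr (-2 * s) * (g y)^2) * indicator {0<..<\<theta>*M} y"
 have m: "?f \<in> Borel" by measurable
 have e: "?f (0 + \<theta> * x) = ennreal (\<theta> powr (-2 * s)) * (ennreal (x powr (-2 * s) * (g (\<theta> * x))^2) * indicator {0<..<M} x)" for x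
  using t by (auto simp: indicator_def powr_mult ennreal_mult[symmetric] zero_less_mult_iff mult_ac)
 have "ennreal (\<theta> powr (2 * s - 1)) * (NN y. ?f y) = ennreal (\<theta> powr (2 * s - 1)) * (ennreal \<bar>\<theta>\<bar> * (NN x. ?f (0 + \<theta> * x)))"
  using nn_integral_real_affine[OF m, of \<theta> 0] t by simp
 also have "... = ennreal (\<theta> powr (2 * s - 1) * \<theta> * \<theta> powr (-2 * s)) * (NN x. ennreal (x powr (-2 * s) * (g (\<theta> * x))^2) * indicator {0<..<M} x)"
  unfolding e by (subst nn_integral_cmult) (use t in \<open>simp_all add: ennreal_mult mult.assoc\<close>)
 also have "\<theta> powr (2 * s - 1) * \<theta> * \<theta> powr (-2 * s) = 1"
 proof -
  have "\<theta> powr (2 * s - 1) * \<theta> * \<theta> powr (-2 * s) = \<theta> powr (2 * s - 1) * \<theta> powr 1 * \<theta> powr (-2 * s)" using t by simp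
  also have "... = \<theta> powr 0" by (simp only: powr_add[symmetric]) simp
  finally show ?thesis using t by simp
 qed
 finally show ?thesis by simp
qed

text \<open>Averaging the differences \<open>g x - g (\<theta> x)\<close> over a range of dilations \<open>\<theta> = 1 + s r\<close> (with a sign \<open>s\<close>)
 gives a Gagliardo seminorm, because \<open>\<bar>x - \<theta> x\<bar> \<le> x\<close>.\<close>
lemma dilation_average:
 fixes g :: "real \<Rightarrow> real"
 assumes [measurable]: "g \<in> Borel" and s: "s = 1 \<or> s = -1" and r: "0 < r1" "r1 < r2" "r2 \<le> 1"
  and M: "0 < M" "M \<le> L" "\<And>r. r1 < r \<Longrightarrow> r < r2 \<Longrightarrow> 0 < (1 + s*r) \<and> (1 + s*r) * M \<le> L" and sg: "\<sigma> > 0"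
 shows "(NN r. (NN x. ennreal (x powr (-2*\<sigma>) * (g x - g ((1 + s*r) * x))^2) * indicator {0<..<M} x) * indicator {r1<..<r2} r)
   \<le> gag \<sigma> {0<..<L} g"
proof -
 let ?J = "{0<..<L}"
 let ?F = "\<lambda>x r. ennreal (x powr (-2*\<sigma>) * (g x - g ((1 + s*r) * x))^2) * indicator {0<..<M} x * indicator {r1<..<r2} r"
 let ?G = "\<lambda>x h. ennreal ((g (x + s * h) - g x)^2) * indicator ?J x * indicator ?J (x + s * h)
   * ennreal (h powr (-1 - 2*\<sigma>)) * indicator {0<..} h"
 have gagG: "gag \<sigma> ?J g = (NN x. NN h. ?G x h)"
  using s gag_alt_right[of g ?J \<sigma>] gag_alt_left[of g ?J \<sigma>] by auto
 have "(NN r. (NN x. ennreal (x powr (-2*\<sigma>) * (g x - g ((1 + s*r) * x))^2) * indicator {0<..<M} x) * indicator {r1<..<r2} r)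
   = (NN r. NN x. ?F x r)"
  by (simp add: nn_integral_multc)
 also have "... = (NN x. NN r. ?F x r)"
  by (rule lborel_pair.Fubini'[symmetric]) simp
 also have "... \<le> (NN x. NN h. ?G x h)"
 proof (rule nn_integral_mono)
  fix x :: real
  show "(NN r. ?F x r) \<le> (NN h. ?G x h)"
  proof (cases "x \<in> {0<..<M}")
   case True
   then have x: "x > 0" by simp
   have m: "(\<lambda>h. ?G x h) \<in> Borel" by measurable
   \<comment> \<open>For fixed x the substitution h = x r has Jacobian x, and x * (x r) powr (-1 -
     2\<sigma>) dominates x powr (-2\<sigma>) because r \<le> 1.\<close>
   have "(NN r. ?F x r) \<le> (NN r. ennreal x * ?G x (0 + x * r))"
   proof (rule nn_integral_mono)
    fix r :: real
    show "?F x r \<le> ennreal x * ?G x (0 + x * r)"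
    proof (cases "r \<in> {r1<..<r2}")
     case r': True
     have th: "0 < (1 + s*r)" "(1 + s*r) * M \<le> L" using M(3)[of r] r' by auto
     have "(1 + s*r) * x < (1 + s*r) * M" using th True by (intro mult_strict_left_mono) auto
     then have "(1 + s*r) * x < L" using th by linarith
     moreover have "x + s * (x * r) = (1 + s*r) * x" by (simp add: algebra_simps)
     moreover have "0 < (1 + s*r) * x" using th x by simp
     ultimately have in1: "x + s * (x * r) \<in> ?J" using th by simp
     have in2: "x \<in> ?J" using True M by auto
     have hp: "0 < x * r" using x r r' by simp
     have "x * r \<le> x" using x r r' by simp
     then have "x powr (-1 - 2*\<sigma>) \<le> (x * r) powr (-1 - 2*\<sigma>)" using hp sg by (intro powr_mono2') auto
     then have "x * x powr (-1 - 2*\<sigma>) \<le> x * (x * r) powr (-1 - 2*\<sigma>)" using x by simp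
     moreover have "x * x powr (-1 - 2*\<sigma>) = x powr (-2*\<sigma>)" using x by (simp add: powr_mult_base)
     ultimately have "x powr (-2*\<sigma>) * (g x - g ((1 + s*r) * x))^2 \<le> x * (x * r) powr (-1 - 2*\<sigma>) * (g x - g ((1 + s*r) * x))^2"
      by (intro mult_right_mono) auto
     also have "(1 + s*r) * x = x + s * (x * r)" by (simp add: algebra_simps)
     finally have "ennreal (x powr (-2*\<sigma>) * (g x - g ((1 + s*r) * x))^2) \<le> ennreal (x * (x * r) powr (-1 - 2*\<sigma>) * (g x - g (x + s * (x * r)))^2)"
      by (simp add: algebra_simps ennreal_leI)
     also have "... = ennreal x * ?G x (0 + x * r)"
      using in1 in2 hp x by (simp add: ennreal_mult mult_ac power2_commute)
     finally show ?thesis using True r' by simp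
    qed simp
   qed
   also have "... = ennreal x * (NN r. ?G x (0 + x * r))" by (rule nn_integral_cmult) measurable
   also have "... = (NN h. ?G x h)"
    using nn_integral_real_affine[OF m, of x 0] x by simp
   finally show ?thesis .
  qed simp
 qed
 finally show ?thesis unfolding gagG .
qed

text \<open>Let H be the weighted integral and write g x = (g x - g (\<theta> x)) + g (\<theta> x).
  By scaling the second part returns H with a factor (1 + e) * q0 below 1 and is absorbed; the first
  part is averaged over \<theta> by \<open>dilation_average\<close>. The range away from 0 costs
  only the squared L2 norm.\<close>

lemma hardy_zero:
 assumes s: "0 < s" "s < 1" "s \<noteq> 1/2" and L: "0 < L"
 shows "\<exists>C>0. \<forall>g\<in>Borel. (\<exists>c>0. \<forall>x<c. g x = 0) \<longrightarrow> sq2 0 L g < \<infinity> \<longrightarrow>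
  (NN x. ennreal (x powr (-2 * s) * (g x)^2) * indicator {0<..<L} x) \<le> ennreal C * (gag s {0<..<L} g + sq2 0 L g)"
proof -
 \<comment> \<open>The dilations \<theta> = 1 + sg * r are contractions in (1/4,1/2) if s > 1/2 and
   expansions in (3/2,2) if s < 1/2. Either way \<theta> powr (2 s - 1) \<le> q0 < 1.\<close>
 obtain sg r1 r2 q0 where sr: "sg = 1 \<or> sg = (-1::real)" "0 < r1" "r1 < r2" "r2 \<le> (1::real)" "0 < q0" "q0 < 1"
  and q: "\<And>r. r1 < r \<Longrightarrow> r < r2 \<Longrightarrow> 0 < 1 + sg * r \<and> 1 + sg * r \<le> 2 \<and> (1 + sg * r) powr (2 * s - 1) \<le> q0"
 proof (cases "s > 1/2")
  case True
  show ?thesis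
  proof (rule that[of "-1" "1/2" "3/4" "(1/2) powr (2 * s - 1)"])
   show "(1/2) powr (2 * s - 1) < 1" using True powr_less_mono2[of "2 * s - 1" "1/2" 1] by simp
   show "0 < 1 + - 1 * r \<and> 1 + - 1 * r \<le> 2 \<and> (1 + - 1 * r) powr (2 * s - 1) \<le> (1/2) powr (2 * s - 1)" if "1/2 < r" "r < 3/4" for r
    using that True by (auto intro!: powr_mono2)
  qed auto
 next
  case False
  then have False': "s < 1/2" using s by simp
  show ?thesis
  proof (rule that[of "1" "1/2" "1" "(3/2) powr (2 * s - 1)"])
   show "(3/2) powr (2 * s - 1) < 1" using False' powr_less_mono2_neg[of "2 * s - 1" 1 "3/2"] by simp
   show "0 < 1 + 1 * r \<and> 1 + 1 * r \<le> 2 \<and> (1 + 1 * r) powr (2 * s - 1) \<le> (3/2) powr (2 * s - 1)" if "1/2 < r" "r < 1" for r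
    using that False' by (auto intro!: powr_mono2')
  qed auto
 qed
 \<comment> \<open>With this e, (1 + e) * q0 \<le> q0 + e = (1 + q0)/2 < 1.\<close>
 define e where "e = (1 - q0) / 2"
 have e: "e > 0" "(1 + e) * q0 < 1"
 proof -
  show "e > 0" using sr by (simp add: e_def)
  have "e * q0 \<le> e" using sr \<open>e > 0\<close> by (simp add: mult_left_le)
  then have "(1 + e) * q0 \<le> q0 + e" by (simp add: algebra_simps)
  also have "... < 1" using sr unfolding e_def by (simp add: field_simps)
  finally show "(1 + e) * q0 < 1" .
 qed
 \<comment> \<open>Half the length, since \<theta> \<le> 2: the dilated interval (0, \<theta> M)
   stays inside (0,L).\<close>
 define M where "M = L/2"
 have M: "0 < M" "M \<le> L" using L by (auto simp: M_def)
 define k where "k = 1 - (1 + e) * q0"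
 have k: "k > 0" using e by (simp add: k_def)
 define i where "i = r2 - r1"
 have i: "i > 0" using sr by (simp add: i_def)
 define C where "C = max ((1 + 1/e) / (i * k)) (M powr (-2 * s) / k)"
 have C: "C > 0" "(1 + 1/e) / (i * k) \<le> C" "M powr (-2 * s) / k \<le> C"
 proof -
  have "0 < (1 + 1/e) / (i * k)" using e i k by (intro divide_pos_pos add_pos_pos mult_pos_pos) auto
  then show "C > 0" by (simp add: C_def less_max_iff_disj)
 qed (auto simp: C_def)
 show ?thesis
 proof (intro exI[of _ C] conjI C(1) ballI impI)
  fix g :: "real \<Rightarrow> real" assume [measurable]: "g \<in> Borel" and v: "\<exists>c>0. \<forall>x<c. g x = 0" and fin: "sq2 0 L g < \<infinity>"
  define H where "H M = (NN x. ennreal (x powr (-2 * s) * (g x)^2) * indicator {0<..<M} x)" for M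
  define D where "D r = (NN x. ennreal (x powr (-2 * s) * (g x - g ((1 + sg*r) * x))^2) * indicator {0<..<M} x)" for r
  have [measurable]: "D \<in> Borel" unfolding D_def by measurable
  obtain c where c: "c > 0" "\<And>x. x < c \<Longrightarrow> g x = 0" using v by blast
  \<comment> \<open>Vanishing near 0 makes H L finite, which is what permits subtracting a multiple
    of it from both sides below.\<close>
  have "H L \<le> (NN x. ennreal (c powr (-2 * s)) * (ennreal ((g x)^2) * indicator {0<..<L} x))"
   unfolding H_def
  proof (rule nn_integral_mono)
   fix x
   show "ennreal (x powr (-2 * s) * (g x)^2) * indicator {0<..<L} x \<le> ennreal (c powr (-2 * s)) * (ennreal ((g x)^2) * indicator {0<..<L} x)"
   proof (cases "x < c")
    case False
    have "x powr (-2 * s) \<le> c powr (-2 * s)" using False c s by (intro powr_mono2') auto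
    then show ?thesis by (auto simp: indicator_def ennreal_mult[symmetric] intro!: ennreal_leI mult_right_mono)
   qed (simp add: c)
  qed
  also have "... = ennreal (c powr (-2 * s)) * sq2 0 L g" unfolding sq2_def by (rule nn_integral_cmult) measurable
  also have "... < \<infinity>" using fin by (simp add: ennreal_mult_less_top)
  finally have HL: "H L < \<infinity>" .
  have split: "H L \<le> H M + ennreal (M powr (-2 * s)) * sq2 0 L g"
  proof -
   have "H L \<le> (NN x. ennreal (x powr (-2 * s) * (g x)^2) * indicator {0<..<M} x + ennreal (M powr (-2 * s)) * (ennreal ((g x)^2) * indicator {0<..<L} x))"
    unfolding H_def
   proof (rule nn_integral_mono)
    fix x
    show "ennreal (x powr (-2 * s) * (g x)^2) * indicator {0<..<L} x \<le> ennreal (x powr (-2 * s) * (g x)^2) * indicator {0<..<M} x + ennreal (M powr (-2 * s)) * (ennreal ((g x)^2) * indicator {0<..<L} x)"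
    proof (cases "x < M")
     case False
     have "x powr (-2 * s) \<le> M powr (-2 * s)" using False M s by (intro powr_mono2') auto
     then have "ennreal (x powr (-2 * s) * (g x)^2) * indicator {0<..<L} x \<le> ennreal (M powr (-2 * s)) * (ennreal ((g x)^2) * indicator {0<..<L} x)"
      by (auto simp: indicator_def ennreal_mult[symmetric] intro!: ennreal_leI mult_right_mono)
     then show ?thesis by (simp add: add_increasing)
    qed (auto simp: indicator_def)
   qed
   also have "... = H M + ennreal (M powr (-2 * s)) * sq2 0 L g"
    unfolding H_def sq2_def by (subst nn_integral_add) (auto simp: nn_integral_cmult)
   finally show ?thesis .
  qed
  have main: "H M \<le> ennreal (1 + 1/e) * D r + ennreal ((1 + e) * q0) * H L" if r: "r1 < r" "r < r2" for r
  proof -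
   let ?t = "1 + sg * r"
   note qr = q[OF r]
   have "H M \<le> (NN x. ennreal (1 + 1/e) * (ennreal (x powr (-2 * s) * (g x - g (?t * x))^2) * indicator {0<..<M} x) + ennreal (1 + e) * (ennreal (x powr (-2 * s) * (g (?t * x))^2) * indicator {0<..<M} x))"
    unfolding H_def
   proof (rule nn_integral_mono)
    fix x
    have "x powr (-2 * s) * (g x)^2 \<le> x powr (-2 * s) * ((1 + 1/e) * (g x - g (?t * x))^2 + (1 + e) * (g (?t * x))^2)"
     by (intro mult_left_mono sq_split_eps e) auto
    also have "... = (1 + 1/e) * (x powr (-2 * s) * (g x - g (?t * x))^2) + (1 + e) * (x powr (-2 * s) * (g (?t * x))^2)"
     by (simp add: algebra_simps)
    finally have "ennreal (x powr (-2 * s) * (g x)^2) \<le> ennreal ..." by (rule ennreal_leI)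
    also have "... = ennreal (1 + 1/e) * ennreal (x powr (-2 * s) * (g x - g (?t * x))^2) + ennreal (1 + e) * ennreal (x powr (-2 * s) * (g (?t * x))^2)"
     using e by (subst ennreal_plus) (auto simp: ennreal_mult simp del: ennreal_plus)
    finally show "ennreal (x powr (-2 * s) * (g x)^2) * indicator {0<..<M} x \<le> ennreal (1 + 1/e) * (ennreal (x powr (-2 * s) * (g x - g (?t * x))^2) * indicator {0<..<M} x) + ennreal (1 + e) * (ennreal (x powr (-2 * s) * (g (?t * x))^2) * indicator {0<..<M} x)"
     by (auto simp: indicator_def)
   qed
   also have "... = ennreal (1 + 1/e) * D r + ennreal (1 + e) * (ennreal (?t powr (2 * s - 1)) * H (?t * M))"
    unfolding H_def D_def using qr
    by (subst nn_integral_add, simp, simp, subst nn_integral_cmult, simp, subst nn_integral_cmult, simp, subst nn_scale_weight) simp_all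
   also have "... \<le> ennreal (1 + 1/e) * D r + ennreal (1 + e) * (ennreal q0 * H L)"
   proof (intro add_left_mono mult_left_mono mult_mono)
    show "ennreal (?t powr (2 * s - 1)) \<le> ennreal q0" using qr by (intro ennreal_leI) auto
    have "?t * M \<le> L" using qr M unfolding M_def by (simp add: mult.commute)
    then show "H (?t * M) \<le> H L" unfolding H_def by (intro nn_integral_mono) (auto simp: indicator_def)
   qed auto
   also have "... = ennreal (1 + 1/e) * D r + ennreal ((1 + e) * q0) * H L"
    using e sr by (simp add: ennreal_mult mult.assoc)
   finally show ?thesis .
  qed
  obtain hl where hl: "H L = ennreal hl" "hl \<ge> 0" using HL by (metis infinity_ennreal_def less_top_ennreal)
  have kr: "ennreal (k * hl) \<le> ennreal (1 + 1/e) * D r + ennreal (M powr (-2 * s)) * sq2 0 L g" if r: "r1 < r" "r < r2" for r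
  proof -
   let ?X = "ennreal (1 + 1/e) * D r + ennreal (M powr (-2 * s)) * sq2 0 L g"
   have "H L \<le> ennreal (1 + 1/e) * D r + ennreal ((1 + e) * q0) * H L + ennreal (M powr (-2 * s)) * sq2 0 L g"
    using split main[OF r] by (meson add_right_mono order_trans)
   then have le: "ennreal hl \<le> ?X + ennreal ((1 + e) * q0 * hl)"
    unfolding hl using e sr hl(2) by (simp add: ennreal_mult'' mult.assoc add_ac)
   have "ennreal (k * hl) + ennreal ((1 + e) * q0 * hl) = ennreal hl"
   proof (subst ennreal_plus[symmetric])
    show "0 \<le> k * hl" "0 \<le> (1 + e) * q0 * hl" using k e sr hl(2) by simp_all
    show "ennreal (k * hl + (1 + e) * q0 * hl) = ennreal hl" by (simp add: k_def algebra_simps)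
   qed
   with le have "ennreal ((1 + e) * q0 * hl) + ennreal (k * hl) \<le> ennreal ((1 + e) * q0 * hl) + ?X"
    by (metis add.commute)
   then show ?thesis by (rule ennreal_add_left_cancel_le[THEN iffD1, THEN disjE]) auto
  qed
  \<comment> \<open>The estimate holds for every admissible r; integrating it over (r1,r2), of
    length i, brings in the Gagliardo seminorm.\<close>
  have "ennreal (k * hl) * ennreal i = (NN r. ennreal (k * hl) * indicator {r1<..<r2} r)"
   using sr by (simp add: nn_integral_cmult_indicator i_def)
  also have "... \<le> (NN r. ennreal (1 + 1/e) * (D r * indicator {r1<..<r2} r) + (ennreal (M powr (-2 * s)) * sq2 0 L g) * indicator {r1<..<r2} r)"
   by (intro nn_integral_mono) (use kr in \<open>auto simp: indicator_def\<close>)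
  also have "... = ennreal (1 + 1/e) * (NN r. D r * indicator {r1<..<r2} r) + (ennreal (M powr (-2 * s)) * sq2 0 L g) * ennreal i"
   using sr by (subst nn_integral_add, simp, simp, subst nn_integral_cmult, simp, subst nn_integral_cmult_indicator) (simp_all add: i_def)
  also have "(NN r. D r * indicator {r1<..<r2} r) \<le> gag s {0<..<L} g"
   unfolding D_def
  proof (rule dilation_average)
   fix r assume "r1 < r" "r < r2"
   from q[OF this] show "0 < 1 + sg * r \<and> (1 + sg * r) * M \<le> L" using L unfolding M_def by (simp add: mult.commute)
  qed (use sr M s in auto)
  finally have fin: "ennreal (k * hl) * ennreal i \<le> ennreal (1 + 1/e) * gag s {0<..<L} g + (ennreal (M powr (-2 * s)) * sq2 0 L g) * ennreal i"
   by (simp add: mult_left_mono)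
  have "H L = ennreal (1 / (i * k)) * (ennreal (k * hl) * ennreal i)"
   using i k hl(2) by (simp add: hl(1) ennreal_mult[symmetric])
  also have "... \<le> ennreal (1 / (i * k)) * (ennreal (1 + 1/e) * gag s {0<..<L} g + (ennreal (M powr (-2 * s)) * sq2 0 L g) * ennreal i)"
   by (intro mult_left_mono fin) auto
  also have "... = ennreal ((1 + 1/e) / (i * k)) * gag s {0<..<L} g + ennreal (M powr (-2 * s) / k) * sq2 0 L g"
  proof -
   have a: "ennreal (1 / (i * k)) * ennreal (1 + 1/e) = ennreal ((1 + 1/e) / (i * k))"
    using e i k by (subst ennreal_mult[symmetric]) auto
   have b: "ennreal (1 / (i * k)) * (ennreal (M powr (-2 * s)) * ennreal i) = ennreal (M powr (-2 * s) / k)"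
    using e i k by (subst ennreal_mult[symmetric], simp, simp, subst ennreal_mult[symmetric]) auto
   show ?thesis unfolding distrib_left mult.assoc[symmetric] a b[symmetric] by (simp add: mult_ac)
  qed
  also have "... \<le> ennreal C * gag s {0<..<L} g + ennreal C * sq2 0 L g"
   by (intro add_mono mult_right_mono ennreal_leI C) auto
  finally show "(NN x. ennreal (x powr (-2 * s) * (g x)^2) * indicator {0<..<L} x) \<le> ennreal C * (gag s {0<..<L} g + sq2 0 L g)"
   unfolding H_def by (simp add: distrib_left)
 qed
qed

lemma gag_shift:
 assumes [measurable]: "w \<in> Borel"
 shows "gag s {0<..<b - a} (\<lambda>x. w (a + x)) = gag s {a<..<b} w"
proof -
 have i: "indicator {0<..<b - a} x = (indicator {a<..<b} (a + x) :: ennreal)" for x :: real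
  by (auto simp: indicator_def)
 have "gag s {0<..<b - a} (\<lambda>x. w (a + x)) = (NN x. NN h. ennreal ((w ((x + a) + h) - w (x + a))^2) * indicator {a<..<b} (x + a) * indicator {a<..<b} ((x + a) + h)
   * ennreal (h powr (-1 - 2 * s)) * indicator {0<..} h)"
  by (subst gag_alt_right) (simp_all add: i add_ac)
 also have "... = gag s {a<..<b} w"
  by (subst gag_alt_right, simp, simp, rule nn_shift(3)[symmetric]) simp
 finally show ?thesis .
qed

text \<open>A pair x, x + h with exactly one point in (a,b) contributes the square of \<phi> at that
  point. The steps h leaving the interval on one side are those beyond the distance t to that
  endpoint, and their weights integrate to t powr (-2 s) / (2 s), a Hardy weight.\<close>

lemma gag_zero_ext:
 assumes [measurable]: "\<phi> \<in> Borel" and z: "\<And>x. x \<notin> {a<..<b} \<Longrightarrow> \<phi> x = 0" and s: "0 < s"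
 shows "gag s UNIV \<phi> \<le> gag s {a<..<b} \<phi> + ennreal (1/(2 * s)) * ((NN x. ennreal ((x - a) powr (-2 * s) * (\<phi> x)^2) * indicator {a<..<b} x)
   + (NN x. ennreal ((b - x) powr (-2 * s) * (\<phi> x)^2) * indicator {a<..<b} x))"
proof -
 let ?J = "{a<..<b}"
 let ?k = "\<lambda>h::real. ennreal (h powr (-1 - 2 * s)) * indicator {0<..} h"
 let ?A = "\<lambda>h x. ennreal ((\<phi> (x + h) - \<phi> x)^2) * indicator ?J x * indicator ?J (x + h)"
 \<comment> \<open>Here the inner point is x + h, reached from the left of a, so the step is at
   least (x + h) - a. Shifting x by h later turns this into the weight at distance x - a.\<close>
 let ?B = "\<lambda>h x. ennreal ((\<phi> (x + h))^2) * indicator ?J (x + h) * indicator {h'. h' \<ge> (x + h) - a} h"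
 let ?C = "\<lambda>h x. ennreal ((\<phi> x)^2) * indicator ?J x * indicator {b - x..} h"
 have pw: "ennreal ((\<phi> (x + h) - \<phi> x)^2) * ?k h \<le> (?A h x + ?B h x + ?C h x) * ?k h" for x h
 proof (cases "h > 0")
  case True
  have "ennreal ((\<phi> (x + h) - \<phi> x)^2) \<le> ?A h x + ?B h x + ?C h x"
  proof (cases "x \<in> ?J"; cases "x + h \<in> ?J")
   assume "x \<notin> ?J" "x + h \<in> ?J" then show ?thesis using z[of x] True by auto
  next
   assume "x \<in> ?J" "x + h \<notin> ?J" then show ?thesis using z[of "x + h"] True by auto
  next
   assume "x \<notin> ?J" "x + h \<notin> ?J" then show ?thesis using z[of "x + h"] z[of x] True by auto
  qed auto
  then show ?thesis by (rule mult_right_mono) simp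
 qed simp
 have [measurable]: "(\<lambda>x. indicator {h'. h' \<ge> (x + h) - a} h :: ennreal) \<in> Borel" for h
 proof -
  have "(\<lambda>x. indicator {h'. h' \<ge> (x + h) - a} h :: ennreal) = (indicator {x. x \<le> a})" by (auto simp: indicator_def fun_eq_iff)
  then show ?thesis by simp
 qed
 have [measurable]: "(\<lambda>x. indicator {b - x..} h :: ennreal) \<in> Borel" for h
 proof -
  have "(\<lambda>x. indicator {b - x..} h :: ennreal) = (indicator {x. b - h \<le> x})" by (auto simp: indicator_def fun_eq_iff)
  then show ?thesis by simp
 qed
 have tail: "(NN h. indicator {t..} h * ?k h) = ennreal (1/(2 * s)) * ennreal (t powr (-2 * s))" if "t > 0" for t
 proof -
  have "(NN h. indicator {t..} h * ?k h) = (NN h. ennreal (h powr (-1 - 2 * s)) * indicator {t..} h)"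
   using that by (intro nn_integral_cong) (auto simp: indicator_def)
  also have "... = ennreal (t powr (-1 - 2 * s + 1) / (- (-1 - 2 * s) - 1))" by (rule nn_powr_inf) (use s that in auto)
  also have "t powr (-1 - 2 * s + 1) / (- (-1 - 2 * s) - 1) = 1/(2 * s) * t powr (-2 * s)" by simp
  also have "ennreal ... = ennreal (1/(2 * s)) * ennreal (t powr (-2 * s))" using s by (intro ennreal_mult) auto
  finally show ?thesis .
 qed
 have gen: "(NN h. NN x. ennreal ((\<phi> x)^2) * indicator ?J x * indicator {f x..} h * ?k h)
   = ennreal (1/(2 * s)) * (NN x. ennreal ((f x) powr (-2 * s) * (\<phi> x)^2) * indicator ?J x)"
  if [measurable]: "f \<in> Borel" and fp: "\<And>x. x \<in> ?J \<Longrightarrow> f x > 0" for f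
 proof -
  have ie: "(indicator {f x..} h :: ennreal) = indicator {z \<in> space (lborel \<Otimes>\<^sub>M lborel). f (snd z) \<le> fst z} (h, x)" for x h
   by (auto simp: indicator_def space_pair_measure)
  have [measurable]: "(\<lambda>(h,x). indicator {f x..} h :: ennreal) \<in> borel_measurable (lborel \<Otimes>\<^sub>M lborel)"
   unfolding ie by measurable
  have [measurable]: "(\<lambda>h. indicator {f x..} h :: ennreal) \<in> borel_measurable lborel" for x by measurable
  have m: "(\<lambda>(h,x). ennreal ((\<phi> x)^2) * indicator ?J x * indicator {f x..} h * ?k h) \<in> borel_measurable (lborel \<Otimes>\<^sub>M lborel)"
   unfolding ie by measurable
  have "(NN h. NN x. ennreal ((\<phi> x)^2) * indicator ?J x * indicator {f x..} h * ?k h)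
    = (NN x. NN h. ennreal ((\<phi> x)^2) * indicator ?J x * indicator {f x..} h * ?k h)"
   by (rule lborel_pair.Fubini'[symmetric, OF m])
  also have "... = (NN x. ennreal (1/(2 * s)) * (ennreal ((f x) powr (-2 * s) * (\<phi> x)^2) * indicator ?J x))"
  proof (rule nn_integral_cong)
   fix x
   have "(NN h. ennreal ((\<phi> x)^2) * indicator ?J x * indicator {f x..} h * ?k h) = ennreal ((\<phi> x)^2) * indicator ?J x * (NN h. indicator {f x..} h * ?k h)"
    by (subst nn_integral_cmult[symmetric]) (auto simp: mult.assoc)
   also have "... = ennreal (1/(2 * s)) * (ennreal ((f x) powr (-2 * s) * (\<phi> x)^2) * indicator ?J x)"
   proof (cases "x \<in> ?J")
    case True then show ?thesis using tail[OF fp[OF True]] by (simp add: ennreal_mult mult_ac)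
   qed simp
   finally show "(NN h. ennreal ((\<phi> x)^2) * indicator ?J x * indicator {f x..} h * ?k h) = ennreal (1/(2 * s)) * (ennreal ((f x) powr (-2 * s) * (\<phi> x)^2) * indicator ?J x)" .
  qed
  also have "... = ennreal (1/(2 * s)) * (NN x. ennreal ((f x) powr (-2 * s) * (\<phi> x)^2) * indicator ?J x)"
   by (rule nn_integral_cmult) measurable
  finally show ?thesis .
 qed
 have sh: "(NN x. ?B h x * ?k h) = (NN x. ennreal ((\<phi> x)^2) * indicator ?J x * indicator {x - a..} h * ?k h)" for h
 proof -
  have [measurable]: "(\<lambda>x. indicator {x - a..} h :: ennreal) \<in> Borel"
  proof -
   have "(\<lambda>x. indicator {x - a..} h :: ennreal) = (indicator {x. x \<le> a + h})" by (auto simp: indicator_def fun_eq_iff)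
   then show ?thesis by simp
  qed
  show ?thesis
   by (subst nn_shift(3)[of "\<lambda>x. ennreal ((\<phi> x)^2) * indicator ?J x * indicator {x - a..} h * ?k h" h], measurable)
    (auto intro!: nn_integral_cong simp: indicator_def)
 qed
 have "gag s UNIV \<phi> = (NN h. (NN x. ennreal ((\<phi> (x + h) - \<phi> x)^2) * ?k h))"
  unfolding gag_def by (simp add: nn_integral_multc mult.assoc)
 also have "... \<le> (NN h. (NN x. (?A h x + ?B h x + ?C h x) * ?k h))"
  by (intro nn_integral_mono pw)
 also have "... = (NN h. (NN x. ?A h x * ?k h) + (NN x. ?B h x * ?k h) + (NN x. ?C h x * ?k h))"
 proof (rule nn_integral_cong)
  fix h :: real
  have nn3: "(NN x. (f x + g x + k x) * c) = (NN x. f x * c) + (NN x. g x * c) + (NN x. k x * c)"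
   if [measurable]: "f \<in> Borel" "g \<in> Borel" "k \<in> Borel" for f g k :: "real \<Rightarrow> ennreal" and c
   by (simp add: distrib_right nn_integral_add)
  show "(NN x. (?A h x + ?B h x + ?C h x) * ?k h) = (NN x. ?A h x * ?k h) + (NN x. ?B h x * ?k h) + (NN x. ?C h x * ?k h)"
  proof (rule nn3)
   show "?A h \<in> Borel" by measurable
   show "?B h \<in> Borel" by (intro borel_measurable_times_ennreal) measurable
   show "?C h \<in> Borel" by (intro borel_measurable_times_ennreal) measurable
  qed
 qed
 also have "... = (NN h. (NN x. ?A h x * ?k h) + (NN x. ennreal ((\<phi> x)^2) * indicator ?J x * indicator {x - a..} h * ?k h) + (NN x. ?C h x * ?k h))"
  unfolding sh ..
 also have "... = (NN h. (NN x. ?A h x * ?k h)) + (NN h. (NN x. ennreal ((\<phi> x)^2) * indicator ?J x * indicator {x - a..} h * ?k h)) + (NN h. (NN x. ?C h x * ?k h))"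
 proof -
  have mm: "(\<lambda>h. NN x. ennreal ((\<phi> x)^2) * indicator ?J x * indicator {f x..} h * ?k h) \<in> borel_measurable lborel"
   if [measurable]: "f \<in> Borel" for f :: "real \<Rightarrow> real"
  proof -
   have ie: "(indicator {f x..} h :: ennreal) = indicator {z \<in> space (borel \<Otimes>\<^sub>M borel). f (snd z) \<le> fst z} (h, x)" for x h
    by (auto simp: indicator_def space_pair_measure)
   show ?thesis unfolding ie by measurable
  qed
  note [measurable] = mm[of "\<lambda>x. x - a", simplified] mm[of "\<lambda>x. b - x", simplified]
  have [measurable]: "(\<lambda>h. (NN x. ?A h x * ?k h)) \<in> borel_measurable lborel" by measurable
  show ?thesis
   by (subst nn_integral_add, measurable, subst nn_integral_add, measurable)
 qed
 also have "(NN h. (NN x. ?A h x * ?k h)) = gag s ?J \<phi>"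
  unfolding gag_def by (simp add: nn_integral_multc mult.assoc[symmetric])
 also have "(NN h. (NN x. ennreal ((\<phi> x)^2) * indicator ?J x * indicator {x - a..} h * ?k h)) = ennreal (1/(2 * s)) * (NN x. ennreal ((x - a) powr (-2 * s) * (\<phi> x)^2) * indicator ?J x)"
  by (rule gen) auto
 also have "(NN h. (NN x. ?C h x * ?k h)) = ennreal (1/(2 * s)) * (NN x. ennreal ((b - x) powr (-2 * s) * (\<phi> x)^2) * indicator ?J x)"
  by (rule gen) auto
 finally show ?thesis by (simp add: distrib_left add.assoc)
qed

lemma hardy_left:
 assumes s: "0 < s" "s < 1" "s \<noteq> 1/2" and ab: "a < b"
 shows "\<exists>C>0. \<forall>g\<in>Borel. (\<exists>c>a. \<forall>x<c. g x = 0) \<longrightarrow> sq2 a b g < \<infinity> \<longrightarrow>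
  (NN x. ennreal ((x - a) powr (-2 * s) * (g x)^2) * indicator {a<..<b} x) \<le> ennreal C * (gag s {a<..<b} g + sq2 a b g)"
proof -
 obtain C where C: "C > 0" "\<And>g. g \<in> Borel \<Longrightarrow> (\<exists>c>0. \<forall>x<c. g x = 0) \<Longrightarrow> sq2 0 (b - a) g < \<infinity> \<Longrightarrow>
  (NN x. ennreal (x powr (-2 * s) * (g x)^2) * indicator {0<..<b - a} x) \<le> ennreal C * (gag s {0<..<b - a} g + sq2 0 (b - a) g)"
  using hardy_zero[OF s, of "b - a"] ab by auto
 show ?thesis
 proof (intro exI[of _ C] conjI C(1) ballI impI)
  fix g :: "real \<Rightarrow> real" assume [measurable]: "g \<in> Borel" and v: "\<exists>c>a. \<forall>x<c. g x = 0" and fin: "sq2 a b g < \<infinity>"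
  have i: "indicator {0<..<b - a} x = (indicator {a<..<b} (x + a) :: ennreal)" for x :: real
   by (auto simp: indicator_def)
  have q: "sq2 0 (b - a) (\<lambda>x. g (a + x)) = sq2 a b g"
   unfolding sq2_def i by (subst nn_shift(3)[of _ a]) (simp_all add: add.commute)
  have H: "(NN x. ennreal (x powr (-2 * s) * (g (a + x))^2) * indicator {0<..<b - a} x) = (NN x. ennreal ((x - a) powr (-2 * s) * (g x)^2) * indicator {a<..<b} x)"
   unfolding i by (subst (2) nn_shift(3)[of _ a]) (simp_all add: add.commute)
  obtain c where c: "c > a" "\<forall>x<c. g x = 0" using v by blast
  have "\<exists>c>0. \<forall>x<c. g (a + x) = 0" by (rule exI[of _ "c - a"]) (use c in auto)
  from C(2)[of "\<lambda>x. g (a + x)", OF _ this] fin show "(NN x. ennreal ((x - a) powr (-2 * s) * (g x)^2) * indicator {a<..<b} x) \<le> ennreal C * (gag s {a<..<b} g + sq2 a b g)"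
   unfolding q H by (simp add: gag_shift)
 qed
qed

text \<open>The two boundary weights of \<open>gag_zero_ext\<close> are bounded by the Hardy
  inequality at a and, after the reflection of x to -x, at b. Vanishing near both endpoints makes it
  applicable on either side.\<close>

lemma gag_zero_ext_le:
 assumes s: "0 < s" "s < 1" "s \<noteq> 1/2" and ab: "a < b"
 shows "\<exists>C>0. \<forall>g\<in>Borel. (\<exists>c d. a < c \<and> d < b \<and> (\<forall>x. x \<notin> {c..d} \<longrightarrow> g x = 0)) \<longrightarrow> sq2 a b g < \<infinity> \<longrightarrow>
  gag s UNIV g \<le> ennreal C * (gag s {a<..<b} g + sq2 a b g)"
proof -
 obtain C1 where C1: "C1 > 0" "\<And>g. g \<in> Borel \<Longrightarrow> (\<exists>c>a. \<forall>x<c. g x = 0) \<Longrightarrow> sq2 a b g < \<infinity> \<Longrightarrow>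
  (NN x. ennreal ((x - a) powr (-2 * s) * (g x)^2) * indicator {a<..<b} x) \<le> ennreal C1 * (gag s {a<..<b} g + sq2 a b g)"
  using hardy_left[OF s ab] by auto
 have ab': "- b < - a" using ab by simp
 obtain C2 where C2: "C2 > 0" "\<And>g. g \<in> Borel \<Longrightarrow> (\<exists>c>-b. \<forall>x<c. g x = 0) \<Longrightarrow> sq2 (-b) (-a) g < \<infinity> \<Longrightarrow>
  (NN x. ennreal ((x - (-b)) powr (-2 * s) * (g x)^2) * indicator {-b<..<-a} x) \<le> ennreal C2 * (gag s {-b<..<-a} g + sq2 (-b) (-a) g)"
  using hardy_left[OF s ab'] by auto
 define C where "C = 1 + 1/(2 * s) * (C1 + C2)"
 have C: "C > 0" using C1(1) C2(1) s by (simp add: C_def add_pos_pos)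
 show ?thesis
 proof (intro exI[of _ C] conjI C ballI impI)
  fix g :: "real \<Rightarrow> real" assume [measurable]: "g \<in> Borel" and v: "\<exists>c d. a < c \<and> d < b \<and> (\<forall>x. x \<notin> {c..d} \<longrightarrow> g x = 0)" and fin: "sq2 a b g < \<infinity>"
  obtain c d where cd: "a < c" "d < b" "\<And>x. x \<notin> {c..d} \<Longrightarrow> g x = 0" using v by blast
  let ?X = "gag s {a<..<b} g + sq2 a b g"
  have L: "(NN x. ennreal ((x - a) powr (-2 * s) * (g x)^2) * indicator {a<..<b} x) \<le> ennreal C1 * ?X"
   by (rule C1(2)) (use cd fin in auto)
  have i: "indicator {-b<..<-a} (-x) = (indicator {a<..<b} x :: ennreal)" for x :: real
   by (auto simp: indicator_def)
  have q: "sq2 (-b) (-a) (\<lambda>x. g (- x)) = sq2 a b g"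
   unfolding sq2_def by (subst nn_shift(2)) (simp_all add: i)
  have H: "(NN x. ennreal ((x - (-b)) powr (-2 * s) * (g (- x))^2) * indicator {-b<..<-a} x) = (NN x. ennreal ((b - x) powr (-2 * s) * (g x)^2) * indicator {a<..<b} x)"
   by (subst nn_shift(2)) (simp_all add: i)
  have um: "uminus ` {a<..<b} = {-b<..<-a}" by (auto simp: image_iff)
  have G: "gag s {-b<..<-a} (\<lambda>x. g (- x)) = gag s {a<..<b} g"
   using gag_reflect[of g "{a<..<b}" s] unfolding um by simp
  have R: "(NN x. ennreal ((b - x) powr (-2 * s) * (g x)^2) * indicator {a<..<b} x) \<le> ennreal C2 * ?X"
  proof -
   have "\<exists>c>-b. \<forall>x<c. g (- x) = 0" by (rule exI[of _ "-d"]) (use cd in auto)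
   from C2(2)[of "\<lambda>x. g (- x)", OF _ this] fin show ?thesis unfolding q H G by simp
  qed
  have "gag s UNIV g \<le> gag s {a<..<b} g + ennreal (1/(2 * s)) * ((NN x. ennreal ((x - a) powr (-2 * s) * (g x)^2) * indicator {a<..<b} x)
   + (NN x. ennreal ((b - x) powr (-2 * s) * (g x)^2) * indicator {a<..<b} x))"
   by (rule gag_zero_ext) (use cd s in auto)
  also have "... \<le> ?X + ennreal (1/(2 * s)) * (ennreal C1 * ?X + ennreal C2 * ?X)"
   by (intro add_mono mult_left_mono L R) auto
  also have "... = ennreal C * ?X"
  proof -
   have "ennreal C = 1 + ennreal (1/(2 * s)) * (ennreal C1 + ennreal C2)"
    unfolding C_def using C1(1) C2(1) s by (simp add: ennreal_mult'' ennreal_plus[symmetric] ennreal_mult[symmetric] del: ennreal_plus)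
     (metis add_nonneg_nonneg divide_nonneg_pos ennreal_1 ennreal_plus less_eq_real_def mult_pos_pos zero_le_one zero_less_numeral)
   then show ?thesis by (simp add: distrib_right distrib_left mult.assoc)
  qed
  finally show "gag s UNIV g \<le> ennreal C * ?X" .
 qed
qed

section \<open>Smooth functions and the energy norm\<close>

text \<open>The derivative is peeled off from the inside, which suits induction over sums and
  products; \<open>smooth_iff\<close> identifies the result with the iterated \<open>deriv\<close>
  of \<open>test_fun\<close>.\<close>

fun smooth_upto :: "nat \<Rightarrow> (real \<Rightarrow> real) \<Rightarrow> bool" where
 "smooth_upto 0 f \<longleftrightarrow> (\<forall>x. f differentiable (at x))"
| "smooth_upto (Suc n) f \<longleftrightarrow> (\<forall>x. f differentiable (at x)) \<and> smooth_upto n (deriv f)"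

definition smooth :: "(real \<Rightarrow> real) \<Rightarrow> bool" where
 "smooth f \<longleftrightarrow> (\<forall>n. smooth_upto n f)"

lemma smooth_upto_iff: "smooth_upto n f \<longleftrightarrow> (\<forall>k\<le>n. \<forall>x. ((deriv ^^ k) f) differentiable (at x))"
proof (induction n arbitrary: f)
 case (Suc n)
 have "(\<forall>k\<le>Suc n. \<forall>x. ((deriv ^^ k) f) differentiable (at x)) \<longleftrightarrow>
   (\<forall>x. f differentiable (at x)) \<and> (\<forall>k\<le>n. \<forall>x. ((deriv ^^ Suc k) f) differentiable (at x))"
  unfolding less_Suc_eq_le[symmetric] All_less_Suc2[of "Suc n"] by simp
 then show ?case by (simp only: smooth_upto.simps Suc.IH funpow_swap1 funpow.simps comp_def)
qed simp

lemma smooth_iff: "smooth f \<longleftrightarrow> (\<forall>k x. ((deriv ^^ k) f) differentiable (at x))"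
 unfolding smooth_def smooth_upto_iff by auto

lemma DERIV_deriv_at: "(f::real\<Rightarrow>real) differentiable (at x) \<Longrightarrow> DERIV f x :> deriv f x"
 by (simp add: DERIV_deriv_iff_real_differentiable)

lemma smooth_upto_mono: "smooth_upto (Suc n) f \<Longrightarrow> smooth_upto n f"
 by (simp add: smooth_upto_iff)

lemma smooth_upto_add: "smooth_upto n f \<Longrightarrow> smooth_upto n g \<Longrightarrow> smooth_upto n (\<lambda>x. f x + g x)"
proof (induction n arbitrary: f g)
 case (Suc n)
 have "deriv (\<lambda>x. f x + g x) = (\<lambda>x. deriv f x + deriv g x)"
  using Suc.prems by (intro ext DERIV_imp_deriv derivative_intros DERIV_deriv_at) auto
 then show ?case using Suc by auto
qed auto

lemma smooth_upto_mult: "smooth_upto n f \<Longrightarrow> smooth_upto n g \<Longrightarrow> smooth_upto n (\<lambda>x. f x * g x)"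
proof (induction n arbitrary: f g)
 case (Suc n)
 have "deriv (\<lambda>x. f x * g x) = (\<lambda>x. f x * deriv g x + deriv f x * g x)"
  using Suc.prems by (intro ext DERIV_imp_deriv DERIV_mult' DERIV_deriv_at) auto
 moreover have "smooth_upto n (\<lambda>x. f x * deriv g x + deriv f x * g x)"
  using Suc.prems by (intro smooth_upto_add Suc.IH) (auto simp: smooth_upto_mono)
 ultimately show ?case using Suc.prems by auto
qed auto

lemma smooth_const [intro]: "smooth (\<lambda>x. c)"
proof -
 have "smooth_upto n (\<lambda>x. c)" for n by (induction n arbitrary: c) auto
 then show ?thesis by (simp add: smooth_def)
qed

lemma smooth_add: "smooth f \<Longrightarrow> smooth g \<Longrightarrow> smooth (\<lambda>x. f x + g x)"
 by (simp add: smooth_def smooth_upto_add)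

lemma smooth_mult: "smooth f \<Longrightarrow> smooth g \<Longrightarrow> smooth (\<lambda>x. f x * g x)"
 by (simp add: smooth_def smooth_upto_mult)

lemma smooth_ident: "smooth (\<lambda>x. x)"
proof -
 have d: "deriv (\<lambda>x::real. x) = (\<lambda>x. 1)" by (intro ext DERIV_imp_deriv DERIV_ident)
 have "smooth_upto n (\<lambda>x. x)" for n
  by (cases n) (use smooth_const[of 1] in \<open>auto simp: d smooth_def\<close>)
 then show ?thesis by (simp add: smooth_def)
qed

lemma smooth_power: "smooth (\<lambda>x. x ^ k)"
 by (induction k) (auto intro!: smooth_mult smooth_ident)

lemma smooth_sum: "(\<And>i. i \<in> I \<Longrightarrow> smooth (f i)) \<Longrightarrow> smooth (\<lambda>x. \<Sum>i\<in>I. f i x)"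
 by (induction I rule: infinite_finite_induct) (auto intro!: smooth_add)

lemma smooth_exp: "smooth (\<lambda>x. exp (c * x))"
proof -
 have d: "deriv (\<lambda>x. k * exp (c * x)) = (\<lambda>x. (k * c) * exp (c * x))" for k
  by (intro ext DERIV_imp_deriv) (auto intro!: derivative_eq_intros)
 have "smooth_upto n (\<lambda>x. k * exp (c * x))" for n k
 proof -
  have "(\<lambda>x. k * exp (c * x)) differentiable (at x)" for k x
   unfolding real_differentiable_def by (rule exI) (auto intro!: derivative_eq_intros)
  then show ?thesis by (induction n arbitrary: k) (auto simp only: d smooth_upto.simps)
 qed
 from this[of _ 1] show ?thesis by (simp add: smooth_def)
qed

lemma smooth_DERIV: "smooth f \<Longrightarrow> DERIV f x :> deriv f x"
 unfolding smooth_iff by (rule DERIV_deriv_at) (metis funpow_0)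

lemma smooth_deriv: "smooth f \<Longrightarrow> smooth (deriv f)"
 unfolding smooth_def using smooth_upto.simps(2) by blast

lemma smooth_isCont: "smooth f \<Longrightarrow> isCont f x"
 using smooth_DERIV DERIV_isCont by blast

lemma smooth_continuous_on: "smooth f \<Longrightarrow> continuous_on A f"
 by (simp add: continuous_at_imp_continuous_on smooth_isCont)

lemma test_fun_alt: "test_fun a b \<phi> \<longleftrightarrow> smooth \<phi> \<and> (\<exists>c d. a < c \<and> d < b \<and> (\<forall>x. x \<notin> {c..d} \<longrightarrow> \<phi> x = 0))"
 unfolding test_fun_def smooth_iff ..

lemma test_fun_smooth: "test_fun a b \<phi> \<Longrightarrow> smooth \<phi>"
 by (simp add: test_fun_alt)

lemma test_fun_zero: "a < b \<Longrightarrow> test_fun a b (\<lambda>x. 0)"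
 unfolding test_fun_alt by (intro conjI smooth_const exI[of _ "(a+b)/2"]) auto

lemma test_fun_mult: "smooth q \<Longrightarrow> test_fun a b \<phi> \<Longrightarrow> test_fun a b (\<lambda>x. q x * \<phi> x)"
 unfolding test_fun_alt by (auto intro: smooth_mult)

lemma test_fun_lin:
 assumes "test_fun a b \<phi>" "test_fun a b \<psi>"
 shows "test_fun a b (\<lambda>x. \<phi> x + r * \<psi> x)"
proof -
 obtain c d where 1: "a < c" "d < b" "\<And>x. x \<notin> {c..d} \<Longrightarrow> \<phi> x = 0" using assms(1) unfolding test_fun_alt by blast
 obtain c' d' where 2: "a < c'" "d' < b" "\<And>x. x \<notin> {c'..d'} \<Longrightarrow> \<psi> x = 0" using assms(2) unfolding test_fun_alt by blast
 show ?thesis unfolding test_fun_alt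
 proof
  show "smooth (\<lambda>x. \<phi> x + r * \<psi> x)" using assms by (auto simp: test_fun_alt intro!: smooth_add smooth_mult)
  have "\<phi> x + r * \<psi> x = 0" if "x \<notin> {min c c'..max d d'}" for x
  proof -
   have "x \<notin> {c..d}" "x \<notin> {c'..d'}" using that by auto
   then show ?thesis using 1 2 by simp
  qed
  moreover have "a < min c c'" "max d d' < b" using 1 2 by auto
  ultimately show "\<exists>c d. a < c \<and> d < b \<and> (\<forall>x. x \<notin> {c..d} \<longrightarrow> \<phi> x + r * \<psi> x = 0)" by blast
 qed
qed

lemma test_fun_diff: "test_fun a b \<phi> \<Longrightarrow> test_fun a b \<psi> \<Longrightarrow> test_fun a b (\<lambda>x. \<phi> x - \<psi> x)"
 using test_fun_lin[of a b \<phi> \<psi> "-1"] by simp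

lemma test_fun_deriv:
 assumes "test_fun a b \<phi>" shows "test_fun a b (deriv \<phi>)"
proof -
 obtain c d where 1: "a < c" "d < b" "\<And>x. x \<notin> {c..d} \<Longrightarrow> \<phi> x = 0" using assms(1) unfolding test_fun_alt by blast
 have "deriv \<phi> x = 0" if "x \<notin> {c..d}" for x
 proof (rule DERIV_imp_deriv, rule has_field_derivative_transform_within_open[where f="\<lambda>x. 0" and S="- {c..d}"])
  show "open (- {c..d})" by (simp add: open_Compl)
 qed (use that 1 in auto)
 then show ?thesis using assms 1 unfolding test_fun_alt by (auto intro: smooth_deriv)
qed

lemma test_fun_outside: "test_fun a b \<phi> \<Longrightarrow> x \<notin> {a<..<b} \<Longrightarrow> \<phi> x = 0"
 unfolding test_fun_alt by (metis atLeastAtMost_iff greaterThanLessThan_iff less_le_trans le_less_trans)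

section \<open>Integrals and Fourier transforms of test functions\<close>

lemma compact_support_integrable:
 fixes f :: "real \<Rightarrow> 'a::euclidean_space"
 assumes "continuous_on UNIV f" "\<And>x. x \<notin> {c..d} \<Longrightarrow> f x = 0"
 shows "integrable lborel f"
proof -
 have "integrable lborel (\<lambda>x. indicator {c..d} x *\<^sub>R f x)"
  by (rule borel_integrable_compact) (use assms continuous_on_subset[OF assms(1)] in auto)
 moreover have "(\<lambda>x. indicator {c..d} x *\<^sub>R f x) = f" using assms by (auto simp: indicator_def fun_eq_iff)
 ultimately show ?thesis by simp
qed

lemma compact_support_bounded:
 fixes f :: "real \<Rightarrow> real"
 assumes "continuous_on UNIV f" "\<And>x. x \<notin> {c..d} \<Longrightarrow> f x = 0"
 shows "\<exists>M\<ge>0. \<forall>x. \<bar>f x\<bar> \<le> M"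
proof -
 have "compact (f ` {c..d})" by (rule compact_continuous_image) (use assms continuous_on_subset[OF assms(1)] in auto)
 then have "bounded (f ` {c..d})" by (rule compact_imp_bounded)
 then obtain M where "\<forall>x\<in>{c..d}. \<bar>f x\<bar> \<le> M" by (auto simp: bounded_iff)
 then have M: "\<And>x. x \<in> {c..d} \<Longrightarrow> \<bar>f x\<bar> \<le> M" by blast
 have "\<bar>f x\<bar> \<le> max M 0" for x using M[of x] assms(2)[of x] by (cases "x \<in> {c..d}") auto
 then show ?thesis by (intro exI[of _ "max M 0"]) auto
qed

lemma test_fun_cont: "test_fun a b \<phi> \<Longrightarrow> continuous_on A \<phi>"
 by (simp add: smooth_continuous_on test_fun_smooth)

lemma test_fun_measurable: "test_fun a b \<phi> \<Longrightarrow> \<phi> \<in> Borel"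
 by (rule borel_measurable_continuous_onI[OF test_fun_cont])

lemma test_fun_integrable:
 assumes "test_fun a b \<phi>"
 shows "integrable lborel \<phi>" "integrable lborel (\<lambda>x. (\<phi> x)^2)"
proof -
 obtain c d where 1: "\<And>x. x \<notin> {c..d} \<Longrightarrow> \<phi> x = 0" using assms(1) unfolding test_fun_alt by blast
 show "integrable lborel \<phi>" "integrable lborel (\<lambda>x. (\<phi> x)^2)"
  by (rule compact_support_integrable[of _ c d]; use 1 in \<open>auto intro!: continuous_intros test_fun_cont[OF assms]\<close>)+
qed

lemma test_fun_integrable_mult:
 assumes "test_fun a b \<phi>" "continuous_on UNIV g"
 shows "integrable lborel (\<lambda>x. \<phi> x * g x)"
proof -
 obtain c d where 1: "\<And>x. x \<notin> {c..d} \<Longrightarrow> \<phi> x = 0" using assms(1) unfolding test_fun_alt by blast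
 show ?thesis
  by (rule compact_support_integrable[of _ c d]) (use 1 assms(2) in \<open>auto intro!: continuous_intros test_fun_cont[OF assms(1)]\<close>)
qed

lemma test_fun_bounded:
 assumes "test_fun a b \<phi>" shows "\<exists>M\<ge>0. \<forall>x. \<bar>\<phi> x\<bar> \<le> M"
proof -
 obtain c d where 1: "\<And>x. x \<notin> {c..d} \<Longrightarrow> \<phi> x = 0" using assms(1) unfolding test_fun_alt by blast
 show ?thesis
  by (rule compact_support_bounded[of _ c d]) (use 1 in \<open>auto intro!: continuous_intros test_fun_cont[OF assms(1)]\<close>)
qed

lemma integral_deriv_compact_support:
 fixes f f' :: "real \<Rightarrow> 'a::euclidean_space"
 assumes d: "\<And>x. (f has_vector_derivative f' x) (at x)" and c: "continuous_on UNIV f'" and z: "\<And>x. x \<notin> {c..d} \<Longrightarrow> f x = 0"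
 shows "integrable lborel f'" "(LB x. f' x) = 0"
proof -
 have z': "f' x = 0" if "x \<notin> {c..d}" for x
 proof -
  have "(f has_vector_derivative 0) (at x)"
   by (rule has_vector_derivative_transform_within_open[where f="\<lambda>x. 0" and S="- {c..d}"])
    (use that z in \<open>auto simp: open_Compl\<close>)
  then show ?thesis using d vector_derivative_unique_at by blast
 qed
 show i: "integrable lborel f'" by (rule compact_support_integrable[OF c z'])
 \<comment> \<open>Enlarging by 1 puts both endpoints outside the support, where f vanishes; min and
   max keep the interval nonempty also when d < c.\<close>
 define C where "C = min c d - 1"
 define D where "D = max c d + 1"
 have CD: "C \<le> D" "C \<notin> {c..d}" "D \<notin> {c..d}" by (auto simp: C_def D_def)
 have "has_bochner_integral lborel (\<lambda>x. indicator {C .. D} x *\<^sub>R f' x) (f D - f C)"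
  by (rule has_bochner_integral_FTC_Icc)
    (use CD d c in \<open>auto intro: has_vector_derivative_at_within continuous_on_subset\<close>)
 moreover have "(\<lambda>x. indicator {C .. D} x *\<^sub>R f' x) = f'"
 proof
  fix x
  show "indicator {C..D} x *\<^sub>R f' x = f' x"
  proof (cases "x \<in> {C..D}")
   case False
   then have "x \<notin> {c..d}" unfolding C_def D_def by auto
   then show ?thesis using z' False by simp
  qed simp
 qed
 ultimately show "(LB x. f' x) = 0"
  using z CD by (simp add: has_bochner_integral_iff)
qed

lemma test_fun_int_deriv:
 assumes "test_fun a b \<phi>" shows "(LB x. deriv \<phi> x) = 0"
proof -
 obtain c d where 1: "\<And>x. x \<notin> {c..d} \<Longrightarrow> \<phi> x = 0" using assms(1) unfolding test_fun_alt by blast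
 show ?thesis
  by (rule integral_deriv_compact_support(2)[of \<phi> _ c d])
   (use assms 1 in \<open>auto simp: has_real_derivative_iff_has_vector_derivative[symmetric] intro: smooth_DERIV test_fun_smooth smooth_continuous_on smooth_deriv\<close>)
qed

text \<open>The product of cis (- \<omega> * x) and \<phi> has compact support, so its derivative
  integrates to zero.\<close>

lemma fourier_deriv:
 assumes "test_fun a b \<phi>"
 shows "fourier (deriv \<phi>) \<omega> = \<i> * complex_of_real \<omega> * fourier \<phi> \<omega>"
proof -
 obtain c d where 1: "\<And>x. x \<notin> {c..d} \<Longrightarrow> \<phi> x = 0" using assms(1) unfolding test_fun_alt by blast
 let ?f = "\<lambda>x. cis (- \<omega> * x) * complex_of_real (\<phi> x)"
 let ?f' = "\<lambda>x. cis (- \<omega> * x) * complex_of_real (deriv \<phi> x) - \<i> * complex_of_real \<omega> * (cis (- \<omega> * x) * complex_of_real (\<phi> x))"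
 have d1: "((\<lambda>x. cis (- \<omega> * x)) has_vector_derivative (- \<i> * complex_of_real \<omega> * cis (- \<omega> * x))) (at x)" for x
 proof -
  have "((\<lambda>z. exp (\<i> * (- complex_of_real \<omega> * z))) has_field_derivative (- \<i> * complex_of_real \<omega> * exp (\<i> * (- complex_of_real \<omega> * of_real x)))) (at (of_real x))"
   by (auto intro!: derivative_eq_intros)
  from has_vector_derivative_real_field[OF this] show ?thesis by (simp add: cis_conv_exp)
 qed
 have d2: "((\<lambda>x. complex_of_real (\<phi> x)) has_vector_derivative (complex_of_real (deriv \<phi> x))) (at x)" for x
  using smooth_DERIV[OF test_fun_smooth[OF assms], of x] by (simp add: has_vector_derivative_of_real has_real_derivative_iff_has_vector_derivative)
 have "(?f has_vector_derivative ?f' x) (at x)" for x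
  by (rule has_vector_derivative_eq_rhs[OF has_vector_derivative_mult[OF d1 d2]]) (simp add: algebra_simps)
 then have "(LB x. ?f' x) = 0"
  by (rule integral_deriv_compact_support(2)[of ?f _ c d])
   (use 1 in \<open>auto simp: cis_conv_exp intro!: continuous_intros smooth_continuous_on smooth_deriv test_fun_smooth[OF assms]\<close>)
 moreover have "(LB x. ?f' x) = fourier (deriv \<phi>) \<omega> - \<i> * complex_of_real \<omega> * fourier \<phi> \<omega>"
  unfolding fourier_def
  using integrable_fourier_kernel[OF test_fun_integrable(1)[OF test_fun_deriv[OF assms]], of \<omega>]
   integrable_fourier_kernel[OF test_fun_integrable(1)[OF assms], of \<omega>]
  by simp
 ultimately show ?thesis by simp
qed

lemma FN_1_deriv:
 assumes "test_fun a b \<phi>"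
 shows "FN 1 \<phi> = (NN \<omega>. ennreal ((cmod (fourier (deriv \<phi>) \<omega>))^2))"
 unfolding FN_def fourier_deriv[OF assms]
 by (intro nn_integral_cong) (simp add: norm_mult power_mult_distrib)

lemma fourier_cong_AE:
 assumes "AE x in lborel. w x = w' x" "w \<in> Borel" "w' \<in> Borel"
 shows "fourier w = fourier w'"
proof
 fix \<omega>
 have [measurable]: "w \<in> Borel" "w' \<in> Borel" using assms by auto
 show "fourier w \<omega> = fourier w' \<omega>"
  unfolding fourier_def cis_conv_exp by (intro integral_cong_AE) (use assms(1) in auto)
qed

lemma FN_cong_AE:
 assumes "AE x in lborel. w x = w' x" "w \<in> Borel" "w' \<in> Borel"
 shows "FN s w = FN s w'"
 unfolding FN_def fourier_cong_AE[OF assms] ..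

text \<open>Difference quotients of w have transforms bounded by |\<omega>| times that of w. Where x
  and x + h both lie in (a,b) they are quotients of \<phi>, and Fatou yields the derivative as h
  tends to 0. This is the order 1 counterpart of the Gagliardo lower bound: any extension pays at
  least for the derivative of \<phi> on (a,b).\<close>

lemma FN_1_lower:
 assumes \<phi>: "test_fun a b \<phi>" and w: "integrable lborel w" and e: "\<And>x. x \<in> {a<..<b} \<Longrightarrow> w x = \<phi> x"
 shows "(NN x. ennreal ((deriv \<phi> x)^2) * indicator {a<..<b} x) \<le> ennreal (1/(2*pi)) * FN 1 w"
proof -
 have [measurable]: "w \<in> Borel" using w by auto
 let ?h = "\<lambda>n. inverse (real (Suc n))"
 let ?S = "\<lambda>n. {x \<in> space borel. x \<in> {a<..<b} \<and> x + ?h n \<in> {a<..<b}}"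
 let ?q = "\<lambda>n x. ennreal (((w (x + ?h n) - w x) / ?h n)^2) * indicator (?S n) x"
 have c: "isCont w x" if "x \<in> {a<..<b}" for x
 proof -
  have "eventually (\<lambda>y. y \<in> {a<..<b}) (nhds x)" using that by (intro eventually_nhds_in_open) auto
  then have ev: "eventually (\<lambda>y. \<phi> y = w y) (nhds x)" by eventually_elim (use e in auto)
  have "isCont \<phi> x" using \<phi> by (simp add: smooth_isCont test_fun_smooth)
  then show ?thesis using isCont_cong[OF ev] by simp
 qed
 have b: "(NN x. ?q n x) \<le> ennreal (1/(2*pi)) * FN 1 w" for n
 proof -
  let ?H = "?h n"
  have H: "?H > 0" by simp
  have "(NN x. ?q n x) = (NN x. ennreal (1 / ?H^2) * (ennreal ((w (x + ?H) - w x)^2) * indicator (?S n) x))"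
   by (intro nn_integral_cong) (auto simp: power_divide ennreal_mult[symmetric] indicator_def simp del: of_nat_Suc)
  also have "... = ennreal (1 / ?H^2) * (NN x. (ennreal ((w (x + ?H) - w x)^2) * indicator (?S n) x))"
   by (rule nn_integral_cmult) measurable
  also have "... \<le> ennreal (1 / ?H^2) * (ennreal (1/(2*pi)) * (NN \<omega>. ennreal ((cmod (fourier (\<lambda>x. w (x + ?H) - w x) \<omega>))^2)))"
  proof (intro mult_left_mono fourier_lower)
   fix x assume "x \<in> ?S n"
   then have "isCont w x" "isCont w (x + ?H)" using c by auto
   then show "isCont (\<lambda>x. w (x + ?H) - w x) x"
    by (intro continuous_intros isCont_o2[where f="\<lambda>x. x + ?H" and g=w]) auto
  qed (use fourier_shift_diff(1)[OF w] in simp_all)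
  also have "... \<le> ennreal (1 / ?H^2) * (ennreal (1/(2*pi)) * (NN \<omega>. ennreal (?H^2) * ennreal (\<bar>\<omega>\<bar> powr (2*1) * (cmod (fourier w \<omega>))^2)))"
  proof (intro mult_left_mono nn_integral_mono)
   fix \<omega> :: real
   have "(cmod (fourier (\<lambda>x. w (x + ?H) - w x) \<omega>))^2 = (cmod (cis (\<omega> * ?H) - 1))^2 * (cmod (fourier w \<omega>))^2"
    unfolding fourier_shift_diff(2)[OF w] by (simp add: norm_mult power_mult_distrib)
   also have "... \<le> (\<omega> * ?H)^2 * (cmod (fourier w \<omega>))^2" by (intro mult_right_mono cis_diff_bound) auto
   also have "... = ?H^2 * (\<bar>\<omega>\<bar> powr (2*1) * (cmod (fourier w \<omega>))^2)" by (simp add: power_mult_distrib)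
   finally have "(cmod (fourier (\<lambda>x. w (x + ?H) - w x) \<omega>))^2 \<le> ?H^2 * (\<bar>\<omega>\<bar> powr (2*1) * (cmod (fourier w \<omega>))^2)" .
   then show "ennreal ((cmod (fourier (\<lambda>x. w (x + ?H) - w x) \<omega>))^2) \<le> ennreal (?H^2) * ennreal (\<bar>\<omega>\<bar> powr (2*1) * (cmod (fourier w \<omega>))^2)"
    by (subst ennreal_mult[symmetric]) (auto intro: ennreal_leI)
  qed auto
  also have "... = (ennreal (1 / ?H^2) * ennreal (?H^2)) * (ennreal (1/(2*pi)) * FN 1 w)"
   unfolding FN_def by (subst nn_integral_cmult) (simp_all add: mult_ac)
  also have "ennreal (1 / ?H^2) * ennreal (?H^2) = 1"
   using H by (subst ennreal_mult[symmetric]) (auto simp del: of_nat_Suc)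
  finally show ?thesis by simp
 qed
 have h0: "?h \<longlonglongrightarrow> 0" by (rule LIMSEQ_inverse_real_of_nat)
 have "(NN x. ennreal ((deriv \<phi> x)^2) * indicator {a<..<b} x) \<le> (NN x. liminf (\<lambda>n. ?q n x))"
 proof (rule nn_integral_mono)
  fix x
  show "ennreal ((deriv \<phi> x)^2) * indicator {a<..<b} x \<le> liminf (\<lambda>n. ?q n x)"
  proof (cases "x \<in> {a<..<b}")
   case True
   have "DERIV \<phi> x :> deriv \<phi> x" by (rule smooth_DERIV[OF test_fun_smooth[OF \<phi>]])
   then have "(\<lambda>h. (\<phi> (x + h) - \<phi> x) / h) \<midarrow>0\<rightarrow> deriv \<phi> x" by (simp add: DERIV_def)
   then have "(\<lambda>n. (\<phi> (x + ?h n) - \<phi> x) / ?h n) \<longlonglongrightarrow> deriv \<phi> x"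
    by (rule filterlim_compose) (use h0 in \<open>auto simp: filterlim_at simp del: of_nat_Suc\<close>)
   then have "(\<lambda>n. ennreal (((\<phi> (x + ?h n) - \<phi> x) / ?h n)^2)) \<longlonglongrightarrow> ennreal ((deriv \<phi> x)^2)"
    by (intro tendsto_ennrealI tendsto_power)
   moreover have "eventually (\<lambda>n. ?q n x = ennreal (((\<phi> (x + ?h n) - \<phi> x) / ?h n)^2)) sequentially"
   proof -
    have "eventually (\<lambda>n. ?h n < b - x) sequentially"
     using order_tendstoD(2)[OF h0, of "b - x"] True by simp
    then show ?thesis
    proof eventually_elim
     case (elim n)
     have "?h n > 0" by simp
     then have "x + ?h n \<in> {a<..<b}" using elim True unfolding greaterThanLessThan_iff by linarith
     then show ?case using True e by (simp del: of_nat_Suc)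
    qed
   qed
   ultimately have "(\<lambda>n. ?q n x) \<longlonglongrightarrow> ennreal ((deriv \<phi> x)^2)" by (simp only: tendsto_cong)
   then have "liminf (\<lambda>n. ?q n x) = ennreal ((deriv \<phi> x)^2)" by (intro lim_imp_Liminf) auto
   then show ?thesis using True by simp
  qed simp
 qed
 also have "... \<le> liminf (\<lambda>n. NN x. ?q n x)" by (rule nn_integral_liminf) simp
 also have "... \<le> liminf (\<lambda>n. ennreal (1/(2*pi)) * FN 1 w)"
  by (intro Liminf_mono always_eventually allI b)
 finally show ?thesis by (simp add: Liminf_const)
qed

section \<open>The energy norm and its equivalence with the Sobolev norm on test functions\<close>

definition zext :: "real \<Rightarrow> real \<Rightarrow> (real \<Rightarrow> real) \<Rightarrow> real \<Rightarrow> real" where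
 "zext a b u = (\<lambda>x. indicator {a<..<b} x * u x)"

definition W :: "real \<Rightarrow> real \<Rightarrow> real \<Rightarrow> (real \<Rightarrow> real) \<Rightarrow> ennreal" where
 "W s a b u = sq2 a b u + FN s (zext a b u)"

lemma Hnorm2_alt: "Hnorm2 s a b u = sq2 a b u + (INF w \<in> extensions a b u. FN s w)"
 unfolding Hnorm2_def sq2_def FN_def ..

lemma zext_test_fun: "test_fun a b \<phi> \<Longrightarrow> zext a b \<phi> = \<phi>"
 using test_fun_outside by (fastforce simp: zext_def indicator_def fun_eq_iff)

lemma sq2_test_fun:
 assumes "test_fun a b \<phi>"
 shows "sq2 a b \<phi> = (NN x. ennreal ((\<phi> x)^2))" "sq2 a b \<phi> < \<infinity>"
proof -
 show 1: "sq2 a b \<phi> = (NN x. ennreal ((\<phi> x)^2))"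
  unfolding sq2_def using test_fun_outside[OF assms] by (intro nn_integral_cong) (auto simp: indicator_def)
 show "sq2 a b \<phi> < \<infinity>" unfolding 1
  by (subst nn_integral_eq_integral[OF test_fun_integrable(2)[OF assms]]) auto
qed

lemma ennreal_le_add_INF:
 fixes c :: ennreal
 assumes "\<And>w. w \<in> A \<Longrightarrow> X \<le> c + f w" "c < top"
 shows "X \<le> c + (INF w\<in>A. f w)"
proof -
 have "X - c \<le> (INF w\<in>A. f w)"
  by (rule INF_greatest) (use assms in \<open>auto simp: ennreal_minus_le_iff\<close>)
 then show ?thesis using assms(2) by (simp add: ennreal_minus_le_iff)
qed

text \<open>Any extension w agrees with \<phi> on (a,b), and what it carries there already controls
  the extension by zero: by Bessel at order 0, by locality of the derivative at order 1, and through
  Gagliardo and Hardy in between. The infimum over w is taken last.\<close>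

lemma W_le_Hnorm2:
 assumes s: "0 \<le> s" "s \<le> 1" "s \<noteq> 1/2" and ab: "a < b"
 shows "\<exists>C>0. \<forall>\<phi>. test_fun a b \<phi> \<longrightarrow> W s a b \<phi> \<le> ennreal C * Hnorm2 s a b \<phi>"
proof -
 have "\<exists>C>0. \<forall>\<phi> w. test_fun a b \<phi> \<longrightarrow> integrable lborel w \<longrightarrow> (\<forall>x\<in>{a<..<b}. w x = \<phi> x) \<longrightarrow> FN s \<phi> \<le> ennreal C * (sq2 a b \<phi> + FN s w)"
 proof -
  consider "s = 0" | "s = 1" | "0 < s" "s < 1" using s by linarith
  then show ?thesis
  proof cases
   case 1
   show ?thesis
   proof (intro exI[of _ "2*pi"] conjI allI impI)
    fix \<phi> w assume \<phi>: "test_fun a b \<phi>"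
    have "FN s \<phi> \<le> (NN \<omega>. ennreal ((cmod (fourier \<phi> \<omega>))^2))"
     unfolding FN_def 1 by (intro nn_integral_mono ennreal_leI) auto
    also have "... \<le> ennreal (2*pi) * sq2 a b \<phi>"
     unfolding sq2_test_fun(1)[OF \<phi>] by (intro fourier_bessel test_fun_integrable[OF \<phi>])
    also have "... \<le> ennreal (2*pi) * (sq2 a b \<phi> + FN s w)" by (intro mult_left_mono) auto
    finally show "FN s \<phi> \<le> ennreal (2*pi) * (sq2 a b \<phi> + FN s w)" .
   qed simp
  next
   case 2
   show ?thesis
   proof (intro exI[of _ 1] conjI allI impI)
    fix \<phi> w assume \<phi>: "test_fun a b \<phi>" and w: "integrable lborel w" and e: "\<forall>x\<in>{a<..<b}. w x = \<phi> x"
    note d = test_fun_deriv[OF \<phi>]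
    have "FN s \<phi> \<le> ennreal (2*pi) * sq2 a b (deriv \<phi>)"
     unfolding 2 FN_1_deriv[OF \<phi>] sq2_test_fun(1)[OF d] by (intro fourier_bessel test_fun_integrable[OF d])
    also have "... \<le> ennreal (2*pi) * (ennreal (1/(2*pi)) * FN 1 w)"
     unfolding sq2_def by (intro mult_left_mono FN_1_lower[OF \<phi> w]) (use e in auto)
    also have "... = FN 1 w" by (simp add: mult.assoc[symmetric] ennreal_mult[symmetric])
    also have "... \<le> sq2 a b \<phi> + FN 1 w" by simp
    finally show "FN s \<phi> \<le> ennreal 1 * (sq2 a b \<phi> + FN s w)" by (simp add: 2)
   qed simp
  next
   case 3
   obtain C1 where C1: "C1 > 0"
    "\<And>w. integrable lborel w \<Longrightarrow> integrable lborel (\<lambda>x. (w x)^2) \<Longrightarrow> FN s w \<le> ennreal C1 * gag s UNIV w"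
    "\<And>w J. integrable lborel w \<Longrightarrow> J \<in> sets borel \<Longrightarrow> (\<And>x. x \<in> J \<Longrightarrow> isCont w x) \<Longrightarrow> gag s J w \<le> ennreal C1 * FN s w"
    by (rule gag_FN[OF 3]) blast
   obtain C2 where C2: "C2 > 0" "\<And>g. g\<in>Borel \<Longrightarrow> (\<exists>c d. a < c \<and> d < b \<and> (\<forall>x. x \<notin> {c..d} \<longrightarrow> g x = 0)) \<Longrightarrow> sq2 a b g < \<infinity> \<Longrightarrow>
     gag s UNIV g \<le> ennreal C2 * (gag s {a<..<b} g + sq2 a b g)"
    using gag_zero_ext_le[OF 3 s(3) ab] by blast
   define C where "C = C1 * C2 * max C1 1"
   show ?thesis
   proof (intro exI[of _ C] conjI allI impI)
    show "C > 0" using C1(1) C2(1) by (simp add: C_def less_max_iff_disj)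
    fix \<phi> w assume \<phi>: "test_fun a b \<phi>" and w: "integrable lborel w" and e: "\<forall>x\<in>{a<..<b}. w x = \<phi> x"
    have c: "isCont w x" if "x \<in> {a<..<b}" for x
    proof -
     have "eventually (\<lambda>y. y \<in> {a<..<b}) (nhds x)" using that by (intro eventually_nhds_in_open) auto
     then have ev: "eventually (\<lambda>y. \<phi> y = w y) (nhds x)" by eventually_elim (use e in auto)
     have "isCont \<phi> x" using \<phi> by (simp add: smooth_isCont test_fun_smooth)
     then show ?thesis using isCont_cong[OF ev] by simp
    qed
    have ge: "gag s {a<..<b} \<phi> = gag s {a<..<b} w"
    proof -
     have "ennreal ((\<phi> (x + h) - \<phi> x)^2) * indicator {a<..<b} x * indicator {a<..<b} (x + h) = ennreal ((w (x + h) - w x)^2) * indicator {a<..<b} x * indicator {a<..<b} (x + h)" for x h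
      by (cases "x \<in> {a<..<b}"; cases "x + h \<in> {a<..<b}") (use e in simp_all)
     then show ?thesis unfolding gag_def by simp
    qed
    have "FN s \<phi> \<le> ennreal C1 * gag s UNIV \<phi>" by (intro C1 test_fun_integrable[OF \<phi>])
    also have "... \<le> ennreal C1 * (ennreal C2 * (gag s {a<..<b} \<phi> + sq2 a b \<phi>))"
     by (intro mult_left_mono C2 test_fun_measurable[OF \<phi>] sq2_test_fun[OF \<phi>]) (use \<phi> in \<open>auto simp: test_fun_def\<close>)
    also have "... \<le> ennreal C1 * (ennreal C2 * (ennreal (max C1 1) * FN s w + ennreal (max C1 1) * sq2 a b \<phi>))"
    proof (intro mult_left_mono add_mono)
     have "gag s {a<..<b} w \<le> ennreal C1 * FN s w" by (intro C1 w c) auto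
     also have "... \<le> ennreal (max C1 1) * FN s w" by (intro mult_right_mono ennreal_leI) auto
     finally show "gag s {a<..<b} \<phi> \<le> ennreal (max C1 1) * FN s w" unfolding ge .
     have "1 * sq2 a b \<phi> \<le> ennreal (max C1 1) * sq2 a b \<phi>" by (intro mult_right_mono) (auto simp flip: ennreal_1 simp del: ennreal_1 intro: ennreal_leI)
     then show "sq2 a b \<phi> \<le> ennreal (max C1 1) * sq2 a b \<phi>" by simp
    qed auto
    also have "... = ennreal C * (sq2 a b \<phi> + FN s w)"
    proof -
     have "ennreal C = ennreal C1 * ennreal C2 * ennreal (max C1 1)" unfolding C_def using C1(1) C2(1) by (simp add: ennreal_mult)
     then show ?thesis by (simp add: distrib_left mult_ac add.commute)
    qed
    finally show "FN s \<phi> \<le> ennreal C * (sq2 a b \<phi> + FN s w)" .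
   qed
  qed
 qed
 then obtain C where C: "C > 0" "\<And>\<phi> w. test_fun a b \<phi> \<Longrightarrow> integrable lborel w \<Longrightarrow> (\<And>x. x\<in>{a<..<b} \<Longrightarrow> w x = \<phi> x) \<Longrightarrow> FN s \<phi> \<le> ennreal C * (sq2 a b \<phi> + FN s w)"
  by blast
 show ?thesis
 proof (intro exI[of _ "C + 1"] conjI allI impI)
  show "C + 1 > 0" using C by simp
  fix \<phi> assume \<phi>: "test_fun a b \<phi>"
  have [measurable]: "\<phi> \<in> Borel" by (rule test_fun_measurable[OF \<phi>])
  have "ennreal (1/C) * FN s \<phi> \<le> sq2 a b \<phi> + FN s w" if w: "w \<in> extensions a b \<phi>" for w
  proof -
   \<comment> \<open>An extension equals \<phi> only almost everywhere on (a,b). Correcting it on a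
     null set leaves \<open>fourier\<close> unchanged and gives equality at every point of
     (a,b).\<close>
   define w' where "w' x = (if x \<in> {a<..<b} then \<phi> x else w x)" for x
   have [measurable]: "w \<in> Borel" and wi: "integrable lborel w" and we: "AE x in lborel. x \<in> {a<..<b} \<longrightarrow> w x = \<phi> x"
    using w by (auto simp: extensions_def)
   have [measurable]: "w' \<in> Borel" unfolding w'_def by measurable
   have ae: "AE x in lborel. w x = w' x" using we by eventually_elim (auto simp: w'_def)
   have w'i: "integrable lborel w'" using integrable_cong_AE[OF _ _ ae] wi by simp
   have "FN s \<phi> \<le> ennreal C * (sq2 a b \<phi> + FN s w')" by (rule C(2)[OF \<phi> w'i]) (simp add: w'_def)
   also have "FN s w' = FN s w" using FN_cong_AE[OF ae] by simp
   finally have "ennreal (1/C) * FN s \<phi> \<le> ennreal (1/C) * (ennreal C * (sq2 a b \<phi> + FN s w))" by (rule mult_left_mono) simp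
   then show ?thesis using C(1) by (simp add: mult.assoc[symmetric] ennreal_mult[symmetric])
  qed
  then have "ennreal (1/C) * FN s \<phi> \<le> Hnorm2 s a b \<phi>"
   unfolding Hnorm2_alt by (rule ennreal_le_add_INF) (use sq2_test_fun(2)[OF \<phi>] in auto)
  then have "ennreal C * (ennreal (1/C) * FN s \<phi>) \<le> ennreal C * Hnorm2 s a b \<phi>" by (rule mult_left_mono) simp
  then have "FN s \<phi> \<le> ennreal C * Hnorm2 s a b \<phi>" using C(1) by (simp add: mult.assoc[symmetric] ennreal_mult[symmetric])
  moreover have "sq2 a b \<phi> \<le> Hnorm2 s a b \<phi>" by (simp add: Hnorm2_alt)
  ultimately have "W s a b \<phi> \<le> Hnorm2 s a b \<phi> + ennreal C * Hnorm2 s a b \<phi>"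
   unfolding W_def zext_test_fun[OF \<phi>] by (rule add_mono[rotated])
  also have "... = ennreal (C + 1) * Hnorm2 s a b \<phi>" using C(1) by (simp add: ennreal_plus distrib_right add.commute)
  finally show "W s a b \<phi> \<le> ennreal (C + 1) * Hnorm2 s a b \<phi>" .
 qed
qed

section \<open>Fractional derivatives of test functions\<close>

lemma lipschitz_from_deriv_bound:
 fixes f :: "real \<Rightarrow> real"
 assumes "smooth f" "\<And>x. x \<in> S \<Longrightarrow> \<bar>deriv f x\<bar> \<le> B" "convex S" "x \<in> S" "y \<in> S"
 shows "\<bar>f x - f y\<bar> \<le> B * \<bar>x - y\<bar>"
 using field_differentiable_bound[of S f "deriv f" B x y] assms smooth_DERIV
 by (auto intro: has_field_derivative_at_within)

text \<open>If both points lie in (a,b), the product rule for differences gives the terms with M and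
  \<Lambda>; if only one does, the other product vanishes with \<phi>. So bounds for q on (a,b) are
  all that enters. Two points of (a,b) differ by less than b - a, hence the \<Lambda> term
  integrates h powr (1 - 2 s) over (0,b - a).\<close>

lemma gag_mult_le:
 assumes s: "0 < s" "s < 1" and ab: "a < b" and [measurable]: "q \<in> Borel" "\<phi> \<in> Borel"
  and z: "\<And>x. x \<notin> {a<..<b} \<Longrightarrow> \<phi> x = 0"
  and M: "\<And>x. x \<in> {a<..<b} \<Longrightarrow> \<bar>q x\<bar> \<le> M" and \<Lambda>: "\<And>x y. x \<in> {a<..<b} \<Longrightarrow> y \<in> {a<..<b} \<Longrightarrow> \<bar>q x - q y\<bar> \<le> \<Lambda> * \<bar>x - y\<bar>"
 shows "gag s UNIV (\<lambda>x. q x * \<phi> x) \<le> ennreal (2 * M^2) * gag s UNIV \<phi> + ennreal (2 * \<Lambda>^2 * ((b - a) powr (2 - 2 * s) / (2 - 2 * s))) * sq2 a b \<phi>"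
proof -
 let ?J = "{a<..<b}"
 have pw: "ennreal ((q (x + h) * \<phi> (x + h) - q x * \<phi> x)^2) \<le> ennreal (2 * M^2) * ennreal ((\<phi> (x + h) - \<phi> x)^2) + ennreal (2 * \<Lambda>^2 * h^2) * indicator {..<b - a} h * (ennreal ((\<phi> x)^2) * indicator ?J x)"
  if h: "h > 0" for x h
 proof -
  have M2: "(q x)^2 \<le> M^2" if "x \<in> ?J" for x using M[OF that] by (simp add: abs_le_square_iff[symmetric])
  have one: "(q y * (\<phi> (x + h) - \<phi> x))^2 \<le> 2 * M^2 * (\<phi> (x + h) - \<phi> x)^2" if "y \<in> ?J" for y
  proof -
   have "(q y)^2 \<le> 2 * M^2" using M2[OF that] by (smt (verit) zero_le_power2)
   then show ?thesis unfolding power_mult_distrib by (intro mult_right_mono) auto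
  qed
  show ?thesis
  proof (cases "x \<in> ?J \<and> x + h \<in> ?J")
   case False
   have "(q (x + h) * \<phi> (x + h) - q x * \<phi> x)^2 \<le> 2 * M^2 * (\<phi> (x + h) - \<phi> x)^2"
   proof (cases "x \<in> ?J")
    case True
    then have 0: "\<phi> (x + h) = 0" using False z by auto
    show ?thesis using one[OF True] by (simp add: 0)
   next
    case nx: False
    then have 0: "\<phi> x = 0" using z by auto
    show ?thesis
    proof (cases "x + h \<in> ?J")
     case True show ?thesis using one[OF True] by (simp add: 0)
    next
     case False then have "\<phi> (x + h) = 0" using z by auto
     then show ?thesis by (simp add: 0)
    qed
   qed
   then have "ennreal ((q (x + h) * \<phi> (x + h) - q x * \<phi> x)^2) \<le> ennreal (2 * M^2) * ennreal ((\<phi> (x + h) - \<phi> x)^2)"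
    by (subst ennreal_mult[symmetric]) (auto intro: ennreal_leI)
   then show ?thesis by (simp add: add_increasing2)
  next
   case True
   then have hb: "h < b - a" by auto
   have "q (x + h) * \<phi> (x + h) - q x * \<phi> x = q (x + h) * (\<phi> (x + h) - \<phi> x) - (q x - q (x + h)) * \<phi> x"
    by (simp add: algebra_simps)
   also have "(...)^2 \<le> 2 * (q (x + h) * (\<phi> (x + h) - \<phi> x))^2 + 2 * ((q x - q (x + h)) * \<phi> x)^2"
    by (rule sum_squares_le_diff)
   also have "... \<le> 2 * M^2 * (\<phi> (x + h) - \<phi> x)^2 + 2 * \<Lambda>^2 * h^2 * (\<phi> x)^2"
   proof -
    have "(q (x + h))^2 * (\<phi> (x + h) - \<phi> x)^2 \<le> M^2 * (\<phi> (x + h) - \<phi> x)^2"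
     using M2[of "x + h"] True by (intro mult_right_mono) auto
    moreover have "(q x - q (x + h))^2 * (\<phi> x)^2 \<le> (\<Lambda>^2 * h^2) * (\<phi> x)^2"
    proof (intro mult_right_mono)
     have "\<bar>q x - q (x + h)\<bar> \<le> \<Lambda> * h" using \<Lambda>[of x "x + h"] True h by simp
     then have "\<bar>q x - q (x + h)\<bar> \<le> \<bar>\<Lambda> * h\<bar>" by linarith
     then show "(q x - q (x + h))^2 \<le> \<Lambda>^2 * h^2" unfolding power_mult_distrib[symmetric] by (simp only: abs_le_square_iff)
    qed auto
    ultimately show ?thesis by (simp add: power_mult_distrib)
   qed
   finally have "ennreal ((q (x + h) * \<phi> (x + h) - q x * \<phi> x)^2) \<le> ennreal (2 * M^2 * (\<phi> (x + h) - \<phi> x)^2 + 2 * \<Lambda>^2 * h^2 * (\<phi> x)^2)"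
    by (rule ennreal_leI)
   also have "... = ennreal (2 * M^2) * ennreal ((\<phi> (x + h) - \<phi> x)^2) + ennreal (2 * \<Lambda>^2 * h^2) * ennreal ((\<phi> x)^2)"
    by (subst ennreal_plus) (auto simp: ennreal_mult[symmetric])
   finally show ?thesis using True hb by simp
  qed
 qed
 let ?k = "\<lambda>h::real. ennreal (h powr (-1 - 2 * s)) * indicator {0<..} h"
 have "gag s UNIV (\<lambda>x. q x * \<phi> x) = (NN h. (NN x. ennreal ((q (x + h) * \<phi> (x + h) - q x * \<phi> x)^2)) * ?k h)"
  unfolding gag_def by (simp add: mult.assoc)
 also have "... \<le> (NN h. (NN x. ennreal (2 * M^2) * ennreal ((\<phi> (x + h) - \<phi> x)^2) + ennreal (2 * \<Lambda>^2 * h^2) * indicator {..<b - a} h * (ennreal ((\<phi> x)^2) * indicator ?J x)) * ?k h)"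
 proof (rule nn_integral_mono)
  fix h :: real
  show "(NN x. ennreal ((q (x + h) * \<phi> (x + h) - q x * \<phi> x)^2)) * ?k h \<le> (NN x. ennreal (2 * M^2) * ennreal ((\<phi> (x + h) - \<phi> x)^2) + ennreal (2 * \<Lambda>^2 * h^2) * indicator {..<b - a} h * (ennreal ((\<phi> x)^2) * indicator ?J x)) * ?k h"
   by (cases "h > 0") (auto intro!: mult_right_mono nn_integral_mono pw)
 qed
 also have "... = (NN h. ennreal (2 * M^2) * ((NN x. ennreal ((\<phi> (x + h) - \<phi> x)^2)) * ?k h) + (ennreal (2 * \<Lambda>^2) * sq2 a b \<phi>) * (ennreal (h powr (1 - 2 * s)) * indicator {0<..<b - a} h))"
 proof (rule nn_integral_cong)
  fix h :: real
  have e: "(NN x. ennreal (2 * M^2) * ennreal ((\<phi> (x + h) - \<phi> x)^2) + ennreal (2 * \<Lambda>^2 * h^2) * indicator {..<b - a} h * (ennreal ((\<phi> x)^2) * indicator ?J x))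
    = ennreal (2 * M^2) * (NN x. ennreal ((\<phi> (x + h) - \<phi> x)^2)) + ennreal (2 * \<Lambda>^2 * h^2) * indicator {..<b - a} h * sq2 a b \<phi>"
   unfolding sq2_def by (simp add: nn_integral_add nn_integral_cmult)
  have k: "ennreal (2 * \<Lambda>^2 * h^2) * indicator {..<b - a} h * ?k h = ennreal (2 * \<Lambda>^2) * (ennreal (h powr (1 - 2 * s)) * indicator {0<..<b - a} h)"
  proof (cases "0 < h")
   case True
   have "h^2 * h powr (-1 - 2 * s) = h powr 2 * h powr (-1 - 2 * s)" using True by simp
   also have "... = h powr (1 - 2 * s)" by (simp only: powr_add[symmetric]) simp
   finally have hp: "h^2 * h powr (-1 - 2 * s) = h powr (1 - 2 * s)" .
   have "ennreal (2 * \<Lambda>^2 * h^2) * ennreal (h powr (-1 - 2 * s)) = ennreal (2 * \<Lambda>^2) * ennreal (h powr (1 - 2 * s))"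
    unfolding hp[symmetric] by (simp add: ennreal_mult[symmetric] mult_ac)
   then show ?thesis using True by (auto simp: indicator_def)
  qed (auto simp: indicator_def)
  show "(NN x. ennreal (2 * M^2) * ennreal ((\<phi> (x + h) - \<phi> x)^2) + ennreal (2 * \<Lambda>^2 * h^2) * indicator {..<b - a} h * (ennreal ((\<phi> x)^2) * indicator ?J x)) * ?k h
    = ennreal (2 * M^2) * ((NN x. ennreal ((\<phi> (x + h) - \<phi> x)^2)) * ?k h) + (ennreal (2 * \<Lambda>^2) * sq2 a b \<phi>) * (ennreal (h powr (1 - 2 * s)) * indicator {0<..<b - a} h)"
   unfolding e distrib_right using k by (simp add: mult_ac)
 qed
 also have "... = ennreal (2 * M^2) * (NN h. (NN x. ennreal ((\<phi> (x + h) - \<phi> x)^2)) * ?k h) + (ennreal (2 * \<Lambda>^2) * sq2 a b \<phi>) * (NN h. ennreal (h powr (1 - 2 * s)) * indicator {0<..<b - a} h)"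
  by (simp add: nn_integral_add nn_integral_cmult)
 also have "(NN h. (NN x. ennreal ((\<phi> (x + h) - \<phi> x)^2)) * ?k h) = gag s UNIV \<phi>"
  unfolding gag_def by (simp add: mult.assoc)
 also have "(NN h. ennreal (h powr (1 - 2 * s)) * indicator {0<..<b - a} h) = ennreal ((b - a) powr (1 - 2 * s + 1) / (1 - 2 * s + 1))"
  by (rule nn_powr_0) (use s ab in auto)
 also have "(ennreal (2 * \<Lambda>^2) * sq2 a b \<phi>) * ennreal ((b - a) powr (1 - 2 * s + 1) / (1 - 2 * s + 1)) = ennreal (2 * \<Lambda>^2 * ((b - a) powr (2 - 2 * s) / (2 - 2 * s))) * sq2 a b \<phi>"
  using s by (subst ennreal_mult) (auto simp: mult_ac)
 finally show ?thesis .
qed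

text \<open>The factor is M^2 with C independent of q: for a difference of two approximants a small
  C1 norm therefore gives a small product, the point on which \<open>mult_apx\<close> rests. At
  order 0 the seminorm is controlled by the L2 norm through Bessel.\<close>

lemma W_mult_le:
 assumes s: "0 \<le> s" "s < 1" and ab: "a < b"
 shows "\<exists>C>0. \<forall>q \<phi> M. smooth q \<longrightarrow> test_fun a b \<phi> \<longrightarrow> (\<forall>x\<in>{a<..<b}. \<bar>q x\<bar> \<le> M \<and> \<bar>deriv q x\<bar> \<le> M) \<longrightarrow>
   W s a b (\<lambda>x. q x * \<phi> x) \<le> ennreal (C * M^2) * W s a b \<phi>"
proof -
 have sqm: "sq2 a b (\<lambda>x. q x * \<phi> x) \<le> ennreal (M^2) * sq2 a b \<phi>" if [measurable]: "\<phi> \<in> Borel" and M: "\<forall>x\<in>{a<..<b}. \<bar>q x\<bar> \<le> M" for q \<phi> M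
 proof -
  have "sq2 a b (\<lambda>x. q x * \<phi> x) \<le> (NN x. ennreal (M^2) * (ennreal ((\<phi> x)^2) * indicator {a<..<b} x))"
   unfolding sq2_def
  proof (rule nn_integral_mono)
   fix x
   show "ennreal ((q x * \<phi> x)^2) * indicator {a<..<b} x \<le> ennreal (M^2) * (ennreal ((\<phi> x)^2) * indicator {a<..<b} x)"
   proof (cases "x \<in> {a<..<b}")
    case True
    have "(q x)^2 \<le> M^2" using M True by (intro abs_le_square_iff[THEN iffD1]) (auto intro: order_trans[OF _ abs_ge_self])
    then have "(q x * \<phi> x)^2 \<le> M^2 * (\<phi> x)^2" unfolding power_mult_distrib by (intro mult_right_mono) auto
    then show ?thesis using True by (simp add: ennreal_mult[symmetric] ennreal_leI)
   qed simp
  qed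
  then show ?thesis unfolding sq2_def by (simp add: nn_integral_cmult)
 qed
 consider "s = 0" | "0 < s" using s by linarith
 then show ?thesis
 proof cases
  case 1
  show ?thesis
  proof (intro exI[of _ "1 + 2*pi"] conjI allI impI)
   fix q \<phi> M assume q: "smooth q" and \<phi>: "test_fun a b \<phi>" and M: "\<forall>x\<in>{a<..<b}. \<bar>q x\<bar> \<le> M \<and> \<bar>deriv q x\<bar> \<le> M"
   have t: "test_fun a b (\<lambda>x. q x * \<phi> x)" by (rule test_fun_mult[OF q \<phi>])
   have "FN s (\<lambda>x. q x * \<phi> x) \<le> (NN \<omega>. ennreal ((cmod (fourier (\<lambda>x. q x * \<phi> x) \<omega>))^2))"
    unfolding FN_def 1 by (intro nn_integral_mono ennreal_leI) auto
   also have "... \<le> ennreal (2*pi) * sq2 a b (\<lambda>x. q x * \<phi> x)"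
    unfolding sq2_test_fun(1)[OF t] by (intro fourier_bessel test_fun_integrable[OF t])
   finally have "W s a b (\<lambda>x. q x * \<phi> x) \<le> sq2 a b (\<lambda>x. q x * \<phi> x) + ennreal (2*pi) * sq2 a b (\<lambda>x. q x * \<phi> x)"
    unfolding W_def zext_test_fun[OF t] by (intro add_mono) auto
   also have "... = ennreal (1 + 2*pi) * sq2 a b (\<lambda>x. q x * \<phi> x)" by (simp add: ennreal_plus distrib_right)
   also have "... \<le> ennreal (1 + 2*pi) * (ennreal (M^2) * sq2 a b \<phi>)"
    by (intro mult_left_mono sqm test_fun_measurable[OF \<phi>]) (use M in auto)
   also have "... \<le> ennreal ((1 + 2*pi) * M^2) * W s a b \<phi>"
    unfolding W_def by (subst ennreal_mult) (auto simp: mult.assoc intro!: mult_left_mono)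
   finally show "W s a b (\<lambda>x. q x * \<phi> x) \<le> ennreal ((1 + 2*pi) * M^2) * W s a b \<phi>" .
  qed (simp add: add_pos_pos)
 next
  case 2
  obtain C1 where C1: "C1 > 0"
   "\<And>w. integrable lborel w \<Longrightarrow> integrable lborel (\<lambda>x. (w x)^2) \<Longrightarrow> FN s w \<le> ennreal C1 * gag s UNIV w"
   "\<And>w J. integrable lborel w \<Longrightarrow> J \<in> sets borel \<Longrightarrow> (\<And>x. x \<in> J \<Longrightarrow> isCont w x) \<Longrightarrow> gag s J w \<le> ennreal C1 * FN s w"
   by (rule gag_FN[OF 2 s(2)]) blast
  define D where "D = (b - a) powr (2 - 2 * s) / (2 - 2 * s)"
  have D: "D \<ge> 0" using s by (simp add: D_def)
  define C where "C = 2 * C1 * C1 + 2 * C1 * D + 1"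
  show ?thesis
  proof (intro exI[of _ C] conjI allI impI)
   show "C > 0" using C1(1) D by (simp add: C_def add_nonneg_pos)
   fix q \<phi> M assume q: "smooth q" and \<phi>: "test_fun a b \<phi>" and M: "\<forall>x\<in>{a<..<b}. \<bar>q x\<bar> \<le> M \<and> \<bar>deriv q x\<bar> \<le> M"
   have t: "test_fun a b (\<lambda>x. q x * \<phi> x)" by (rule test_fun_mult[OF q \<phi>])
   have [measurable]: "q \<in> Borel" by (rule borel_measurable_continuous_onI[OF smooth_continuous_on[OF q]])
   have [measurable]: "\<phi> \<in> Borel" by (rule test_fun_measurable[OF \<phi>])
   have "FN s (\<lambda>x. q x * \<phi> x) \<le> ennreal C1 * gag s UNIV (\<lambda>x. q x * \<phi> x)"
    by (intro C1 test_fun_integrable[OF t])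
   also have "... \<le> ennreal C1 * (ennreal (2 * M^2) * gag s UNIV \<phi> + ennreal (2 * M^2 * D) * sq2 a b \<phi>)"
    unfolding D_def
   proof (intro mult_left_mono gag_mult_le 2 s ab)
    show "\<phi> x = 0" if "x \<notin> {a<..<b}" for x using test_fun_outside[OF \<phi> that] .
    show "\<bar>q x - q y\<bar> \<le> M * \<bar>x - y\<bar>" if "x \<in> {a<..<b}" "y \<in> {a<..<b}" for x y
     by (rule lipschitz_from_deriv_bound[OF q, of "{a<..<b}"]) (use M that in auto)
   qed (use M in auto)
   also have "... \<le> ennreal C1 * (ennreal (2 * M^2) * (ennreal C1 * FN s \<phi>) + ennreal (2 * M^2 * D) * sq2 a b \<phi>)"
    by (intro mult_left_mono add_mono order_refl C1(3) test_fun_integrable[OF \<phi>] smooth_isCont test_fun_smooth[OF \<phi>]) auto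
   also have "... = ennreal (2 * C1 * C1 * M^2) * FN s \<phi> + ennreal (2 * C1 * D * M^2) * sq2 a b \<phi>"
   proof -
    have "ennreal C1 * (ennreal (2 * M^2) * ennreal C1) = ennreal (C1 * (2 * M^2 * C1))"
     using C1(1) by (simp add: ennreal_mult)
    moreover have "C1 * (2 * M^2 * C1) = 2 * C1 * C1 * M^2" by simp
    moreover have "ennreal C1 * ennreal (2 * M^2 * D) = ennreal (C1 * (2 * M^2 * D))"
     using C1(1) D by (subst ennreal_mult) auto
    moreover have "C1 * (2 * M^2 * D) = 2 * C1 * D * M^2" by simp
    ultimately show ?thesis unfolding distrib_left by (metis mult.assoc)
   qed
   finally have F: "FN s (\<lambda>x. q x * \<phi> x) \<le> ennreal (2 * C1 * C1 * M^2) * FN s \<phi> + ennreal (2 * C1 * D * M^2) * sq2 a b \<phi>" .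
   have "W s a b (\<lambda>x. q x * \<phi> x) \<le> ennreal (M^2) * sq2 a b \<phi> + (ennreal (2 * C1 * C1 * M^2) * FN s \<phi> + ennreal (2 * C1 * D * M^2) * sq2 a b \<phi>)"
    unfolding W_def zext_test_fun[OF t] by (intro add_mono F sqm) (use M in auto)
   also have "... \<le> ennreal (M^2) * W s a b \<phi> + (ennreal (2 * C1 * C1 * M^2) * W s a b \<phi> + ennreal (2 * C1 * D * M^2) * W s a b \<phi>)"
    unfolding W_def zext_test_fun[OF \<phi>] by (intro add_mono mult_left_mono) auto
   also have "... = ennreal (C * M^2) * W s a b \<phi>"
   proof -
    have "ennreal (C * M^2) = ennreal (M^2 + (2 * C1 * C1 * M^2 + 2 * C1 * D * M^2))" by (simp add: C_def algebra_simps)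
    also have "... = ennreal (M^2) + (ennreal (2 * C1 * C1 * M^2) + ennreal (2 * C1 * D * M^2))"
     using C1(1) D by (subst ennreal_plus, simp, simp, subst ennreal_plus) auto
    finally show ?thesis by (simp add: distrib_right)
   qed
   finally show "W s a b (\<lambda>x. q x * \<phi> x) \<le> ennreal (C * M^2) * W s a b \<phi>" .
  qed
 qed
qed

section \<open>Truncated kernels and explicit formulas for the fractional derivatives\<close>

definition kern :: "real \<Rightarrow> real \<Rightarrow> real \<Rightarrow> real" where
 "kern s L t = t powr (-s) * indicator {0<..<L} t"

lemma kern_measurable [measurable]: "kern s L \<in> Borel"
 unfolding kern_def[abs_def] by measurable

lemma kern_nonneg [simp]: "kern s L t \<ge> 0" by (simp add: kern_def)

lemma kern_integrable:
 assumes "s < 1" "0 < L" shows "integrable lborel (kern s L)" "(LB t. kern s L t) = L powr (1 - s) / (1 - s)"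
proof -
 have e: "(NN t. ennreal (kern s L t)) = ennreal (L powr (1 - s) / (1 - s))"
 proof -
  have "(NN t. ennreal (kern s L t)) = (NN t. ennreal (t powr (-s)) * indicator {0<..<L} t)"
   by (intro nn_integral_cong) (auto simp: kern_def indicator_def)
  also have "... = ennreal (L powr (-s + 1) / (-s + 1))" by (rule nn_powr_0) (use assms in auto)
  finally show ?thesis by (simp add: add.commute)
 qed
 show "integrable lborel (kern s L)" by (rule integrableI_nonneg) (auto simp: e)
 show "(LB t. kern s L t) = L powr (1 - s) / (1 - s)"
  by (subst integral_eq_nn_integral) (use assms in \<open>auto simp: e\<close>)
qed

text \<open>The remainder is uniform in the base point, which lets the derivative pass under an
  integral against any integrable kernel.\<close>

lemma test_fun_taylor:
 assumes \<phi>: "test_fun a b \<phi>"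
 shows "\<exists>M\<ge>0. \<forall>u h. \<bar>\<phi> (u + h) - \<phi> u - h * deriv \<phi> u\<bar> \<le> M * h^2"
proof -
 obtain M where M: "M \<ge> 0" "\<And>x. \<bar>deriv (deriv \<phi>) x\<bar> \<le> M"
  using test_fun_bounded[OF test_fun_deriv[OF test_fun_deriv[OF \<phi>]]] by blast
 have s: "smooth \<phi>" "smooth (deriv \<phi>)" using \<phi> by (auto intro: test_fun_smooth smooth_deriv)
 have "\<bar>\<phi> (u + h) - \<phi> u - h * deriv \<phi> u\<bar> \<le> M * h^2" for u h
 proof -
  \<comment> \<open>A segment rather than an interval, as h may be negative.\<close>
  let ?S = "closed_segment u (u + h)"
  have "norm ((\<lambda>v. \<phi> v - v * deriv \<phi> u) (u + h) - (\<lambda>v. \<phi> v - v * deriv \<phi> u) u) \<le> (M * \<bar>h\<bar>) * norm (u + h - u)"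
  proof (rule field_differentiable_bound[of ?S _ "\<lambda>v. deriv \<phi> v - deriv \<phi> u"])
   fix v assume v: "v \<in> ?S"
   show "((\<lambda>v. \<phi> v - v * deriv \<phi> u) has_field_derivative deriv \<phi> v - deriv \<phi> u) (at v within ?S)"
    by (rule has_field_derivative_at_within) (auto intro!: derivative_eq_intros smooth_DERIV[OF s(1)])
   have "\<bar>deriv \<phi> v - deriv \<phi> u\<bar> \<le> M * \<bar>v - u\<bar>"
    by (rule lipschitz_from_deriv_bound[OF s(2), of UNIV]) (use M in auto)
   also have "... \<le> M * \<bar>h\<bar>" using v M(1) by (intro mult_left_mono) (auto simp: closed_segment_eq_real_ivl split: if_splits)
   finally show "norm (deriv \<phi> v - deriv \<phi> u) \<le> M * \<bar>h\<bar>" by simp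
  qed auto
  then show ?thesis by (simp add: algebra_simps power2_eq_square abs_mult_self_eq flip: abs_mult)
 qed
 then show ?thesis using M(1) by blast
qed

lemma test_fun_conv_integrable:
 assumes k: "integrable lborel k" and \<phi>: "test_fun a b \<phi>"
 shows "integrable lborel (\<lambda>t. k t * \<phi> (y - s * t))"
proof -
 obtain M where M: "M \<ge> 0" "\<And>x. \<bar>\<phi> x\<bar> \<le> M" using test_fun_bounded[OF \<phi>] by blast
 have [measurable]: "\<phi> \<in> Borel" "k \<in> Borel" using test_fun_measurable[OF \<phi>] k by auto
 have "integrable lborel (\<lambda>t. k t * M)" using k by simp
 then show ?thesis
  by (rule Bochner_Integration.integrable_bound) (use M in \<open>auto simp: abs_mult intro!: mult_left_mono\<close>)
qed

text \<open>The derivative falls on the test function, so the singularity of k matters only through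
  its integrability. The values s = 1 and s = -1 give left and right convolutions and, for
  correlations, shifts to the right.\<close>

lemma conv_DERIV:
 assumes k: "integrable lborel k" and \<phi>: "test_fun a b \<phi>"
 shows "DERIV (\<lambda>y. LB t. k t * \<phi> (y - s * t)) y :> (LB t. k t * deriv \<phi> (y - s * t))"
proof -
 obtain M where M: "M \<ge> 0" "\<And>u h. \<bar>\<phi> (u + h) - \<phi> u - h * deriv \<phi> u\<bar> \<le> M * h^2" using test_fun_taylor[OF \<phi>] by blast
 let ?K = "LB t. \<bar>k t\<bar>"
 let ?F = "\<lambda>y. LB t. k t * \<phi> (y - s * t)"
 let ?D = "LB t. k t * deriv \<phi> (y - s * t)"
 note i = test_fun_conv_integrable[OF k \<phi>] test_fun_conv_integrable[OF k test_fun_deriv[OF \<phi>]]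
 have b: "\<bar>(?F (y + h) - ?F y) / h - ?D\<bar> \<le> M * ?K * \<bar>h\<bar>" if h: "h \<noteq> 0" for h
 proof -
  have sh: "(y + h) - s * t = (y - s * t) + h" for t by simp
  have eq: "(\<lambda>t. k t * (\<phi> ((y - s * t) + h) - \<phi> (y - s * t) - h * deriv \<phi> (y - s * t)))
    = (\<lambda>t. k t * \<phi> ((y + h) - s * t) - k t * \<phi> (y - s * t) - h * (k t * deriv \<phi> (y - s * t)))"
   unfolding sh by (simp add: right_diff_distrib mult.left_commute)
  have ie: "integrable lborel (\<lambda>t. k t * (\<phi> ((y - s * t) + h) - \<phi> (y - s * t) - h * deriv \<phi> (y - s * t)))"
   unfolding eq by (intro Bochner_Integration.integrable_diff integrable_mult_right i)
  let ?R = "\<lambda>t. k t * (\<phi> ((y - s * t) + h) - \<phi> (y - s * t) - h * deriv \<phi> (y - s * t))"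
  have 1: "?F (y + h) - ?F y - h * ?D = (LB t. ?R t)"
   unfolding eq using i(1)[of "y + h" s] i[of y s] by simp
  have 2: "(LB t. \<bar>?R t\<bar>) \<le> (LB t. \<bar>k t\<bar> * (M * h^2))"
  proof (rule integral_mono[OF integrable_abs[OF ie]])
   show "integrable lborel (\<lambda>t. \<bar>k t\<bar> * (M * h^2))" using k by simp
   show "\<bar>?R t\<bar> \<le> \<bar>k t\<bar> * (M * h^2)" for t
    unfolding abs_mult[of "k t"] by (rule mult_left_mono[OF M(2) abs_ge_zero])
  qed
  have "\<bar>?F (y + h) - ?F y - h * ?D\<bar> \<le> M * ?K * h^2"
   unfolding 1 by (rule order_trans[OF integral_abs_bound order_trans[OF 2]]) (simp add: mult_ac)
  then have n1: "\<bar>?F (y + h) - ?F y - h * ?D\<bar> / \<bar>h\<bar> \<le> M * ?K * h^2 / \<bar>h\<bar>" by (rule divide_right_mono) simp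
  have n2: "M * ?K * h^2 / \<bar>h\<bar> = M * ?K * \<bar>h\<bar>"
  proof -
   have "h^2 = \<bar>h\<bar> * \<bar>h\<bar>" by (simp add: power2_eq_square)
   moreover have "X * (\<bar>h\<bar> * \<bar>h\<bar>) / \<bar>h\<bar> = X * \<bar>h\<bar>" for X using h by (simp add: field_simps)
   ultimately show ?thesis by metis
  qed
  have n3: "\<bar>?F (y + h) - ?F y - h * ?D\<bar> / \<bar>h\<bar> = \<bar>(?F (y + h) - ?F y) / h - ?D\<bar>"
   unfolding abs_divide[symmetric] using h by (simp add: diff_divide_distrib)
  show ?thesis using n1 unfolding n2 n3 .
 qed
 show ?thesis
  unfolding DERIV_def
 proof (rule LIM_imp_LIM[of "\<lambda>h. M * ?K * \<bar>h\<bar>" 0, rotated])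
  show "(\<lambda>h. M * ?K * \<bar>h\<bar>) \<midarrow>0\<rightarrow> 0" by (rule tendsto_eq_intros | simp)+
  fix h :: real assume "h \<noteq> 0"
  then show "norm ((?F (y + h) - ?F y) / h - ?D) \<le> norm (M * ?K * \<bar>h\<bar> - 0)"
   using order_trans[OF b abs_ge_self] by simp
 qed
qed

lemma conv_isCont:
 assumes k: "integrable lborel k" and \<phi>: "test_fun a b \<phi>"
 shows "isCont (\<lambda>y. LB t. k t * \<phi> (y - s * t)) y"
 using conv_DERIV[OF assms] by (rule DERIV_isCont)

text \<open>At order 0 the kernel is an indicator and the convolution with the derivative
  telescopes. This serves order 1, where the first of two derivatives undoes an integration, and the
  identity at order 0.\<close>

lemma kern0_conv_deriv:
 assumes \<phi>: "test_fun a b \<phi>" and L: "0 < L"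
 shows "(LB t. kern 0 L t * deriv \<phi> (y - s * t)) * s = \<phi> y - \<phi> (y - s * L)"
proof -
 have d: "((\<lambda>t. - \<phi> (y - s * t)) has_vector_derivative (deriv \<phi> (y - s * t) * s)) (at t)" for t
  unfolding has_real_derivative_iff_has_vector_derivative[symmetric]
 proof -
  have "DERIV (\<lambda>t. \<phi> (y - s * t)) t :> deriv \<phi> (y - s * t) * (- s)"
   by (rule DERIV_chain2[OF smooth_DERIV[OF test_fun_smooth[OF \<phi>]]]) (auto intro!: derivative_eq_intros)
  from DERIV_minus[OF this] show "DERIV (\<lambda>t. - \<phi> (y - s * t)) t :> deriv \<phi> (y - s * t) * s" by simp
 qed
 have cd: "continuous_on {0..L} (\<lambda>t. deriv \<phi> (y - s * t) * s)"
  by (intro continuous_on_mult continuous_on_const continuous_on_compose2[OF test_fun_cont[OF test_fun_deriv[OF \<phi>], of UNIV]] continuous_intros) auto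
 have "has_bochner_integral lborel (\<lambda>t. indicator {0..L} t *\<^sub>R (deriv \<phi> (y - s * t) * s)) (- \<phi> (y - s * L) - - \<phi> (y - s * 0))"
  by (rule has_bochner_integral_FTC_Icc[OF _ has_vector_derivative_at_within[OF d] cd]) (use L in simp)
 then have "(LB t. indicator {0..L} t *\<^sub>R (deriv \<phi> (y - s * t) * s)) = \<phi> y - \<phi> (y - s * L)"
  by (simp add: has_bochner_integral_iff)
 moreover have "(LB t. indicator {0..L} t *\<^sub>R (deriv \<phi> (y - s * t) * s)) = (LB t. (kern 0 L t * deriv \<phi> (y - s * t)) * s)"
 proof (rule integral_cong_AE)
  have "AE x in lborel. x \<noteq> (0::real)" "AE x in lborel. x \<noteq> L" by (rule AE_lborel_singleton)+
  then show "AE t in lborel. indicator {0..L} t *\<^sub>R (deriv \<phi> (y - s * t) * s) = (kern 0 L t * deriv \<phi> (y - s * t)) * s"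
   by eventually_elim (auto simp: kern_def indicator_def)
  have [measurable]: "deriv \<phi> \<in> Borel" by (rule test_fun_measurable[OF test_fun_deriv[OF \<phi>]])
  show "(\<lambda>t. indicator {0..L} t *\<^sub>R (deriv \<phi> (y - s * t) * s)) \<in> borel_measurable lborel" by measurable
  show "(\<lambda>t. (kern 0 L t * deriv \<phi> (y - s * t)) * s) \<in> borel_measurable lborel" by measurable
 qed
 ultimately show ?thesis by simp
qed

text \<open>The convention n - 1 \<le> \<mu> < n assigns two derivatives to order 1, which is why s
  = 1 is treated separately from s < 1.\<close>

lemma ord_n_eq: "0 \<le> s \<Longrightarrow> s < 1 \<Longrightarrow> ord_n s = 1" "ord_n 1 = 2"
proof -
 assume "0 \<le> s" "s < 1"
 then have "\<lfloor>s\<rfloor> = 0" by (simp add: floor_eq_iff)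
 then show "ord_n s = 1" by (simp add: ord_n_def)
qed (simp add: ord_n_def)

text \<open>For y < b a value t \<ge> b - a leads to y - t < a, where \<phi> vanishes. Truncating
  the kernel at b - a therefore changes nothing there, and it makes the kernel integrable on the
  line.\<close>

lemma RL_left_conv:
 assumes \<phi>: "test_fun a b \<phi>" and y: "y < b" and ab: "a < b"
 shows "(LINT \<xi>:{a..y}|lborel. \<phi> \<xi> * (y - \<xi>) powr (-s)) = (LB t. kern s (b - a) t * \<phi> (y - 1 * t))"
proof -
 have "(LINT \<xi>:{a..y}|lborel. \<phi> \<xi> * (y - \<xi>) powr (-s)) = (LB t. indicator {a..y} (y + (-1) * t) *\<^sub>R (\<phi> (y + (-1) * t) * (y - (y + (-1) * t)) powr (-s)))"
  unfolding set_lebesgue_integral_def by (subst lborel_integral_real_affine[of "-1" _ y]) auto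
 also have "... = (LB t. kern s (b - a) t * \<phi> (y - 1 * t))"
 proof (rule Bochner_Integration.integral_cong)
  fix t
  show "indicator {a..y} (y + (-1) * t) *\<^sub>R (\<phi> (y + (-1) * t) * (y - (y + (-1) * t)) powr (-s)) = kern s (b - a) t * \<phi> (y - 1 * t)"
  proof (cases "y - t \<in> {a<..<b} \<and> 0 < t")
   case True
   then show ?thesis using y by (auto simp: kern_def indicator_def)
  next
   \<comment> \<open>At t = 0 the left integrand vanishes as well, because
     \<open>0 powr (-s)\<close> is 0, so the two integrands agree at every point.\<close>
   case False
   then have "\<phi> (y - t) = 0 \<or> t \<le> 0" using test_fun_outside[OF \<phi>, of "y - t"] by auto
   then show ?thesis by (auto simp: kern_def indicator_def)
  qed
 qed simp
 finally show ?thesis .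
qed

lemma RL_right_conv:
 assumes \<phi>: "test_fun a b \<phi>" and y: "a < y" and ab: "a < b"
 shows "(LINT \<xi>:{y..b}|lborel. \<phi> \<xi> * (\<xi> - y) powr (-s)) = (LB t. kern s (b - a) t * \<phi> (y - (-1) * t))"
proof -
 have "(LINT \<xi>:{y..b}|lborel. \<phi> \<xi> * (\<xi> - y) powr (-s)) = (LB t. indicator {y..b} (y + 1 * t) *\<^sub>R (\<phi> (y + 1 * t) * ((y + 1 * t) - y) powr (-s)))"
  unfolding set_lebesgue_integral_def by (subst lborel_integral_real_affine[of "1" _ y]) auto
 also have "... = (LB t. kern s (b - a) t * \<phi> (y - (-1) * t))"
 proof (rule Bochner_Integration.integral_cong)
  fix t
  show "indicator {y..b} (y + 1 * t) *\<^sub>R (\<phi> (y + 1 * t) * ((y + 1 * t) - y) powr (-s)) = kern s (b - a) t * \<phi> (y - (-1) * t)"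
  proof (cases "y + t \<in> {a<..<b} \<and> 0 < t")
   case True
   then show ?thesis using y by (auto simp: kern_def indicator_def)
  next
   case False
   then have "\<phi> (y + t) = 0 \<or> t \<le> 0" using test_fun_outside[OF \<phi>, of "y + t"] by auto
   then show ?thesis by (auto simp: kern_def indicator_def)
  qed
 qed simp
 finally show ?thesis .
qed

lemma test_fun_exp: "test_fun a b \<phi> \<Longrightarrow> test_fun a b (\<lambda>x. exp (lam * x) * \<phi> x)"
 by (rule test_fun_mult[OF smooth_exp])

text \<open>The convolution form holds on the open half line of all y < b, so it may be
  differentiated at x; the derivative then sits on exp (lam * x) * \<phi> x.\<close>

lemma DL_formula:
 assumes \<phi>: "test_fun a b \<phi>" and s: "0 \<le> s" "s < 1" and x: "x < b" and ab: "a < b"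
 shows "DL a s lam \<phi> x = exp (- lam * x) / Gamma (1 - s) * (LB t. kern s (b - a) t * deriv (\<lambda>x. exp (lam * x) * \<phi> x) (x - 1 * t))"
proof -
 let ?\<Phi> = "\<lambda>x. exp (lam * x) * \<phi> x"
 note \<Phi> = test_fun_exp[OF \<phi>, of lam]
 have k: "integrable lborel (kern s (b - a))" by (rule kern_integrable) (use s ab in auto)
 have "DERIV (\<lambda>y. LINT \<xi>:{a..y}|lborel. ?\<Phi> \<xi> * (y - \<xi>) powr (-s)) x :> (LB t. kern s (b - a) t * deriv ?\<Phi> (x - 1 * t))"
  by (rule has_field_derivative_transform_within_open[OF conv_DERIV[OF k \<Phi>], of "{..<b}"])
   (use x RL_left_conv[OF \<Phi> _ ab] in auto)
 then show ?thesis unfolding DL_def by (simp add: ord_n_eq(1)[OF s] DERIV_imp_deriv)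
qed

lemma DR_formula:
 assumes \<phi>: "test_fun a b \<phi>" and s: "0 \<le> s" "s < 1" and x: "a < x" and ab: "a < b"
 shows "DR b s lam \<phi> x = - exp (lam * x) / Gamma (1 - s) * (LB t. kern s (b - a) t * deriv (\<lambda>x. exp (- lam * x) * \<phi> x) (x - (-1) * t))"
proof -
 let ?\<Phi> = "\<lambda>x. exp (- lam * x) * \<phi> x"
 note \<Phi> = test_fun_exp[OF \<phi>, of "- lam"]
 have k: "integrable lborel (kern s (b - a))" by (rule kern_integrable) (use s ab in auto)
 have "DERIV (\<lambda>y. LINT \<xi>:{y..b}|lborel. ?\<Phi> \<xi> * (\<xi> - y) powr (-s)) x :> (LB t. kern s (b - a) t * deriv ?\<Phi> (x - (-1) * t))"
  by (rule has_field_derivative_transform_within_open[OF conv_DERIV[OF k \<Phi>], of "{a<..}"])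
   (use x RL_right_conv[OF \<Phi> _ ab, symmetric] in auto)
 then show ?thesis unfolding DR_def by (simp add: ord_n_eq(1)[OF s] DERIV_imp_deriv)
qed

lemma deriv_exp_mult:
 assumes "test_fun a b \<phi>"
 shows "deriv (\<lambda>x. exp (lam * x) * \<phi> x) x = exp (lam * x) * (deriv \<phi> x + lam * \<phi> x)"
 by (rule DERIV_imp_deriv) (auto intro!: derivative_eq_intros smooth_DERIV[OF test_fun_smooth[OF assms]] simp: algebra_simps)

text \<open>The first derivative undoes the integration of exp (lam * x) * \<phi> x, the second
  differentiates this product, and the Gamma factor is Gamma 1 = 1.\<close>

lemma DL_1:
 assumes \<phi>: "test_fun a b \<phi>" and x: "x < b" and ab: "a < b"
 shows "DL a 1 lam \<phi> x = deriv \<phi> x + lam * \<phi> x"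
proof -
 let ?\<Phi> = "\<lambda>x. exp (lam * x) * \<phi> x"
 note \<Phi> = test_fun_exp[OF \<phi>, of lam]
 let ?F = "\<lambda>y. LINT \<xi>:{a..y}|lborel. ?\<Phi> \<xi> * (y - \<xi>) powr (-0)"
 have k: "integrable lborel (kern 0 (b - a))" by (rule kern_integrable) (use ab in auto)
 have dF: "deriv ?F y = ?\<Phi> y" if y: "y < b" for y
 proof (rule DERIV_imp_deriv)
  have "DERIV ?F y :> (LB t. kern 0 (b - a) t * deriv ?\<Phi> (y - 1 * t))"
   by (rule has_field_derivative_transform_within_open[OF conv_DERIV[OF k \<Phi>], of "{..<b}"])
    (use y RL_left_conv[OF \<Phi> _ ab, of _ 0] in auto)
  also have "(LB t. kern 0 (b - a) t * deriv ?\<Phi> (y - 1 * t)) = ?\<Phi> y"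
   using kern0_conv_deriv[OF \<Phi>, of "b - a" y 1] test_fun_outside[OF \<Phi>, of "y - (b - a)"] ab y by simp
  finally show "DERIV ?F y :> ?\<Phi> y" .
 qed
 have "deriv (deriv ?F) x = deriv ?\<Phi> x"
 proof (rule DERIV_imp_deriv)
  show "DERIV (deriv ?F) x :> deriv ?\<Phi> x"
   by (rule has_field_derivative_transform_within_open[OF smooth_DERIV[OF test_fun_smooth[OF \<Phi>]], of "{..<b}"])
    (use x dF in auto)
 qed
 then show ?thesis unfolding DL_def
  by (simp add: ord_n_eq(2) numeral_2_eq_2 deriv_exp_mult[OF \<phi>]  exp_minus)
qed

lemma DR_1:
 assumes \<phi>: "test_fun a b \<phi>" and x: "a < x" and ab: "a < b"
 shows "DR b 1 lam \<phi> x = - deriv \<phi> x + lam * \<phi> x"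
proof -
 let ?\<Phi> = "\<lambda>x. exp (- lam * x) * \<phi> x"
 note \<Phi> = test_fun_exp[OF \<phi>, of "- lam"]
 let ?F = "\<lambda>y. LINT \<xi>:{y..b}|lborel. ?\<Phi> \<xi> * (\<xi> - y) powr (-0)"
 have k: "integrable lborel (kern 0 (b - a))" by (rule kern_integrable) (use ab in auto)
 have dF: "deriv ?F y = - ?\<Phi> y" if y: "a < y" for y
 proof (rule DERIV_imp_deriv)
  have "DERIV ?F y :> (LB t. kern 0 (b - a) t * deriv ?\<Phi> (y - (-1) * t))"
   by (rule has_field_derivative_transform_within_open[OF conv_DERIV[OF k \<Phi>], of "{a<..}"])
    (use y RL_right_conv[OF \<Phi> _ ab, of _ 0, symmetric] in auto)
  also have "(LB t. kern 0 (b - a) t * deriv ?\<Phi> (y - (-1) * t)) = - ?\<Phi> y"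
   using kern0_conv_deriv[OF \<Phi>, of "b - a" y "-1"] test_fun_outside[OF \<Phi>, of "y - (a - b)"] ab y by simp
  finally show "DERIV ?F y :> - ?\<Phi> y" .
 qed
 have "deriv (deriv ?F) x = - deriv ?\<Phi> x"
 proof (rule DERIV_imp_deriv)
  show "DERIV (deriv ?F) x :> - deriv ?\<Phi> x"
   by (rule has_field_derivative_transform_within_open[OF DERIV_minus[OF smooth_DERIV[OF test_fun_smooth[OF \<Phi>]]], of "{a<..}"])
    (use x dF in auto)
 qed
 moreover have "DR b 1 lam \<phi> x = exp (lam * x) * deriv (deriv ?F) x"
 proof -
  have "real 2 - 1 - 1 = (-0::real)" by simp
  then show ?thesis unfolding DR_def ord_n_eq(2) by (simp only: numeral_2_eq_2) simp
 qed
 ultimately show ?thesis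
  unfolding deriv_exp_mult[OF \<phi>] by (simp add: exp_minus field_simps)
qed

lemma DR_0:
 assumes \<phi>: "test_fun a b \<phi>" and x: "a < x" and ab: "a < b"
 shows "DR b 0 0 \<phi> x = \<phi> x"
 using kern0_conv_deriv[OF \<phi>, of "b - a" x "-1"] test_fun_outside[OF \<phi>, of "x - (a - b)"] ab x
 by (simp add: DR_formula[OF \<phi> _ _ x ab] )

section \<open>Fourier transform of the truncated kernel\<close>

definition kern_hat :: "real \<Rightarrow> real \<Rightarrow> real \<Rightarrow> complex" where
 "kern_hat s L \<omega> = (LB t. complex_of_real (kern s L t) * cis (- \<omega> * t))"

text \<open>One integration by parts against the oscillating factor. As t powr (-s) decreases, the
  remaining integral is at most (A powr (-s) - L powr (-s)) / |\<omega>|, which together with the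
  two boundary terms adds up to the bound.\<close>

lemma kern_tail_bound:
 assumes s: "0 < s" and A: "0 < A" "A < L" and w: "\<omega> \<noteq> 0"
 shows "cmod (LB t. indicator {A..L} t *\<^sub>R (complex_of_real (t powr (-s)) * cis (- \<omega> * t))) \<le> 2 * A powr (-s) / \<bar>\<omega>\<bar>"
proof -
 let ?E = "\<lambda>t. (\<i> / complex_of_real \<omega>) * cis (- \<omega> * t)"
 let ?f = "\<lambda>t. complex_of_real (t powr (-s)) * cis (- \<omega> * t)"
 let ?g = "\<lambda>t. complex_of_real (-s * t powr (-s-1)) * ?E t"
 have dE: "(?E has_vector_derivative cis (- \<omega> * t)) (at t)" for t
 proof -
  have "((\<lambda>z. (\<i> / complex_of_real \<omega>) * exp (\<i> * (- complex_of_real \<omega> * z))) has_field_derivative exp (\<i> * (- complex_of_real \<omega> * of_real t))) (at (of_real t))"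
   using w by (auto intro!: derivative_eq_intros)
  from has_vector_derivative_real_field[OF this] show ?thesis by (simp add: cis_conv_exp)
 qed
 have dp: "((\<lambda>t. complex_of_real (t powr (-s))) has_vector_derivative complex_of_real (-s * t powr (-s-1))) (at t)" if "t > 0" for t
  using has_real_derivative_powr[OF that, of "-s"] by (simp only: has_real_derivative_iff_has_vector_derivative has_vector_derivative_of_real)
 have d: "((\<lambda>t. complex_of_real (t powr (-s)) * ?E t) has_vector_derivative ?f t + ?g t) (at t)" if "t > 0" for t
  by (rule has_vector_derivative_eq_rhs[OF has_vector_derivative_mult[OF dp[OF that] dE]]) simp
 have cc: "continuous_on S (\<lambda>t. cis (- \<omega> * t))" for S unfolding cis_conv_exp by (intro continuous_intros)
 have cp: "continuous_on {A..L} (\<lambda>t. t powr r)" for r using A by (auto intro!: continuous_intros)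
 have cg: "continuous_on {A..L} ?g" and cf: "continuous_on {A..L} ?f"
  by (intro continuous_on_mult continuous_on_const continuous_on_of_real cc cp)+
 have ifg: "integrable lborel (\<lambda>t. indicator {A..L} t *\<^sub>R ?f t)" "integrable lborel (\<lambda>t. indicator {A..L} t *\<^sub>R ?g t)"
  by (intro borel_integrable_compact cf cg compact_Icc)+
 have "has_bochner_integral lborel (\<lambda>t. indicator {A..L} t *\<^sub>R (?f t + ?g t)) (complex_of_real (L powr (-s)) * ?E L - complex_of_real (A powr (-s)) * ?E A)"
  by (rule has_bochner_integral_FTC_Icc[OF _ has_vector_derivative_at_within[OF d]]) (use A continuous_on_add[OF cf cg] in auto)
 from has_bochner_integral_integral_eq[OF this] have I: "(LB t. indicator {A..L} t *\<^sub>R ?f t) + (LB t. indicator {A..L} t *\<^sub>R ?g t) = complex_of_real (L powr (-s)) * ?E L - complex_of_real (A powr (-s)) * ?E A"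
  by (subst Bochner_Integration.integral_add[OF ifg, symmetric]) (simp only: scaleR_add_right)
 have nE: "cmod (?E t) = 1 / \<bar>\<omega>\<bar>" for t by (simp add: norm_mult norm_divide)
 have g: "cmod (LB t. indicator {A..L} t *\<^sub>R ?g t) \<le> (A powr (-s) - L powr (-s)) / \<bar>\<omega>\<bar>"
 proof -
  have "has_bochner_integral lborel (\<lambda>t. indicator {A..L} t *\<^sub>R (s * t powr (-s-1))) (- (L powr (-s)) - - (A powr (-s)))"
  proof (rule has_bochner_integral_FTC_Icc)
   show "((\<lambda>t. - (t powr (-s))) has_vector_derivative s * x powr (-s-1)) (at x within {A..L})" if "A \<le> x" "x \<le> L" for x
   proof -
    have "DERIV (\<lambda>t. - (t powr (-s))) x :> - (-s * x powr (-s-1))"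
     using A that by (intro DERIV_minus has_real_derivative_powr) auto
    then show ?thesis by (simp add: has_real_derivative_iff_has_vector_derivative has_vector_derivative_at_within)
   qed
  qed (use A in \<open>auto intro!: continuous_intros\<close>)
  then have h: "integrable lborel (\<lambda>t. indicator {A..L} t *\<^sub>R (s * t powr (-s-1)))"
   "(LB t. indicator {A..L} t *\<^sub>R (s * t powr (-s-1))) = A powr (-s) - L powr (-s)"
   by (auto simp: has_bochner_integral_iff)
  have "cmod (LB t. indicator {A..L} t *\<^sub>R ?g t) \<le> (LB t. cmod (indicator {A..L} t *\<^sub>R ?g t))" by (rule integral_norm_bound)
  also have "... = (LB t. indicator {A..L} t *\<^sub>R (s * t powr (-s-1)) / \<bar>\<omega>\<bar>)"
  proof (intro Bochner_Integration.integral_cong refl)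
   fix t
   have "cmod (complex_of_real (-s * t powr (-s-1))) = s * t powr (-s-1)"
    unfolding norm_of_real abs_mult using s by simp
   then show "cmod (indicator {A..L} t *\<^sub>R ?g t) = indicator {A..L} t *\<^sub>R (s * t powr (-s-1)) / \<bar>\<omega>\<bar>"
    unfolding norm_scaleR norm_mult[of "complex_of_real _" "_ * _"] nE by simp
  qed
  also have "... = (A powr (-s) - L powr (-s)) / \<bar>\<omega>\<bar>" using h by simp
  finally show ?thesis .
 qed
 have eq: "(LB t. indicator {A..L} t *\<^sub>R ?f t) = complex_of_real (L powr (-s)) * ?E L - complex_of_real (A powr (-s)) * ?E A - (LB t. indicator {A..L} t *\<^sub>R ?g t)"
  using I by (rule eq_diff_eq[THEN iffD2])
 have "cmod (LB t. indicator {A..L} t *\<^sub>R ?f t) \<le> cmod (complex_of_real (L powr (-s)) * ?E L) + cmod (complex_of_real (A powr (-s)) * ?E A) + cmod (LB t. indicator {A..L} t *\<^sub>R ?g t)"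
  unfolding eq by (rule order_trans[OF norm_triangle_ineq4 add_right_mono[OF norm_triangle_ineq4]])
 also have "... \<le> L powr (-s) / \<bar>\<omega>\<bar> + A powr (-s) / \<bar>\<omega>\<bar> + (A powr (-s) - L powr (-s)) / \<bar>\<omega>\<bar>"
  unfolding norm_mult[of "complex_of_real _"] nE using g by simp
 also have "... = 2 * A powr (-s) / \<bar>\<omega>\<bar>" using w by (simp add: field_simps)
 finally show ?thesis .
qed

text \<open>The cut is at the wavelength scale A = 1 / |\<omega>|. Below it the absolute value of
  the kernel is integrated, giving 1 / (1 - s); above it the oscillation gives the 2. Both pieces
  scale like |\<omega>| powr (s - 1).\<close>

lemma kern_hat_bound:
 assumes s: "0 < s" "s < 1" and L: "0 < L" and w: "\<omega> \<noteq> 0"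
 shows "cmod (kern_hat s L \<omega>) \<le> (1 / (1 - s) + 2) * \<bar>\<omega>\<bar> powr (s - 1)"
proof -
 define A where "A = 1 / \<bar>\<omega>\<bar>"
 have A: "A > 0" using w by (simp add: A_def)
 have As: "A powr (1 - s) = \<bar>\<omega>\<bar> powr (s - 1)" using w by (simp add: A_def powr_divide powr_minus_divide[symmetric])
 have At: "A powr (-s) / \<bar>\<omega>\<bar> = \<bar>\<omega>\<bar> powr (s - 1)"
  using w by (simp add: A_def powr_divide powr_minus_divide powr_diff)
 have small: "cmod (LB t. complex_of_real (kern s B t) * cis (- \<omega> * t)) \<le> \<bar>\<omega>\<bar> powr (s - 1) / (1 - s)" if B: "0 < B" "B \<le> A" for B
 proof -
  have "cmod (LB t. complex_of_real (kern s B t) * cis (- \<omega> * t)) \<le> (LB t. cmod (complex_of_real (kern s B t) * cis (- \<omega> * t)))"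
   by (rule integral_norm_bound)
  also have "... = B powr (1 - s) / (1 - s)" using kern_integrable(2)[of s B] s B by (simp add: norm_mult)
  also have "... \<le> A powr (1 - s) / (1 - s)" using s B by (intro divide_right_mono powr_mono2) auto
  finally show ?thesis using As by simp
 qed
 show ?thesis
 proof (cases "L \<le> A")
  case True
  have "cmod (kern_hat s L \<omega>) \<le> \<bar>\<omega>\<bar> powr (s - 1) / (1 - s)" unfolding kern_hat_def by (rule small[OF L True])
  also have "... \<le> (1 / (1 - s) + 2) * \<bar>\<omega>\<bar> powr (s - 1)" by (simp add: distrib_right)
  finally show ?thesis .
 next
  case False
  then have AL: "A < L" by simp
  have mc: "(\<lambda>t. cis (- \<omega> * t)) \<in> Borel" unfolding cis_conv_exp by measurable
  have i1: "integrable lborel (\<lambda>t. complex_of_real (kern s A t) * cis (- \<omega> * t))"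
   by (rule Bochner_Integration.integrable_bound[OF kern_integrable(1)[OF s(2) A]]) (use mc in \<open>auto simp: norm_mult\<close>)
  have i2: "integrable lborel (\<lambda>t. indicator {A..L} t *\<^sub>R (complex_of_real (t powr (-s)) * cis (- \<omega> * t)))"
   using A unfolding cis_conv_exp by (intro borel_integrable_compact) (auto intro!: continuous_intros)
  have "kern_hat s L \<omega> = (LB t. complex_of_real (kern s A t) * cis (- \<omega> * t) + indicator {A..L} t *\<^sub>R (complex_of_real (t powr (-s)) * cis (- \<omega> * t)))"
   unfolding kern_hat_def
  proof (rule integral_cong_AE)
   have "AE x in lborel. x \<noteq> L" by (rule AE_lborel_singleton)
   then show "AE t in lborel. complex_of_real (kern s L t) * cis (- \<omega> * t) = complex_of_real (kern s A t) * cis (- \<omega> * t) + indicator {A..L} t *\<^sub>R (complex_of_real (t powr (-s)) * cis (- \<omega> * t))"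
    by eventually_elim (use A AL in \<open>auto simp: kern_def indicator_def\<close>)
  qed (use mc in measurable)
  also have "... = (LB t. complex_of_real (kern s A t) * cis (- \<omega> * t)) + (LB t. indicator {A..L} t *\<^sub>R (complex_of_real (t powr (-s)) * cis (- \<omega> * t)))"
   by (rule Bochner_Integration.integral_add[OF i1 i2])
  finally have eq: "kern_hat s L \<omega> = ..." .
  have "cmod (kern_hat s L \<omega>) \<le> \<bar>\<omega>\<bar> powr (s - 1) / (1 - s) + 2 * A powr (-s) / \<bar>\<omega>\<bar>"
   unfolding eq by (rule order_trans[OF norm_triangle_ineq add_mono[OF small[OF A order_refl] kern_tail_bound[OF s(1) A AL w]]])
  also have "... = (1 / (1 - s) + 2) * \<bar>\<omega>\<bar> powr (s - 1)" using At by (simp add: distrib_right)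
  finally show ?thesis .
 qed
qed

lemma conv_integrable:
 fixes k f :: "real \<Rightarrow> real"
 assumes k: "integrable lborel k" and f: "integrable lborel f"
 shows "integrable lborel (\<lambda>x. LB t. k t * f (x - s * t))"
proof -
 have [measurable]: "k \<in> Borel" "f \<in> Borel" using k f by auto
 have sh: "integrable lborel (\<lambda>x. f (x - c))" "(LB x. \<bar>f (x - c)\<bar>) = (LB x. \<bar>f x\<bar>)" for c
  using lborel_integrable_real_affine[OF f, of 1 "-c"] lborel_integral_real_affine[of 1 "\<lambda>x. \<bar>f x\<bar>" "-c"] by simp_all
 have "integrable (lborel \<Otimes>\<^sub>M lborel) (\<lambda>(t,x). k t * f (x - s * t))"
  by (rule lborel_pair.Fubini_integrable) (use k sh in \<open>simp_all add: abs_mult\<close>)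
 from lborel_pair.integrable_fst'[OF lborel_pair.integrable_product_swap[OF this]] show ?thesis by simp
qed

lemma fourier_conv:
 assumes k: "integrable lborel k" and f: "integrable lborel f"
 shows "fourier (\<lambda>x. LB t. k t * f (x - s * t)) \<omega> = (LB t. complex_of_real (k t) * cis (- (s * \<omega>) * t)) * fourier f \<omega>"
proof -
 have [measurable]: "k \<in> Borel" "f \<in> Borel" using k f by auto
 have sh: "integrable lborel (\<lambda>x. f (x - c))" "(LB x. \<bar>f (x - c)\<bar>) = (LB x. \<bar>f x\<bar>)" for c
  using lborel_integrable_real_affine[OF f, of 1 "-c"] lborel_integral_real_affine[of 1 "\<lambda>x. \<bar>f x\<bar>" "-c"] by simp_all
 have I: "integrable (lborel \<Otimes>\<^sub>M lborel) (\<lambda>(t,x). k t * f (x - s * t))"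
  by (rule lborel_pair.Fubini_integrable) (use k sh in \<open>simp_all add: abs_mult\<close>)
 have I2: "integrable (lborel \<Otimes>\<^sub>M lborel) (\<lambda>(t,x). cis (- \<omega> * x) * complex_of_real (k t * f (x - s * t)))"
 proof (rule Bochner_Integration.integrable_bound[OF I])
  show "(\<lambda>(t,x). cis (- \<omega> * x) * complex_of_real (k t * f (x - s * t))) \<in> borel_measurable (lborel \<Otimes>\<^sub>M lborel)"
   unfolding cis_conv_exp by measurable
 qed (auto simp: norm_mult)
 have "fourier (\<lambda>x. LB t. k t * f (x - s * t)) \<omega> = (LB x. LB t. cis (- \<omega> * x) * complex_of_real (k t * f (x - s * t)))"
  unfolding fourier_def integral_complex_of_real[symmetric] by simp
 also have "... = (LB t. LB x. cis (- \<omega> * x) * complex_of_real (k t * f (x - s * t)))"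
  by (rule lborel_pair.Fubini_integral[OF I2])
 also have "... = (LB t. complex_of_real (k t) * cis (- (s * \<omega>) * t) * fourier f \<omega>)"
 proof (rule Bochner_Integration.integral_cong)
  fix t
  have "(LB x. cis (- \<omega> * x) * complex_of_real (k t * f (x - s * t))) = (LB x. cis (- \<omega> * (s * t + 1 * x)) * complex_of_real (k t * f ((s * t + 1 * x) - s * t)))"
   by (subst lborel_integral_real_affine[of 1 _ "s * t"]) simp_all
  also have "... = (LB x. (complex_of_real (k t) * cis (- (s * \<omega>) * t)) * (cis (- \<omega> * x) * complex_of_real (f x)))"
  proof (rule Bochner_Integration.integral_cong)
   fix x
   have "cis (- \<omega> * (s * t + 1 * x)) = cis (- (s * \<omega>) * t) * cis (- \<omega> * x)" by (simp add: cis_mult algebra_simps)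
   then show "cis (- \<omega> * (s * t + 1 * x)) * complex_of_real (k t * f ((s * t + 1 * x) - s * t)) = (complex_of_real (k t) * cis (- (s * \<omega>) * t)) * (cis (- \<omega> * x) * complex_of_real (f x))"
    by simp
  qed simp
  also have "... = complex_of_real (k t) * cis (- (s * \<omega>) * t) * fourier f \<omega>"
   unfolding fourier_def by simp
  finally show "(LB x. cis (- \<omega> * x) * complex_of_real (k t * f (x - s * t))) = complex_of_real (k t) * cis (- (s * \<omega>) * t) * fourier f \<omega>" .
 qed simp
 also have "... = (LB t. complex_of_real (k t) * cis (- (s * \<omega>) * t)) * fourier f \<omega>" by simp
 finally show ?thesis .
qed

text \<open>The derivative contributes a factor \<omega> and the kernel |\<omega>| powr (s - 1), so
  the multiplier has size |\<omega>| powr s. The convolution is continuous everywhere, so the lower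
  half of Plancherel applies on the whole line.\<close>

lemma kern_conv_bound:
 assumes s: "0 < s" "s < 1" and L: "0 < L" and sg: "\<bar>r\<bar> = 1" and \<phi>: "test_fun a b \<phi>"
 shows "(NN x. ennreal ((LB t. kern s L t * deriv \<phi> (x - r * t))^2)) \<le> ennreal ((1 / (1 - s) + 2)^2 / (2*pi)) * FN s \<phi>"
proof -
 let ?g = "\<lambda>x. LB t. kern s L t * deriv \<phi> (x - r * t)"
 let ?C = "1 / (1 - s) + 2"
 note d = test_fun_deriv[OF \<phi>]
 note k = kern_integrable(1)[OF s(2) L]
 have "(NN x. ennreal ((?g x)^2)) = (NN x. ennreal ((?g x)^2) * indicator UNIV x)" by simp
 also have "... \<le> ennreal (1/(2*pi)) * (NN \<omega>. ennreal ((cmod (fourier ?g \<omega>))^2))"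
  by (rule fourier_lower[OF conv_integrable[OF k test_fun_integrable(1)[OF d]] conv_isCont[OF k d]]) simp
 also have "... \<le> ennreal (1/(2*pi)) * (NN \<omega>. ennreal (?C^2) * ennreal (\<bar>\<omega>\<bar> powr (2 * s) * (cmod (fourier \<phi> \<omega>))^2))"
 proof (intro mult_left_mono nn_integral_mono)
  fix \<omega> :: real
  have F: "fourier ?g \<omega> = kern_hat s L (r * \<omega>) * (\<i> * complex_of_real \<omega> * fourier \<phi> \<omega>)"
   unfolding fourier_conv[OF k test_fun_integrable(1)[OF d]] kern_hat_def fourier_deriv[OF \<phi>] ..
  have "(cmod (fourier ?g \<omega>))^2 \<le> ?C^2 * (\<bar>\<omega>\<bar> powr (2 * s) * (cmod (fourier \<phi> \<omega>))^2)"
  proof (cases "\<omega> = 0")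
   case False
   have "cmod (kern_hat s L (r * \<omega>)) \<le> ?C * \<bar>r * \<omega>\<bar> powr (s - 1)"
    by (rule kern_hat_bound[OF s L]) (use False sg in auto)
   also have "\<bar>r * \<omega>\<bar> = \<bar>\<omega>\<bar>" using sg by (simp add: abs_mult)
   finally have "cmod (fourier ?g \<omega>) \<le> (?C * \<bar>\<omega>\<bar> powr (s - 1)) * (\<bar>\<omega>\<bar> * cmod (fourier \<phi> \<omega>))"
    unfolding F norm_mult by (simp add: mult_right_mono)
   also have "... = ?C * (\<bar>\<omega>\<bar> powr s * cmod (fourier \<phi> \<omega>))"
   proof -
    have "\<bar>\<omega>\<bar> powr (s - 1) * \<bar>\<omega>\<bar> = \<bar>\<omega>\<bar> powr s" using False by (simp add: powr_diff)
    then show ?thesis by (metis mult.assoc)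
   qed
   finally have "(cmod (fourier ?g \<omega>))^2 \<le> (?C * (\<bar>\<omega>\<bar> powr s * cmod (fourier \<phi> \<omega>)))^2" by (rule power_mono) simp
   also have "... = ?C^2 * ((\<bar>\<omega>\<bar> powr s)^2 * (cmod (fourier \<phi> \<omega>))^2)" unfolding power_mult_distrib ..
   also have "(\<bar>\<omega>\<bar> powr s)^2 = \<bar>\<omega>\<bar> powr (2 * s)" using False by (simp add: powr_power mult.commute)
   finally show ?thesis .
  next
   case True
   have "fourier ?g \<omega> = 0" unfolding F using True by simp
   then show ?thesis by simp
  qed
  then show "ennreal ((cmod (fourier ?g \<omega>))^2) \<le> ennreal (?C^2) * ennreal (\<bar>\<omega>\<bar> powr (2 * s) * (cmod (fourier \<phi> \<omega>))^2)"
   by (subst ennreal_mult[symmetric]) (auto intro: ennreal_leI)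
 qed auto
 also have "... = ennreal (1/(2*pi)) * (ennreal (?C^2) * FN s \<phi>)"
 proof -
  have [measurable]: "\<phi> \<in> Borel" by (rule test_fun_measurable[OF \<phi>])
  show ?thesis unfolding FN_def by (subst nn_integral_cmult) simp_all
 qed
 also have "... = ennreal (?C^2/(2*pi)) * FN s \<phi>" by (simp add: mult.assoc[symmetric] ennreal_mult[symmetric])
 finally show ?thesis .
qed

section \<open>Boundedness of the tempered derivatives from the energy norm to L2\<close>

lemma exp_bounds_interval:
 assumes "a < b"
 shows "\<exists>M>0. \<forall>x\<in>{a<..<b::real}. exp (lam * x) \<le> M \<and> \<bar>lam * exp (lam * x)\<bar> \<le> M"
proof -
 define B where "B = exp (\<bar>lam\<bar> * (\<bar>a\<bar> + \<bar>b\<bar>))"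
 have "exp (lam * x) \<le> B" if "x \<in> {a<..<b}" for x
 proof -
  have "lam * x \<le> \<bar>lam\<bar> * \<bar>x\<bar>" by (metis abs_ge_self abs_mult)
  also have "... \<le> \<bar>lam\<bar> * (\<bar>a\<bar> + \<bar>b\<bar>)" using that by (intro mult_left_mono) auto
  finally show ?thesis by (simp add: B_def)
 qed
 then have B: "exp (lam * x) \<le> B" if "x \<in> {a<..<b}" for x using that .
 have B0: "B > 0" by (simp add: B_def)
 show ?thesis
 proof (intro exI[of _ "(1 + \<bar>lam\<bar>) * B"] conjI ballI)
  show "0 < (1 + \<bar>lam\<bar>) * B" using B0 by (simp add: add_pos_nonneg)
  fix x assume x: "x \<in> {a<..<b}"
  have 1: "0 \<le> \<bar>lam\<bar> * B" using B0 by simp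
  have 2: "\<bar>lam\<bar> * exp (lam * x) \<le> \<bar>lam\<bar> * B" by (intro mult_left_mono B x) simp
  show "exp (lam * x) \<le> (1 + \<bar>lam\<bar>) * B" using B[OF x] 1 by (simp add: distrib_right)
  show "\<bar>lam * exp (lam * x)\<bar> \<le> (1 + \<bar>lam\<bar>) * B" using 2 B0 by (simp add: distrib_right abs_mult)
 qed
qed

text \<open>One estimate for both sides: r = 1 or -1 selects the direction, lam is the inner and l
  the outer exponent. The inner exponential is a smooth multiplier covered by
  \<open>W_mult_le\<close>; the outer one is bounded on (a,b).\<close>

lemma weighted_conv_bound:
 assumes s: "0 < s" "s < 1" and ab: "a < b" and sg: "\<bar>r\<bar> = 1"
 shows "\<exists>C>0. \<forall>\<phi>. test_fun a b \<phi> \<longrightarrow>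
  sq2 a b (\<lambda>x. c * exp (l * x) * (LB t. kern s (b - a) t * deriv (\<lambda>x. exp (lam * x) * \<phi> x) (x - r * t))) \<le> ennreal C * W s a b \<phi>"
proof -
 obtain M1 where M1: "M1 > 0" "\<And>x. x \<in> {a<..<b} \<Longrightarrow> exp (l * x) \<le> M1" using exp_bounds_interval[OF ab] by blast
 obtain M2 where M2: "M2 > 0" "\<And>x. x \<in> {a<..<b} \<Longrightarrow> exp (lam * x) \<le> M2 \<and> \<bar>lam * exp (lam * x)\<bar> \<le> M2" using exp_bounds_interval[OF ab] by blast
 obtain C2 where C2: "C2 > 0" "\<And>q \<phi> M. smooth q \<Longrightarrow> test_fun a b \<phi> \<Longrightarrow> (\<forall>x\<in>{a<..<b}. \<bar>q x\<bar> \<le> M \<and> \<bar>deriv q x\<bar> \<le> M) \<Longrightarrow>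
   W s a b (\<lambda>x. q x * \<phi> x) \<le> ennreal (C2 * M^2) * W s a b \<phi>" using W_mult_le[of s a b] s ab by auto
 define K where "K = (1 / (1 - s) + 2)^2 / (2*pi)"
 \<comment> \<open>The summand 1 keeps C positive also when c = 0.\<close>
 define C where "C = (c * M1)^2 * K * (C2 * M2^2) + 1"
 have K: "K \<ge> 0" by (simp add: K_def)
 have C: "C > 0" unfolding C_def using K C2(1) by (intro add_nonneg_pos mult_nonneg_nonneg) auto
 show ?thesis
 proof (intro exI[of _ C] conjI C allI impI)
  fix \<phi> assume \<phi>: "test_fun a b \<phi>"
  let ?\<Phi> = "\<lambda>x. exp (lam * x) * \<phi> x"
  note \<Phi> = test_fun_exp[OF \<phi>, of lam]
  let ?g = "\<lambda>x. LB t. kern s (b - a) t * deriv ?\<Phi> (x - r * t)"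
  have gm: "?g \<in> Borel"
   using conv_integrable[OF kern_integrable(1)[of s "b - a"] test_fun_integrable(1)[OF test_fun_deriv[OF \<Phi>]], of r] s ab by auto
  have de: "deriv (\<lambda>x. exp (lam * x)) x = lam * exp (lam * x)" for x by (rule DERIV_imp_deriv) (auto intro!: derivative_eq_intros)
  have "sq2 a b (\<lambda>x. c * exp (l * x) * ?g x) \<le> (NN x. ennreal ((c * M1)^2) * ennreal ((?g x)^2))"
   unfolding sq2_def
  proof (rule nn_integral_mono)
   fix x
   show "ennreal ((c * exp (l * x) * ?g x)^2) * indicator {a<..<b} x \<le> ennreal ((c * M1)^2) * ennreal ((?g x)^2)"
   proof (cases "x \<in> {a<..<b}")
    case True
    have "(exp (l * x))^2 \<le> M1^2" using M1(2)[OF True] by (intro power_mono) auto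
    then have "(c * exp (l * x) * ?g x)^2 \<le> (c * M1)^2 * (?g x)^2" unfolding power_mult_distrib
     by (intro mult_right_mono mult_left_mono) auto
    then show ?thesis using True by (simp add: ennreal_mult[symmetric] ennreal_leI)
   qed simp
  qed
  also have "... = ennreal ((c * M1)^2) * (NN x. ennreal ((?g x)^2))"
   using gm by (intro nn_integral_cmult) auto
  also have "... \<le> ennreal ((c * M1)^2) * (ennreal K * FN s ?\<Phi>)"
   unfolding K_def by (intro mult_left_mono kern_conv_bound[OF s _ sg \<Phi>]) (use ab in auto)
  also have "... \<le> ennreal ((c * M1)^2) * (ennreal K * (ennreal (C2 * M2^2) * W s a b \<phi>))"
  proof (intro mult_left_mono)
   have "FN s ?\<Phi> \<le> W s a b ?\<Phi>" unfolding W_def zext_test_fun[OF \<Phi>] by simp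
   also have "... \<le> ennreal (C2 * M2^2) * W s a b \<phi>"
    by (rule C2(2)[OF smooth_exp \<phi>]) (use M2 in \<open>auto simp: de\<close>)
   finally show "FN s ?\<Phi> \<le> ennreal (C2 * M2^2) * W s a b \<phi>" .
  qed auto
  also have "... = ennreal ((c * M1)^2 * K * (C2 * M2^2)) * W s a b \<phi>"
  proof -
   have "ennreal ((c * M1)^2 * K * (C2 * M2^2)) = ennreal ((c * M1)^2) * ennreal K * ennreal (C2 * M2^2)"
    using K C2(1) by (subst ennreal_mult, simp, simp, subst ennreal_mult) auto
   then show ?thesis by (simp only: mult.assoc)
  qed
  also have "... \<le> ennreal C * W s a b \<phi>" by (intro mult_right_mono ennreal_leI) (auto simp: C_def)
  finally show "sq2 a b (\<lambda>x. c * exp (l * x) * ?g x) \<le> ennreal C * W s a b \<phi>" .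
 qed
qed

lemma sq2_cong: "(\<And>x. x \<in> {a<..<b} \<Longrightarrow> u x = v x) \<Longrightarrow> sq2 a b u = sq2 a b v"
 unfolding sq2_def by (intro nn_integral_cong) (auto simp: indicator_def)

lemma sq2_zext: "sq2 a b u = (NN x. ennreal ((zext a b u x)^2))"
 unfolding sq2_def by (intro nn_integral_cong) (simp add: zext_def indicator_def)

lemma sq2_add_le:
 assumes [measurable]: "zext a b u \<in> Borel" "zext a b v \<in> Borel"
 shows "sq2 a b (\<lambda>x. u x - v x) \<le> 2 * sq2 a b u + 2 * sq2 a b v"
proof -
 have "sq2 a b (\<lambda>x. u x - v x) \<le> (NN x. 2 * ennreal ((zext a b u x)^2) + 2 * ennreal ((zext a b v x)^2))"
  unfolding sq2_zext
 proof (rule nn_integral_mono)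
  fix x
  have "(zext a b (\<lambda>x. u x - v x) x)^2 \<le> 2 * (zext a b u x)^2 + 2 * (zext a b v x)^2"
   unfolding zext_def right_diff_distrib by (rule sum_squares_le_diff)
  then have "ennreal ((zext a b (\<lambda>x. u x - v x) x)^2) \<le> ennreal (2 * (zext a b u x)^2 + 2 * (zext a b v x)^2)" by (rule ennreal_leI)
  then show "ennreal ((zext a b (\<lambda>x. u x - v x) x)^2) \<le> 2 * ennreal ((zext a b u x)^2) + 2 * ennreal ((zext a b v x)^2)"
   by (simp add: ennreal_mult)
 qed
 also have "... = 2 * sq2 a b u + 2 * sq2 a b v" unfolding sq2_zext by (simp add: nn_integral_add nn_integral_cmult)
 finally show ?thesis .
qed

lemma sq2_cmult:
 assumes [measurable]: "zext a b u \<in> Borel"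
 shows "sq2 a b (\<lambda>x. c * u x) = ennreal (c^2) * sq2 a b u"
proof -
 have z: "zext a b (\<lambda>x. c * u x) x = c * zext a b u x" for x by (simp add: zext_def)
 show ?thesis unfolding sq2_zext z by (simp add: power_mult_distrib ennreal_mult nn_integral_cmult)
qed

lemma D1_bound:
 assumes ab: "a < b"
 shows "\<exists>C>0. \<forall>\<phi>. test_fun a b \<phi> \<longrightarrow> sq2 a b (\<lambda>x. c * deriv \<phi> x - l * \<phi> x) \<le> ennreal C * W 1 a b \<phi>"
proof -
 define C where "C = 2 * c^2 + 2 * l^2 + 1"
 have C: "C > 0" by (simp add: C_def add_nonneg_pos)
 show ?thesis
 proof (intro exI[of _ C] conjI C allI impI)
  fix \<phi> assume \<phi>: "test_fun a b \<phi>"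
  note d = test_fun_deriv[OF \<phi>]
  have m: "zext a b \<phi> \<in> Borel" "zext a b (deriv \<phi>) \<in> Borel"
   unfolding zext_test_fun[OF \<phi>] zext_test_fun[OF d] by (intro test_fun_measurable[OF \<phi>] test_fun_measurable[OF d])+
  have m': "zext a b (\<lambda>x. k * u x) \<in> Borel" if [measurable]: "zext a b u \<in> Borel" for k u
  proof -
   have "zext a b (\<lambda>x. k * u x) = (\<lambda>x. k * zext a b u x)" by (auto simp: zext_def)
   then show ?thesis by simp
  qed
  have "sq2 a b (deriv \<phi>) \<le> ennreal (1/(2*pi)) * FN 1 \<phi>"
   unfolding sq2_def by (rule FN_1_lower[OF \<phi> test_fun_integrable(1)[OF \<phi>]]) simp
  also have "... \<le> 1 * FN 1 \<phi>"
  proof (rule mult_right_mono)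
   have "1/(2*pi) \<le> 1" using pi_gt3 by simp
   then show "ennreal (1/(2*pi)) \<le> 1" using ennreal_leI[of "1/(2*pi)" 1] by simp
  qed simp
  finally have f: "sq2 a b (deriv \<phi>) \<le> W 1 a b \<phi>" unfolding W_def zext_test_fun[OF \<phi>] by (simp add: add_increasing)
  have f0: "sq2 a b \<phi> \<le> W 1 a b \<phi>" unfolding W_def by simp
  have "sq2 a b (\<lambda>x. c * deriv \<phi> x - l * \<phi> x) \<le> 2 * sq2 a b (\<lambda>x. c * deriv \<phi> x) + 2 * sq2 a b (\<lambda>x. l * \<phi> x)"
   by (intro sq2_add_le m' m)
  also have "... \<le> 2 * (ennreal (c^2) * W 1 a b \<phi>) + 2 * (ennreal (l^2) * W 1 a b \<phi>)"
   unfolding sq2_cmult[OF m(1)] sq2_cmult[OF m(2)] by (intro add_mono mult_left_mono f f0) auto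
  also have "... = ennreal (2 * c^2 + 2 * l^2) * W 1 a b \<phi>"
   by (simp add: ennreal_plus ennreal_mult distrib_right mult.assoc)
  also have "... \<le> ennreal C * W 1 a b \<phi>" by (intro mult_right_mono ennreal_leI) (auto simp: C_def)
  finally show "sq2 a b (\<lambda>x. c * deriv \<phi> x - l * \<phi> x) \<le> ennreal C * W 1 a b \<phi>" .
 qed
qed

lemma DL_bound:
 assumes ab: "a < b" and s: "0 < s" "s \<le> 1"
 shows "\<exists>C>0. \<forall>\<phi>. test_fun a b \<phi> \<longrightarrow> sq2 a b (DL a s lam \<phi>) \<le> ennreal C * W s a b \<phi>"
proof (cases "s = 1")
 case True
 obtain C where C: "C > 0" "\<And>\<phi>. test_fun a b \<phi> \<Longrightarrow> sq2 a b (\<lambda>x. 1 * deriv \<phi> x - (- lam) * \<phi> x) \<le> ennreal C * W 1 a b \<phi>"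
  using D1_bound[OF ab] by blast
 have "sq2 a b (DL a s lam \<phi>) \<le> ennreal C * W s a b \<phi>" if \<phi>: "test_fun a b \<phi>" for \<phi>
 proof -
  have "sq2 a b (DL a s lam \<phi>) = sq2 a b (\<lambda>x. 1 * deriv \<phi> x - (- lam) * \<phi> x)"
   unfolding True by (rule sq2_cong) (simp add: DL_1[OF \<phi> _ ab])
  then show ?thesis using C(2)[OF \<phi>] True by simp
 qed
 then show ?thesis using C(1) by blast
next
 case False
 then have s1: "s < 1" using s by simp
 obtain C where C: "C > 0" "\<And>\<phi>. test_fun a b \<phi> \<Longrightarrow> sq2 a b (\<lambda>x. (1 / Gamma (1 - s)) * exp ((- lam) * x) * (LB t. kern s (b - a) t * deriv (\<lambda>x. exp (lam * x) * \<phi> x) (x - 1 * t))) \<le> ennreal C * W s a b \<phi>"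
  using weighted_conv_bound[OF s(1) s1 ab, of 1 "1 / Gamma (1 - s)" "- lam" lam] by auto
 have "sq2 a b (DL a s lam \<phi>) \<le> ennreal C * W s a b \<phi>" if \<phi>: "test_fun a b \<phi>" for \<phi>
 proof -
  have "sq2 a b (DL a s lam \<phi>) = sq2 a b (\<lambda>x. (1 / Gamma (1 - s)) * exp ((- lam) * x) * (LB t. kern s (b - a) t * deriv (\<lambda>x. exp (lam * x) * \<phi> x) (x - 1 * t)))"
   by (rule sq2_cong) (use s s1 in \<open>simp add: DL_formula[OF \<phi> _ _ _ ab]\<close>)
  then show ?thesis using C(2)[OF \<phi>] by simp
 qed
 then show ?thesis using C(1) by blast
qed

text \<open>Order 0 is included for lam = 0, since it is the order 1 - \<alpha>/2 of the convection
  terms at \<alpha> = 2.\<close>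

lemma DR_bound:
 assumes ab: "a < b" and s: "0 < s \<or> s = 0 \<and> lam = 0" "s \<le> 1"
 shows "\<exists>C>0. \<forall>\<phi>. test_fun a b \<phi> \<longrightarrow> sq2 a b (DR b s lam \<phi>) \<le> ennreal C * W s a b \<phi>"
proof -
 consider "s = 1" | "s = 0" "lam = 0" | "0 < s" "s < 1" using s by linarith
 then show ?thesis
 proof cases
  case 1
  obtain C where C: "C > 0" "\<And>\<phi>. test_fun a b \<phi> \<Longrightarrow> sq2 a b (\<lambda>x. (-1) * deriv \<phi> x - (- lam) * \<phi> x) \<le> ennreal C * W 1 a b \<phi>"
   using D1_bound[OF ab] by blast
  have "sq2 a b (DR b s lam \<phi>) \<le> ennreal C * W s a b \<phi>" if \<phi>: "test_fun a b \<phi>" for \<phi>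
  proof -
   have "sq2 a b (DR b s lam \<phi>) = sq2 a b (\<lambda>x. (-1) * deriv \<phi> x - (- lam) * \<phi> x)"
    unfolding 1 by (rule sq2_cong) (simp add: DR_1[OF \<phi> _ ab])
   then show ?thesis using C(2)[OF \<phi>] 1 by simp
  qed
  then show ?thesis using C(1) by blast
 next
  case 2
  have "sq2 a b (DR b s lam \<phi>) \<le> ennreal 1 * W s a b \<phi>" if \<phi>: "test_fun a b \<phi>" for \<phi>
  proof -
   have "sq2 a b (DR b s lam \<phi>) = sq2 a b \<phi>"
    unfolding 2 by (rule sq2_cong) (simp add: DR_0[OF \<phi> _ ab])
   then show ?thesis by (simp add: W_def)
  qed
  then show ?thesis by (intro exI[of _ 1]) auto
 next
  case 3
  obtain C where C: "C > 0" "\<And>\<phi>. test_fun a b \<phi> \<Longrightarrow> sq2 a b (\<lambda>x. (- 1 / Gamma (1 - s)) * exp (lam * x) * (LB t. kern s (b - a) t * deriv (\<lambda>x. exp ((- lam) * x) * \<phi> x) (x - (-1) * t))) \<le> ennreal C * W s a b \<phi>"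
   using weighted_conv_bound[OF 3 ab, of "-1" "- 1 / Gamma (1 - s)" lam "- lam"] by auto
  have "sq2 a b (DR b s lam \<phi>) \<le> ennreal C * W s a b \<phi>" if \<phi>: "test_fun a b \<phi>" for \<phi>
  proof -
   have "sq2 a b (DR b s lam \<phi>) = sq2 a b (\<lambda>x. (- 1 / Gamma (1 - s)) * exp (lam * x) * (LB t. kern s (b - a) t * deriv (\<lambda>x. exp ((- lam) * x) * \<phi> x) (x - (-1) * t)))"
    by (rule sq2_cong) (use 3 in \<open>simp add: DR_formula[OF \<phi> _ _ _ ab]\<close>)
   then show ?thesis using C(2)[OF \<phi>] by simp
  qed
  then show ?thesis using C(1) by blast
 qed
qed

section \<open>Convection terms\<close>

lemma integrable_pair_conv:
 fixes k f :: "real \<Rightarrow> real"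
 assumes k: "integrable lborel k" and f: "integrable lborel f"
 shows "integrable (lborel \<Otimes>\<^sub>M lborel) (\<lambda>(t,x). k t * f (x - t))"
proof -
 have [measurable]: "k \<in> Borel" "f \<in> Borel" using k f by auto
 have sh: "integrable lborel (\<lambda>x. f (x - c))" "(LB x. \<bar>f (x - c)\<bar>) = (LB x. \<bar>f x\<bar>)" for c
  using lborel_integrable_real_affine[OF f, of 1 "-c"] lborel_integral_real_affine[of 1 "\<lambda>x. \<bar>f x\<bar>" "-c"] by simp_all
 show ?thesis
  by (rule lborel_pair.Fubini_integrable) (use k sh in \<open>simp_all add: abs_mult\<close>)
qed

lemma Fubini_swap_conv:
 fixes k f :: "real \<Rightarrow> real" and h :: "real \<Rightarrow> real \<Rightarrow> real"
 assumes k: "integrable lborel k" and f: "integrable lborel f"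
  and h: "(\<lambda>(t,x). h t x) \<in> borel_measurable (lborel \<Otimes>\<^sub>M lborel)"
  and b: "\<And>t x. \<bar>h t x\<bar> \<le> \<bar>k t * f (x - t)\<bar> * B"
 shows "(LB t. LB x. h t x) = (LB x. LB t. h t x)"
proof -
 have "integrable (lborel \<Otimes>\<^sub>M lborel) (\<lambda>z. (case z of (t,x) \<Rightarrow> k t * f (x - t)) * B)"
  using integrable_pair_conv[OF k f] by simp
 then have "integrable (lborel \<Otimes>\<^sub>M lborel) (\<lambda>(t,x). h t x)"
  by (rule Bochner_Integration.integrable_bound[OF _ h])
   (use order_trans[OF b mult_left_mono[OF abs_ge_self abs_ge_zero]] in \<open>auto simp: abs_mult\<close>)
 from lborel_pair.Fubini_integral[OF this] show ?thesis by simp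
qed

lemma shift_integral:
 fixes f :: "real \<Rightarrow> real"
 shows "(LB x. f (x + c)) = (LB x. f x)"
 using lborel_integral_real_affine[of 1 f c] by (simp add: add.commute)

text \<open>Substituting x = y + t and then z = r + t gathers the two kernels, which point in
  opposite directions, into an ordinary convolution, while f and g combine into a correlation.
  Boundedness of g and of the correlation supplies the majorants for the exchanges.\<close>

lemma conv_correlation:
 assumes k1: "integrable lborel k1" and k2: "integrable lborel k2" and f: "test_fun a b f" and g: "test_fun a b g"
 shows "(LB x. (LB t. k1 t * f (x - 1 * t)) * (LB r. k2 r * g (x - (-1) * r)))
  = (LB z. (LB t. k1 t * k2 (z - t)) * (LB y. f y * g (y + z)))"
proof -
 have [measurable]: "k1 \<in> Borel" "k2 \<in> Borel" "f \<in> Borel" "g \<in> Borel"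
  using k1 k2 test_fun_measurable[OF f] test_fun_measurable[OF g] by auto
 note fi = test_fun_integrable(1)[OF f]
 obtain M where M: "M \<ge> 0" "\<And>x. \<bar>g x\<bar> \<le> M" using test_fun_bounded[OF g] by blast
 define G where "G x = (LB r. k2 r * g (x - (-1) * r))" for x
 define H where "H z = (LB y. f y * g (y + z))" for z
 have [measurable]: "G \<in> Borel" unfolding G_def by measurable
 have [measurable]: "H \<in> Borel" unfolding H_def by measurable
 have Gb: "\<bar>G x\<bar> \<le> (LB r. \<bar>k2 r\<bar>) * M" for x
 proof -
  have "\<bar>G x\<bar> \<le> (LB r. \<bar>k2 r * g (x - (-1) * r)\<bar>)" unfolding G_def by (rule integral_abs_bound)
  also have "... \<le> (LB r. \<bar>k2 r\<bar> * M)"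
   by (rule integral_mono[OF integrable_abs[OF test_fun_conv_integrable[OF k2 g]]]) (use k2 in \<open>auto simp: abs_mult intro!: mult_left_mono M(2)\<close>)
  finally show ?thesis by simp
 qed
 have Hb: "\<bar>H z\<bar> \<le> (LB y. \<bar>f y\<bar>) * M" for z
 proof -
  have i: "integrable lborel (\<lambda>y. f y * g (y + z))" using test_fun_conv_integrable[OF fi g, of z "-1"] by (simp add: add.commute)
  have "\<bar>H z\<bar> \<le> (LB y. \<bar>f y * g (y + z)\<bar>)" unfolding H_def by (rule integral_abs_bound)
  also have "... \<le> (LB y. \<bar>f y\<bar> * M)"
   by (rule integral_mono[OF integrable_abs[OF i]]) (use fi in \<open>auto simp: abs_mult intro!: mult_left_mono M(2)\<close>)
  finally show ?thesis by simp
 qed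
 have "(LB x. (LB t. k1 t * f (x - 1 * t)) * G x) = (LB x. LB t. k1 t * f (x - t) * G x)"
  by simp
 also have "... = (LB t. LB x. k1 t * f (x - t) * G x)"
  by (rule Fubini_swap_conv[OF k1 fi, symmetric, where B="(LB r. \<bar>k2 r\<bar>) * M"])
   (use Gb in \<open>auto simp: abs_mult mult.assoc intro!: mult_left_mono\<close>)
 also have "... = (LB t. LB z. k1 t * k2 (z - t) * H z)"
 proof (rule Bochner_Integration.integral_cong[OF refl])
  fix t
  have "(LB x. k1 t * f (x - t) * G x) = (LB y. k1 t * f (y + t - t) * G (y + t))"
   by (rule shift_integral[symmetric, of "\<lambda>x. k1 t * f (x - t) * G x"])
  also have "... = k1 t * (LB y. LB r. f y * (k2 r * g (y + t + r)))"
   unfolding G_def by (simp add: mult.assoc)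
  also have "(LB y. LB r. f y * (k2 r * g (y + t + r))) = (LB r. LB y. f y * (k2 r * g (y + t + r)))"
  proof (rule Fubini_swap_bound[where f=f and g="\<lambda>r. k2 r * M"])
   show "norm (f y * (k2 r * g (y + t + r))) \<le> \<bar>f y\<bar> * \<bar>k2 r * M\<bar>" for y r
    using M(1) by (auto simp: abs_mult intro!: mult_left_mono M(2))
  qed (use fi k2 in auto)
  also have "... = (LB r. k2 r * H (r + t))"
   unfolding H_def by (intro Bochner_Integration.integral_cong refl, subst integral_mult_right_zero[symmetric])
    (auto intro!: Bochner_Integration.integral_cong simp: mult_ac add_ac)
  also have "... = (LB z. k2 (z - t) * H z)"
   using shift_integral[of "\<lambda>z. k2 (z - t) * H z" t] by simp
  finally show "(LB x. k1 t * f (x - t) * G x) = (LB z. k1 t * k2 (z - t) * H z)"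
   by (simp add: mult.assoc)
 qed
 also have "... = (LB z. LB t. k1 t * k2 (z - t) * H z)"
  by (rule Fubini_swap_conv[OF k1 k2, where B="(LB y. \<bar>f y\<bar>) * M"])
   (use Hb in \<open>auto simp: abs_mult mult.assoc intro!: mult_left_mono\<close>)
 also have "... = (LB z. (LB t. k1 t * k2 (z - t)) * H z)" by simp
 finally show ?thesis unfolding G_def H_def .
qed

text \<open>For 0 < z < L the truncation is inactive, and t = z u turns the convolution into the
  Beta integral.\<close>

lemma kern_conv_Beta:
 assumes s: "s < 1" "\<tau> < 1" and z: "0 < z" "z < L"
 shows "(LB t. kern s L t * kern \<tau> L (z - t)) = Beta (1 - s) (1 - \<tau>) * z powr (1 - s - \<tau>)"
proof -
 let ?F = "\<lambda>t. ennreal (kern s L t * kern \<tau> L (z - t))"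
 have m: "?F \<in> Borel" by measurable
 have B0: "Beta (1 - s) (1 - \<tau>) \<ge> 0" using s by (simp add: Beta_def Gamma_real_nonneg)
 have "(NN t. ?F t) = ennreal \<bar>z\<bar> * (NN u. ?F (0 + z * u))"
  by (rule nn_integral_real_affine[OF m]) (use z in auto)
 also have "(NN u. ?F (0 + z * u)) = (NN u. ennreal (z powr (-s - \<tau>)) * (ennreal (u powr (1 - s - 1) * (1 - u) powr (1 - \<tau> - 1)) * indicator {0..1} u))"
 proof (rule nn_integral_cong_AE)
  have "AE x in lborel. x \<noteq> (0::real)" "AE x in lborel. x \<noteq> (1::real)" by (rule AE_lborel_singleton)+
  then show "AE u in lborel. ?F (0 + z * u) = ennreal (z powr (-s - \<tau>)) * (ennreal (u powr (1 - s - 1) * (1 - u) powr (1 - \<tau> - 1)) * indicator {0..1} u)"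
  proof eventually_elim
   case (elim u)
   show ?case
   proof (cases "0 < u \<and> u < 1")
    case True
    have "z * u < z * 1" using True z by (intro mult_strict_left_mono) auto
    then have zu: "0 < z * u" "z * u < L" "0 < z - z * u" "z - z * u < L"
    proof -
     have "0 < z * u" using True z by simp
     then show "0 < z * u" "z * u < L" "0 < z - z * u" "z - z * u < L" using \<open>z * u < z * 1\<close> z by linarith+
    qed
    have e: "z - z * u = z * (1 - u)" by (simp add: algebra_simps)
    have "kern s L (z * u) * kern \<tau> L (z - z * u) = (z powr (-s) * z powr (-\<tau>)) * (u powr (-s) * (1 - u) powr (-\<tau>))"
    proof -
     have "kern s L (z * u) = (z * u) powr (-s)" "kern \<tau> L (z - z * u) = (z - z * u) powr (-\<tau>)"
      unfolding kern_def using zu by (simp_all only: indicator_simps greaterThanLessThan_iff)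
     then show ?thesis using True z by (simp add: e powr_mult)
    qed
    also have "z powr (-s) * z powr (-\<tau>) = z powr (-s - \<tau>)" by (simp add: powr_add[symmetric])
    finally show ?thesis using True by (simp add: ennreal_mult)
   next
    case False
    then have "u < 0 \<or> u > 1" using elim by auto
    then have "kern s L (z * u) * kern \<tau> L (z - z * u) = 0"
     using z by (auto simp: kern_def indicator_def zero_less_mult_iff mult_less_cancel_left_pos[of z 1 u, simplified] algebra_simps)
    then show ?thesis using \<open>u < 0 \<or> u > 1\<close> by auto
   qed
  qed
 qed
 also have "... = ennreal (z powr (-s - \<tau>)) * (NN u. ennreal (u powr (1 - s - 1) * (1 - u) powr (1 - \<tau> - 1)) * indicator {0..1} u)"
  by (rule nn_integral_cmult) measurable
 also have "(NN u. ennreal (u powr (1 - s - 1) * (1 - u) powr (1 - \<tau> - 1)) * indicator {0..1} u) = ennreal (Beta (1 - s) (1 - \<tau>))"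
  by (rule nn_integral_has_integral_lebesgue'[OF _ has_integral_Beta_real]) (use s in auto)
 finally have "(NN t. ?F t) = ennreal (z * (z powr (-s - \<tau>) * Beta (1 - s) (1 - \<tau>)))"
  using z B0 by (simp add: ennreal_mult)
 also have "z * (z powr (-s - \<tau>) * Beta (1 - s) (1 - \<tau>)) = Beta (1 - s) (1 - \<tau>) * z powr (1 - s - \<tau>)"
 proof -
  have "z * z powr (-s - \<tau>) = z powr (1 - s - \<tau>)" using z powr_mult_base[of z "-s - \<tau>"] by (simp add: algebra_simps)
  then show ?thesis by (metis mult.assoc mult.commute)
 qed
 finally show ?thesis
  by (subst integral_eq_nn_integral) (use B0 in auto)
qed

lemma kern_conv_neg:
 "z \<le> 0 \<Longrightarrow> (LB t. kern s L t * kern \<tau> L (z - t)) = 0"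
proof -
 assume "z \<le> 0"
 then have "(\<lambda>t. kern s L t * kern \<tau> L (z - t)) = (\<lambda>t. 0)" by (auto simp: kern_def indicator_def fun_eq_iff)
 then show ?thesis by simp
qed

lemma correlation_outside:
 assumes f: "test_fun a b f" and g: "test_fun a b g" and z: "z \<ge> b - a"
 shows "(LB y. f y * g (y + z)) = 0"
proof -
 have "f y * g (y + z) = 0" for y
  using test_fun_outside[OF f, of y] test_fun_outside[OF g, of "y + z"] z by (cases "y \<in> {a<..<b}") auto
 then have "(\<lambda>y. f y * g (y + z)) = (\<lambda>y. 0)" by (rule ext)
 then show ?thesis by (simp only:) simp
qed

text \<open>The left convolution vanishes up to a and the right one from b on, so the inner product
  over (a,b) equals the one over the line. The correlation vanishes for z \<ge> b - a, so the
  convolved kernels matter only where \<open>kern_conv_Beta\<close> evaluates them.\<close>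

lemma kern_form:
 assumes s: "s < 1" "\<tau> < 1" and ab: "a < b" and f: "test_fun a b f" and g: "test_fun a b g"
 shows "(LINT x:{a<..<b}|lborel. (LB t. kern s (b - a) t * f (x - 1 * t)) * (LB r. kern \<tau> (b - a) r * g (x - (-1) * r)))
  = Beta (1 - s) (1 - \<tau>) * (LB z. indicator {0<..<b - a} z * (z powr (1 - s - \<tau>) * (LB y. f y * g (y + z))))"
proof -
 let ?L = "b - a"
 have L: "?L > 0" using ab by simp
 have out: "(LB t. kern s ?L t * f (x - 1 * t)) * (LB r. kern \<tau> ?L r * g (x - (-1) * r)) = 0" if "x \<notin> {a<..<b}" for x
 proof (cases "x \<le> a")
  case True
  then have "kern s ?L t * f (x - 1 * t) = 0" for t using test_fun_outside[OF f, of "x - t"] by (auto simp: kern_def indicator_def)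
  then have "(\<lambda>t. kern s ?L t * f (x - 1 * t)) = (\<lambda>t. 0)" by (rule ext)
  then show ?thesis by (simp only:) simp
 next
  case False
  then have "kern \<tau> ?L r * g (x - (-1) * r) = 0" for r using test_fun_outside[OF g, of "x + r"] that by (auto simp: kern_def indicator_def)
  then have "(\<lambda>r. kern \<tau> ?L r * g (x - (-1) * r)) = (\<lambda>r. 0)" by (rule ext)
  then show ?thesis by (simp only:) simp
 qed
 have "(LINT x:{a<..<b}|lborel. (LB t. kern s ?L t * f (x - 1 * t)) * (LB r. kern \<tau> ?L r * g (x - (-1) * r)))
   = (LB x. (LB t. kern s ?L t * f (x - 1 * t)) * (LB r. kern \<tau> ?L r * g (x - (-1) * r)))"
  unfolding set_lebesgue_integral_def
 proof (rule Bochner_Integration.integral_cong[OF refl])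
  fix x
  show "indicator {a<..<b} x *\<^sub>R ((LB t. kern s ?L t * f (x - 1 * t)) * (LB r. kern \<tau> ?L r * g (x - (-1) * r)))
    = (LB t. kern s ?L t * f (x - 1 * t)) * (LB r. kern \<tau> ?L r * g (x - (-1) * r))"
   using out[of x] by (cases "x \<in> {a<..<b}") simp_all
 qed
 also have "... = (LB z. (LB t. kern s ?L t * kern \<tau> ?L (z - t)) * (LB y. f y * g (y + z)))"
  by (rule conv_correlation[OF kern_integrable(1)[OF s(1) L] kern_integrable(1)[OF s(2) L] f g])
 also have "... = (LB z. Beta (1 - s) (1 - \<tau>) * (indicator {0<..<?L} z * (z powr (1 - s - \<tau>) * (LB y. f y * g (y + z)))))"
 proof (rule Bochner_Integration.integral_cong[OF refl])
  fix z
  consider "z \<le> 0" | "0 < z" "z < ?L" | "z \<ge> ?L" by linarith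
  then show "(LB t. kern s ?L t * kern \<tau> ?L (z - t)) * (LB y. f y * g (y + z)) = Beta (1 - s) (1 - \<tau>) * (indicator {0<..<?L} z * (z powr (1 - s - \<tau>) * (LB y. f y * g (y + z))))"
  proof cases
   case 1 then show ?thesis by (simp add: kern_conv_neg)
  next
   case 2 then show ?thesis by (simp add: kern_conv_Beta[OF s 2])
  next
   case 3 then show ?thesis using correlation_outside[OF f g 3] by simp
  qed
 qed
 also have "... = Beta (1 - s) (1 - \<tau>) * (LB z. indicator {0<..<?L} z * (z powr (1 - s - \<tau>) * (LB y. f y * g (y + z))))" by simp
 finally show ?thesis .
qed

lemma L2ip_test: "test_fun a b \<phi> \<Longrightarrow> L2ip a b \<phi> g = (LB x. \<phi> x * g x)"
 unfolding L2ip_def set_lebesgue_integral_def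
proof (rule Bochner_Integration.integral_cong[OF refl])
 fix x assume "test_fun a b \<phi>"
 then show "indicator {a<..<b} x *\<^sub>R (\<phi> x * g x) = \<phi> x * g x" using test_fun_outside[of a b \<phi> x] by (cases "x \<in> {a<..<b}") auto
qed

lemma L2ip_cong: "(\<And>x. x \<in> {a<..<b} \<Longrightarrow> g x = g' x) \<Longrightarrow> (\<And>x. x \<in> {a<..<b} \<Longrightarrow> h x = h' x) \<Longrightarrow> L2ip a b g h = L2ip a b g' h'"
 unfolding L2ip_def by (rule set_lebesgue_integral_cong) auto

lemma correlation_DERIV:
 assumes f: "integrable lborel f" and g: "test_fun a b g"
 shows "DERIV (\<lambda>z. LB y. f y * g (y + z)) z :> (LB y. f y * deriv g (y + z))"
 using conv_DERIV[OF f g, of "-1" z] by (simp add: add.commute)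

text \<open>The orders s and 1 - s give the power 0 of z, and the correlation of the two derivatives
  is the z-derivative of the correlation of \<phi>' with \<psi>. Its integral over (0,b - a) is
  minus the value at 0, the minus sign being that of the right derivative; Beta (1 - s) s cancels
  the Gamma factors.\<close>

lemma DL_DR_convection:
 assumes s: "1/2 < s" "s \<le> 1" and ab: "a < b" and \<phi>: "test_fun a b \<phi>" and \<psi>: "test_fun a b \<psi>"
 shows "L2ip a b (DL a s 0 \<phi>) (DR b (1 - s) 0 \<psi>) = (LB x. deriv \<phi> x * \<psi> x)"
proof (cases "s = 1")
 case True
 have "L2ip a b (DL a s 0 \<phi>) (DR b (1 - s) 0 \<psi>) = L2ip a b (deriv \<phi>) \<psi>"
  by (rule L2ip_cong) (use True in \<open>simp_all add: DL_1[OF \<phi> _ ab] DR_0[OF \<psi> _ ab]\<close>)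
 then show ?thesis using L2ip_test[OF test_fun_deriv[OF \<phi>]] by simp
next
 case False
 then have s1: "0 < s" "s < 1" using s by auto
 let ?L = "b - a"
 note d\<phi> = test_fun_deriv[OF \<phi>] and d\<psi> = test_fun_deriv[OF \<psi>]
 let ?H = "\<lambda>z. LB y. deriv \<phi> y * deriv \<psi> (y + z)"
 let ?Q = "\<lambda>z. LB y. deriv \<phi> y * \<psi> (y + z)"
 have Hd: "DERIV ?Q z :> ?H z" for z by (rule correlation_DERIV[OF test_fun_integrable(1)[OF d\<phi>] \<psi>])
 have Hc: "continuous_on A ?H" for A
  using correlation_DERIV[OF test_fun_integrable(1)[OF d\<phi>] d\<psi>] by (intro DERIV_atLeastAtMost_imp_continuous_on DERIV_isCont continuous_at_imp_continuous_on ballI) blast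
 have "has_bochner_integral lborel (\<lambda>z. indicator {0..?L} z *\<^sub>R ?H z) (?Q ?L - ?Q 0)"
  by (rule has_bochner_integral_FTC_Icc[OF _ _ Hc]) (use ab Hd in \<open>auto simp: has_real_derivative_iff_has_vector_derivative has_vector_derivative_at_within\<close>)
 then have I: "(LB z. indicator {0..?L} z *\<^sub>R ?H z) = - ?Q 0" and Im: "integrable lborel (\<lambda>z. indicator {0..?L} z *\<^sub>R ?H z)"
  using correlation_outside[OF d\<phi> \<psi>, of ?L] by (auto simp: has_bochner_integral_iff)
 \<comment> \<open>\<open>z powr 0\<close> is 1 for z > 0, and the endpoints of the interval form a
   null set.\<close>
 have I2: "(LB z. indicator {0<..<?L} z * (z powr (1 - s - (1 - s)) * ?H z)) = (LB z. indicator {0..?L} z *\<^sub>R ?H z)"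
 proof (rule integral_cong_AE)
  have "AE x in lborel. x \<noteq> (0::real)" "AE x in lborel. x \<noteq> ?L" by (rule AE_lborel_singleton)+
  then show "AE z in lborel. indicator {0<..<?L} z * (z powr (1 - s - (1 - s)) * ?H z) = indicator {0..?L} z *\<^sub>R ?H z"
   by eventually_elim (auto simp: indicator_def)
  have [measurable]: "?H \<in> Borel" by (rule borel_measurable_continuous_onI[OF Hc])
  show "(\<lambda>z. indicator {0<..<?L} z * (z powr (1 - s - (1 - s)) * ?H z)) \<in> borel_measurable lborel" by measurable
  show "(\<lambda>z. indicator {0..?L} z *\<^sub>R ?H z) \<in> borel_measurable lborel" by measurable
 qed
 have "L2ip a b (DL a s 0 \<phi>) (DR b (1 - s) 0 \<psi>) = (LINT x:{a<..<b}|lborel. (- 1 / (Gamma (1 - s) * Gamma s)) *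
   ((LB t. kern s ?L t * deriv \<phi> (x - 1 * t)) * (LB r. kern (1 - s) ?L r * deriv \<psi> (x - (-1) * r))))"
  unfolding L2ip_def
  by (rule set_lebesgue_integral_cong) (use s1 in \<open>simp_all add: DL_formula[OF \<phi> _ _ _ ab] DR_formula[OF \<psi> _ _ _ ab]\<close>)
 also have "... = (- 1 / (Gamma (1 - s) * Gamma s)) * (Beta (1 - s) (1 - (1 - s)) * (LB z. indicator {0<..<?L} z * (z powr (1 - s - (1 - s)) * ?H z)))"
  unfolding set_integral_mult_right using kern_form[OF _ _ ab d\<phi> d\<psi>, of s "1 - s"] s1 by simp
 also have "... = ?Q 0"
 proof -
  have "Gamma s > 0" "Gamma (1 - s) > 0" using s1 by (auto intro: Gamma_real_pos)
  then have "Gamma s \<noteq> 0" "Gamma (1 - s) \<noteq> 0" by linarith+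
  then show ?thesis unfolding I2 I by (simp add: Beta_def)
 qed
 finally show ?thesis by simp
qed

section \<open>Coercivity of the fractional form\<close>

text \<open>Two integrations by parts take both derivatives off T. As T and T1 vanish at 0 and T2 is
  bounded on [0,M], T1 is O(z) and T is O(z^2); with \<alpha> < 2 the singular weights are then
  integrable and the boundary terms at 0 vanish.\<close>

lemma frac_by_parts:
 fixes T T1 T2 :: "real \<Rightarrow> real"
 assumes al: "1 < \<alpha>" "\<alpha> < 2" and d: "\<And>z. DERIV T z :> T1 z" "\<And>z. DERIV T1 z :> T2 z" and c: "continuous_on UNIV T2"
  and z: "T 0 = 0" "T1 0 = 0" and M: "0 < M"
 shows "set_integrable lborel {0<..<M} (\<lambda>z. z powr (1 - \<alpha>) * T2 z)" "set_integrable lborel {0<..<M} (\<lambda>z. z powr (-1 - \<alpha>) * T z)"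
  "(LINT z:{0<..<M}|lborel. z powr (1 - \<alpha>) * T2 z) = \<alpha> * (\<alpha> - 1) * (LINT z:{0<..<M}|lborel. z powr (-1 - \<alpha>) * T z) + (M powr (1 - \<alpha>) * T1 M + (\<alpha> - 1) * M powr (-\<alpha>) * T M)"
proof -
 have ct: "continuous_on A T" "continuous_on A T1" for A
  using d by (meson DERIV_isCont continuous_at_imp_continuous_on)+
 have [measurable]: "T \<in> Borel" "T1 \<in> Borel" "T2 \<in> Borel"
  using ct c by (auto intro: borel_measurable_continuous_onI)
 obtain K where K: "K \<ge> 0" "\<And>z. z \<in> {0..M} \<Longrightarrow> \<bar>T2 z\<bar> \<le> K"
 proof -
  have "compact (T2 ` {0..M})" by (rule compact_continuous_image[OF continuous_on_subset[OF c]]) auto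
  then have "bounded (T2 ` {0..M})" by (rule compact_imp_bounded)
  then obtain B where "\<forall>x\<in>{0..M}. \<bar>T2 x\<bar> \<le> B" by (auto simp: bounded_iff)
  then show ?thesis using that[of "max B 0"] by fastforce
 qed
 have T1b: "\<bar>T1 z\<bar> \<le> K * z" if "0 \<le> z" "z \<le> M" for z
 proof -
  have "norm (T1 z - T1 0) \<le> K * norm (z - 0)"
   by (rule field_differentiable_bound[of "{0..z}" T1 T2]) (use that K d in \<open>auto intro: has_field_derivative_at_within\<close>)
  then show ?thesis using z that by simp
 qed
 have Tb: "\<bar>T z\<bar> \<le> K * z * z" if "0 \<le> z" "z \<le> M" for z
 proof -
  have "norm (T z - T 0) \<le> (K * z) * norm (z - 0)"
  proof (rule field_differentiable_bound[of "{0..z}" T T1])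
   fix w assume w: "w \<in> {0..z}"
   show "(T has_field_derivative T1 w) (at w within {0..z})" using d by (auto intro: has_field_derivative_at_within)
   have "\<bar>T1 w\<bar> \<le> K * w" using T1b[of w] w that by auto
   also have "... \<le> K * z" using w K by (intro mult_left_mono) auto
   finally show "norm (T1 w) \<le> K * z" by simp
  qed (use that in auto)
  then show ?thesis using z that by simp
 qed
 have ik: "integrable lborel (\<lambda>z. kern (\<alpha> - 1) M z * K)" using kern_integrable(1)[of "\<alpha> - 1" M] al M by simp
 have p1: "z powr (-1 - \<alpha>) * (z * z) = z powr (1 - \<alpha>)" if "z > 0" for z :: real
 proof -
  have "z * z = z powr 2" using that by (simp add: power2_eq_square)
  then show ?thesis by (simp only: powr_add[symmetric]) simp
 qed
 show i1: "set_integrable lborel {0<..<M} (\<lambda>z. z powr (1 - \<alpha>) * T2 z)"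
  unfolding set_integrable_def
  by (rule Bochner_Integration.integrable_bound[OF ik])
   (use K in \<open>auto simp: indicator_def kern_def abs_mult intro!: mult_left_mono\<close>)
 show i2: "set_integrable lborel {0<..<M} (\<lambda>z. z powr (-1 - \<alpha>) * T z)"
  unfolding set_integrable_def
 proof (rule Bochner_Integration.integrable_bound[OF ik])
  show "AE z in lborel. norm (indicator {0<..<M} z *\<^sub>R (z powr (-1 - \<alpha>) * T z)) \<le> norm (kern (\<alpha> - 1) M z * K)"
  proof (rule AE_I2)
   fix z
   show "norm (indicator {0<..<M} z *\<^sub>R (z powr (-1 - \<alpha>) * T z)) \<le> norm (kern (\<alpha> - 1) M z * K)"
   proof (cases "z \<in> {0<..<M}")
    case True
    have "z powr (-1 - \<alpha>) * \<bar>T z\<bar> \<le> z powr (-1 - \<alpha>) * (K * z * z)" using Tb[of z] True by (intro mult_left_mono) auto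
    also have "... = K * (z powr (-1 - \<alpha>) * (z * z))" by simp
    also have "... = K * z powr (1 - \<alpha>)" using p1[of z] True by simp
    finally show ?thesis using True K(1) by (simp add: kern_def abs_mult mult.commute)
   qed simp
  qed
 qed simp
 \<comment> \<open>The boundary terms of both integrations by parts. The derivative of this sum is
   the difference of the two integrands, and on (0,M] it is bounded by K * \<alpha> * z powr (2 -
   \<alpha>), hence continuous up to 0.\<close>
 let ?V = "\<lambda>z. z powr (1 - \<alpha>) * T1 z + (\<alpha> - 1) * z powr (-\<alpha>) * T z"
 have hi: "((\<lambda>z. z powr (1 - \<alpha>) * T2 z - \<alpha> * (\<alpha> - 1) * (z powr (-1 - \<alpha>) * T z)) has_integral (?V M - ?V 0)) {0..M}"
 proof (rule fundamental_theorem_of_calculus_interior)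
  show "(?V has_vector_derivative x powr (1 - \<alpha>) * T2 x - \<alpha> * (\<alpha> - 1) * (x powr (-1 - \<alpha>) * T x)) (at x)" if "x \<in> {0<..<M}" for x
  proof -
   have x: "x > 0" using that by simp
   have "DERIV ?V x :> ((1 - \<alpha>) * x powr (1 - \<alpha> - 1) * T1 x + T2 x * x powr (1 - \<alpha>)) + (((\<alpha> - 1) * ((-\<alpha>) * x powr (-\<alpha> - 1))) * T x + T1 x * ((\<alpha> - 1) * x powr (-\<alpha>)))"
    by (intro DERIV_add DERIV_mult DERIV_cmult has_real_derivative_powr d x)
   then have "DERIV ?V x :> x powr (1 - \<alpha>) * T2 x - \<alpha> * (\<alpha> - 1) * (x powr (-1 - \<alpha>) * T x)"
   proof (rule DERIV_cong)
    have e: "- \<alpha> - 1 = -1 - \<alpha>" "1 - \<alpha> - 1 = - \<alpha>" by simp_all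
    show "((1 - \<alpha>) * x powr (1 - \<alpha> - 1) * T1 x + T2 x * x powr (1 - \<alpha>)) + (((\<alpha> - 1) * ((-\<alpha>) * x powr (-\<alpha> - 1))) * T x + T1 x * ((\<alpha> - 1) * x powr (-\<alpha>))) = x powr (1 - \<alpha>) * T2 x - \<alpha> * (\<alpha> - 1) * (x powr (-1 - \<alpha>) * T x)"
     unfolding e by (simp add: algebra_simps)
   qed
   then show ?thesis by (simp add: has_real_derivative_iff_has_vector_derivative)
  qed
  show "continuous_on {0..M} ?V"
   unfolding continuous_on_eq_continuous_within
  proof
   fix x assume x: "x \<in> {0..M}"
   show "continuous (at x within {0..M}) ?V"
   proof (cases "x = 0")
    case False
    then have "isCont ?V x" using x d by (intro continuous_intros) (auto intro: DERIV_isCont)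
    then show ?thesis by (rule continuous_at_imp_continuous_at_within)
   next
    case True
    have "((\<lambda>y. K * \<alpha> * y powr (2 - \<alpha>)) \<longlongrightarrow> K * \<alpha> * 0) (at 0 within {0..M})"
     by (intro tendsto_mult tendsto_const tendsto_zero_powrI[where b="2 - \<alpha>"]) (use al in \<open>auto intro: tendsto_within_subset tendsto_ident_at simp: eventually_at_filter\<close>)
    then have 0: "((\<lambda>y. K * \<alpha> * y powr (2 - \<alpha>)) \<longlongrightarrow> 0) (at 0 within {0..M})" by simp
    have "(?V \<longlongrightarrow> 0) (at 0 within {0..M})"
    proof (rule Lim_null_comparison[OF _ 0])
     show "\<forall>\<^sub>F y in at 0 within {0..M}. norm (?V y) \<le> K * \<alpha> * y powr (2 - \<alpha>)"
      unfolding eventually_at_filter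
     proof (rule always_eventually, intro allI impI)
      fix y assume y: "y \<noteq> 0" "y \<in> {0..M}"
      then have y0: "y > 0" by simp
      have q: "y powr (1 - \<alpha>) * y = y powr (2 - \<alpha>)" "y powr (-\<alpha>) * (y * y) = y powr (2 - \<alpha>)"
      proof -
       have "y powr (1 - \<alpha>) * y powr 1 = y powr (2 - \<alpha>)" "y powr (-\<alpha>) * y powr 2 = y powr (2 - \<alpha>)" by (simp_all only: powr_add[symmetric]) simp_all
       then show "y powr (1 - \<alpha>) * y = y powr (2 - \<alpha>)" "y powr (-\<alpha>) * (y * y) = y powr (2 - \<alpha>)" using y0 by (auto simp: power2_eq_square)
      qed
      have 1: "\<bar>y powr (1 - \<alpha>) * T1 y\<bar> \<le> K * y powr (2 - \<alpha>)"
      proof -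
       have "y powr (1 - \<alpha>) * \<bar>T1 y\<bar> \<le> y powr (1 - \<alpha>) * (K * y)" using T1b[of y] y by (intro mult_left_mono) auto
       then show ?thesis using q(1) by (simp add: abs_mult algebra_simps)
      qed
      have 2: "\<bar>(\<alpha> - 1) * y powr (-\<alpha>) * T y\<bar> \<le> (\<alpha> - 1) * (K * y powr (2 - \<alpha>))"
      proof -
       have "y powr (-\<alpha>) * \<bar>T y\<bar> \<le> y powr (-\<alpha>) * (K * y * y)" using Tb[of y] y by (intro mult_left_mono) auto
       also have "... = K * (y powr (-\<alpha>) * (y * y))" by simp
       finally have "y powr (-\<alpha>) * \<bar>T y\<bar> \<le> K * y powr (2 - \<alpha>)" unfolding q .
       then have "(\<alpha> - 1) * (y powr (-\<alpha>) * \<bar>T y\<bar>) \<le> (\<alpha> - 1) * (K * y powr (2 - \<alpha>))" using al by (intro mult_left_mono) auto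
       then show ?thesis using al by (simp add: abs_mult mult.assoc)
      qed
      have "norm (?V y) \<le> K * y powr (2 - \<alpha>) + (\<alpha> - 1) * (K * y powr (2 - \<alpha>))"
       unfolding real_norm_def by (rule order_trans[OF abs_triangle_ineq add_mono[OF 1 2]])
      then show "norm (?V y) \<le> K * \<alpha> * y powr (2 - \<alpha>)" by (simp add: algebra_simps)
     qed
    qed
    then show ?thesis unfolding continuous_within True by simp
   qed
  qed
 qed (use M in simp)
 note e1 = set_borel_integral_eq_integral[OF i1] and e2 = set_borel_integral_eq_integral[OF i2]
 have io: "f integrable_on {0<..<M} \<longleftrightarrow> f integrable_on {0..M}" "integral {0<..<M} f = integral {0..M} f" for f :: "real \<Rightarrow> real"
  using integrable_on_open_interval[of f 0 M] integral_open_interval[of 0 M f] by (simp_all add: box_real)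
 have "integral {0..M} (\<lambda>z. z powr (1 - \<alpha>) * T2 z - \<alpha> * (\<alpha> - 1) * (z powr (-1 - \<alpha>) * T z)) = (LINT z:{0<..<M}|lborel. z powr (1 - \<alpha>) * T2 z) - \<alpha> * (\<alpha> - 1) * (LINT z:{0<..<M}|lborel. z powr (-1 - \<alpha>) * T z)"
  unfolding e1(2) e2(2) io(2) using e1(1) e2(1) unfolding io(1) by (subst integral_diff) (auto intro: integrable_on_mult_right)
 moreover have "integral {0..M} (\<lambda>z. z powr (1 - \<alpha>) * T2 z - \<alpha> * (\<alpha> - 1) * (z powr (-1 - \<alpha>) * T z)) = ?V M - ?V 0" using hi by (rule integral_unique)
 ultimately show "(LINT z:{0<..<M}|lborel. z powr (1 - \<alpha>) * T2 z) = \<alpha> * (\<alpha> - 1) * (LINT z:{0<..<M}|lborel. z powr (-1 - \<alpha>) * T z) + (M powr (1 - \<alpha>) * T1 M + (\<alpha> - 1) * M powr (-\<alpha>) * T M)"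
  using z by simp
qed

text \<open>Enlarging (0,M) to the half line and scaling by lam gives lam^2 * lam powr (\<alpha> -
  2) * Gamma (2 - \<alpha>). This is the price of the tempering, and it matches the zero order term
  of the form.\<close>

lemma gamma_tail_le:
 fixes \<alpha> :: real
 assumes al: "1 < \<alpha>" "\<alpha> < 2" and l: "0 \<le> lam" and M: "0 < M"
 shows "set_integrable lborel {0<..<M} (\<lambda>z. z powr (1 - \<alpha>) * exp (- lam * z))"
  "lam^2 * (LINT z:{0<..<M}|lborel. z powr (1 - \<alpha>) * exp (- lam * z)) \<le> lam powr \<alpha> * Gamma (2 - \<alpha>)"
proof -
 have k: "integrable lborel (kern (\<alpha> - 1) M)" using kern_integrable(1)[of "\<alpha> - 1" M] al M by simp
 show i: "set_integrable lborel {0<..<M} (\<lambda>z. z powr (1 - \<alpha>) * exp (- lam * z))"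
  unfolding set_integrable_def
  by (rule Bochner_Integration.integrable_bound[OF k]) (use l in \<open>auto simp: kern_def indicator_def abs_mult intro!: mult_left_le\<close>)
 show "lam^2 * (LINT z:{0<..<M}|lborel. z powr (1 - \<alpha>) * exp (- lam * z)) \<le> lam powr \<alpha> * Gamma (2 - \<alpha>)"
 \<comment> \<open>At lam = 0 both sides are 0, because \<open>0 powr \<alpha>\<close> is 0.\<close>
 proof (cases "lam = 0")
  case False
  then have lp: "lam > 0" using l by simp
  have G0: "Gamma (2 - \<alpha>) > 0" using al by (intro Gamma_real_pos) auto
  let ?F = "\<lambda>t. ennreal (t powr (1 - \<alpha>) / exp t) * indicator {0..} t"
  have m: "?F \<in> Borel" by measurable
  have gi: "(NN t. ?F t) = ennreal (Gamma (2 - \<alpha>))"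
   by (rule nn_integral_has_integral_lebesgue') (use Gamma_integral_real[of "2 - \<alpha>"] al in \<open>auto simp: diff_diff_eq\<close>)
  have "ennreal (LINT z:{0<..<M}|lborel. z powr (1 - \<alpha>) * exp (- lam * z)) = (NN z. ennreal (indicator {0<..<M} z *\<^sub>R (z powr (1 - \<alpha>) * exp (- lam * z))))"
   unfolding set_lebesgue_integral_def using i[unfolded set_integrable_def] by (subst nn_integral_eq_integral) auto
  also have "... \<le> (NN z. ennreal (lam powr (\<alpha> - 1)) * ?F (0 + lam * z))"
  proof (rule nn_integral_mono)
   fix z
   show "ennreal (indicator {0<..<M} z *\<^sub>R (z powr (1 - \<alpha>) * exp (- lam * z))) \<le> ennreal (lam powr (\<alpha> - 1)) * ?F (0 + lam * z)"
   proof (cases "z \<in> {0<..<M}")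
    case True
    have "lam powr (\<alpha> - 1) * ((lam * z) powr (1 - \<alpha>) / exp (lam * z)) = (lam powr (\<alpha> - 1) * lam powr (1 - \<alpha>)) * (z powr (1 - \<alpha>) * exp (- lam * z))"
     using True lp by (simp add: powr_mult exp_minus field_simps)
    also have "lam powr (\<alpha> - 1) * lam powr (1 - \<alpha>) = 1" using lp by (simp add: powr_add[symmetric])
    finally have "z powr (1 - \<alpha>) * exp (- lam * z) = lam powr (\<alpha> - 1) * ((lam * z) powr (1 - \<alpha>) / exp (lam * z))" by simp
    then show ?thesis using True lp by (simp add: ennreal_mult[symmetric])
   qed simp
  qed
  also have "... = ennreal (lam powr (\<alpha> - 1)) * (NN z. ?F (0 + lam * z))" by (rule nn_integral_cmult) measurable
  finally have "ennreal (lam^2) * ennreal (LINT z:{0<..<M}|lborel. z powr (1 - \<alpha>) * exp (- lam * z)) \<le> ennreal (lam^2) * (ennreal (lam powr (\<alpha> - 1)) * (NN z. ?F (0 + lam * z)))"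
   by (rule mult_left_mono) simp
  also have "... = ennreal (lam powr \<alpha>) * (ennreal \<bar>lam\<bar> * (NN z. ?F (0 + lam * z)))"
  proof -
   have "lam^2 * lam powr (\<alpha> - 1) = lam powr \<alpha> * \<bar>lam\<bar>"
    using lp by (simp add: powr_diff power2_eq_square)
   then have "ennreal (lam^2) * ennreal (lam powr (\<alpha> - 1)) = ennreal (lam powr \<alpha>) * ennreal \<bar>lam\<bar>"
    by (simp add: ennreal_mult[symmetric])
   then show ?thesis by (simp only: mult.assoc[symmetric])
  qed
  also have "ennreal \<bar>lam\<bar> * (NN z. ?F (0 + lam * z)) = ennreal (Gamma (2 - \<alpha>))"
   using nn_integral_real_affine[OF m, of lam 0] lp gi by simp
  finally have "ennreal (lam^2 * (LINT z:{0<..<M}|lborel. z powr (1 - \<alpha>) * exp (- lam * z))) \<le> ennreal (lam powr \<alpha> * Gamma (2 - \<alpha>))"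
   using G0 by (simp add: ennreal_mult')
  then show ?thesis using G0 by (subst (asm) ennreal_le_iff) auto
 qed simp
qed

text \<open>Expansion of the squares of \<phi> (x + h) - \<phi> x and \<phi> (x + h) + \<phi> x. The
  first expresses the Gagliardo integrand through the autocorrelation; nonnegativity of both gives
  the two-sided bound.\<close>

lemma correlation_square:
 assumes \<phi>: "test_fun a b \<phi>"
 shows "(NN x. ennreal ((\<phi> (x + h) - \<phi> x)^2)) = ennreal (2 * ((LB y. (\<phi> y)^2) - (LB y. \<phi> y * \<phi> (y + h))))"
  "(LB y. \<phi> y * \<phi> (y + h)) \<le> (LB y. (\<phi> y)^2)" "- (LB y. (\<phi> y)^2) \<le> (LB y. \<phi> y * \<phi> (y + h))"
proof -
 note i2 = test_fun_integrable(2)[OF \<phi>]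
 have ih: "integrable lborel (\<lambda>y. \<phi> y * \<phi> (y + h))"
  using test_fun_conv_integrable[OF test_fun_integrable(1)[OF \<phi>] \<phi>, of h "-1"] by (simp add: add.commute)
 have i2h: "integrable lborel (\<lambda>y. (\<phi> (y + h))^2)" "(LB y. (\<phi> (y + h))^2) = (LB y. (\<phi> y)^2)"
  using lborel_integrable_real_affine[OF i2, of 1 h] shift_integral[of "\<lambda>y. (\<phi> y)^2" h] by (simp_all add: add.commute)
 have ip: "integrable lborel (\<lambda>y. (\<phi> (y + h))^2 + (\<phi> y)^2 + r * (\<phi> y * \<phi> (y + h)))" for r using ih i2 i2h by simp
 have e: "(LB y. (\<phi> (y + h))^2 + (\<phi> y)^2 + r * (\<phi> y * \<phi> (y + h))) = 2 * (LB y. (\<phi> y)^2) + r * (LB y. \<phi> y * \<phi> (y + h))" for r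
  using ih i2 i2h by simp
 have m: "(\<phi> (y + h) - \<phi> y)^2 = (\<phi> (y + h))^2 + (\<phi> y)^2 + (-2) * (\<phi> y * \<phi> (y + h))" for y by (simp add: power2_diff)
 have p: "(\<phi> (y + h) + \<phi> y)^2 = (\<phi> (y + h))^2 + (\<phi> y)^2 + 2 * (\<phi> y * \<phi> (y + h))" for y by (simp add: power2_sum)
 have "0 \<le> (LB y. (\<phi> (y + h) - \<phi> y)^2)" "0 \<le> (LB y. (\<phi> (y + h) + \<phi> y)^2)" by simp_all
 then show "(LB y. \<phi> y * \<phi> (y + h)) \<le> (LB y. (\<phi> y)^2)" "- (LB y. (\<phi> y)^2) \<le> (LB y. \<phi> y * \<phi> (y + h))"
  unfolding m p e by linarith+
 show "(NN x. ennreal ((\<phi> (x + h) - \<phi> x)^2)) = ennreal (2 * ((LB y. (\<phi> y)^2) - (LB y. \<phi> y * \<phi> (y + h))))"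
 proof (subst nn_integral_eq_integral)
  show "integrable lborel (\<lambda>x. (\<phi> (x + h) - \<phi> x)^2)" unfolding m by (rule ip)
  show "ennreal (LB x. (\<phi> (x + h) - \<phi> x)^2) = ennreal (2 * ((LB y. (\<phi> y)^2) - (LB y. \<phi> y * \<phi> (y + h))))"
   unfolding m e by (simp add: right_diff_distrib)
 qed simp
qed

text \<open>The correlation is differentiated in z in two ways, through g directly and, after a
  shift, through f; uniqueness of the derivative gives the identity.\<close>

lemma correlation_by_parts:
 assumes f: "test_fun a b f" and g: "test_fun a b g"
 shows "(LB y. deriv f y * g (y + z)) = - (LB y. f y * deriv g (y + z))"
proof -
 let ?C = "\<lambda>z. LB y. f y * g (y + z)"
 let ?h = "\<lambda>w. LB y. g y * f (y + w)"
 have C: "?C z = ?h (- z)" for z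
  using shift_integral[of "\<lambda>y. f (y - z) * g y" z] by (simp add: mult.commute)
 have "DERIV ?C z :> (LB y. f y * deriv g (y + z))" by (rule correlation_DERIV[OF test_fun_integrable(1)[OF f] g])
 moreover have "DERIV ?C z :> (LB y. g y * deriv f (y + (- z))) * (-1)"
  unfolding C by (rule DERIV_chain2[OF correlation_DERIV[OF test_fun_integrable(1)[OF g] f]]) (auto intro!: derivative_eq_intros)
 ultimately have "(LB y. f y * deriv g (y + z)) = (LB y. g y * deriv f (y + (- z))) * (-1)" by (rule DERIV_unique)
 moreover have "(LB y. g y * deriv f (y + (- z))) = (LB y. deriv f y * g (y + z))"
  using shift_integral[of "\<lambda>y. g y * deriv f (y + (- z))" z] by (simp add: mult.commute)
 ultimately show ?thesis by simp
qed

lemma integral_self_deriv: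
 assumes "test_fun a b f" shows "(LB y. f y * deriv f y) = 0"
proof -
 have "(LB y. deriv f y * f y) = (LB y. f y * deriv f y)" by (simp add: mult.commute)
 then show ?thesis using correlation_by_parts[OF assms assms, of 0] by simp
qed

text \<open>The outer exponentials of the left and right derivative cancel, so
  \<open>kern_form\<close> applies to the derivatives of exp (lam * x) * \<phi> x and exp (- lam *
  x) * \<phi> x. Moving one derivative across makes the inner integral the second z-derivative of a
  correlation, and the minus sign of the right derivative cancels.\<close>

lemma DL_DR_form:
 assumes s: "1/2 < s" "s < 1" and ab: "a < b" and \<phi>: "test_fun a b \<phi>"
 shows "L2ip a b (DL a s lam \<phi>) (DR b s lam \<phi>) = 1 / Gamma (2 - 2 * s) *
   (LB z. indicator {0<..<b - a} z * (z powr (1 - 2 * s) *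
    (LB y. exp (lam * y) * \<phi> y * deriv (deriv (\<lambda>x. exp (- lam * x) * \<phi> x)) (y + z))))"
proof -
 let ?L = "b - a"
 let ?f = "\<lambda>x. exp (lam * x) * \<phi> x" and ?g = "\<lambda>x. exp (- lam * x) * \<phi> x"
 note f = test_fun_exp[OF \<phi>, of lam] and g = test_fun_exp[OF \<phi>, of "- lam"]
 note df = test_fun_deriv[OF f] and dg = test_fun_deriv[OF g]
 have "L2ip a b (DL a s lam \<phi>) (DR b s lam \<phi>) = (LINT x:{a<..<b}|lborel. (- 1 / (Gamma (1 - s) * Gamma (1 - s))) *
   ((LB t. kern s ?L t * deriv ?f (x - 1 * t)) * (LB r. kern s ?L r * deriv ?g (x - (-1) * r))))"
  unfolding L2ip_def
 proof (rule set_lebesgue_integral_cong, simp, intro allI impI)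
  fix x assume x: "x \<in> {a<..<b}"
  define A where "A = (LB t. kern s ?L t * deriv ?f (x - 1 * t))"
  define B where "B = (LB r. kern s ?L r * deriv ?g (x - (-1) * r))"
  have l: "DL a s lam \<phi> x = exp (- lam * x) / Gamma (1 - s) * A" unfolding A_def by (rule DL_formula[OF \<phi> _ _ _ ab]) (use s x in auto)
  have r: "DR b s lam \<phi> x = - exp (lam * x) / Gamma (1 - s) * B" unfolding B_def by (rule DR_formula[OF \<phi> _ _ _ ab]) (use s x in auto)
  show "DL a s lam \<phi> x * DR b s lam \<phi> x = (- 1 / (Gamma (1 - s) * Gamma (1 - s))) * (A * B)"
   unfolding l r by (simp add: exp_minus field_simps)
 qed
 also have "... = (- 1 / (Gamma (1 - s) * Gamma (1 - s))) * (Beta (1 - s) (1 - s) * (LB z. indicator {0<..<?L} z * (z powr (1 - s - s) * (LB y. deriv ?f y * deriv ?g (y + z)))))"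
  unfolding set_integral_mult_right using kern_form[OF _ _ ab df dg, of s s] s by simp
 also have "(LB z. indicator {0<..<?L} z * (z powr (1 - s - s) * (LB y. deriv ?f y * deriv ?g (y + z)))) = - (LB z. indicator {0<..<?L} z * (z powr (1 - 2 * s) * (LB y. ?f y * deriv (deriv ?g) (y + z))))"
  unfolding correlation_by_parts[OF f dg] by simp
 also have "(- 1 / (Gamma (1 - s) * Gamma (1 - s))) * (Beta (1 - s) (1 - s) * - (LB z. indicator {0<..<?L} z * (z powr (1 - 2 * s) * (LB y. ?f y * deriv (deriv ?g) (y + z)))))
   = 1 / Gamma (2 - 2 * s) * (LB z. indicator {0<..<?L} z * (z powr (1 - 2 * s) * (LB y. ?f y * deriv (deriv ?g) (y + z))))"
 proof -
  have "Gamma (1 - s) > 0" using s by (intro Gamma_real_pos) auto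
  then have "(- 1 / (Gamma (1 - s) * Gamma (1 - s))) * (Beta (1 - s) (1 - s) * - X) = 1 / Gamma (2 - 2 * s) * X" for X
   by (simp add: Beta_def)
  then show ?thesis .
 qed
 finally show ?thesis .
qed

text \<open>With R the autocorrelation of \<phi> and P z = exp (- lam * z) * R z, the form is a
  weighted integral of the second derivative of P. Comparison with R 0 * exp (- lam * z) leaves a
  function T flat at 0, to which \<open>frac_by_parts\<close> applies, while the comparison function
  costs at most the lam powr (2 s) term by \<open>gamma_tail_le\<close>. The witness g is the
  integral of z powr (-1 - 2 s) * T z over (0,b - a).\<close>

lemma form_lower_bound:
 assumes s: "1/2 < s" "s < 1" and ab: "a < b" and l: "0 \<le> lam" and \<phi>: "test_fun a b \<phi>"
 shows "\<exists>g\<ge>0. 2 * s * (2 * s - 1) / Gamma (2 - 2 * s) * g \<le> - L2ip a b (DL a s lam \<phi>) (DR b s lam \<phi>) + lam powr (2 * s) * L2ip a b \<phi> \<phi>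
   \<and> gag s UNIV \<phi> \<le> ennreal (2 * exp (lam * (b - a)) * g + 4 * L2ip a b \<phi> \<phi> * ((b - a) powr (- 2 * s) / (2 * s)))"
proof -
 let ?L = "b - a"
 define \<alpha> where "\<alpha> = 2 * s"
 have al: "1 < \<alpha>" "\<alpha> < 2" using s by (auto simp: \<alpha>_def)
 have L: "?L > 0" using ab by simp
 let ?f = "\<lambda>x. exp (lam * x) * \<phi> x" and ?g = "\<lambda>x. exp (- lam * x) * \<phi> x"
 note f = test_fun_exp[OF \<phi>, of lam] and g = test_fun_exp[OF \<phi>, of "- lam"]
 note dg = test_fun_deriv[OF g]
 note ddg = test_fun_deriv[OF dg]
 note fi = test_fun_integrable(1)[OF f]
 define P where "P z = (LB y. ?f y * ?g (y + z))" for z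
 define P1 where "P1 z = (LB y. ?f y * deriv ?g (y + z))" for z
 define P2 where "P2 z = (LB y. ?f y * deriv (deriv ?g) (y + z))" for z
 define R where "R z = (LB y. \<phi> y * \<phi> (y + z))" for z
 define R0 where "R0 = (LB y. (\<phi> y)^2)"
 have R0: "R0 \<ge> 0" "R 0 = R0" "L2ip a b \<phi> \<phi> = R0" by (simp_all add: R0_def R_def L2ip_test[OF \<phi>] power2_eq_square)
 have RS: "R z \<le> R0" "- R0 \<le> R z" for z using correlation_square(2,3)[OF \<phi>] by (auto simp: R_def R0_def)
 have PR: "P z = exp (- lam * z) * R z" for z
 proof -
  have "P z = (LB y. exp (- lam * z) * (\<phi> y * \<phi> (y + z)))"
   unfolding P_def
  proof (rule Bochner_Integration.integral_cong[OF refl])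
   fix y
   have "exp (lam * y) * exp (- lam * (y + z)) = exp (- lam * z)" unfolding exp_add[symmetric] by (simp add: algebra_simps)
   then have "(exp (lam * y) * exp (- lam * (y + z))) * (\<phi> y * \<phi> (y + z)) = exp (- lam * z) * (\<phi> y * \<phi> (y + z))" by simp
   then show "?f y * ?g (y + z) = exp (- lam * z) * (\<phi> y * \<phi> (y + z))" by (simp only: mult_ac)
  qed
  then show ?thesis by (simp add: R_def)
 qed
 have dP: "DERIV P z :> P1 z" "DERIV P1 z :> P2 z" for z
  unfolding P_def P1_def P2_def by (rule correlation_DERIV[OF fi g], rule correlation_DERIV[OF fi dg])
 have cP2: "continuous_on UNIV P2"
  unfolding P2_def using correlation_DERIV[OF fi ddg] by (meson DERIV_isCont continuous_at_imp_continuous_on)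
 have out: "P1 z = 0" "P2 z = 0" if "z \<ge> ?L" for z
  unfolding P1_def P2_def by (rule correlation_outside[OF f _ that], intro dg ddg)+
 \<comment> \<open>Only the tempering contributes, since the integral of \<phi> times its derivative
   is 0. This value makes T1 vanish at 0.\<close>
 have P10: "P1 0 = - lam * R0"
 proof -
  have "P1 0 = (LB y. \<phi> y * deriv \<phi> y - lam * (\<phi> y)^2)"
   unfolding P1_def
  proof (rule Bochner_Integration.integral_cong[OF refl])
   fix y
   have "exp (lam * y) * exp (- lam * y) = 1" unfolding exp_add[symmetric] by simp
   then have "(exp (lam * y) * exp (- lam * y)) * (\<phi> y * (deriv \<phi> y + (- lam) * \<phi> y)) = \<phi> y * deriv \<phi> y - lam * (\<phi> y)^2"
    by (simp add: power2_eq_square algebra_simps)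
   then show "?f y * deriv ?g (y + 0) = \<phi> y * deriv \<phi> y - lam * (\<phi> y)^2"
    unfolding deriv_exp_mult[OF \<phi>] by (simp only: mult_ac add_0_right)
  qed
  also have "... = (LB y. \<phi> y * deriv \<phi> y) - lam * R0"
   unfolding R0_def using test_fun_integrable(2)[OF \<phi>] test_fun_integrable_mult[OF \<phi> test_fun_cont[OF test_fun_deriv[OF \<phi>]]] by simp
  finally show ?thesis using integral_self_deriv[OF \<phi>] by simp
 qed
 \<comment> \<open>The gap to the comparison function equals exp (- lam * z) * (R0 - R z). It is
   nonnegative since R z \<le> R0, and it vanishes at 0 together with its derivative.\<close>
 define T where "T z = R0 * exp (- lam * z) - P z" for z
 define T1 where "T1 z = - lam * R0 * exp (- lam * z) - P1 z" for z
 define T2 where "T2 z = lam^2 * R0 * exp (- lam * z) - P2 z" for z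
 have dT: "DERIV T z :> T1 z" "DERIV T1 z :> T2 z" for z
  unfolding T_def T1_def T2_def by (auto intro!: derivative_eq_intros dP simp: power2_eq_square)
 have cT2: "continuous_on UNIV T2" unfolding T2_def by (intro continuous_intros cP2)
 have T0: "T 0 = 0" "T1 0 = 0" unfolding T_def T1_def using PR[of 0] R0 P10 by simp_all
 have TS: "T z = exp (- lam * z) * (R0 - R z)" for z unfolding T_def PR by (simp add: algebra_simps)
 have Tpos: "T z \<ge> 0" for z unfolding TS using RS by simp
 have [measurable]: "T \<in> Borel" "P2 \<in> Borel"
  using dT(1) cP2 by (auto intro!: borel_measurable_continuous_onI continuous_at_imp_continuous_on DERIV_isCont)
 note fp = frac_by_parts[OF al dT cT2 T0]
 define J where "J M = (LINT z:{0<..<M}|lborel. z powr (-1 - \<alpha>) * T z)" for M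
 define gg where "gg = J ?L"
 have gg0: "gg \<ge> 0" unfolding gg_def J_def set_lebesgue_integral_def using Tpos by (intro Bochner_Integration.integral_nonneg) auto
 define X where "X = (LB z. indicator {0<..<?L} z * (z powr (1 - \<alpha>) * P2 z))"
 have G0: "Gamma (2 - \<alpha>) > 0" using al by (intro Gamma_real_pos) auto
 \<comment> \<open>P2 vanishes beyond b - a, so the integral may be taken up to any larger M. The
   negative part of the boundary term, lam * R0 * M powr (1 - \<alpha>), then disappears as M tends
   to infinity.\<close>
 have XM: "X \<le> lam powr \<alpha> * Gamma (2 - \<alpha>) * R0 - \<alpha> * (\<alpha> - 1) * gg + lam * R0 * M powr (1 - \<alpha>)" if M: "M \<ge> ?L" for M
 proof -
  have M0: "M > 0" using M L by linarith
  note gt = gamma_tail_le[OF al l M0]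
  have "X = (LINT z:{0<..<M}|lborel. (lam^2 * R0) * (z powr (1 - \<alpha>) * exp (- lam * z)) - z powr (1 - \<alpha>) * T2 z)"
   unfolding X_def set_lebesgue_integral_def
  proof (rule Bochner_Integration.integral_cong[OF refl])
   fix z
   show "indicator {0<..<?L} z * (z powr (1 - \<alpha>) * P2 z) = indicator {0<..<M} z *\<^sub>R ((lam^2 * R0) * (z powr (1 - \<alpha>) * exp (- lam * z)) - z powr (1 - \<alpha>) * T2 z)"
    using M out(2)[of z] by (auto simp: indicator_def T2_def algebra_simps)
  qed
  also have "... = (lam^2 * R0) * (LINT z:{0<..<M}|lborel. z powr (1 - \<alpha>) * exp (- lam * z)) - (LINT z:{0<..<M}|lborel. z powr (1 - \<alpha>) * T2 z)"
   using gt(1) fp(1)[OF M0] by (simp add: set_integral_diff)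
  also have "... = R0 * (lam^2 * (LINT z:{0<..<M}|lborel. z powr (1 - \<alpha>) * exp (- lam * z))) - (\<alpha> * (\<alpha> - 1) * J M + (M powr (1 - \<alpha>) * T1 M + (\<alpha> - 1) * M powr (-\<alpha>) * T M))"
   unfolding fp(3)[OF M0] J_def by simp
  also have "... \<le> R0 * (lam powr \<alpha> * Gamma (2 - \<alpha>)) - (\<alpha> * (\<alpha> - 1) * gg + (- (M powr (1 - \<alpha>) * (lam * R0)) + 0))"
  proof (intro diff_mono mult_left_mono gt(2) R0(1) add_mono)
   show "gg \<le> J M" unfolding gg_def J_def set_lebesgue_integral_def
    by (rule integral_mono) (use fp(2)[OF L] fp(2)[OF M0] M Tpos in \<open>auto simp: set_integrable_def indicator_def\<close>)
   have "exp (- lam * M) \<le> 1" using l M0 by simp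
   then have "lam * R0 * exp (- lam * M) \<le> lam * R0 * 1" using l R0(1) by (intro mult_left_mono) auto
   then have "- (lam * R0) \<le> T1 M" unfolding T1_def out(1)[OF M] by simp
   from mult_left_mono[OF this, of "M powr (1 - \<alpha>)"] show "- (M powr (1 - \<alpha>) * (lam * R0)) \<le> M powr (1 - \<alpha>) * T1 M" by simp
   show "0 \<le> (\<alpha> - 1) * M powr (-\<alpha>) * T M" using al Tpos by simp
  qed (use al in auto)
  finally show ?thesis by (simp add: algebra_simps)
 qed
 have X: "X \<le> lam powr \<alpha> * Gamma (2 - \<alpha>) * R0 - \<alpha> * (\<alpha> - 1) * gg"
 proof -
  have "((\<lambda>M::real. M powr (1 - \<alpha>)) \<longlongrightarrow> 0) at_top" by (rule tendsto_neg_powr) (use al in \<open>auto intro: filterlim_ident\<close>)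
  then have "((\<lambda>M. lam powr \<alpha> * Gamma (2 - \<alpha>) * R0 - \<alpha> * (\<alpha> - 1) * gg + lam * R0 * M powr (1 - \<alpha>)) \<longlongrightarrow> lam powr \<alpha> * Gamma (2 - \<alpha>) * R0 - \<alpha> * (\<alpha> - 1) * gg + lam * R0 * 0) at_top"
   by (intro tendsto_intros)
  then have "X \<le> lam powr \<alpha> * Gamma (2 - \<alpha>) * R0 - \<alpha> * (\<alpha> - 1) * gg + lam * R0 * 0"
  proof (rule tendsto_lowerbound)
   show "\<forall>\<^sub>F M in at_top. X \<le> lam powr \<alpha> * Gamma (2 - \<alpha>) * R0 - \<alpha> * (\<alpha> - 1) * gg + lam * R0 * M powr (1 - \<alpha>)"
    using eventually_ge_at_top[of ?L] by eventually_elim (rule XM)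
  qed simp
  then show ?thesis by simp
 qed
 have form: "L2ip a b (DL a s lam \<phi>) (DR b s lam \<phi>) = 1 / Gamma (2 - \<alpha>) * X"
  unfolding DL_DR_form[OF s ab \<phi>] X_def P2_def \<alpha>_def ..
 have "1 / Gamma (2 - \<alpha>) * X \<le> 1 / Gamma (2 - \<alpha>) * (lam powr \<alpha> * Gamma (2 - \<alpha>) * R0 - \<alpha> * (\<alpha> - 1) * gg)"
  using X G0 by (intro mult_left_mono) auto
 also have "... = lam powr \<alpha> * R0 - \<alpha> * (\<alpha> - 1) / Gamma (2 - \<alpha>) * gg" using G0 by (simp add: field_simps)
 finally have c1: "\<alpha> * (\<alpha> - 1) / Gamma (2 - \<alpha>) * gg \<le> - L2ip a b (DL a s lam \<phi>) (DR b s lam \<phi>) + lam powr \<alpha> * L2ip a b \<phi> \<phi>"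
  unfolding form R0(3) by linarith
 \<comment> \<open>For h < b - a the damping exp (- lam * h) is at least exp (- lam * (b - a)),
   whence the exponential factor in front of g. For larger h the crude R0 - R h \<le> 2 * R0 leaves
   a multiple of the squared L2 norm.\<close>
 have c2: "gag s UNIV \<phi> \<le> ennreal (2 * exp (lam * ?L) * gg + 4 * R0 * (?L powr (- \<alpha>) / \<alpha>))"
 proof -
  let ?a = "\<lambda>h. ennreal (2 * exp (lam * ?L)) * ennreal (indicator {0<..<?L} h *\<^sub>R (h powr (-1 - \<alpha>) * T h))"
  let ?b = "\<lambda>h. ennreal (4 * R0) * (ennreal (h powr (-1 - \<alpha>)) * indicator {?L..} h)"
  have "gag s UNIV \<phi> = (NN h. ennreal (2 * (R0 - R h)) * ennreal (h powr (-1 - \<alpha>)) * indicator {0<..} h)"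
   unfolding gag_def \<alpha>_def R0_def R_def correlation_square(1)[OF \<phi>, symmetric] by simp
  also have "... \<le> (NN h. ?a h + ?b h)"
  proof (rule nn_integral_mono)
   fix h :: real
   consider "h \<le> 0" | "0 < h" "h < ?L" | "h \<ge> ?L" by linarith
   then show "ennreal (2 * (R0 - R h)) * ennreal (h powr (-1 - \<alpha>)) * indicator {0<..} h \<le> ?a h + ?b h"
   proof cases
    case 2
    have "lam * h \<le> lam * ?L" using 2 l by (intro mult_left_mono) auto
    then have "1 \<le> exp (lam * ?L) * exp (- lam * h)" unfolding exp_add[symmetric] by simp
    from mult_right_mono[OF this, of "R0 - R h"] have "R0 - R h \<le> exp (lam * ?L) * T h" unfolding TS using RS[of h] by (simp add: mult.assoc)
    then have "2 * (R0 - R h) * h powr (-1 - \<alpha>) \<le> 2 * (exp (lam * ?L) * T h) * h powr (-1 - \<alpha>)" by (intro mult_right_mono) auto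
    also have "... = 2 * exp (lam * ?L) * (h powr (-1 - \<alpha>) * T h)" by simp
    finally have "ennreal (2 * (R0 - R h) * h powr (-1 - \<alpha>)) \<le> ennreal (2 * exp (lam * ?L) * (h powr (-1 - \<alpha>) * T h))" by (rule ennreal_leI)
    then show ?thesis using 2 RS[of h] Tpos[of h] by (simp add: ennreal_mult[symmetric])
   next
    case 3
    have "ennreal (2 * (R0 - R h)) \<le> ennreal (4 * R0)" using RS[of h] by (intro ennreal_leI) auto
    from mult_right_mono[OF this, of "ennreal (h powr (-1 - \<alpha>))"] show ?thesis using 3 L by (simp add: mult.assoc)
   qed auto
  qed
  also have "... = (NN h. ?a h) + (NN h. ?b h)" by (rule nn_integral_add) measurable
  also have "(NN h. ?a h) = ennreal (2 * exp (lam * ?L)) * (NN h. ennreal (indicator {0<..<?L} h *\<^sub>R (h powr (-1 - \<alpha>) * T h)))"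
   by (rule nn_integral_cmult) measurable
  also have "(NN h. ennreal (indicator {0<..<?L} h *\<^sub>R (h powr (-1 - \<alpha>) * T h))) = ennreal gg"
   unfolding gg_def J_def set_lebesgue_integral_def
   by (rule nn_integral_eq_integral) (use fp(2)[OF L] Tpos in \<open>auto simp: set_integrable_def\<close>)
  also have "(NN h. ?b h) = ennreal (4 * R0) * (NN h. (ennreal (h powr (-1 - \<alpha>)) * indicator {?L..} h))"
   by (rule nn_integral_cmult) measurable
  also have "(NN h. (ennreal (h powr (-1 - \<alpha>)) * indicator {?L..} h)) = ennreal (?L powr (-1 - \<alpha> + 1) / (- (-1 - \<alpha>) - 1))"
   by (rule nn_powr_inf) (use al L in auto)
  also have "?L powr (-1 - \<alpha> + 1) / (- (-1 - \<alpha>) - 1) = ?L powr (- \<alpha>) / \<alpha>" by simp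
  also have "ennreal (2 * exp (lam * ?L)) * ennreal gg + ennreal (4 * R0) * ennreal (?L powr (- \<alpha>) / \<alpha>) = ennreal (2 * exp (lam * ?L) * gg + 4 * R0 * (?L powr (- \<alpha>) / \<alpha>))"
   using gg0 R0(1) al by (simp add: ennreal_mult[symmetric] ennreal_plus[symmetric] del: ennreal_plus)
  finally show ?thesis .
 qed
 show ?thesis using gg0 c1 c2 R0(3) unfolding \<alpha>_def by (intro exI[of _ gg]) (auto simp: algebra_simps)
qed

lemma sq2_L2ip_test: "test_fun a b \<phi> \<Longrightarrow> sq2 a b \<phi> = ennreal (L2ip a b \<phi> \<phi>)"
 unfolding sq2_test_fun(1) L2ip_test power2_eq_square[symmetric]
 by (rule nn_integral_eq_integral[OF test_fun_integrable(2)]) auto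

text \<open>\<open>form_lower_bound\<close> controls the seminorm up to a multiple of the squared L2
  norm, and \<kappa> > 0 pays for the latter. At s = 1 the lam^2 terms cancel exactly and the form
  is the squared norm of the derivative.\<close>

lemma form_coercive:
 assumes s: "1/2 < s" "s \<le> 1" and ab: "a < b" and l: "0 \<le> lam" and \<kappa>: "0 < \<kappa>"
 shows "\<exists>c>0. \<forall>\<phi>. test_fun a b \<phi> \<longrightarrow> ennreal c * W s a b \<phi> \<le> ennreal (- L2ip a b (DL a s lam \<phi>) (DR b s lam \<phi>) + lam powr (2 * s) * L2ip a b \<phi> \<phi> + \<kappa> * L2ip a b \<phi> \<phi>)"
proof (cases "s = 1")
 case True
 define c where "c = min (1/(2*pi)) \<kappa>"
 have c: "c > 0" "c * (2*pi) \<le> 1" "c \<le> \<kappa>" using \<kappa> by (auto simp: c_def min_mult_distrib_right min_le_iff_disj)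
 show ?thesis
 proof (intro exI[of _ c] conjI c(1) allI impI)
  fix \<phi> assume \<phi>: "test_fun a b \<phi>"
  note d = test_fun_deriv[OF \<phi>]
  let ?R = "L2ip a b \<phi> \<phi>" and ?D = "L2ip a b (deriv \<phi>) (deriv \<phi>)"
  have R: "?R \<ge> 0" "?D \<ge> 0" unfolding L2ip_test[OF \<phi>] L2ip_test[OF d] by simp_all
  have "L2ip a b (DL a s lam \<phi>) (DR b s lam \<phi>) = L2ip a b (\<lambda>x. deriv \<phi> x + lam * \<phi> x) (\<lambda>x. - deriv \<phi> x + lam * \<phi> x)"
   by (rule L2ip_cong) (use True in \<open>simp_all add: DL_1[OF \<phi> _ ab] DR_1[OF \<phi> _ ab]\<close>)
  also have "... = (LB x. (deriv \<phi> x + lam * \<phi> x) * (- deriv \<phi> x + lam * \<phi> x))"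
   using L2ip_test[OF test_fun_lin[OF d \<phi>, of lam]] by simp
  also have "... = (LB x. lam^2 * (\<phi> x * \<phi> x) - deriv \<phi> x * deriv \<phi> x)"
   by (intro Bochner_Integration.integral_cong refl) (simp add: power2_eq_square algebra_simps)
  also have "... = lam^2 * ?R - ?D"
   unfolding L2ip_test[OF \<phi>] L2ip_test[OF d] using test_fun_integrable(2)[OF \<phi>] test_fun_integrable(2)[OF d] by (simp add: power2_eq_square)
  finally have e: "- L2ip a b (DL a s lam \<phi>) (DR b s lam \<phi>) + lam powr (2 * s) * ?R + \<kappa> * ?R = ?D + \<kappa> * ?R"
   using True l by (cases "lam = 0") auto
  have "W s a b \<phi> \<le> ennreal ?R + ennreal (2*pi) * ennreal ?D"
   unfolding W_def zext_test_fun[OF \<phi>] True FN_1_deriv[OF \<phi>] sq2_L2ip_test[OF \<phi>] sq2_L2ip_test[OF d, symmetric] sq2_test_fun(1)[OF d]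
   by (intro add_mono order_refl fourier_bessel test_fun_integrable[OF d])
  also have "... = ennreal (?R + 2*pi * ?D)" using R by (simp add: ennreal_mult[symmetric] ennreal_plus[symmetric] del: ennreal_plus)
  finally have "ennreal c * W s a b \<phi> \<le> ennreal c * ennreal (?R + 2*pi * ?D)" by (rule mult_left_mono) simp
  also have "... = ennreal (c * ?R + (c * (2*pi)) * ?D)" using c R by (simp add: ennreal_mult[symmetric] algebra_simps)
  also have "... \<le> ennreal (\<kappa> * ?R + 1 * ?D)" using c R by (intro ennreal_leI add_mono mult_right_mono) auto
  finally show "ennreal c * W s a b \<phi> \<le> ennreal (- L2ip a b (DL a s lam \<phi>) (DR b s lam \<phi>) + lam powr (2 * s) * ?R + \<kappa> * ?R)"
   unfolding e by (simp add: add.commute)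
 qed
next
 case False
 then have s1: "0 < s" "s < 1" using s by auto
 obtain C1 where C1: "C1 > 0"
  "\<And>w. integrable lborel w \<Longrightarrow> integrable lborel (\<lambda>x. (w x)^2) \<Longrightarrow> FN s w \<le> ennreal C1 * gag s UNIV w"
  by (rule gag_FN[OF s1]) blast
 define c0 where "c0 = 2 * s * (2 * s - 1) / Gamma (2 - 2 * s)"
 have "Gamma (2 - 2 * s) > 0" using s1 by (intro Gamma_real_pos) auto
 then have c0: "c0 > 0" using s by (simp add: c0_def)
 define D1 where "D1 = C1 * (2 * exp (lam * (b - a)))"
 define D2 where "D2 = 1 + C1 * (4 * ((b - a) powr (- 2 * s) / (2 * s)))"
 have D: "D1 > 0" "D2 > 0" using C1(1) s1 by (auto simp: D1_def D2_def intro!: add_pos_nonneg)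
 \<comment> \<open>D1 and D2 are the coefficients of g and of the squared L2 norm in the upper bound
   for \<open>W\<close>; c is small enough that c * D1 \<le> c0 and c * D2 \<le> \<kappa>.\<close>
 define c where "c = min (c0 / D1) (\<kappa> / D2)"
 have c: "c > 0" "c * D1 \<le> c0" "c * D2 \<le> \<kappa>"
 proof -
  show "c > 0" using c0 D \<kappa> by (simp add: c_def)
  have "c \<le> c0 / D1" "c \<le> \<kappa> / D2" by (simp_all add: c_def)
  then show "c * D1 \<le> c0" "c * D2 \<le> \<kappa>" using D by (simp_all add: pos_le_divide_eq)
 qed
 show ?thesis
 proof (intro exI[of _ c] conjI c(1) allI impI)
  fix \<phi> assume \<phi>: "test_fun a b \<phi>"
  let ?R = "L2ip a b \<phi> \<phi>"
  have R: "?R \<ge> 0" unfolding L2ip_test[OF \<phi>] by simp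
  obtain g where g: "g \<ge> 0" "c0 * g \<le> - L2ip a b (DL a s lam \<phi>) (DR b s lam \<phi>) + lam powr (2 * s) * ?R"
   "gag s UNIV \<phi> \<le> ennreal (2 * exp (lam * (b - a)) * g + 4 * ?R * ((b - a) powr (- 2 * s) / (2 * s)))"
   using form_lower_bound[OF s(1) s1(2) ab l \<phi>] unfolding c0_def by blast
  have "W s a b \<phi> \<le> ennreal ?R + ennreal C1 * ennreal (2 * exp (lam * (b - a)) * g + 4 * ?R * ((b - a) powr (- 2 * s) / (2 * s)))"
   unfolding W_def zext_test_fun[OF \<phi>] sq2_L2ip_test[OF \<phi>]
   by (intro add_mono order_refl order_trans[OF C1(2)[OF test_fun_integrable[OF \<phi>]] mult_left_mono[OF g(3)]]) simp
  also have "... = ennreal (?R + C1 * (2 * exp (lam * (b - a)) * g + 4 * ?R * ((b - a) powr (- 2 * s) / (2 * s))))"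
  proof -
   have "0 \<le> 2 * exp (lam * (b - a)) * g + 4 * ?R * ((b - a) powr (- 2 * s) / (2 * s))" using g(1) R s1 by (intro add_nonneg_nonneg mult_nonneg_nonneg) auto
   then show ?thesis using R C1(1) by (simp add: ennreal_mult[symmetric] ennreal_plus[symmetric] del: ennreal_plus)
  qed
  also have "?R + C1 * (2 * exp (lam * (b - a)) * g + 4 * ?R * ((b - a) powr (- 2 * s) / (2 * s))) = D1 * g + D2 * ?R"
   by (simp add: D1_def D2_def algebra_simps)
  finally have "ennreal c * W s a b \<phi> \<le> ennreal c * ennreal (D1 * g + D2 * ?R)" by (rule mult_left_mono) simp
  also have "... = ennreal ((c * D1) * g + (c * D2) * ?R)" using c D g R by (simp add: ennreal_mult[symmetric] algebra_simps)
  also have "... \<le> ennreal (c0 * g + \<kappa> * ?R)" using c g R by (intro ennreal_leI add_mono mult_right_mono) auto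
  also have "... \<le> ennreal (- L2ip a b (DL a s lam \<phi>) (DR b s lam \<phi>) + lam powr (2 * s) * ?R + \<kappa> * ?R)"
   using g by (intro ennreal_leI) auto
  finally show "ennreal c * W s a b \<phi> \<le> ennreal (- L2ip a b (DL a s lam \<phi>) (DR b s lam \<phi>) + lam powr (2 * s) * ?R + \<kappa> * ?R)" .
 qed
qed

section \<open>Completeness of L2 and limits in the energy norm\<close>

text \<open>Measurability is required after extension by zero, because products with m or c and the
  images under \<open>DL\<close> and \<open>DR\<close> are controlled on (a,b) alone.\<close>

definition L2i :: "real \<Rightarrow> real \<Rightarrow> (real \<Rightarrow> real) \<Rightarrow> bool" where
 "L2i a b g \<longleftrightarrow> zext a b g \<in> Borel \<and> sq2 a b g < \<infinity>"

lemma zext_lin: "zext a b (\<lambda>x. g x + r * h x) = (\<lambda>x. zext a b g x + r * zext a b h x)"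
 by (auto simp: zext_def algebra_simps)

lemma zext_diff: "zext a b (\<lambda>x. g x - h x) = (\<lambda>x. zext a b g x - zext a b h x)"
 by (auto simp: zext_def algebra_simps)

lemma zext_cmult: "zext a b (\<lambda>x. r * h x) = (\<lambda>x. r * zext a b h x)"
 by (auto simp: zext_def algebra_simps)

lemma zext_measurable: "u \<in> Borel \<Longrightarrow> zext a b u \<in> Borel"
 unfolding zext_def by measurable

lemma L2i_square_integrable:
 assumes "L2i a b g" shows "integrable lborel (\<lambda>x. (zext a b g x)^2)" "sq2 a b g = ennreal (L2ip a b g g)" "L2ip a b g g \<ge> 0"
proof -
 have [measurable]: "zext a b g \<in> Borel" and f: "sq2 a b g < \<infinity>" using assms by (auto simp: L2i_def)
 show i: "integrable lborel (\<lambda>x. (zext a b g x)^2)" by (rule integrableI_nonneg) (use f in \<open>auto simp: sq2_zext\<close>)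
 have e: "L2ip a b g g = (LB x. (zext a b g x)^2)"
  unfolding L2ip_def set_lebesgue_integral_def by (intro Bochner_Integration.integral_cong refl) (simp add: zext_def indicator_def power2_eq_square)
 show "sq2 a b g = ennreal (L2ip a b g g)" unfolding sq2_zext e by (rule nn_integral_eq_integral[OF i]) simp
 show "L2ip a b g g \<ge> 0" unfolding e by simp
qed

lemma L2i_integrable:
 assumes "L2i a b g" shows "integrable lborel (zext a b g)"
proof -
 have [measurable]: "zext a b g \<in> Borel" using assms by (auto simp: L2i_def)
 have "integrable lborel (\<lambda>x. indicator {a<..<b} x + (zext a b g x)^2)"
 proof (rule Bochner_Integration.integrable_add[OF _ L2i_square_integrable(1)[OF assms]])
  show "integrable lborel (indicat_real {a<..<b})" by (cases "a \<le> b") (auto simp: integrable_indicator_iff)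
 qed
 then show ?thesis
 proof (rule Bochner_Integration.integrable_bound)
  have "\<bar>zext a b g x\<bar> \<le> indicator {a<..<b} x + (zext a b g x)^2" for x
  proof (cases "x \<in> {a<..<b}")
   case True
   have "0 \<le> (\<bar>zext a b g x\<bar> - 1/2)^2" by simp
   then have "\<bar>zext a b g x\<bar> \<le> 1 + (zext a b g x)^2" by (simp add: power2_diff) (simp add: power2_eq_square)
   then show ?thesis using True by simp
  qed (simp add: zext_def)
  then show "AE x in lborel. norm (zext a b g x) \<le> norm (indicator {a<..<b} x + (zext a b g x)^2)"
   by (auto intro!: AE_I2 order_trans[OF _ abs_ge_self])
 qed simp
qed

lemma L2ip_zext: "L2ip a b g h = (LB x. zext a b g x * zext a b h x)"
 unfolding L2ip_def set_lebesgue_integral_def by (intro Bochner_Integration.integral_cong refl) (simp add: zext_def indicator_def)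

lemma L2i_prod_integrable:
 assumes "L2i a b g" "L2i a b h" shows "integrable lborel (\<lambda>x. zext a b g x * zext a b h x)"
proof -
 have [measurable]: "zext a b g \<in> Borel" "zext a b h \<in> Borel" using assms by (auto simp: L2i_def)
 have "integrable lborel (\<lambda>x. (zext a b g x)^2 + (zext a b h x)^2)"
  using L2i_square_integrable(1)[OF assms(1)] L2i_square_integrable(1)[OF assms(2)] by simp
 then show ?thesis
 proof (rule Bochner_Integration.integrable_bound)
  have "\<bar>u * v\<bar> \<le> u^2 + v^2" for u v :: real
  proof -
   have "2 * \<bar>u * v\<bar> \<le> u^2 + v^2" using sum_squares_bound[of "\<bar>u\<bar>" "\<bar>v\<bar>"] by (simp add: abs_mult)
   then show ?thesis using abs_ge_zero[of "u * v"] by linarith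
  qed
  then show "AE x in lborel. norm (zext a b g x * zext a b h x) \<le> norm ((zext a b g x)^2 + (zext a b h x)^2)" by simp
 qed simp
qed

lemma L2i_lin:
 assumes "L2i a b g" "L2i a b h" shows "L2i a b (\<lambda>x. g x + r * h x)"
proof -
 have [measurable]: "zext a b g \<in> Borel" "zext a b h \<in> Borel" using assms by (auto simp: L2i_def)
 have rh: "zext a b (\<lambda>x. (-r) * h x) \<in> Borel" unfolding zext_cmult by measurable
 have "sq2 a b (\<lambda>x. g x - (-r) * h x) \<le> 2 * sq2 a b g + 2 * sq2 a b (\<lambda>x. (-r) * h x)"
  by (rule sq2_add_le) (use rh in auto)
 also have "... < \<infinity>" using assms unfolding sq2_cmult[OF \<open>zext a b h \<in> Borel\<close>]
  by (auto simp: L2i_def ennreal_mult_less_top)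
 finally show ?thesis unfolding L2i_def zext_lin by simp
qed

lemma L2i_test: "test_fun a b \<phi> \<Longrightarrow> L2i a b \<phi>"
 using sq2_test_fun(2)[of a b \<phi>] by (simp add: L2i_def zext_test_fun test_fun_measurable)

lemma L2ip_sym: "L2ip a b g h = L2ip a b h g" unfolding L2ip_zext by (simp add: mult.commute)

lemma L2ip_lin_left:
 assumes "L2i a b g" "L2i a b g'" "L2i a b h" shows "L2ip a b (\<lambda>x. g x + r * g' x) h = L2ip a b g h + r * L2ip a b g' h"
 unfolding L2ip_zext zext_lin using L2i_prod_integrable[OF assms(1,3)] L2i_prod_integrable[OF assms(2,3)]
 by (simp add: distrib_right mult.assoc)

lemma L2ip_lin_right:
 assumes "L2i a b g" "L2i a b g'" "L2i a b h" shows "L2ip a b h (\<lambda>x. g x + r * g' x) = L2ip a b h g + r * L2ip a b h g'"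
 using L2ip_lin_left[OF assms] by (simp add: L2ip_sym)

text \<open>Nonnegativity for all r forces C \<ge> 0, and B = 0 if C = 0; otherwise r = - B / C is
  the minimiser. Besides Cauchy--Schwarz this is used with A = 0, where it makes the first variation
  at a minimum vanish.\<close>

lemma quadratic_nonneg_discr:
 assumes "\<And>r::real. 0 \<le> A + 2 * r * B + r^2 * C" shows "B^2 \<le> A * C"
proof -
 have A: "A \<ge> 0" using assms[of 0] by simp
 consider "C = 0" | "C \<noteq> 0" by blast
 then show ?thesis
 proof cases
  case 1
  have "B = 0"
  proof (rule ccontr)
   assume B: "B \<noteq> 0"
   have "0 \<le> A + 2 * (- (A + 1) / (2 * B)) * B" using assms[of "- (A + 1) / (2 * B)"] 1 by simp
   also have "... = -1" using B by (simp add: field_simps)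
   finally show False by simp
  qed
  then show ?thesis using 1 by simp
 next
  case 2
  have "0 \<le> A + 2 * (- B / C) * B + (- B / C)^2 * C" by (rule assms)
  also have "... = A - B^2 / C" using 2 by (simp add: power2_eq_square field_simps)
  finally have le: "B^2 / C \<le> A" by simp
  have "C > 0"
  proof (rule ccontr)
   assume "\<not> C > 0"
   then have C: "C < 0" using 2 by simp
   \<comment> \<open>For C < 0 a large r lets the quadratic term dominate: the quotient makes r * (-
     C) exceed A + 2 * |B|, and the summand 1 ensures r \<ge> 1.\<close>
   define r where "r = (A + 2 * \<bar>B\<bar> + 1) / (- C) + 1"
   have r: "r \<ge> 1" "r * (- C) > A + 2 * \<bar>B\<bar>" unfolding r_def using A C by (auto simp: field_simps)
   have "r^2 * (- C) = r * (r * (- C))" by (simp add: power2_eq_square)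
   also have "... > r * (A + 2 * \<bar>B\<bar>)" using r by (intro mult_strict_left_mono) auto
   finally have 1: "r^2 * (- C) > r * A + 2 * r * \<bar>B\<bar>" by (simp add: algebra_simps)
   have 2: "r * A \<ge> A" using r A by (simp add: mult_le_cancel_right1)
   have 3: "2 * r * \<bar>B\<bar> \<ge> 2 * r * B" using r by (intro mult_left_mono) auto
   have "0 \<le> A + 2 * r * B + r^2 * C" by (rule assms)
   then show False using 1 2 3 by (simp add: algebra_simps)
  qed
  then show ?thesis using le by (simp add: field_simps)
 qed
qed

lemma L2ip_CS:
 assumes g: "L2i a b g" and h: "L2i a b h" shows "\<bar>L2ip a b g h\<bar> \<le> sqrt (L2ip a b g g) * sqrt (L2ip a b h h)"
proof -
 have "(L2ip a b g h)^2 \<le> L2ip a b g g * L2ip a b h h"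
 proof (rule quadratic_nonneg_discr)
  fix r
  have gh: "L2i a b (\<lambda>x. g x + r * h x)" by (rule L2i_lin[OF g h])
  have "0 \<le> L2ip a b (\<lambda>x. g x + r * h x) (\<lambda>x. g x + r * h x)" by (rule L2i_square_integrable(3)[OF gh])
  also have "... = L2ip a b g g + 2 * r * L2ip a b g h + r^2 * L2ip a b h h"
   unfolding L2ip_lin_left[OF g h gh] L2ip_lin_right[OF g h g] L2ip_lin_right[OF g h h] L2ip_sym[of a b h g]
   by (simp add: power2_eq_square algebra_simps)
  finally show "0 \<le> L2ip a b g g + 2 * r * L2ip a b g h + r^2 * L2ip a b h h" .
 qed
 then have "sqrt ((L2ip a b g h)^2) \<le> sqrt (L2ip a b g g * L2ip a b h h)" by (rule real_sqrt_le_mono)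
 then show ?thesis by (simp add: real_sqrt_mult)
qed

lemma sq2_zero_AE:
 assumes "zext a b g \<in> Borel" "sq2 a b g = 0" shows "AE x in lborel. x \<in> {a<..<b} \<longrightarrow> g x = 0"
proof -
 have [measurable]: "zext a b g \<in> Borel" by fact
 have "AE x in lborel. ennreal ((zext a b g x)^2) = 0"
  using assms(2) unfolding sq2_zext by (subst nn_integral_0_iff_AE[symmetric]) auto
 then show ?thesis by eventually_elim (auto simp: zext_def)
qed

lemma L2ip_cong_AE:
 assumes "AE x in lborel. x \<in> {a<..<b} \<longrightarrow> g x = g' x" "L2i a b g" "L2i a b g'" "L2i a b h"
 shows "L2ip a b g h = L2ip a b g' h" "L2ip a b h g = L2ip a b h g'"
proof -
 have [measurable]: "zext a b g \<in> Borel" "zext a b g' \<in> Borel" "zext a b h \<in> Borel"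
  using assms by (auto simp: L2i_def)
 show "L2ip a b g h = L2ip a b g' h" unfolding L2ip_zext
 proof (rule integral_cong_AE)
  show "AE x in lborel. zext a b g x * zext a b h x = zext a b g' x * zext a b h x"
   using assms(1) by eventually_elim (auto simp: zext_def indicator_def)
 qed simp_all
 then show "L2ip a b h g = L2ip a b h g'" by (simp add: L2ip_sym)
qed

lemma ennreal_null_seqI:
 fixes f :: "nat \<Rightarrow> ennreal"
 assumes "\<And>e::real. 0 < e \<Longrightarrow> \<exists>N. \<forall>n\<ge>N. f n \<le> ennreal e" shows "f \<longlonglongrightarrow> 0"
proof (rule tendsto_zero_ennreal)
 fix r :: real assume r: "0 < r"
 then obtain N where N: "\<And>n. n \<ge> N \<Longrightarrow> f n \<le> ennreal (r/2)" using assms[of "r/2"] by auto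
 show "\<forall>\<^sub>F i in sequentially. f i < ennreal r"
  using eventually_ge_at_top[of N]
 proof eventually_elim
  case (elim n)
  have "ennreal (r/2) < ennreal r" using r by (simp add: ennreal_less_iff)
  then show ?case using N[OF elim] by (rule le_less_trans[rotated])
 qed
qed

lemma ennreal_null_seqD:
 fixes f :: "nat \<Rightarrow> ennreal"
 assumes "f \<longlonglongrightarrow> 0" "0 < e" shows "\<exists>N. \<forall>n\<ge>N. f n \<le> ennreal e"
 using order_tendstoD(2)[OF assms(1), of "ennreal e"] assms(2) unfolding eventually_sequentially by (auto intro: less_imp_le)

lemma subseq_above:
 fixes N :: "nat \<Rightarrow> nat"
 shows "\<exists>r. strict_mono r \<and> (\<forall>k. N k \<le> r k)"
proof (intro exI[of _ "\<lambda>k. (\<Sum>i\<le>k. N i) + k"] conjI allI)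
 show "strict_mono (\<lambda>k. (\<Sum>i\<le>k. N i) + k)" by (rule strict_mono_Suc_iff[THEN iffD2]) simp
 show "N k \<le> (\<Sum>i\<le>k. N i) + k" for k by (simp add: trans_le_add1 member_le_sum)
qed

text \<open>Riesz--Fischer written with squares. Along a subsequence whose increments have squared
  norm at most (1/4)^k, the weights 2^k still give an integrable sum of squares, so almost
  everywhere the increments decay like sqrt (1/2) ^ k and are summable. Fatou then gives convergence
  of the full sequence.\<close>

lemma L2_complete:
 fixes f :: "nat \<Rightarrow> 'a \<Rightarrow> real"
 assumes [measurable]: "\<And>n. f n \<in> borel_measurable M"
  and C: "\<And>e. 0 < e \<Longrightarrow> \<exists>N. \<forall>m\<ge>N. \<forall>n\<ge>N. (\<integral>\<^sup>+x. ennreal ((f m x - f n x)^2) \<partial>M) \<le> ennreal e"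
 shows "\<exists>g\<in>borel_measurable M. (\<lambda>n. \<integral>\<^sup>+x. ennreal ((f n x - g x)^2) \<partial>M) \<longlonglongrightarrow> 0"
proof -
 have "\<forall>k. \<exists>N. \<forall>m\<ge>N. \<forall>n\<ge>N. (\<integral>\<^sup>+x. ennreal ((f m x - f n x)^2) \<partial>M) \<le> ennreal ((1/4)^k)"
  by (intro allI C) simp
 then obtain N where N: "\<And>k m n. m \<ge> N k \<Longrightarrow> n \<ge> N k \<Longrightarrow> (\<integral>\<^sup>+x. ennreal ((f m x - f n x)^2) \<partial>M) \<le> ennreal ((1/4)^k)" by metis
 obtain r where r: "strict_mono r" "\<And>k. N k \<le> r k" using subseq_above by blast
 define D where "D k x = f (r (Suc k)) x - f (r k) x" for k x
 have [measurable]: "D k \<in> borel_measurable M" for k unfolding D_def by measurable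
 have Db: "(\<integral>\<^sup>+x. ennreal ((D k x)^2) \<partial>M) \<le> ennreal ((1/4)^k)" for k
  unfolding D_def using r(2)[of k] strict_monoD[OF r(1), of k "Suc k"] by (intro N) auto
 have "(\<integral>\<^sup>+x. (\<Sum>k. ennreal (2^k) * ennreal ((D k x)^2)) \<partial>M) = (\<Sum>k. \<integral>\<^sup>+x. ennreal (2^k) * ennreal ((D k x)^2) \<partial>M)"
  by (rule nn_integral_suminf) measurable
 also have "... \<le> (\<Sum>k. ennreal ((1/2)^k))"
 proof (intro suminf_le)
  fix k
  have "(\<integral>\<^sup>+x. ennreal (2^k) * ennreal ((D k x)^2) \<partial>M) = ennreal (2^k) * (\<integral>\<^sup>+x. ennreal ((D k x)^2) \<partial>M)" by (rule nn_integral_cmult) measurable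
  also have "... \<le> ennreal (2^k) * ennreal ((1/4)^k)" by (intro mult_left_mono Db) auto
  also have "... = ennreal ((1/2)^k)" by (simp add: ennreal_mult[symmetric] power_mult_distrib[symmetric])
  finally show "(\<integral>\<^sup>+x. ennreal (2^k) * ennreal ((D k x)^2) \<partial>M) \<le> ennreal ((1/2)^k)" .
 qed auto
 also have "... = ennreal (\<Sum>k. (1/2)^k)" by (rule suminf_ennreal2) (auto intro: summable_geometric)
 also have "... < \<infinity>" by simp
 finally have "AE x in M. (\<Sum>k. ennreal (2^k) * ennreal ((D k x)^2)) \<noteq> \<infinity>"
  by (intro nn_integral_noteq_infinite) auto
 then have conv: "AE x in M. convergent (\<lambda>k. f (r k) x)"
 proof eventually_elim
  case (elim x)
  let ?S = "\<Sum>k. ennreal (2^k) * ennreal ((D k x)^2)"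
  obtain B where B: "?S = ennreal B" "B \<ge> 0" using elim by (cases ?S) auto
  have Dk: "\<bar>D k x\<bar> \<le> sqrt B * (sqrt (1/2))^k" for k
  proof -
   have "ennreal (2^k) * ennreal ((D k x)^2) \<le> ?S" using sum_le_suminf[of "\<lambda>k. ennreal (2^k) * ennreal ((D k x)^2)" "{k}"] by simp
   then have "2^k * (D k x)^2 \<le> B" unfolding B using B(2) by (simp add: ennreal_mult[symmetric])
   then have "(D k x)^2 \<le> B * (1/2)^k" by (simp add: power_divide field_simps)
   then have "sqrt ((D k x)^2) \<le> sqrt (B * (1/2)^k)" by (rule real_sqrt_le_mono)
   then have "\<bar>D k x\<bar> \<le> sqrt (B * (1/2)^k)" by (simp only: real_sqrt_abs)
   also have "... = sqrt B * (sqrt (1/2))^k" by (simp only: real_sqrt_mult real_sqrt_power)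
   finally show ?thesis .
  qed
  have "summable (\<lambda>k. sqrt B * (sqrt (1/2))^k)"
   by (intro summable_mult summable_geometric) (simp add: real_sqrt_divide)
  then have "summable (\<lambda>k. D k x)" by (rule summable_comparison_test'[where N=0]) (use Dk in auto)
  then have "convergent (\<lambda>n. \<Sum>k<n. D k x)" by (simp add: summable_iff_convergent)
  then have "convergent (\<lambda>n. (\<Sum>k<n. D k x) + f (r 0) x)" by (intro convergent_add convergent_const)
  moreover have "(\<Sum>k<n. D k x) + f (r 0) x = f (r n) x" for n
   unfolding D_def using sum_lessThan_telescope[of "\<lambda>k. f (r k) x" n] by simp
  ultimately show ?case by simp
 qed
 define g where "g x = lim (\<lambda>k. f (r k) x)" for x
 have [measurable]: "g \<in> borel_measurable M" unfolding g_def by measurable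
 have lim: "AE x in M. (\<lambda>k. f (r k) x) \<longlonglongrightarrow> g x" using conv by eventually_elim (simp add: g_def convergent_LIMSEQ_iff)
 have "(\<lambda>n. \<integral>\<^sup>+x. ennreal ((f n x - g x)^2) \<partial>M) \<longlonglongrightarrow> 0"
 proof (rule ennreal_null_seqI)
  fix e :: real assume "e > 0"
  then obtain K where K: "\<And>m n. m \<ge> K \<Longrightarrow> n \<ge> K \<Longrightarrow> (\<integral>\<^sup>+x. ennreal ((f m x - f n x)^2) \<partial>M) \<le> ennreal e" using C by blast
  have "(\<integral>\<^sup>+x. ennreal ((f n x - g x)^2) \<partial>M) \<le> ennreal e" if n: "n \<ge> K" for n
  proof -
   have "(\<integral>\<^sup>+x. ennreal ((f n x - g x)^2) \<partial>M) = (\<integral>\<^sup>+x. liminf (\<lambda>k. ennreal ((f n x - f (r k) x)^2)) \<partial>M)"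
   proof (rule nn_integral_cong_AE)
    show "AE x in M. ennreal ((f n x - g x)^2) = liminf (\<lambda>k. ennreal ((f n x - f (r k) x)^2))"
     using lim
    proof eventually_elim
     case (elim x)
     then have "(\<lambda>k. ennreal ((f n x - f (r k) x)^2)) \<longlonglongrightarrow> ennreal ((f n x - g x)^2)"
      by (intro tendsto_ennrealI tendsto_intros)
     then show ?case by (intro lim_imp_Liminf[symmetric]) auto
    qed
   qed
   also have "... \<le> liminf (\<lambda>k. \<integral>\<^sup>+x. ennreal ((f n x - f (r k) x)^2) \<partial>M)" by (rule nn_integral_liminf) measurable
   also have "... \<le> liminf (\<lambda>k. ennreal e)"
   proof (rule Liminf_mono)
    show "\<forall>\<^sub>F k in sequentially. (\<integral>\<^sup>+x. ennreal ((f n x - f (r k) x)^2) \<partial>M) \<le> ennreal e"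
     using eventually_ge_at_top[of K]
     by eventually_elim (use K n seq_suble[OF r(1)] in \<open>metis order_trans\<close>)
   qed
   finally show ?thesis by (simp add: Liminf_const)
  qed
  then show "\<exists>N. \<forall>n\<ge>N. (\<integral>\<^sup>+x. ennreal ((f n x - g x)^2) \<partial>M) \<le> ennreal e" by blast
 qed
 then show ?thesis using \<open>g \<in> borel_measurable M\<close> by blast
qed

lemma L2ab_complete:
 fixes f :: "nat \<Rightarrow> real \<Rightarrow> real"
 assumes m: "\<And>n. zext a b (f n) \<in> Borel"
  and C: "\<And>e. 0 < e \<Longrightarrow> \<exists>N. \<forall>m\<ge>N. \<forall>n\<ge>N. sq2 a b (\<lambda>x. f m x - f n x) \<le> ennreal e"
 shows "\<exists>g\<in>Borel. (\<lambda>n. sq2 a b (\<lambda>x. f n x - g x)) \<longlonglongrightarrow> 0"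
proof -
 have "\<exists>g\<in>borel_measurable lborel. (\<lambda>n. NN x. ennreal ((zext a b (f n) x - g x)^2)) \<longlonglongrightarrow> 0"
  by (rule L2_complete) (use m C in \<open>auto simp: sq2_zext zext_diff\<close>)
 then obtain g where g: "g \<in> Borel" "(\<lambda>n. NN x. ennreal ((zext a b (f n) x - g x)^2)) \<longlonglongrightarrow> 0" by auto
 have "sq2 a b (\<lambda>x. f n x - g x) \<le> (NN x. ennreal ((zext a b (f n) x - g x)^2))" for n
  unfolding sq2_def by (intro nn_integral_mono) (auto simp: zext_def indicator_def)
 then have "(\<lambda>n. sq2 a b (\<lambda>x. f n x - g x)) \<longlonglongrightarrow> 0"
  by (intro tendsto_sandwich[OF _ _ tendsto_const g(2)]) auto
 with g(1) show ?thesis by blast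
qed

section \<open>The energy norm under linear combinations and limits\<close>

lemma fourier_diff:
 assumes "integrable lborel u" "integrable lborel v"
 shows "fourier (\<lambda>x. u x - v x) \<omega> = fourier u \<omega> - fourier v \<omega>"
 using integrable_fourier_kernel[OF assms(1), of \<omega>] integrable_fourier_kernel[OF assms(2), of \<omega>]
 by (simp add: fourier_def right_diff_distrib)

lemma fourier_cmult: "fourier (\<lambda>x. r * u x) \<omega> = of_real r * fourier u \<omega>"
 unfolding fourier_def by (subst integral_mult_right_zero[symmetric]) (auto intro!: Bochner_Integration.integral_cong simp: mult.left_commute)

lemma cmod_diff_square: "(cmod (z - w))^2 \<le> 2 * (cmod z)^2 + 2 * (cmod w)^2"
proof -
 have "(cmod (z - w))^2 \<le> (cmod z + cmod w)^2" by (intro power_mono norm_triangle_ineq4) auto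
 also have "... \<le> 2 * (cmod z)^2 + 2 * (cmod w)^2" using sum_squares_le_diff[of "cmod z" "- cmod w"] by simp
 finally show ?thesis .
qed

lemma FN_diff_le:
 assumes u: "integrable lborel u" and v: "integrable lborel v"
 shows "FN s (\<lambda>x. u x - v x) \<le> 2 * FN s u + 2 * FN s v"
proof -
 have [measurable]: "u \<in> Borel" "v \<in> Borel" using u v by auto
 have "FN s (\<lambda>x. u x - v x) \<le> (NN \<omega>. 2 * ennreal (\<bar>\<omega>\<bar> powr (2 * s) * (cmod (fourier u \<omega>))^2) + 2 * ennreal (\<bar>\<omega>\<bar> powr (2 * s) * (cmod (fourier v \<omega>))^2))"
  unfolding FN_def
 proof (rule nn_integral_mono)
  fix \<omega>
  have "\<bar>\<omega>\<bar> powr (2 * s) * (cmod (fourier (\<lambda>x. u x - v x) \<omega>))^2 \<le> \<bar>\<omega>\<bar> powr (2 * s) * (2 * (cmod (fourier u \<omega>))^2 + 2 * (cmod (fourier v \<omega>))^2)"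
   unfolding fourier_diff[OF u v] by (intro mult_left_mono cmod_diff_square) auto
  also have "... = 2 * (\<bar>\<omega>\<bar> powr (2 * s) * (cmod (fourier u \<omega>))^2) + 2 * (\<bar>\<omega>\<bar> powr (2 * s) * (cmod (fourier v \<omega>))^2)" by (simp add: algebra_simps)
  finally have "ennreal (\<bar>\<omega>\<bar> powr (2 * s) * (cmod (fourier (\<lambda>x. u x - v x) \<omega>))^2) \<le> ennreal ..." by (rule ennreal_leI)
  then show "ennreal (\<bar>\<omega>\<bar> powr (2 * s) * (cmod (fourier (\<lambda>x. u x - v x) \<omega>))^2) \<le> 2 * ennreal (\<bar>\<omega>\<bar> powr (2 * s) * (cmod (fourier u \<omega>))^2) + 2 * ennreal (\<bar>\<omega>\<bar> powr (2 * s) * (cmod (fourier v \<omega>))^2)"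
   by (simp add: ennreal_mult[of 2])
 qed
 also have "... = 2 * FN s u + 2 * FN s v"
  unfolding FN_def by (simp add: nn_integral_add nn_integral_cmult)
 finally show ?thesis .
qed

lemma FN_cmult:
 assumes [measurable]: "u \<in> Borel"
 shows "FN s (\<lambda>x. r * u x) = ennreal (r^2) * FN s u"
 unfolding FN_def fourier_cmult
 by (subst nn_integral_cmult[symmetric]) (auto intro!: nn_integral_cong simp: norm_mult power_mult_distrib ennreal_mult[symmetric] mult_ac)

lemma W_diff_le:
 assumes u: "zext a b u \<in> Borel" and v: "zext a b v \<in> Borel"
 shows "W s a b (\<lambda>x. u x - v x) \<le> 2 * W s a b u + 2 * W s a b v"
proof (cases "sq2 a b u < \<infinity> \<and> sq2 a b v < \<infinity>")
 case True
 then have i: "integrable lborel (zext a b u)" "integrable lborel (zext a b v)" using u v by (auto intro!: L2i_integrable simp: L2i_def)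
 have "W s a b (\<lambda>x. u x - v x) \<le> (2 * sq2 a b u + 2 * sq2 a b v) + (2 * FN s (zext a b u) + 2 * FN s (zext a b v))"
  unfolding W_def zext_diff by (intro add_mono sq2_add_le u v FN_diff_le i)
 then show ?thesis unfolding W_def by (simp add: distrib_left add_ac)
next
 case False
 then have "2 * W s a b u + 2 * W s a b v = top" by (auto simp: W_def ennreal_mult_eq_top_iff less_top[symmetric])
 then show ?thesis by (simp only: top_greatest)
qed

lemma W_cmult:
 assumes u: "zext a b u \<in> Borel"
 shows "W s a b (\<lambda>x. r * u x) = ennreal (r^2) * W s a b u"
 unfolding W_def zext_cmult sq2_cmult[OF u] FN_cmult[OF u] by (simp add: distrib_left)

lemma zext_lin_measurable: "zext a b u \<in> Borel \<Longrightarrow> zext a b v \<in> Borel \<Longrightarrow> zext a b (\<lambda>x. u x + r * v x) \<in> Borel"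
 unfolding zext_lin by (intro borel_measurable_add borel_measurable_times borel_measurable_const)

lemma zext_diff_measurable: "zext a b u \<in> Borel \<Longrightarrow> zext a b v \<in> Borel \<Longrightarrow> zext a b (\<lambda>x. u x - v x) \<in> Borel"
 unfolding zext_diff by (intro borel_measurable_diff)

lemma W_lin_le:
 assumes u: "zext a b u \<in> Borel" and v: "zext a b v \<in> Borel"
 shows "W s a b (\<lambda>x. u x + r * v x) \<le> 2 * W s a b u + 2 * (ennreal (r^2) * W s a b v)"
proof -
 have m: "zext a b (\<lambda>x. (-r) * v x) \<in> Borel" using v unfolding zext_cmult by measurable
 have "W s a b (\<lambda>x. u x - (-r) * v x) \<le> 2 * W s a b u + 2 * W s a b (\<lambda>x. (-r) * v x)" by (rule W_diff_le[OF u m])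
 then show ?thesis unfolding W_cmult[OF v] by simp
qed

text \<open>On a bounded interval L2 controls L1 and hence the transform uniformly in \<omega>, so
  L2 convergence yields pointwise convergence of transforms.\<close>

lemma fourier_zext_bound:
 assumes g: "L2i a b g" and ab: "a < b" shows "cmod (fourier (zext a b g) \<omega>) \<le> sqrt (b - a) * sqrt (L2ip a b g g)"
proof -
 have [measurable]: "zext a b g \<in> Borel" using g by (simp add: L2i_def)
 have one: "L2i a b (\<lambda>x. 1)" "L2ip a b (\<lambda>x. 1) (\<lambda>x. 1) = b - a"
  using ab by (auto simp: L2i_def zext_def sq2_def L2ip_def set_lebesgue_integral_def)
 have za: "zext a b (\<lambda>x. \<bar>g x\<bar>) = (\<lambda>x. \<bar>zext a b g x\<bar>)" by (auto simp: zext_def abs_mult)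
 have ga: "L2i a b (\<lambda>x. \<bar>g x\<bar>)" "L2ip a b (\<lambda>x. \<bar>g x\<bar>) (\<lambda>x. \<bar>g x\<bar>) = L2ip a b g g"
  using g by (auto simp: L2i_def za sq2_zext L2ip_zext)
 have "cmod (fourier (zext a b g) \<omega>) \<le> (LB x. \<bar>zext a b g x\<bar>)" by (rule fourier_bound[OF L2i_integrable[OF g]])
 also have "... = L2ip a b (\<lambda>x. 1) (\<lambda>x. \<bar>g x\<bar>)"
  unfolding L2ip_zext za by (intro Bochner_Integration.integral_cong refl) (auto simp: zext_def indicator_def)
 also have "... \<le> sqrt (b - a) * sqrt (L2ip a b g g)"
  using L2ip_CS[OF one(1) ga(1)] unfolding one ga by (rule order_trans[OF abs_ge_self])
 finally show ?thesis .
qed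

lemma fourier_zext_tendsto:
 assumes u: "zext a b u \<in> Borel" and f: "\<And>n. zext a b (f n) \<in> Borel" and ab: "a < b"
  and l: "(\<lambda>n. sq2 a b (\<lambda>x. u x - f n x)) \<longlonglongrightarrow> 0"
 shows "(\<lambda>n. fourier (zext a b (\<lambda>x. u x - f n x)) \<omega>) \<longlonglongrightarrow> 0"
proof -
 have "\<forall>\<^sub>F n in sequentially. sq2 a b (\<lambda>x. u x - f n x) < ennreal 1" using order_tendstoD(2)[OF l, of 1] by simp
 then have ev: "\<forall>\<^sub>F n in sequentially. L2i a b (\<lambda>x. u x - f n x)"
  by eventually_elim (use zext_diff_measurable[OF u f] in \<open>auto simp: L2i_def intro: less_trans\<close>)
 have l2: "(\<lambda>n. L2ip a b (\<lambda>x. u x - f n x) (\<lambda>x. u x - f n x)) \<longlonglongrightarrow> 0"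
 proof -
  have "(\<lambda>n. enn2real (sq2 a b (\<lambda>x. u x - f n x))) \<longlonglongrightarrow> enn2real 0" by (rule tendsto_enn2real) (use l in auto)
  moreover have "\<forall>\<^sub>F n in sequentially. enn2real (sq2 a b (\<lambda>x. u x - f n x)) = L2ip a b (\<lambda>x. u x - f n x) (\<lambda>x. u x - f n x)"
   using ev by eventually_elim (simp add: L2i_square_integrable)
  ultimately show ?thesis by (simp add: tendsto_cong)
 qed
 have "(\<lambda>n. sqrt (b - a) * sqrt (L2ip a b (\<lambda>x. u x - f n x) (\<lambda>x. u x - f n x))) \<longlonglongrightarrow> sqrt (b - a) * sqrt 0"
  by (intro tendsto_intros l2)
 then have z: "(\<lambda>n. sqrt (b - a) * sqrt (L2ip a b (\<lambda>x. u x - f n x) (\<lambda>x. u x - f n x))) \<longlonglongrightarrow> 0" by simp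
 show ?thesis
  by (rule Lim_null_comparison[OF _ z]) (use ev in eventually_elim, rule fourier_zext_bound[OF _ ab])
qed

text \<open>L2 convergence fixes the pointwise limit of the transforms of f m - f n as m grows, and
  Fatou bounds the seminorm of u - f n by the Cauchy tail. In this way a Cauchy sequence in
  \<open>W\<close> converges in \<open>W\<close> to its L2 limit.\<close>

lemma W_limit:
 assumes u: "zext a b u \<in> Borel" and f: "\<And>n. zext a b (f n) \<in> Borel" and ab: "a < b"
  and l: "(\<lambda>n. sq2 a b (\<lambda>x. u x - f n x)) \<longlonglongrightarrow> 0" and fin: "\<And>n. sq2 a b (f n) < \<infinity>"
  and C: "\<And>e. 0 < e \<Longrightarrow> \<exists>N. \<forall>m\<ge>N. \<forall>n\<ge>N. W s a b (\<lambda>x. f m x - f n x) \<le> ennreal e"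
 shows "(\<lambda>n. W s a b (\<lambda>x. u x - f n x)) \<longlonglongrightarrow> 0"
proof (rule ennreal_null_seqI)
 fix e :: real assume e: "e > 0"
 then have e2: "e/2 > 0" by simp
 obtain N where N: "\<And>m n. m \<ge> N \<Longrightarrow> n \<ge> N \<Longrightarrow> W s a b (\<lambda>x. f m x - f n x) \<le> ennreal (e/2)" using C[OF e2] by blast
 obtain N' where N': "\<And>n. n \<ge> N' \<Longrightarrow> sq2 a b (\<lambda>x. u x - f n x) \<le> ennreal (e/2)" using ennreal_null_seqD[OF l e2] by blast
 have fm[measurable]: "zext a b (\<lambda>x. f m x - f n x) \<in> Borel" for m n by (rule zext_diff_measurable[OF f f])
 have [measurable]: "zext a b (\<lambda>x. u x - f n x) \<in> Borel" for n by (rule zext_diff_measurable[OF u f])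
 have "W s a b (\<lambda>x. u x - f n x) \<le> ennreal e" if n: "n \<ge> max N N'" for n
 proof -
  have li: "L2i a b (\<lambda>x. u x - f n x)" unfolding L2i_def using N'[of n] n by (auto intro: le_less_trans)
  have ev: "\<forall>\<^sub>F m in sequentially. fourier (zext a b (\<lambda>x. f m x - f n x)) \<omega> = fourier (zext a b (\<lambda>x. u x - f n x)) \<omega> - fourier (zext a b (\<lambda>x. u x - f m x)) \<omega>" for \<omega>
   using eventually_ge_at_top[of N']
  proof eventually_elim
   case (elim m)
   have lm: "L2i a b (\<lambda>x. u x - f m x)" unfolding L2i_def using N'[OF elim] by (auto intro: le_less_trans)
   have e: "zext a b (\<lambda>x. f m x - f n x) = (\<lambda>x. zext a b (\<lambda>x. u x - f n x) x - zext a b (\<lambda>x. u x - f m x) x)" by (auto simp: zext_def algebra_simps)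
   show ?case unfolding e by (rule fourier_diff[OF L2i_integrable[OF li] L2i_integrable[OF lm]])
  qed
  have lim: "(\<lambda>m. fourier (zext a b (\<lambda>x. f m x - f n x)) \<omega>) \<longlonglongrightarrow> fourier (zext a b (\<lambda>x. u x - f n x)) \<omega>" for \<omega>
  proof -
   have "(\<lambda>m. fourier (zext a b (\<lambda>x. u x - f n x)) \<omega> - fourier (zext a b (\<lambda>x. u x - f m x)) \<omega>) \<longlonglongrightarrow> fourier (zext a b (\<lambda>x. u x - f n x)) \<omega> - 0"
    by (intro tendsto_diff tendsto_const fourier_zext_tendsto[OF u f ab l])
   then show ?thesis using tendsto_cong[OF ev] by simp
  qed
  have "FN s (zext a b (\<lambda>x. u x - f n x)) = (NN \<omega>. liminf (\<lambda>m. ennreal (\<bar>\<omega>\<bar> powr (2 * s) * (cmod (fourier (zext a b (\<lambda>x. f m x - f n x)) \<omega>))^2)))"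
   unfolding FN_def
  proof (rule nn_integral_cong)
   fix \<omega>
   have "(\<lambda>m. ennreal (\<bar>\<omega>\<bar> powr (2 * s) * (cmod (fourier (zext a b (\<lambda>x. f m x - f n x)) \<omega>))^2)) \<longlonglongrightarrow> ennreal (\<bar>\<omega>\<bar> powr (2 * s) * (cmod (fourier (zext a b (\<lambda>x. u x - f n x)) \<omega>))^2)"
    by (intro tendsto_ennrealI tendsto_intros lim)
   then show "ennreal (\<bar>\<omega>\<bar> powr (2 * s) * (cmod (fourier (zext a b (\<lambda>x. u x - f n x)) \<omega>))^2) = liminf (\<lambda>m. ennreal (\<bar>\<omega>\<bar> powr (2 * s) * (cmod (fourier (zext a b (\<lambda>x. f m x - f n x)) \<omega>))^2))"
    by (intro lim_imp_Liminf[symmetric]) auto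
  qed
  also have "... \<le> liminf (\<lambda>m. FN s (zext a b (\<lambda>x. f m x - f n x)))"
   unfolding FN_def by (rule nn_integral_liminf) simp
  also have "... \<le> liminf (\<lambda>m. ennreal (e/2))"
  proof (rule Liminf_mono)
   show "\<forall>\<^sub>F m in sequentially. FN s (zext a b (\<lambda>x. f m x - f n x)) \<le> ennreal (e/2)"
    using eventually_ge_at_top[of N]
   proof eventually_elim
    case (elim m)
    have "FN s (zext a b (\<lambda>x. f m x - f n x)) \<le> W s a b (\<lambda>x. f m x - f n x)" by (simp add: W_def)
    also have "... \<le> ennreal (e/2)" using N[of m n] elim n by simp
    finally show ?case .
   qed
  qed
  finally have "FN s (zext a b (\<lambda>x. u x - f n x)) \<le> ennreal (e/2)" by (simp add: Liminf_const)
  moreover have "sq2 a b (\<lambda>x. u x - f n x) \<le> ennreal (e/2)" using N' n by simp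
  ultimately have "W s a b (\<lambda>x. u x - f n x) \<le> ennreal (e/2) + ennreal (e/2)" unfolding W_def by (rule add_mono[rotated])
  also have "... = ennreal e" using e by (simp add: ennreal_plus[symmetric] del: ennreal_plus)
  finally show ?thesis .
 qed
 then show "\<exists>N. \<forall>n\<ge>N. W s a b (\<lambda>x. u x - f n x) \<le> ennreal e" by blast
qed

section \<open>The norm with the infimum over extensions\<close>

lemma Hnorm2_le_W:
 assumes u: "zext a b u \<in> Borel" shows "Hnorm2 s a b u \<le> W s a b u"
proof (cases "sq2 a b u < \<infinity>")
 case True
 then have l: "L2i a b u" using u by (simp add: L2i_def)
 have "zext a b u \<in> extensions a b u"
  unfolding extensions_def using u L2i_integrable[OF l] L2i_square_integrable(1)[OF l] by (auto simp: zext_def)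
 then show ?thesis unfolding Hnorm2_alt W_def by (intro add_mono order_refl INF_lower)
qed (simp add: W_def less_top[symmetric])

lemma extensions_diff:
 assumes "w1 \<in> extensions a b u" "w2 \<in> extensions a b v" shows "(\<lambda>x. w1 x - w2 x) \<in> extensions a b (\<lambda>x. u x - v x)"
proof -
 have [measurable]: "w1 \<in> Borel" "w2 \<in> Borel" and i: "integrable lborel w1" "integrable lborel w2"
  "integrable lborel (\<lambda>x. (w1 x)^2)" "integrable lborel (\<lambda>x. (w2 x)^2)"
  and ae: "AE x in lborel. x \<in> {a<..<b} \<longrightarrow> w1 x = u x" "AE x in lborel. x \<in> {a<..<b} \<longrightarrow> w2 x = v x" using assms by (auto simp: extensions_def)
 have "integrable lborel (\<lambda>x. 2 * (w1 x)^2 + 2 * (w2 x)^2)" using i by simp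
 then have "integrable lborel (\<lambda>x. (w1 x - w2 x)^2)"
  by (rule Bochner_Integration.integrable_bound) (use sum_squares_le_diff in auto)
 moreover have "AE x in lborel. x \<in> {a<..<b} \<longrightarrow> w1 x - w2 x = u x - v x" using ae by eventually_elim auto
 ultimately show ?thesis using i unfolding extensions_def by auto
qed

lemma extensions_cmult:
 assumes "w \<in> extensions a b u" shows "(\<lambda>x. r * w x) \<in> extensions a b (\<lambda>x. r * u x)"
proof -
 have ae: "AE x in lborel. x \<in> {a<..<b} \<longrightarrow> w x = u x" using assms by (auto simp: extensions_def)
 then have "AE x in lborel. x \<in> {a<..<b} \<longrightarrow> r * w x = r * u x" by eventually_elim auto
 then show ?thesis using assms unfolding extensions_def by (auto simp: power_mult_distrib)
qed

lemma Hnorm2_diff_le: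
 assumes u: "zext a b u \<in> Borel" and v: "zext a b v \<in> Borel"
 shows "Hnorm2 s a b (\<lambda>x. u x - v x) \<le> 2 * Hnorm2 s a b u + 2 * Hnorm2 s a b v"
proof -
 let ?I = "\<lambda>u. INF w \<in> extensions a b u. FN s w"
 have I: "?I (\<lambda>x. u x - v x) \<le> 2 * ?I u + 2 * ?I v"
 proof (rule ennreal_le_epsilon)
  fix e :: real assume fin: "2 * ?I u + 2 * ?I v < top" and e: "0 < e"
  have fu: "?I u < top" "?I v < top" using fin by (auto simp: ennreal_mult_less_top)
  \<comment> \<open>Extensions within e/4 of each infimum: doubled and added, the two errors give
    e.\<close>
  have "?I u < ?I u + ennreal (e/4)" "?I v < ?I v + ennreal (e/4)"
  proof -
   have lt: "X < X + ennreal (e/4)" if "X < top" for X :: ennreal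
    using ennreal_add_left_cancel_less[of X 0 "ennreal (e/4)"] that e by (auto simp: less_top)
   show "?I u < ?I u + ennreal (e/4)" "?I v < ?I v + ennreal (e/4)" by (intro lt fu)+
  qed
  then obtain w1 w2 where w: "w1 \<in> extensions a b u" "FN s w1 < ?I u + ennreal (e/4)" "w2 \<in> extensions a b v" "FN s w2 < ?I v + ennreal (e/4)"
   using INF_less_iff[of "FN s" "extensions a b u"] INF_less_iff[of "FN s" "extensions a b v"] by blast
  have "?I (\<lambda>x. u x - v x) \<le> FN s (\<lambda>x. w1 x - w2 x)" by (rule INF_lower[OF extensions_diff[OF w(1,3)]])
  also have "... \<le> 2 * FN s w1 + 2 * FN s w2" by (rule FN_diff_le) (use w in \<open>auto simp: extensions_def\<close>)
  also have "... \<le> 2 * (?I u + ennreal (e/4)) + 2 * (?I v + ennreal (e/4))" using w by (intro add_mono mult_left_mono less_imp_le) auto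
  also have "... = 2 * ?I u + 2 * ?I v + (2 * ennreal (e/4) + 2 * ennreal (e/4))" by (simp add: distrib_left add_ac)
  also have "2 * ennreal (e/4) + 2 * ennreal (e/4) = ennreal e"
  proof -
   have "2 * ennreal (e/4) = ennreal (2 * (e/4))" using e by (subst ennreal_mult) auto
   then show ?thesis using e by (simp add: ennreal_plus[symmetric] del: ennreal_plus)
  qed
  finally show "?I (\<lambda>x. u x - v x) \<le> 2 * ?I u + 2 * ?I v + ennreal e" .
 qed
 have "Hnorm2 s a b (\<lambda>x. u x - v x) \<le> (2 * sq2 a b u + 2 * sq2 a b v) + (2 * ?I u + 2 * ?I v)"
  unfolding Hnorm2_alt by (intro add_mono I sq2_add_le u v)
 then show ?thesis unfolding Hnorm2_alt by (simp add: distrib_left add_ac)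
qed

lemma Hnorm2_cmult_le:
 assumes u: "zext a b u \<in> Borel" and r: "r \<noteq> 0"
 shows "Hnorm2 s a b (\<lambda>x. r * u x) \<le> ennreal (r^2) * Hnorm2 s a b u"
proof -
 let ?I = "\<lambda>u. INF w \<in> extensions a b u. FN s w"
 have "ennreal (1/r^2) * ?I (\<lambda>x. r * u x) \<le> ?I u"
 proof (rule INF_greatest)
  fix w assume w: "w \<in> extensions a b u"
  have "?I (\<lambda>x. r * u x) \<le> FN s (\<lambda>x. r * w x)" by (rule INF_lower[OF extensions_cmult[OF w]])
  also have "... = ennreal (r^2) * FN s w" by (rule FN_cmult) (use w in \<open>auto simp: extensions_def\<close>)
  finally have "ennreal (1/r^2) * ?I (\<lambda>x. r * u x) \<le> ennreal (1/r^2) * (ennreal (r^2) * FN s w)" by (rule mult_left_mono) simp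
  then show "ennreal (1/r^2) * ?I (\<lambda>x. r * u x) \<le> FN s w" using r by (simp add: mult.assoc[symmetric] ennreal_mult[symmetric])
 qed
 then have "ennreal (r^2) * (ennreal (1/r^2) * ?I (\<lambda>x. r * u x)) \<le> ennreal (r^2) * ?I u" by (rule mult_left_mono) simp
 then have "?I (\<lambda>x. r * u x) \<le> ennreal (r^2) * ?I u" using r by (simp add: mult.assoc[symmetric] ennreal_mult[symmetric])
 then show ?thesis unfolding Hnorm2_alt sq2_cmult[OF u] distrib_left by (intro add_mono order_refl)
qed

section \<open>Closure of the test functions and extension of operators\<close>

text \<open>Approximation measured in \<open>W\<close> instead of \<open>Hnorm2\<close>; by
  \<open>apx_iff\<close> the two notions admit the same sequences.\<close>

definition apx :: "real \<Rightarrow> real \<Rightarrow> real \<Rightarrow> (real \<Rightarrow> real) \<Rightarrow> (nat \<Rightarrow> real \<Rightarrow> real) \<Rightarrow> bool" where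
 "apx s a b u \<phi> \<longleftrightarrow> (\<forall>n. test_fun a b (\<phi> n)) \<and> (\<lambda>n. W s a b (\<lambda>x. u x - \<phi> n x)) \<longlonglongrightarrow> 0"

lemma zext_test_measurable: "test_fun a b \<phi> \<Longrightarrow> zext a b \<phi> \<in> Borel"
 by (simp add: zext_test_fun test_fun_measurable)

lemma ennreal_mult_eps: "0 < C \<Longrightarrow> 0 \<le> e \<Longrightarrow> ennreal C * ennreal (e / C) = ennreal e"
 by (simp add: ennreal_mult[symmetric])

lemma ennreal_le_of_null_seq:
 fixes X Y :: ennreal
 assumes "\<And>n. X \<le> Y + ennreal c * e n" "e \<longlonglongrightarrow> 0" shows "X \<le> Y"
proof (rule ennreal_le_epsilon)
 fix d :: real assume d: "0 < d"
 define c' where "c' = max c 1"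
 have c': "c' > 0" "c \<le> c'" by (auto simp: c'_def)
 obtain N where "\<And>n. n \<ge> N \<Longrightarrow> e n \<le> ennreal (d / c')" using ennreal_null_seqD[OF assms(2), of "d / c'"] d c' by auto
 then have "e N \<le> ennreal (d / c')" by simp
 then have "ennreal c * e N \<le> ennreal c' * ennreal (d / c')" using c' by (intro mult_mono ennreal_leI) auto
 also have "... = ennreal d" using c' d by (intro ennreal_mult_eps) auto
 finally have "Y + ennreal c * e N \<le> Y + ennreal d" by (rule add_left_mono)
 with assms(1)[of N] show "X \<le> Y + ennreal d" by (rule order_trans)
qed

lemma null_seq_le:
 fixes f g :: "nat \<Rightarrow> ennreal"
 assumes "\<And>n. f n \<le> g n" "g \<longlonglongrightarrow> 0" shows "f \<longlonglongrightarrow> 0"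
 by (rule tendsto_sandwich[OF _ _ tendsto_const assms(2)]) (use assms(1) in auto)

lemma null_seq_lin:
 fixes f g :: "nat \<Rightarrow> ennreal"
 assumes "f \<longlonglongrightarrow> 0" "g \<longlonglongrightarrow> 0" "c < top" "d < top" shows "(\<lambda>n. c * f n + d * g n) \<longlonglongrightarrow> 0"
proof -
 have "(\<lambda>n. c * f n + d * g n) \<longlonglongrightarrow> c * 0 + d * 0"
  using assms by (intro tendsto_add ennreal_tendsto_cmult) auto
 then show ?thesis by simp
qed

text \<open>\<open>W_le_Hnorm2\<close> speaks of test functions, and u - \<phi> n need not be one.
  It is applied to the differences \<phi> m - \<phi> n, which are small in \<open>Hnorm2\<close>,
  and \<open>W_limit\<close> transfers the result to u. Conversely, the extension by zero is a
  competitor in the infimum.\<close>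

lemma apx_iff:
 assumes s: "0 \<le> s" "s \<le> 1" "s \<noteq> 1/2" and ab: "a < b" and u: "zext a b u \<in> Borel"
 shows "(\<forall>n. test_fun a b (\<phi> n)) \<and> (\<lambda>n. Hnorm2 s a b (\<lambda>x. u x - \<phi> n x)) \<longlonglongrightarrow> 0 \<longleftrightarrow> apx s a b u \<phi>"
proof
 assume A: "(\<forall>n. test_fun a b (\<phi> n)) \<and> (\<lambda>n. Hnorm2 s a b (\<lambda>x. u x - \<phi> n x)) \<longlonglongrightarrow> 0"
 then have t: "\<And>n. test_fun a b (\<phi> n)" and l: "(\<lambda>n. Hnorm2 s a b (\<lambda>x. u x - \<phi> n x)) \<longlonglongrightarrow> 0" by auto
 note zm = zext_test_measurable[OF t]
 have um: "zext a b (\<lambda>x. u x - \<phi> n x) \<in> Borel" for n by (rule zext_diff_measurable[OF u zm])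
 obtain C where C: "C > 0" "\<And>\<phi>. test_fun a b \<phi> \<Longrightarrow> W s a b \<phi> \<le> ennreal C * Hnorm2 s a b \<phi>"
  using W_le_Hnorm2[OF s ab] by blast
 have "(\<lambda>n. W s a b (\<lambda>x. u x - \<phi> n x)) \<longlonglongrightarrow> 0"
 proof (rule W_limit[OF u zm ab])
  show "(\<lambda>n. sq2 a b (\<lambda>x. u x - \<phi> n x)) \<longlonglongrightarrow> 0"
   by (rule null_seq_le[OF _ l]) (simp add: Hnorm2_alt)
  show "sq2 a b (\<phi> n) < \<infinity>" for n by (rule sq2_test_fun[OF t])
  fix e :: real assume e: "0 < e"
  obtain N where N: "\<And>n. n \<ge> N \<Longrightarrow> Hnorm2 s a b (\<lambda>x. u x - \<phi> n x) \<le> ennreal (e / (4 * C))"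
   using ennreal_null_seqD[OF l, of "e / (4 * C)"] e C(1) by auto
  have "W s a b (\<lambda>x. \<phi> m x - \<phi> n x) \<le> ennreal e" if mn: "m \<ge> N" "n \<ge> N" for m n
  proof -
   have "W s a b (\<lambda>x. \<phi> m x - \<phi> n x) \<le> ennreal C * Hnorm2 s a b (\<lambda>x. \<phi> m x - \<phi> n x)" by (rule C(2)[OF test_fun_diff[OF t t]])
   also have "(\<lambda>x. \<phi> m x - \<phi> n x) = (\<lambda>x. (u x - \<phi> n x) - (u x - \<phi> m x))" by auto
   also have "Hnorm2 s a b ... \<le> 2 * Hnorm2 s a b (\<lambda>x. u x - \<phi> n x) + 2 * Hnorm2 s a b (\<lambda>x. u x - \<phi> m x)" by (rule Hnorm2_diff_le[OF um um])
   also have "... \<le> 2 * ennreal (e / (4 * C)) + 2 * ennreal (e / (4 * C))" by (intro add_mono mult_left_mono N mn) auto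
   also have "... = ennreal (e / C)"
   proof -
    have "2 * ennreal (e / (4 * C)) = ennreal (2 * (e / (4 * C)))" using e C(1) by (subst ennreal_mult) auto
    then show ?thesis using e C(1) by (simp add: ennreal_plus[symmetric] del: ennreal_plus)
   qed
   finally show ?thesis using ennreal_mult_eps[OF C(1), of e] e by (simp add: mult_left_mono)
  qed
  then show "\<exists>N. \<forall>m\<ge>N. \<forall>n\<ge>N. W s a b (\<lambda>x. \<phi> m x - \<phi> n x) \<le> ennreal e" by blast
 qed
 then show "apx s a b u \<phi>" using t by (simp add: apx_def)
next
 assume A: "apx s a b u \<phi>"
 then have t: "\<And>n. test_fun a b (\<phi> n)" and l: "(\<lambda>n. W s a b (\<lambda>x. u x - \<phi> n x)) \<longlonglongrightarrow> 0" by (auto simp: apx_def)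
 have "(\<lambda>n. Hnorm2 s a b (\<lambda>x. u x - \<phi> n x)) \<longlonglongrightarrow> 0"
  by (rule null_seq_le[OF Hnorm2_le_W[OF zext_diff_measurable[OF u zext_test_measurable[OF t]]] l])
 then show "(\<forall>n. test_fun a b (\<phi> n)) \<and> (\<lambda>n. Hnorm2 s a b (\<lambda>x. u x - \<phi> n x)) \<longlonglongrightarrow> 0" using t by blast
qed

lemma W_le_apx:
 assumes u: "zext a b u \<in> Borel" and \<phi>: "test_fun a b \<phi>"
 shows "W s a b u \<le> 2 * W s a b (\<lambda>x. u x - \<phi> x) + 2 * W s a b \<phi>" "W s a b \<phi> \<le> 2 * W s a b u + 2 * W s a b (\<lambda>x. u x - \<phi> x)"
proof -
 note z = zext_test_measurable[OF \<phi>]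
 note d = zext_diff_measurable[OF u z]
 show "W s a b u \<le> 2 * W s a b (\<lambda>x. u x - \<phi> x) + 2 * W s a b \<phi>"
  using W_lin_le[OF d z, of s 1] by simp
 show "W s a b \<phi> \<le> 2 * W s a b u + 2 * W s a b (\<lambda>x. u x - \<phi> x)"
  using W_diff_le[OF u d, of s] by simp
qed

lemma H0_iff:
 assumes s: "0 \<le> s" "s \<le> 1" "s \<noteq> 1/2" and ab: "a < b"
 shows "u \<in> H0 s a b \<longleftrightarrow> u \<in> Borel \<and> (\<exists>\<phi>. apx s a b u \<phi>)"
 unfolding H0_def using apx_iff[OF s ab zext_measurable, of u] by auto

lemma apx_lin:
 assumes u: "zext a b u \<in> Borel" and v: "zext a b v \<in> Borel" and A: "apx s a b u \<phi>" "apx s a b v \<psi>"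
 shows "apx s a b (\<lambda>x. u x + r * v x) (\<lambda>n x. \<phi> n x + r * \<psi> n x)"
proof -
 have t: "test_fun a b (\<phi> n)" "test_fun a b (\<psi> n)" for n using A by (auto simp: apx_def)
 have "(\<lambda>n. W s a b (\<lambda>x. (u x + r * v x) - (\<phi> n x + r * \<psi> n x))) \<longlonglongrightarrow> 0"
 proof (rule null_seq_le)
  fix n
  have e: "(\<lambda>x. (u x + r * v x) - (\<phi> n x + r * \<psi> n x)) = (\<lambda>x. (u x - \<phi> n x) + r * (v x - \<psi> n x))" by (simp add: algebra_simps)
  show "W s a b (\<lambda>x. (u x + r * v x) - (\<phi> n x + r * \<psi> n x)) \<le> 2 * W s a b (\<lambda>x. u x - \<phi> n x) + (2 * ennreal (r^2)) * W s a b (\<lambda>x. v x - \<psi> n x)"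
   unfolding e mult.assoc by (intro W_lin_le zext_diff_measurable u v zext_test_measurable t)
  show "(\<lambda>n. 2 * W s a b (\<lambda>x. u x - \<phi> n x) + (2 * ennreal (r^2)) * W s a b (\<lambda>x. v x - \<psi> n x)) \<longlonglongrightarrow> 0"
   by (rule null_seq_lin) (use A in \<open>auto simp: apx_def ennreal_mult_less_top\<close>)
 qed
 then show ?thesis using t by (auto simp: apx_def intro: test_fun_lin)
qed

lemma apx_const: "test_fun a b \<phi> \<Longrightarrow> apx s a b \<phi> (\<lambda>n. \<phi>)"
 unfolding apx_def by (simp add: W_def sq2_def zext_def FN_def fourier_def)

lemma H0_lin:
 assumes s: "0 \<le> s" "s \<le> 1" "s \<noteq> 1/2" and ab: "a < b" and "u \<in> H0 s a b" "v \<in> H0 s a b"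
 shows "(\<lambda>x. u x + r * v x) \<in> H0 s a b"
 using assms(5,6) unfolding H0_iff[OF s ab] by (auto intro: apx_lin zext_measurable)

lemma test_fun_H0:
 assumes s: "0 \<le> s" "s \<le> 1" "s \<noteq> 1/2" and ab: "a < b" and "test_fun a b \<phi>"
 shows "\<phi> \<in> H0 s a b"
 unfolding H0_iff[OF s ab] using assms(5) by (auto intro: test_fun_measurable apx_const)

section \<open>Comparison of different orders and finiteness of the energy\<close>

lemma FN_interp:
 assumes s: "0 \<le> s" "s \<le> \<tau>" and w: "integrable lborel w" and w2: "integrable lborel (\<lambda>x. (w x)^2)"
 shows "FN s w \<le> ennreal (2 * pi) * (NN x. ennreal ((w x)^2)) + FN \<tau> w"
proof -
 have [measurable]: "w \<in> Borel" using w by auto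
 have "FN s w \<le> (NN \<omega>. ennreal ((cmod (fourier w \<omega>))^2) + ennreal (\<bar>\<omega>\<bar> powr (2 * \<tau>) * (cmod (fourier w \<omega>))^2))"
  unfolding FN_def
 proof (rule nn_integral_mono)
  fix \<omega> :: real
  have "\<bar>\<omega>\<bar> powr (2 * s) \<le> 1 + \<bar>\<omega>\<bar> powr (2 * \<tau>)"
  proof (cases "\<bar>\<omega>\<bar> \<le> 1")
   case True
   then have "\<bar>\<omega>\<bar> powr (2 * s) \<le> 1" using s by (intro powr_le1) auto
   then show ?thesis by (simp add: add_increasing2)
  next
   case False
   then have "\<bar>\<omega>\<bar> powr (2 * s) \<le> \<bar>\<omega>\<bar> powr (2 * \<tau>)" using s by (intro powr_mono) auto
   then show ?thesis by simp
  qed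
  then have "\<bar>\<omega>\<bar> powr (2 * s) * (cmod (fourier w \<omega>))^2 \<le> (1 + \<bar>\<omega>\<bar> powr (2 * \<tau>)) * (cmod (fourier w \<omega>))^2" by (rule mult_right_mono) simp
  then have "ennreal (\<bar>\<omega>\<bar> powr (2 * s) * (cmod (fourier w \<omega>))^2) \<le> ennreal ((cmod (fourier w \<omega>))^2 + \<bar>\<omega>\<bar> powr (2 * \<tau>) * (cmod (fourier w \<omega>))^2)"
   by (intro ennreal_leI) (simp add: distrib_right)
  then show "ennreal (\<bar>\<omega>\<bar> powr (2 * s) * (cmod (fourier w \<omega>))^2) \<le> ennreal ((cmod (fourier w \<omega>))^2) + ennreal (\<bar>\<omega>\<bar> powr (2 * \<tau>) * (cmod (fourier w \<omega>))^2)"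
   by simp
 qed
 also have "... = (NN \<omega>. ennreal ((cmod (fourier w \<omega>))^2)) + FN \<tau> w"
  unfolding FN_def by (rule nn_integral_add) simp_all
 also have "... \<le> ennreal (2 * pi) * (NN x. ennreal ((w x)^2)) + FN \<tau> w"
  by (intro add_right_mono fourier_bessel w w2)
 finally show ?thesis .
qed

text \<open>Lower powers of |\<omega>| are bounded by 1 plus higher ones, and the 1 is paid by
  Bessel. This lets right derivatives of order 1 - s < s act on functions of order s.\<close>

lemma W_mono:
 assumes s: "0 \<le> s" "s \<le> \<tau>" and u: "zext a b u \<in> Borel"
 shows "W s a b u \<le> ennreal (1 + 2 * pi) * W \<tau> a b u"
proof (cases "sq2 a b u < \<infinity>")
 case True
 then have l: "L2i a b u" using u by (simp add: L2i_def)
 have "W s a b u \<le> sq2 a b u + (ennreal (2 * pi) * sq2 a b u + FN \<tau> (zext a b u))"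
  unfolding W_def sq2_zext[of a b u] by (intro add_mono order_refl FN_interp s L2i_integrable l L2i_square_integrable)
 also have "... = ennreal (1 + 2 * pi) * sq2 a b u + 1 * FN \<tau> (zext a b u)" by (simp add: ennreal_plus distrib_right add_ac)
 also have "... \<le> ennreal (1 + 2 * pi) * sq2 a b u + ennreal (1 + 2 * pi) * FN \<tau> (zext a b u)"
  by (intro add_left_mono mult_right_mono) (auto simp: ennreal_plus)
 finally show ?thesis by (simp add: W_def distrib_left)
next
 case False
 then have "ennreal (1 + 2 * pi) * W \<tau> a b u = top" by (auto simp: W_def ennreal_mult_eq_top_iff less_top[symmetric] add_pos_pos)
 then show ?thesis by (simp only: top_greatest)
qed

text \<open>Order 1 is checked through the derivative, again a test function, and dominates every
  lower order.\<close>

lemma W_test_finite: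
 assumes \<phi>: "test_fun a b \<phi>" and s: "0 \<le> s" "s \<le> 1" shows "W s a b \<phi> < \<infinity>"
proof -
 note d = test_fun_deriv[OF \<phi>]
 have "FN 1 \<phi> \<le> ennreal (2 * pi) * sq2 a b (deriv \<phi>)"
  unfolding FN_1_deriv[OF \<phi>] sq2_test_fun(1)[OF d] by (intro fourier_bessel test_fun_integrable[OF d])
 also have "... < \<infinity>" using sq2_test_fun(2)[OF d] by (simp add: ennreal_mult_less_top)
 finally have "W 1 a b \<phi> < \<infinity>" unfolding W_def zext_test_fun[OF \<phi>] using sq2_test_fun(2)[OF \<phi>] by simp
 then have "ennreal (1 + 2 * pi) * W 1 a b \<phi> < \<infinity>" by (simp add: ennreal_mult_less_top)
 then show ?thesis using W_mono[OF s zext_test_measurable[OF \<phi>]] by (rule le_less_trans[rotated])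
qed

lemma W_apx_finite:
 assumes u: "zext a b u \<in> Borel" and A: "apx s a b u \<phi>" and s: "0 \<le> s" "s \<le> 1"
 shows "W s a b u < \<infinity>"
proof -
 obtain N where N: "\<And>n. n \<ge> N \<Longrightarrow> W s a b (\<lambda>x. u x - \<phi> n x) \<le> ennreal 1" using ennreal_null_seqD[OF _ zero_less_one] A unfolding apx_def by blast
 have t: "test_fun a b (\<phi> N)" using A by (simp add: apx_def)
 have "W s a b u \<le> 2 * ennreal 1 + 2 * W s a b (\<phi> N)"
  by (rule order_trans[OF W_le_apx(1)[OF u t] add_right_mono[OF mult_left_mono[OF N]]]) auto
 also have "... < \<infinity>" using W_test_finite[OF t s] by (simp add: ennreal_mult_less_top)
 finally show ?thesis .
qed

text \<open>Linearity is asked inside (a,b) alone, where the convolution formulas describe the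
  derivatives.\<close>

definition bounded_test_op :: "real \<Rightarrow> real \<Rightarrow> real \<Rightarrow> ((real \<Rightarrow> real) \<Rightarrow> real \<Rightarrow> real) \<Rightarrow> bool" where
 "bounded_test_op s a b D \<longleftrightarrow> (\<forall>\<phi>. test_fun a b \<phi> \<longrightarrow> zext a b (D \<phi>) \<in> Borel) \<and>
  (\<forall>\<phi> \<psi> r. test_fun a b \<phi> \<longrightarrow> test_fun a b \<psi> \<longrightarrow> (\<forall>x\<in>{a<..<b}. D (\<lambda>x. \<phi> x + r * \<psi> x) x = D \<phi> x + r * D \<psi> x)) \<and>
  (\<exists>C>0. \<forall>\<phi>. test_fun a b \<phi> \<longrightarrow> sq2 a b (D \<phi>) \<le> ennreal C * W s a b \<phi>)"

lemma bounded_test_op_diff: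
 assumes "bounded_test_op s a b D" "test_fun a b \<phi>" "test_fun a b \<psi>"
 shows "sq2 a b (\<lambda>x. D \<phi> x - D \<psi> x) = sq2 a b (D (\<lambda>x. \<phi> x - \<psi> x))"
proof (rule sq2_cong)
 fix x assume "x \<in> {a<..<b}"
 then have "D (\<lambda>x. \<phi> x + (-1) * \<psi> x) x = D \<phi> x + (-1) * D \<psi> x" using assms unfolding bounded_test_op_def by blast
 then show "D \<phi> x - D \<psi> x = D (\<lambda>x. \<phi> x - \<psi> x) x" by simp
qed

text \<open>The choice in \<open>ext_op\<close> is legitimate: the images of an approximating
  sequence are Cauchy in L2, and comparison with this sequence shows that every other one has the
  same limit. The value is thus determined up to null sets on (a,b).\<close>

lemma ext_op_converges:
 assumes s: "0 \<le> s" "s \<le> 1" "s \<noteq> 1/2" and ab: "a < b" and D: "bounded_test_op s a b D" and u: "zext a b u \<in> Borel" and ex: "\<exists>\<phi>. apx s a b u \<phi>"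
 shows "ext_op s a b D u \<in> Borel" "\<And>\<phi>. apx s a b u \<phi> \<Longrightarrow> (\<lambda>n. sq2 a b (\<lambda>x. D (\<phi> n) x - ext_op s a b D u x)) \<longlonglongrightarrow> 0"
proof -
 obtain \<phi> where \<phi>: "apx s a b u \<phi>" using ex by blast
 then have t: "\<And>n. test_fun a b (\<phi> n)" and l: "(\<lambda>n. W s a b (\<lambda>x. u x - \<phi> n x)) \<longlonglongrightarrow> 0" by (auto simp: apx_def)
 obtain C where C: "C > 0" "\<And>\<phi>. test_fun a b \<phi> \<Longrightarrow> sq2 a b (D \<phi>) \<le> ennreal C * W s a b \<phi>" using D unfolding bounded_test_op_def by blast
 have Dm: "zext a b (D \<phi>) \<in> Borel" if "test_fun a b \<phi>" for \<phi> using D that unfolding bounded_test_op_def by blast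
 have diff: "sq2 a b (\<lambda>x. D \<psi> x - D \<theta> x) \<le> ennreal C * (2 * W s a b (\<lambda>x. u x - \<theta> x) + 2 * W s a b (\<lambda>x. u x - \<psi> x))"
  if t: "test_fun a b \<psi>" "test_fun a b \<theta>" for \<psi> \<theta>
 proof -
  have "sq2 a b (\<lambda>x. D \<psi> x - D \<theta> x) \<le> ennreal C * W s a b (\<lambda>x. \<psi> x - \<theta> x)"
   unfolding bounded_test_op_diff[OF D t] by (rule C(2)[OF test_fun_diff[OF t]])
  also have "(\<lambda>x. \<psi> x - \<theta> x) = (\<lambda>x. (u x - \<theta> x) - (u x - \<psi> x))" by auto
  also have "W s a b ... \<le> 2 * W s a b (\<lambda>x. u x - \<theta> x) + 2 * W s a b (\<lambda>x. u x - \<psi> x)"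
   by (intro W_diff_le zext_diff_measurable u zext_test_measurable t)
  finally show ?thesis by (simp add: mult_left_mono)
 qed
 have "\<exists>g\<in>Borel. (\<lambda>n. sq2 a b (\<lambda>x. D (\<phi> n) x - g x)) \<longlonglongrightarrow> 0"
 proof (rule L2ab_complete[OF Dm[OF t]])
  fix e :: real assume e: "0 < e"
  obtain N where N: "\<And>n. n \<ge> N \<Longrightarrow> W s a b (\<lambda>x. u x - \<phi> n x) \<le> ennreal (e / (4 * C))"
   using ennreal_null_seqD[OF l, of "e / (4 * C)"] e C(1) by auto
  have "sq2 a b (\<lambda>x. D (\<phi> m) x - D (\<phi> n) x) \<le> ennreal e" if mn: "m \<ge> N" "n \<ge> N" for m n
  proof -
   have "sq2 a b (\<lambda>x. D (\<phi> m) x - D (\<phi> n) x) \<le> ennreal C * (2 * ennreal (e / (4 * C)) + 2 * ennreal (e / (4 * C)))"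
    by (rule order_trans[OF diff[OF t t]]) (intro add_mono mult_left_mono N mn zero_le)
   also have "2 * ennreal (e / (4 * C)) + 2 * ennreal (e / (4 * C)) = ennreal (e / C)"
   proof -
    have "2 * ennreal (e / (4 * C)) = ennreal (2 * (e / (4 * C)))" using e C(1) by (subst ennreal_mult) auto
    then show ?thesis using e C(1) by (simp add: ennreal_plus[symmetric] del: ennreal_plus)
   qed
   finally show ?thesis using ennreal_mult_eps[OF C(1), of e] e by simp
  qed
  then show "\<exists>N. \<forall>m\<ge>N. \<forall>n\<ge>N. sq2 a b (\<lambda>x. D (\<phi> m) x - D (\<phi> n) x) \<le> ennreal e" by blast
 qed
 then obtain g where g: "g \<in> Borel" "(\<lambda>n. sq2 a b (\<lambda>x. D (\<phi> n) x - g x)) \<longlonglongrightarrow> 0" by blast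
 have all: "(\<lambda>n. sq2 a b (\<lambda>x. D (\<psi> n) x - g x)) \<longlonglongrightarrow> 0" if \<psi>: "apx s a b u \<psi>" for \<psi>
 proof -
  have t': "\<And>n. test_fun a b (\<psi> n)" and l': "(\<lambda>n. W s a b (\<lambda>x. u x - \<psi> n x)) \<longlonglongrightarrow> 0" using \<psi> by (auto simp: apx_def)
  have gm: "zext a b g \<in> Borel" by (rule zext_measurable[OF g(1)])
  show ?thesis
  proof (rule null_seq_le)
   fix n
   have e: "(\<lambda>x. D (\<psi> n) x - g x) = (\<lambda>x. (D (\<psi> n) x - D (\<phi> n) x) - (g x - D (\<phi> n) x))" by auto
   have e': "sq2 a b (\<lambda>x. g x - D (\<phi> n) x) = sq2 a b (\<lambda>x. D (\<phi> n) x - g x)" unfolding sq2_def by (simp add: power2_commute)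
   have "sq2 a b (\<lambda>x. D (\<psi> n) x - g x) \<le> 2 * sq2 a b (\<lambda>x. D (\<psi> n) x - D (\<phi> n) x) + 2 * sq2 a b (\<lambda>x. g x - D (\<phi> n) x)"
    by (subst e) (intro sq2_add_le zext_diff_measurable Dm t t' gm)
   also have "... \<le> 2 * (ennreal C * (2 * W s a b (\<lambda>x. u x - \<phi> n x) + 2 * W s a b (\<lambda>x. u x - \<psi> n x))) + 2 * sq2 a b (\<lambda>x. D (\<phi> n) x - g x)"
    unfolding e' by (intro add_mono mult_left_mono diff t t' order_refl) auto
   finally show "sq2 a b (\<lambda>x. D (\<psi> n) x - g x) \<le> (2 * ennreal C) * (2 * W s a b (\<lambda>x. u x - \<phi> n x) + 2 * W s a b (\<lambda>x. u x - \<psi> n x)) + 2 * sq2 a b (\<lambda>x. D (\<phi> n) x - g x)"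
    by (simp add: mult.assoc)
   show "(\<lambda>n. (2 * ennreal C) * (2 * W s a b (\<lambda>x. u x - \<phi> n x) + 2 * W s a b (\<lambda>x. u x - \<psi> n x)) + 2 * sq2 a b (\<lambda>x. D (\<phi> n) x - g x)) \<longlonglongrightarrow> 0"
    by (intro null_seq_lin l l' g) (auto simp: ennreal_mult_less_top)
  qed
 qed
 have sq: "(NN x. ennreal ((D (\<phi> n) x - g x)^2) * indicator {a<..<b} x) = sq2 a b (\<lambda>x. D (\<phi> n) x - g x)" for \<phi> n g
  unfolding sq2_def ..
 define P where "P g \<longleftrightarrow> g \<in> borel_measurable lborel \<and> (\<forall>\<phi>. apx s a b u \<phi> \<longrightarrow> (\<lambda>n. sq2 a b (\<lambda>x. D (\<phi> n) x - g x)) \<longlonglongrightarrow> 0)" for g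
 have "\<exists>g. P g" unfolding P_def using g(1) all by auto
 then have "P (SOME g. P g)" by (rule someI_ex)
 moreover have "ext_op s a b D u = (SOME g. P g)"
  unfolding ext_op_def apx_iff[OF s ab u] sq P_def ..
 ultimately have "P (ext_op s a b D u)" by simp
 then show "ext_op s a b D u \<in> Borel" "\<And>\<phi>. apx s a b u \<phi> \<Longrightarrow> (\<lambda>n. sq2 a b (\<lambda>x. D (\<phi> n) x - ext_op s a b D u x)) \<longlonglongrightarrow> 0" unfolding P_def by auto
qed

lemma deriv_lin:
 assumes "test_fun a b \<phi>" "test_fun a b \<psi>"
 shows "deriv (\<lambda>x. \<phi> x + r * \<psi> x) x = deriv \<phi> x + r * deriv \<psi> x"
 by (rule DERIV_imp_deriv) (auto intro!: derivative_eq_intros smooth_DERIV test_fun_smooth[OF assms(1)] test_fun_smooth[OF assms(2)])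

lemma conv_exp_lin:
 assumes k: "integrable lborel k" and \<phi>: "test_fun a b \<phi>" and \<psi>: "test_fun a b \<psi>"
 shows "(LB t. k t * deriv (\<lambda>x. exp (l * x) * (\<phi> x + r * \<psi> x)) (y - s * t))
  = (LB t. k t * deriv (\<lambda>x. exp (l * x) * \<phi> x) (y - s * t)) + r * (LB t. k t * deriv (\<lambda>x. exp (l * x) * \<psi> x) (y - s * t))"
proof -
 have e: "(\<lambda>x. exp (l * x) * (\<phi> x + r * \<psi> x)) = (\<lambda>x. exp (l * x) * \<phi> x + r * (exp (l * x) * \<psi> x))" by (simp add: algebra_simps)
 show ?thesis
  unfolding e deriv_lin[OF test_fun_exp[OF \<phi>] test_fun_exp[OF \<psi>]]
  using test_fun_conv_integrable[OF k test_fun_deriv[OF test_fun_exp[OF \<phi>, of l]], of y s] test_fun_conv_integrable[OF k test_fun_deriv[OF test_fun_exp[OF \<psi>, of l]], of y s]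
  by (simp add: distrib_left mult.left_commute)
qed

lemma conv_exp_measurable:
 assumes k: "integrable lborel k" and \<phi>: "test_fun a b \<phi>"
 shows "(\<lambda>x. LB t. k t * deriv (\<lambda>x. exp (l * x) * \<phi> x) (x - s * t)) \<in> Borel"
 by (intro borel_measurable_continuous_onI continuous_at_imp_continuous_on ballI conv_isCont[OF k test_fun_deriv[OF test_fun_exp[OF \<phi>]]])

lemma zext_cong: "(\<And>x. x \<in> {a<..<b} \<Longrightarrow> g x = h x) \<Longrightarrow> zext a b g = zext a b h"
 by (auto simp: zext_def indicator_def)

lemma bounded_test_op_DL:
 assumes ab: "a < b" and s: "0 < s" "s \<le> 1"
 shows "bounded_test_op s a b (DL a s lam)"
 unfolding bounded_test_op_def
proof (intro conjI allI impI ballI DL_bound[OF ab s])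
 fix \<phi> assume \<phi>: "test_fun a b \<phi>"
 show "zext a b (DL a s lam \<phi>) \<in> Borel"
 proof (cases "s = 1")
  case True
  have e: "zext a b (DL a s lam \<phi>) = zext a b (\<lambda>x. deriv \<phi> x + lam * \<phi> x)" by (rule zext_cong) (simp add: True DL_1[OF \<phi> _ ab])
  show ?thesis unfolding e by (intro zext_test_measurable test_fun_lin test_fun_deriv \<phi>)
 next
  case False
  then have s1: "s < 1" using s by simp
  have e: "zext a b (DL a s lam \<phi>) = zext a b (\<lambda>x. exp (- lam * x) / Gamma (1 - s) * (LB t. kern s (b - a) t * deriv (\<lambda>x. exp (lam * x) * \<phi> x) (x - 1 * t)))"
   by (rule zext_cong, rule DL_formula[OF \<phi> _ s1 _ ab]) (use s in auto)
  have [measurable]: "(\<lambda>x. LB t. kern s (b - a) t * deriv (\<lambda>x. exp (lam * x) * \<phi> x) (x - 1 * t)) \<in> Borel"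
   by (rule conv_exp_measurable[OF kern_integrable(1)[OF s1] \<phi>]) (use ab in simp)
  show ?thesis unfolding e by (rule zext_measurable) measurable
 qed
next
 fix \<phi> \<psi> r x assume \<phi>: "test_fun a b \<phi>" and \<psi>: "test_fun a b \<psi>" and x: "x \<in> {a<..<b}"
 note l = test_fun_lin[OF \<phi> \<psi>, of r]
 show "DL a s lam (\<lambda>x. \<phi> x + r * \<psi> x) x = DL a s lam \<phi> x + r * DL a s lam \<psi> x"
 proof (cases "s = 1")
  case True
  show ?thesis unfolding True using x by (simp add: DL_1[OF _ _ ab] \<phi> \<psi> l deriv_lin[OF \<phi> \<psi>] algebra_simps)
 next
  case False
  then have s1: "0 \<le> s" "s < 1" using s by auto
  have xb: "x < b" using x by simp
  have k: "integrable lborel (kern s (b - a))" by (rule kern_integrable(1)) (use s1 ab in auto)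
  show ?thesis
   unfolding DL_formula[OF l s1 xb ab] DL_formula[OF \<phi> s1 xb ab] DL_formula[OF \<psi> s1 xb ab] conv_exp_lin[OF k \<phi> \<psi>] by (simp add: algebra_simps)
 qed
qed

lemma bounded_test_op_DR:
 assumes ab: "a < b" and s: "0 < s \<or> s = 0 \<and> lam = 0" "s \<le> 1"
 shows "bounded_test_op s a b (DR b s lam)"
 unfolding bounded_test_op_def
proof (intro conjI allI impI ballI DR_bound[OF ab s])
 fix \<phi> assume \<phi>: "test_fun a b \<phi>"
 show "zext a b (DR b s lam \<phi>) \<in> Borel"
 proof (cases "s = 1")
  case True
  have e: "zext a b (DR b s lam \<phi>) = zext a b (\<lambda>x. - deriv \<phi> x + lam * \<phi> x)" by (rule zext_cong) (simp add: True DR_1[OF \<phi> _ ab])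
  have [measurable]: "\<phi> \<in> Borel" "deriv \<phi> \<in> Borel" by (intro test_fun_measurable[OF \<phi>] test_fun_measurable[OF test_fun_deriv[OF \<phi>]])+
  show ?thesis unfolding e by (rule zext_measurable) measurable
 next
  case False
  then have s1: "0 \<le> s" "s < 1" using s by auto
  have e: "zext a b (DR b s lam \<phi>) = zext a b (\<lambda>x. - exp (lam * x) / Gamma (1 - s) * (LB t. kern s (b - a) t * deriv (\<lambda>x. exp (- lam * x) * \<phi> x) (x - (-1) * t)))"
   by (rule zext_cong, rule DR_formula[OF \<phi> s1 _ ab]) auto
  have [measurable]: "(\<lambda>x. LB t. kern s (b - a) t * deriv (\<lambda>x. exp (- lam * x) * \<phi> x) (x - (-1) * t)) \<in> Borel"
   by (rule conv_exp_measurable[OF kern_integrable(1)[OF s1(2)] \<phi>]) (use ab in simp)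
  show ?thesis unfolding e by (rule zext_measurable) measurable
 qed
next
 fix \<phi> \<psi> r x assume \<phi>: "test_fun a b \<phi>" and \<psi>: "test_fun a b \<psi>" and x: "x \<in> {a<..<b}"
 note l = test_fun_lin[OF \<phi> \<psi>, of r]
 show "DR b s lam (\<lambda>x. \<phi> x + r * \<psi> x) x = DR b s lam \<phi> x + r * DR b s lam \<psi> x"
 proof (cases "s = 1")
  case True
  show ?thesis unfolding True using x by (simp add: DR_1[OF _ _ ab] \<phi> \<psi> l deriv_lin[OF \<phi> \<psi>] algebra_simps)
 next
  case False
  then have s1: "0 \<le> s" "s < 1" using s by auto
  have xb: "a < x" using x by simp
  have k: "integrable lborel (kern s (b - a))" by (rule kern_integrable(1)) (use s1 ab in auto)
  show ?thesis
   unfolding DR_formula[OF l s1 xb ab] DR_formula[OF \<phi> s1 xb ab] DR_formula[OF \<psi> s1 xb ab] conv_exp_lin[OF k \<phi> \<psi>] by (simp add: algebra_simps)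
 qed
qed

section \<open>The Lax--Milgram lemma\<close>

text \<open>The solution minimises J v = S v v - 2 * g v. Testing midpoints makes a minimising
  sequence Cauchy in q, and the first variation at the limit is the equation. Since q may be a
  seminorm on functions, u is one of possibly many limits.\<close>

lemma lax_milgram_symmetric:
 fixes V :: "('a \<Rightarrow> real) set" and S :: "('a \<Rightarrow> real) \<Rightarrow> ('a \<Rightarrow> real) \<Rightarrow> real" and q g :: "('a \<Rightarrow> real) \<Rightarrow> real"
 assumes ne: "v0 \<in> V" and lin: "\<And>u v r. u \<in> V \<Longrightarrow> v \<in> V \<Longrightarrow> (\<lambda>x. u x + r * v x) \<in> V"
  and S1: "\<And>u v w r. u \<in> V \<Longrightarrow> v \<in> V \<Longrightarrow> w \<in> V \<Longrightarrow> S (\<lambda>x. u x + r * v x) w = S u w + r * S v w"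
  and sym: "\<And>u v. u \<in> V \<Longrightarrow> v \<in> V \<Longrightarrow> S u v = S v u"
  and bd: "\<And>u v. u \<in> V \<Longrightarrow> v \<in> V \<Longrightarrow> \<bar>S u v\<bar> \<le> C * q u * q v"
  and co: "\<And>u. u \<in> V \<Longrightarrow> c * (q u)^2 \<le> S u u" and c: "0 < c" and q0: "\<And>u. u \<in> V \<Longrightarrow> 0 \<le> q u"
  and complete: "\<And>x. (\<And>n::nat. x n \<in> V) \<Longrightarrow> (\<And>e. 0 < e \<Longrightarrow> \<exists>N. \<forall>m\<ge>N. \<forall>n\<ge>N. (q (\<lambda>t. x m t - x n t))^2 \<le> e) \<Longrightarrow> \<exists>u\<in>V. (\<lambda>n. q (\<lambda>t. u t - x n t)) \<longlonglongrightarrow> 0"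
  and g1: "\<And>u v r. u \<in> V \<Longrightarrow> v \<in> V \<Longrightarrow> g (\<lambda>x. u x + r * v x) = g u + r * g v" and gb: "\<And>v. v \<in> V \<Longrightarrow> \<bar>g v\<bar> \<le> K * q v"
 shows "\<exists>u\<in>V. \<forall>v\<in>V. S u v = g v"
proof -
 have S2: "S w (\<lambda>x. u x + r * v x) = S w u + r * S w v" if "u \<in> V" "v \<in> V" "w \<in> V" for u v w r
  using S1[OF that] sym that lin[OF that(1,2)] by metis
 define J where "J v = S v v - 2 * g v" for v
 have Jlow: "J v \<ge> - K\<^sup>2 / c" if v: "v \<in> V" for v
 proof -
  have "0 \<le> (c * q v - K)^2 / c" using c by simp
  also have "... = c * (q v)^2 - 2 * (K * q v) + K^2 / c" using c by (simp add: power2_eq_square field_simps)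
  finally show ?thesis unfolding J_def using co[OF v] gb[OF v] by simp
 qed
 have bb: "bdd_below (J ` V)" using Jlow by (auto intro!: bdd_belowI)
 define I where "I = Inf (J ` V)"
 have Imin: "I \<le> J v" if "v \<in> V" for v unfolding I_def by (rule cInf_lower[OF _ bb]) (use that in auto)
 have "\<exists>x\<in>V. J x < I + e" if "e > 0" for e
 proof -
  have "Inf (J ` V) < I + e" using that by (simp add: I_def)
  then show ?thesis using cInf_less_iff[OF _ bb] ne by auto
 qed
 then have "\<forall>n. \<exists>x\<in>V. J x < I + inverse (real (Suc n))" by simp
 then obtain x where x: "\<And>n. x n \<in> V" "\<And>n. J (x n) < I + inverse (real (Suc n))" by metis
 have Jadd: "J (\<lambda>t. u t + r * v t) = J u + 2 * r * (S u v - g v) + r^2 * S v v" if "u \<in> V" "v \<in> V" for u v r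
  unfolding J_def S1[OF that lin[OF that]] S2[OF that that(1)] S2[OF that that(2)] g1[OF that] using sym[OF that]
  by (simp add: power2_eq_square algebra_simps)
 have xe: "0 \<le> inverse (real (Suc n)) + 2 * r * (S (x n) v - g v) + r^2 * S v v" if v: "v \<in> V" for n r v
  using Imin[OF lin[OF x(1)[of n] v, of r]] x(2)[of n] unfolding Jadd[OF x(1) v] by linarith
 have cauchy: "c * (q (\<lambda>t. x m t - x n t))^2 \<le> 2 * inverse (real (Suc m)) + 2 * inverse (real (Suc n))" for m n
 proof -
  define d where "d = (\<lambda>t. x m t - x n t)"
  have dV: "d \<in> V" unfolding d_def using lin[OF x(1)[of m] x(1)[of n], of "-1"] by simp
  have xm: "x m = (\<lambda>t. x n t + 1 * d t)" by (auto simp: d_def)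
  \<comment> \<open>The midpoint of x n and x m lies in V, so J is at least I there; this is the
    parallelogram argument behind the Cauchy property.\<close>
  have mid: "(\<lambda>t. x n t + (1/2) * d t) \<in> V" by (rule lin[OF x(1) dV])
  have Jm: "J (x m) = J (x n) + 2 * (S (x n) d - g d) + S d d" using Jadd[OF x(1)[of n] dV, of 1] unfolding xm[symmetric] by simp
  have "I \<le> J (x n) + (S (x n) d - g d) + S d d / 4" using Imin[OF mid] unfolding Jadd[OF x(1)[of n] dV, of "1/2"] by (simp add: power2_eq_square)
  then have "S d d \<le> 2 * J (x m) + 2 * J (x n) - 4 * I" unfolding Jm by (simp add: field_simps)
  then have "S d d \<le> 2 * inverse (real (Suc m)) + 2 * inverse (real (Suc n))" using x(2)[of m] x(2)[of n] by linarith
  then show ?thesis using co[OF dV] unfolding d_def by linarith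
 qed
 have "\<exists>u\<in>V. (\<lambda>n. q (\<lambda>t. u t - x n t)) \<longlonglongrightarrow> 0"
 proof (rule complete[OF x(1)])
  fix e :: real assume e: "0 < e"
  obtain N where N: "\<And>n. n \<ge> N \<Longrightarrow> inverse (real (Suc n)) < c * e / 4"
   using order_tendstoD(2)[OF LIMSEQ_inverse_real_of_nat, of "c * e / 4"] c e unfolding eventually_sequentially by auto
  have "(q (\<lambda>t. x m t - x n t))^2 \<le> e" if "m \<ge> N" "n \<ge> N" for m n
  proof -
   have "c * (q (\<lambda>t. x m t - x n t))^2 \<le> c * e" using cauchy[of m n] N[OF that(1)] N[OF that(2)] by linarith
   then show ?thesis using c by simp
  qed
  then show "\<exists>N. \<forall>m\<ge>N. \<forall>n\<ge>N. (q (\<lambda>t. x m t - x n t))^2 \<le> e" by blast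
 qed
 then obtain u where u: "u \<in> V" "(\<lambda>n. q (\<lambda>t. u t - x n t)) \<longlonglongrightarrow> 0" by blast
 have conv: "(\<lambda>n. S (x n) v) \<longlonglongrightarrow> S u v" if v: "v \<in> V" for v
 proof (rule LIM_zero_cancel)
  have z: "(\<lambda>n. C * q (\<lambda>t. u t - x n t) * q v) \<longlonglongrightarrow> 0"
   using tendsto_mult_right[OF tendsto_mult_left[OF u(2), of C], of "q v"] by simp
  show "(\<lambda>n. S (x n) v - S u v) \<longlonglongrightarrow> 0"
  proof (rule Lim_null_comparison[OF _ z], rule always_eventually, rule allI)
   fix n
   have dV: "(\<lambda>t. u t + (-1) * x n t) \<in> V" by (rule lin[OF u(1) x(1)])
   have "S (\<lambda>t. u t + (-1) * x n t) v = S u v - S (x n) v" unfolding S1[OF u(1) x(1) v] by simp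
   then show "norm (S (x n) v - S u v) \<le> C * q (\<lambda>t. u t - x n t) * q v" using bd[OF dV v] by simp
  qed
 qed
 have "S u v = g v" if v: "v \<in> V" for v
 proof -
  \<comment> \<open>As x n minimises J up to 1 / (n + 1), the limit leaves a nonnegative quadratic
    in r without constant term, whose linear coefficient must vanish.\<close>
  have "(S u v - g v)^2 \<le> 0 * S v v"
  proof (rule quadratic_nonneg_discr)
   fix r
   have "(\<lambda>n. inverse (real (Suc n)) + 2 * r * (S (x n) v - g v) + r^2 * S v v) \<longlonglongrightarrow> 0 + 2 * r * (S u v - g v) + r^2 * S v v"
    by (intro tendsto_intros conv[OF v] LIMSEQ_inverse_real_of_nat)
   then show "0 \<le> 0 + 2 * r * (S u v - g v) + r^2 * S v v"
    by (rule LIMSEQ_le_const) (use xe[OF v] in auto)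
  qed
  then show ?thesis by simp
 qed
 then show ?thesis using u(1) by blast
qed

text \<open>The nonsymmetric case: with the symmetric part \<open>S\<close> of \<open>A\<close> as inner product and \<open>w\<close> representing \<open>A e\<close>,
 the damped Richardson step \<open>e - \<rho> w\<close> contracts since \<open>A e e = S e e\<close>.\<close>
lemma lax_milgram:
 fixes V :: "('a \<Rightarrow> real) set" and A :: "('a \<Rightarrow> real) \<Rightarrow> ('a \<Rightarrow> real) \<Rightarrow> real" and q f :: "('a \<Rightarrow> real) \<Rightarrow> real"
 assumes ne: "v0 \<in> V" and lin: "\<And>u v r. u \<in> V \<Longrightarrow> v \<in> V \<Longrightarrow> (\<lambda>x. u x + r * v x) \<in> V"
  and A1: "\<And>u v w r. u \<in> V \<Longrightarrow> v \<in> V \<Longrightarrow> w \<in> V \<Longrightarrow> A (\<lambda>x. u x + r * v x) w = A u w + r * A v w"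
  and A2: "\<And>u v w r. u \<in> V \<Longrightarrow> v \<in> V \<Longrightarrow> w \<in> V \<Longrightarrow> A w (\<lambda>x. u x + r * v x) = A w u + r * A w v"
  and bd: "\<And>u v. u \<in> V \<Longrightarrow> v \<in> V \<Longrightarrow> \<bar>A u v\<bar> \<le> C * q u * q v" and C: "0 < C"
  and co: "\<And>u. u \<in> V \<Longrightarrow> c * (q u)^2 \<le> A u u" and c: "0 < c" and q0: "\<And>u. u \<in> V \<Longrightarrow> 0 \<le> q u"
  and complete: "\<And>x. (\<And>n::nat. x n \<in> V) \<Longrightarrow> (\<And>e. 0 < e \<Longrightarrow> \<exists>N. \<forall>m\<ge>N. \<forall>n\<ge>N. (q (\<lambda>t. x m t - x n t))^2 \<le> e) \<Longrightarrow> \<exists>u\<in>V. (\<lambda>n. q (\<lambda>t. u t - x n t)) \<longlonglongrightarrow> 0"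
  and f1: "\<And>u v r. u \<in> V \<Longrightarrow> v \<in> V \<Longrightarrow> f (\<lambda>x. u x + r * v x) = f u + r * f v" and fb: "\<And>v. v \<in> V \<Longrightarrow> \<bar>f v\<bar> \<le> K * q v"
 shows "\<exists>u\<in>V. \<forall>v\<in>V. A u v = f v"
proof -
 define S where "S u v = (A u v + A v u) / 2" for u v
 have S1: "S (\<lambda>x. u x + r * v x) w = S u w + r * S v w" if "u \<in> V" "v \<in> V" "w \<in> V" for u v w r
  unfolding S_def A1[OF that] A2[OF that] by (simp add: algebra_simps add_divide_distrib)
 have sym: "S u v = S v u" for u v by (simp add: S_def)
 have S2: "S w (\<lambda>x. u x + r * v x) = S w u + r * S w v" if "u \<in> V" "v \<in> V" "w \<in> V" for u v w r
  using S1[OF that] by (simp add: sym[of w])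
 have AS: "A u u = S u u" for u by (simp add: S_def)
 have Sb: "\<bar>S u v\<bar> \<le> C * q u * q v" if "u \<in> V" "v \<in> V" for u v
  using bd[OF that] bd[OF that(2,1)] by (simp add: S_def mult_ac)
 have Sc: "c * (q u)^2 \<le> S u u" if "u \<in> V" for u using co[OF that] AS by simp
 have Sp: "0 \<le> S u u" if "u \<in> V" for u using Sc[OF that] c by (meson less_imp_le mult_nonneg_nonneg order_trans zero_le_power2)
 have riesz: "\<exists>u\<in>V. \<forall>v\<in>V. S u v = g v" if "\<And>u v r. u \<in> V \<Longrightarrow> v \<in> V \<Longrightarrow> g (\<lambda>x. u x + r * v x) = g u + r * g v" "\<And>v. v \<in> V \<Longrightarrow> \<bar>g v\<bar> \<le> L * q v" for g L
  by (rule lax_milgram_symmetric[where V=V and S=S and q=q and g=g and K=L and C=C and c=c and ?v0.0=v0]; (rule ne lin S1 sym Sb Sc c q0 complete that; assumption)?)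
 have cs: "(S u v)^2 \<le> S u u * S v v" if "u \<in> V" "v \<in> V" for u v
 proof (rule quadratic_nonneg_discr)
  fix r
  have "S (\<lambda>x. u x + r * v x) (\<lambda>x. u x + r * v x) = S u u + 2 * r * S u v + r^2 * S v v"
   unfolding S1[OF that lin[OF that]] S2[OF that that(1)] S2[OF that that(2)] sym[of v u] by (simp add: power2_eq_square algebra_simps)
  then show "0 \<le> S u u + 2 * r * S u v + r^2 * S v v" using Sp[OF lin[OF that, of r]] by simp
 qed
 have dV: "(\<lambda>t. u t - v t) \<in> V" if "u \<in> V" "v \<in> V" for u v using lin[OF that, of "-1"] by simp
 have S1d: "S (\<lambda>t. u t - v t) w = S u w - S v w" if "u \<in> V" "v \<in> V" "w \<in> V" for u v w using S1[OF that, of "-1"] by simp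
 have A1d: "A (\<lambda>t. u t - v t) w = A u w - A v w" if "u \<in> V" "v \<in> V" "w \<in> V" for u v w using A1[OF that, of "-1"] by simp
 \<comment> \<open>This value minimises 1 - 2 \<rho> + \<rho>^2 (C/c)^2, the factor of the step
   below; the minimum is 1 - \<rho>.\<close>
 define \<rho> where "\<rho> = (c / C)^2"
 have \<rho>: "\<rho> > 0" using c C by (simp add: \<rho>_def)
 have "\<exists>w\<in>V. \<forall>v\<in>V. S w v = S u v - \<rho> * (A u v - f v)" if u: "u \<in> V" for u
 proof (rule riesz[where L="C * q u + \<rho> * (C * q u + K)"])
  show "S u (\<lambda>x. v x + r * w x) - \<rho> * (A u (\<lambda>x. v x + r * w x) - f (\<lambda>x. v x + r * w x)) = S u v - \<rho> * (A u v - f v) + r * (S u w - \<rho> * (A u w - f w))" if "v \<in> V" "w \<in> V" for v w r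
   unfolding S2[OF that u] A2[OF that u] f1[OF that] by (simp add: algebra_simps)
  show "\<bar>S u v - \<rho> * (A u v - f v)\<bar> \<le> (C * q u + \<rho> * (C * q u + K)) * q v" if v: "v \<in> V" for v
  proof -
   have "\<bar>A u v - f v\<bar> \<le> (C * q u + K) * q v" using bd[OF u v] fb[OF v] by (simp add: algebra_simps)
   then have "\<rho> * \<bar>A u v - f v\<bar> \<le> \<rho> * ((C * q u + K) * q v)" using \<rho> by (intro mult_left_mono) auto
   then have "\<bar>\<rho> * (A u v - f v)\<bar> \<le> \<rho> * ((C * q u + K) * q v)" using \<rho> by (simp add: abs_mult)
   then show ?thesis using Sb[OF u v] by (simp add: algebra_simps)
  qed
 qed
 then obtain T where T: "\<And>u. u \<in> V \<Longrightarrow> T u \<in> V" "\<And>u v. u \<in> V \<Longrightarrow> v \<in> V \<Longrightarrow> S (T u) v = S u v - \<rho> * (A u v - f v)" by metis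
 define \<tau> where "\<tau> = 1 - \<rho>"
 have contr: "S (\<lambda>t. T u t - T v t) (\<lambda>t. T u t - T v t) \<le> \<tau> * S (\<lambda>t. u t - v t) (\<lambda>t. u t - v t)" if uv: "u \<in> V" "v \<in> V" for u v
 proof -
  define e where "e = (\<lambda>t. u t - v t)"
  define e' where "e' = (\<lambda>t. T u t - T v t)"
  define w where "w = (\<lambda>t. (1/\<rho>) * (e t - e' t))"
  have eV: "e \<in> V" "e' \<in> V" unfolding e_def e'_def by (intro dV uv T)+
  have wV: "w \<in> V"
  proof -
   have "(\<lambda>t. (\<lambda>t. e t - e t) t + (1/\<rho>) * (\<lambda>t. e t - e' t) t) \<in> V" by (intro lin dV eV)
   then show ?thesis by (simp add: w_def)
  qed
  have ee: "e' = (\<lambda>t. e t + (-\<rho>) * w t)" using \<rho> by (auto simp: w_def)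
  have Se': "S e' x = S e x - \<rho> * A e x" if "x \<in> V" for x
   unfolding e_def e'_def S1d[OF T(1)[OF uv(1)] T(1)[OF uv(2)] that] S1d[OF uv that] A1d[OF uv that] T(2)[OF uv(1) that] T(2)[OF uv(2) that] by (simp add: algebra_simps)
  have Sw: "S w x = A e x" if "x \<in> V" for x
  proof -
   have "S e' x = S e x - \<rho> * S w x" unfolding ee S1[OF eV(1) wV that] by simp
   then show ?thesis using Se'[OF that] \<rho> by simp
  qed
  \<comment> \<open>S w w = A e w is bounded by C * q e * q w, and coercivity bounds q by S.
    Cancelling one factor S w w then controls w by e.\<close>
  have "S w w * S w w \<le> (C / c)^2 * S e e * S w w"
  proof -
   have 1: "\<bar>S w w\<bar> \<le> C * (q e * q w)" using Sw[OF wV] bd[OF eV(1) wV] by (simp add: mult.assoc)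
   have 2: "(q e)^2 \<le> S e e / c" "(q w)^2 \<le> S w w / c" using Sc[OF eV(1)] Sc[OF wV] c by (simp_all add: pos_le_divide_eq mult.commute)
   have "(S w w)^2 \<le> (C * (q e * q w))^2" using 1 by (metis abs_le_square_iff abs_ge_self order_trans)
   also have "... = C^2 * ((q e)^2 * (q w)^2)" by (simp add: power_mult_distrib)
   also have "... \<le> C^2 * ((S e e / c) * (S w w / c))" using 2 Sp[OF eV(1)] c by (intro mult_left_mono mult_mono) auto
   finally show ?thesis by (simp add: power2_eq_square field_simps)
  qed
  then have ww: "S w w \<le> (C / c)^2 * S e e" using Sp[OF wV] Sp[OF eV(1)] by (cases "S w w = 0") auto
  have "S e' e' = S e e - 2 * \<rho> * S e w + \<rho>^2 * S w w"
  proof -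
   have eV': "(\<lambda>t. e t + (-\<rho>) * w t) \<in> V" using eV(2) ee by simp
   show ?thesis
    unfolding ee S1[OF eV(1) wV eV'] S2[OF eV(1) wV eV(1)] S2[OF eV(1) wV wV] sym[of w e] by (simp add: power2_eq_square algebra_simps)
  qed
  also have "S e w = S e e" using Sw[OF eV(1)] AS sym by metis
  also have "S e e - 2 * \<rho> * S e e + \<rho>^2 * S w w \<le> S e e - 2 * \<rho> * S e e + \<rho>^2 * ((C / c)^2 * S e e)"
   using ww by (intro add_left_mono mult_left_mono) auto
  also have "... = \<tau> * S e e"
  proof -
   have "\<rho>^2 * (C / c)^2 = \<rho>" using c C by (simp add: \<rho>_def power_divide power2_eq_square)
   then have "\<rho>^2 * ((C / c)^2 * S e e) = \<rho> * S e e" by (metis mult.assoc)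
   then show ?thesis by (simp add: \<tau>_def algebra_simps)
  qed
  finally show ?thesis unfolding e_def e'_def .
 qed
 define x where "x n = (T ^^ n) v0" for n
 have xV: "x n \<in> V" for n unfolding x_def by (induction n) (auto intro: ne T)
 have xS: "x (Suc n) = T (x n)" for n by (simp add: x_def)
 define D where "D = S (\<lambda>t. x 1 t - x 0 t) (\<lambda>t. x 1 t - x 0 t)"
 have D0: "D \<ge> 0" unfolding D_def by (intro Sp dV xV)
 \<comment> \<open>The maximum covers the case c > C, in which \<tau> is negative.\<close>
 define \<theta> where "\<theta> = sqrt (max \<tau> 0)"
 have \<theta>: "0 \<le> \<theta>" "\<theta> < 1" "\<tau> \<le> \<theta>^2" using \<rho> by (auto simp: \<theta>_def \<tau>_def)
 have step: "S (\<lambda>t. x (Suc n) t - x n t) (\<lambda>t. x (Suc n) t - x n t) \<le> (\<theta>^2)^n * D" for n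
 proof (induction n)
  case (Suc n)
  have "S (\<lambda>t. x (Suc (Suc n)) t - x (Suc n) t) (\<lambda>t. x (Suc (Suc n)) t - x (Suc n) t) \<le> \<tau> * S (\<lambda>t. x (Suc n) t - x n t) (\<lambda>t. x (Suc n) t - x n t)"
   unfolding xS[of "Suc n"] unfolding xS[of n] by (rule contr[OF T(1)[OF xV] xV])
  also have "... \<le> \<theta>^2 * S (\<lambda>t. x (Suc n) t - x n t) (\<lambda>t. x (Suc n) t - x n t)" by (intro mult_right_mono \<theta> Sp dV xV)
  also have "... \<le> \<theta>^2 * ((\<theta>^2)^n * D)" by (intro mult_left_mono Suc.IH) auto
  finally show ?case by (simp add: mult.assoc)
 qed (simp add: D_def)
 define N where "N u = sqrt (S u u)" for u
 have tri: "N (\<lambda>t. u t - w t) \<le> N (\<lambda>t. u t - v t) + N (\<lambda>t. v t - w t)" if "u \<in> V" "v \<in> V" "w \<in> V" for u v w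
 proof -
  define p where "p = (\<lambda>t. u t - v t)"
  define r where "r = (\<lambda>t. v t - w t)"
  have pV: "p \<in> V" "r \<in> V" unfolding p_def r_def by (intro dV that)+
  have e: "(\<lambda>t. u t - w t) = (\<lambda>t. p t + 1 * r t)" by (auto simp: p_def r_def)
  have "S (\<lambda>t. p t + 1 * r t) (\<lambda>t. p t + 1 * r t) = S p p + 2 * S p r + S r r"
   unfolding S1[OF pV lin[OF pV]] S2[OF pV pV(1)] S2[OF pV pV(2)] sym[of r p] by simp
  also have "... \<le> (sqrt (S p p) + sqrt (S r r))^2"
  proof -
   have "sqrt ((S p r)^2) \<le> sqrt (S p p * S r r)" by (rule real_sqrt_le_mono[OF cs[OF pV]])
   then have "S p r \<le> sqrt (S p p) * sqrt (S r r)" by (simp add: real_sqrt_mult)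
   then show ?thesis using Sp[OF pV(1)] Sp[OF pV(2)] by (simp add: power2_sum)
  qed
  finally have "sqrt (S (\<lambda>t. p t + 1 * r t) (\<lambda>t. p t + 1 * r t)) \<le> sqrt ((sqrt (S p p) + sqrt (S r r))^2)" by (rule real_sqrt_le_mono)
  then show ?thesis unfolding N_def e[symmetric] using Sp[OF pV(1)] Sp[OF pV(2)] unfolding p_def r_def by simp
 qed
 have Nstep: "N (\<lambda>t. x (Suc n) t - x n t) \<le> \<theta>^n * sqrt D" for n
 proof -
  have "N (\<lambda>t. x (Suc n) t - x n t) \<le> sqrt ((\<theta>^2)^n * D)" unfolding N_def by (rule real_sqrt_le_mono[OF step])
  also have "(\<theta>^2)^n = (\<theta>^n)^2" by (simp add: power_mult[symmetric] mult.commute)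
  also have "sqrt ((\<theta>^n)^2 * D) = \<theta>^n * sqrt D" using \<theta> by (simp add: real_sqrt_mult)
  finally show ?thesis .
 qed
 have far: "N (\<lambda>t. x (n + k) t - x n t) \<le> \<theta>^n * sqrt D * (\<Sum>i<k. \<theta>^i)" for n k
 proof (induction k)
  case 0
  have "S (\<lambda>t. x n t - x n t) (\<lambda>t. x n t - x n t) = 0" using S1d[OF xV xV dV[OF xV xV], of n n n n] by simp
  then show ?case by (simp add: N_def)
 next
  case (Suc k)
  have "N (\<lambda>t. x (n + Suc k) t - x n t) \<le> N (\<lambda>t. x (n + Suc k) t - x (n + k) t) + N (\<lambda>t. x (n + k) t - x n t)" by (intro tri xV)
  also have "... \<le> \<theta>^(n + k) * sqrt D + \<theta>^n * sqrt D * (\<Sum>i<k. \<theta>^i)" using Nstep[of "n + k"] Suc by simp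
  finally show ?case by (simp add: power_add algebra_simps)
 qed
 have far2: "S (\<lambda>t. x m t - x n t) (\<lambda>t. x m t - x n t) \<le> (\<theta>^k * (sqrt D / (1 - \<theta>)))^2" if mn: "m \<ge> k" "n \<ge> k" for m n k
 proof -
  have one: "S (\<lambda>t. x m t - x n t) (\<lambda>t. x m t - x n t) \<le> (\<theta>^k * (sqrt D / (1 - \<theta>)))^2" if mn: "m \<ge> n" "n \<ge> k" for m n
  proof -
   have "(\<Sum>i<m - n. \<theta>^i) \<le> (\<Sum>i. \<theta>^i)" by (rule sum_le_suminf) (use \<theta> in \<open>auto intro: summable_geometric\<close>)
   also have "... = 1 / (1 - \<theta>)" using suminf_geometric[of \<theta>] \<theta> by simp
   finally have "\<theta>^n * sqrt D * (\<Sum>i<m - n. \<theta>^i) \<le> \<theta>^n * sqrt D * (1 / (1 - \<theta>))" using \<theta> D0 by (intro mult_left_mono) auto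
   also have "... \<le> \<theta>^k * sqrt D * (1 / (1 - \<theta>))" using \<theta> D0 mn by (intro mult_right_mono power_decreasing) auto
   finally have "N (\<lambda>t. x m t - x n t) \<le> \<theta>^k * (sqrt D / (1 - \<theta>))" using far[of n "m - n"] mn by simp
   then have "(N (\<lambda>t. x m t - x n t))^2 \<le> (\<theta>^k * (sqrt D / (1 - \<theta>)))^2" unfolding N_def by (intro power_mono real_sqrt_ge_zero Sp dV xV)
   then show ?thesis unfolding N_def using Sp[OF dV[OF xV xV]] by simp
  qed
  have sw: "S (\<lambda>t. x m t - x n t) (\<lambda>t. x m t - x n t) = S (\<lambda>t. x n t - x m t) (\<lambda>t. x n t - x m t)"
   unfolding S1d[OF xV xV dV[OF xV xV]] sym[of _ "\<lambda>t. x m t - x n t"] sym[of _ "\<lambda>t. x n t - x m t"]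
   by (simp add: S1d[OF xV xV xV])
  show ?thesis using one[of n m] one[of m n] mn sw by (cases "m \<ge> n") auto
 qed
 have "\<exists>u\<in>V. (\<lambda>n. q (\<lambda>t. u t - x n t)) \<longlonglongrightarrow> 0"
 proof (rule complete[OF xV])
  fix e :: real assume e: "0 < e"
  have "(\<lambda>k. (\<theta>^k * (sqrt D / (1 - \<theta>)))^2) \<longlonglongrightarrow> (0 * (sqrt D / (1 - \<theta>)))^2"
   by (intro tendsto_intros LIMSEQ_realpow_zero \<theta>)
  then have "\<forall>\<^sub>F k in sequentially. (\<theta>^k * (sqrt D / (1 - \<theta>)))^2 < c * e" by (rule order_tendstoD) (use c e in simp)
  then obtain k where k: "(\<theta>^k * (sqrt D / (1 - \<theta>)))^2 < c * e" unfolding eventually_sequentially by blast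
  have "(q (\<lambda>t. x m t - x n t))^2 \<le> e" if "m \<ge> k" "n \<ge> k" for m n
  proof -
   have "c * (q (\<lambda>t. x m t - x n t))^2 \<le> c * e" using Sc[OF dV[OF xV xV], of m n] far2[OF that] k by linarith
   then show ?thesis using c by simp
  qed
  then show "\<exists>N. \<forall>m\<ge>N. \<forall>n\<ge>N. (q (\<lambda>t. x m t - x n t))^2 \<le> e" by blast
 qed
 then obtain u where u: "u \<in> V" "(\<lambda>n. q (\<lambda>t. u t - x n t)) \<longlonglongrightarrow> 0" by blast
 have conv: "(\<lambda>n. B (x n) v) \<longlonglongrightarrow> B u v"
  if v: "v \<in> V" and B1: "\<And>u w. u \<in> V \<Longrightarrow> w \<in> V \<Longrightarrow> B (\<lambda>t. u t - w t) v = B u v - B w v" and Bb: "\<And>u. u \<in> V \<Longrightarrow> \<bar>B u v\<bar> \<le> C * q u * q v" for v and B :: "('a \<Rightarrow> real) \<Rightarrow> ('a \<Rightarrow> real) \<Rightarrow> real"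
 proof (rule LIM_zero_cancel)
  have z: "(\<lambda>n. C * q (\<lambda>t. u t - x n t) * q v) \<longlonglongrightarrow> 0"
   using tendsto_mult_right[OF tendsto_mult_left[OF u(2), of C], of "q v"] by simp
  show "(\<lambda>n. B (x n) v - B u v) \<longlonglongrightarrow> 0"
  proof (rule Lim_null_comparison[OF _ z], rule always_eventually, rule allI)
   fix n
   show "norm (B (x n) v - B u v) \<le> C * q (\<lambda>t. u t - x n t) * q v" using Bb[OF dV[OF u(1) xV, of n]] unfolding B1[OF u(1) xV] by simp
  qed
 qed
 \<comment> \<open>The recursion is tested with v and passed to the limit, giving S u v = S u v -
   \<rho> * (A u v - f v).\<close>
 have "A u v = f v" if v: "v \<in> V" for v
 proof -
  have cS: "(\<lambda>n. S (x n) v) \<longlonglongrightarrow> S u v" by (rule conv[OF v]) (use S1d Sb v in auto)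
  have cA: "(\<lambda>n. A (x n) v) \<longlonglongrightarrow> A u v" by (rule conv[OF v]) (use A1d bd v in auto)
  have "(\<lambda>n. S (x (Suc n)) v) \<longlonglongrightarrow> S u v - \<rho> * (A u v - f v)"
   unfolding xS T(2)[OF xV v] by (intro tendsto_intros cS cA)
  moreover have "(\<lambda>n. S (x (Suc n)) v) \<longlonglongrightarrow> S u v" by (rule LIMSEQ_Suc[OF cS])
  ultimately have "S u v - \<rho> * (A u v - f v) = S u v" by (rule LIMSEQ_unique)
  then show ?thesis using \<rho> by simp
 qed
 then show ?thesis using u(1) by blast
qed

section \<open>Boundedness and linearity of the extended operators, and polynomial
  approximation\<close>

lemma ext_op_bound:
 assumes s: "0 \<le> s" "s \<le> 1" "s \<noteq> 1/2" and ab: "a < b" and D: "bounded_test_op s a b D"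
 shows "\<exists>C>0. \<forall>u. zext a b u \<in> Borel \<longrightarrow> (\<exists>\<phi>. apx s a b u \<phi>) \<longrightarrow> sq2 a b (ext_op s a b D u) \<le> ennreal C * W s a b u"
proof -
 obtain C where C: "C > 0" "\<And>\<phi>. test_fun a b \<phi> \<Longrightarrow> sq2 a b (D \<phi>) \<le> ennreal C * W s a b \<phi>" using D unfolding bounded_test_op_def by blast
 have Dm: "zext a b (D \<phi>) \<in> Borel" if "test_fun a b \<phi>" for \<phi> using D that unfolding bounded_test_op_def by blast
 show ?thesis
 proof (intro exI[of _ "4 * C"] conjI allI impI)
  show "4 * C > 0" using C by simp
  fix u assume u: "zext a b u \<in> Borel" and ex: "\<exists>\<phi>. apx s a b u \<phi>"
  obtain \<phi> where \<phi>: "apx s a b u \<phi>" using ex by blast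
  then have t: "\<And>n. test_fun a b (\<phi> n)" and l: "(\<lambda>n. W s a b (\<lambda>x. u x - \<phi> n x)) \<longlonglongrightarrow> 0" by (auto simp: apx_def)
  define g where "g = ext_op s a b D u"
  have gm: "zext a b g \<in> Borel" unfolding g_def by (intro zext_measurable ext_op_converges[OF s ab D u ex])
  have gl: "(\<lambda>n. sq2 a b (\<lambda>x. D (\<phi> n) x - g x)) \<longlonglongrightarrow> 0" unfolding g_def by (rule ext_op_converges(2)[OF s ab D u ex \<phi>])
  have nl: "(\<lambda>n. (4 * ennreal C) * W s a b (\<lambda>x. u x - \<phi> n x) + 2 * sq2 a b (\<lambda>x. D (\<phi> n) x - g x)) \<longlonglongrightarrow> 0"
   by (rule null_seq_lin[OF l gl]) (auto simp: ennreal_mult_less_top)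
  have "sq2 a b g \<le> ennreal (4 * C) * W s a b u"
  proof (rule ennreal_le_of_null_seq[OF _ nl])
   fix n
   let ?w = "W s a b (\<lambda>x. u x - \<phi> n x)" and ?r = "sq2 a b (\<lambda>x. D (\<phi> n) x - g x)"
   have e: "g = (\<lambda>x. D (\<phi> n) x - (D (\<phi> n) x - g x))" by auto
   have "sq2 a b g \<le> 2 * sq2 a b (D (\<phi> n)) + 2 * ?r"
    by (subst e) (intro sq2_add_le Dm t zext_diff_measurable gm)
   also have "... \<le> 2 * (ennreal C * (2 * W s a b u + 2 * ?w)) + 2 * ?r"
    by (intro add_right_mono mult_left_mono order_trans[OF C(2)[OF t]] W_le_apx u t) auto
   also have "2 * (ennreal C * (2 * W s a b u + 2 * ?w)) = (4 * ennreal C) * W s a b u + (4 * ennreal C) * ?w"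
    by (simp add: distrib_left mult.assoc[symmetric] mult.commute[of "ennreal C" 2])
   finally have f: "sq2 a b g \<le> (4 * ennreal C) * W s a b u + (4 * ennreal C) * ?w + 2 * ?r" .
   have e4: "ennreal (4 * C) = 4 * ennreal C" using C(1) by (subst ennreal_mult) auto
   show "sq2 a b g \<le> ennreal (4 * C) * W s a b u + ennreal 1 * ((4 * ennreal C) * ?w + 2 * ?r)"
    unfolding e4 using f by (simp add: add.assoc)
  qed
  then show "sq2 a b (ext_op s a b D u) \<le> ennreal (4 * C) * W s a b u" by (simp add: g_def)
 qed
qed

text \<open>The values on u, v and u + r v come from three separate choices, so equality is asserted
  almost everywhere. It holds because \<phi> n + r * \<psi> n approximates the combination and D is
  linear on test functions.\<close>

lemma ext_op_lin:
 assumes s: "0 \<le> s" "s \<le> 1" "s \<noteq> 1/2" and ab: "a < b" and D: "bounded_test_op s a b D"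
  and u: "zext a b u \<in> Borel" "\<exists>\<phi>. apx s a b u \<phi>" and v: "zext a b v \<in> Borel" "\<exists>\<phi>. apx s a b v \<phi>"
 shows "AE x in lborel. x \<in> {a<..<b} \<longrightarrow> ext_op s a b D (\<lambda>x. u x + r * v x) x = ext_op s a b D u x + r * ext_op s a b D v x"
proof -
 obtain \<phi> where \<phi>: "apx s a b u \<phi>" using u by blast
 obtain \<psi> where \<psi>: "apx s a b v \<psi>" using v by blast
 have t: "test_fun a b (\<phi> n)" "test_fun a b (\<psi> n)" for n using \<phi> \<psi> by (auto simp: apx_def)
 have Dm: "zext a b (D \<phi>) \<in> Borel" if "test_fun a b \<phi>" for \<phi> using D that unfolding bounded_test_op_def by blast
 note \<theta> = apx_lin[OF u(1) v(1) \<phi> \<psi>, of r]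
 define g where "g = ext_op s a b D u"
 define h where "h = ext_op s a b D v"
 define k where "k = ext_op s a b D (\<lambda>x. u x + r * v x)"
 have w: "zext a b (\<lambda>x. u x + r * v x) \<in> Borel" "\<exists>\<phi>. apx s a b (\<lambda>x. u x + r * v x) \<phi>"
  using \<theta> zext_lin_measurable[OF u(1) v(1)] by blast+
 have m: "zext a b g \<in> Borel" "zext a b h \<in> Borel" "zext a b k \<in> Borel"
  unfolding g_def h_def k_def by (intro zext_measurable ext_op_converges[OF s ab D] u v w)+
 have gl: "(\<lambda>n. sq2 a b (\<lambda>x. D (\<phi> n) x - g x)) \<longlonglongrightarrow> 0" unfolding g_def by (rule ext_op_converges(2)[OF s ab D u \<phi>])
 have hl: "(\<lambda>n. sq2 a b (\<lambda>x. D (\<psi> n) x - h x)) \<longlonglongrightarrow> 0" unfolding h_def by (rule ext_op_converges(2)[OF s ab D v \<psi>])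
 have kl: "(\<lambda>n. sq2 a b (\<lambda>x. D (\<lambda>x. \<phi> n x + r * \<psi> n x) x - k x)) \<longlonglongrightarrow> 0" unfolding k_def by (rule ext_op_converges(2)[OF s ab D w \<theta>])
 have km: "zext a b (\<lambda>x. k x - (g x + r * h x)) \<in> Borel" by (intro zext_diff_measurable zext_lin_measurable m)
 have "sq2 a b (\<lambda>x. k x - (g x + r * h x)) \<le> 0"
 proof (rule ennreal_le_of_null_seq)
  fix n
  let ?a = "sq2 a b (\<lambda>x. D (\<phi> n) x - g x)" and ?b = "sq2 a b (\<lambda>x. D (\<psi> n) x - h x)" and ?c = "sq2 a b (\<lambda>x. D (\<lambda>x. \<phi> n x + r * \<psi> n x) x - k x)"
  define P where "P = (\<lambda>x. D (\<phi> n) x - g x)"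
  define Q where "Q = (\<lambda>x. D (\<psi> n) x - h x)"
  define R where "R = (\<lambda>x. D (\<lambda>x. \<phi> n x + r * \<psi> n x) x - k x)"
  have PQR: "zext a b P \<in> Borel" "zext a b Q \<in> Borel" "zext a b R \<in> Borel"
   unfolding P_def Q_def R_def by (intro zext_diff_measurable m Dm t test_fun_lin)+
  have rQ: "zext a b (\<lambda>x. (-r) * Q x) \<in> Borel" using PQR(2) unfolding zext_cmult by measurable
  have "sq2 a b (\<lambda>x. k x - (g x + r * h x)) = sq2 a b (\<lambda>x. (P x - (-r) * Q x) - R x)"
  proof (rule sq2_cong)
   fix x assume "x \<in> {a<..<b}"
   then have "D (\<lambda>x. \<phi> n x + r * \<psi> n x) x = D (\<phi> n) x + r * D (\<psi> n) x" using D t unfolding bounded_test_op_def by blast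
   then show "k x - (g x + r * h x) = (P x - (-r) * Q x) - R x" unfolding P_def Q_def R_def by (simp add: algebra_simps)
  qed
  also have "... \<le> 2 * sq2 a b (\<lambda>x. P x - (-r) * Q x) + 2 * sq2 a b R" by (intro sq2_add_le zext_diff_measurable PQR rQ)
  also have "... \<le> 2 * (2 * sq2 a b P + 2 * sq2 a b (\<lambda>x. (-r) * Q x)) + 2 * sq2 a b R" by (intro add_right_mono mult_left_mono sq2_add_le PQR rQ) auto
  also have "sq2 a b (\<lambda>x. (-r) * Q x) = ennreal (r^2) * sq2 a b Q" unfolding sq2_cmult[OF PQR(2)] by simp
  finally show "sq2 a b (\<lambda>x. k x - (g x + r * h x)) \<le> 0 + ennreal 1 * (1 * (4 * ?a + (4 * ennreal (r^2)) * ?b) + 2 * ?c)"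
   by (simp add: P_def[symmetric] Q_def[symmetric] R_def[symmetric] distrib_left mult.assoc[symmetric])
 next
  show "(\<lambda>n. 1 * (4 * sq2 a b (\<lambda>x. D (\<phi> n) x - g x) + (4 * ennreal (r^2)) * sq2 a b (\<lambda>x. D (\<psi> n) x - h x)) + 2 * sq2 a b (\<lambda>x. D (\<lambda>x. \<phi> n x + r * \<psi> n x) x - k x)) \<longlonglongrightarrow> 0"
   by (intro null_seq_lin gl hl kl) (auto simp: ennreal_mult_less_top)
 qed
 then have "sq2 a b (\<lambda>x. k x - (g x + r * h x)) = 0" by simp
 from sq2_zero_AE[OF km this] show ?thesis unfolding g_def h_def k_def by eventually_elim auto
qed

lemma ext_op_test:
 assumes s: "0 \<le> s" "s \<le> 1" "s \<noteq> 1/2" and ab: "a < b" and D: "bounded_test_op s a b D" and \<phi>: "test_fun a b \<phi>"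
 shows "AE x in lborel. x \<in> {a<..<b} \<longrightarrow> ext_op s a b D \<phi> x = D \<phi> x"
proof -
 have ex: "\<exists>\<psi>. apx s a b \<phi> \<psi>" using apx_const[OF \<phi>] by blast
 note e = ext_op_converges[OF s ab D zext_test_measurable[OF \<phi>] ex]
 have "sq2 a b (\<lambda>x. D \<phi> x - ext_op s a b D \<phi> x) = 0" using e(2)[OF apx_const[OF \<phi>]] by (simp add: LIMSEQ_const_iff)
 moreover have "zext a b (\<lambda>x. D \<phi> x - ext_op s a b D \<phi> x) \<in> Borel"
 proof (intro zext_diff_measurable zext_measurable[OF e(1)])
  show "zext a b (D \<phi>) \<in> Borel" using D \<phi> unfolding bounded_test_op_def by blast
 qed
 ultimately show ?thesis by (auto dest: sq2_zero_AE elim: AE_mp)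
qed

definition bounded_op :: "real \<Rightarrow> real \<Rightarrow> real \<Rightarrow> ((real \<Rightarrow> real) \<Rightarrow> real \<Rightarrow> real) \<Rightarrow> bool" where
 "bounded_op s a b E \<longleftrightarrow> (\<forall>u\<in>H0 s a b. L2i a b (E u)) \<and> (\<exists>C>0. \<forall>u\<in>H0 s a b. sq2 a b (E u) \<le> ennreal C * W s a b u) \<and>
  (\<forall>u\<in>H0 s a b. \<forall>v\<in>H0 s a b. \<forall>r. AE x in lborel. x \<in> {a<..<b} \<longrightarrow> E (\<lambda>x. u x + r * v x) x = E u x + r * E v x)"

lemma bopI:
 assumes m: "\<And>u. u \<in> H0 s a b \<Longrightarrow> zext a b (E u) \<in> Borel"
  and C: "C > 0" "\<And>u. u \<in> H0 s a b \<Longrightarrow> sq2 a b (E u) \<le> ennreal C * W s a b u" and W: "\<And>u. u \<in> H0 s a b \<Longrightarrow> W s a b u < \<infinity>"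
  and l: "\<And>u v r. u \<in> H0 s a b \<Longrightarrow> v \<in> H0 s a b \<Longrightarrow> AE x in lborel. x \<in> {a<..<b} \<longrightarrow> E (\<lambda>x. u x + r * v x) x = E u x + r * E v x"
 shows "bounded_op s a b E"
proof -
 have "sq2 a b (E u) < \<infinity>" if "u \<in> H0 s a b" for u
  using C(2)[OF that] W[OF that] by (auto simp: ennreal_mult_less_top intro: le_less_trans)
 then show ?thesis unfolding bounded_op_def L2i_def using m C l by blast
qed

text \<open>T is the identity or multiplication by m, and \<sigma> is s or 1 - s: every extended
  derivative occurring in the form is an instance.\<close>

lemma bounded_op_ext:
 assumes s: "0 \<le> \<sigma>" "\<sigma> \<le> 1" "\<sigma> \<noteq> 1/2" and ab: "a < b" and D: "bounded_test_op \<sigma> a b D"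
  and T: "\<And>u v r. T (\<lambda>x. u x + r * v x) = (\<lambda>x. T u x + r * T v x)" and W: "\<And>u. u \<in> H0 s a b \<Longrightarrow> W s a b u < \<infinity>"
  and TH: "\<And>u. u \<in> H0 s a b \<Longrightarrow> zext a b (T u) \<in> Borel" "\<And>u. u \<in> H0 s a b \<Longrightarrow> \<exists>\<psi>. apx \<sigma> a b (T u) \<psi>"
  and K: "0 < K" "\<And>u. u \<in> H0 s a b \<Longrightarrow> W \<sigma> a b (T u) \<le> ennreal K * W s a b u"
 shows "bounded_op s a b (\<lambda>u. ext_op \<sigma> a b D (T u))"
proof -
 obtain C where C: "C > 0" "\<And>u. zext a b u \<in> Borel \<Longrightarrow> (\<exists>\<phi>. apx \<sigma> a b u \<phi>) \<Longrightarrow> sq2 a b (ext_op \<sigma> a b D u) \<le> ennreal C * W \<sigma> a b u"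
  using ext_op_bound[OF s ab D] by blast
 show ?thesis
 proof (rule bopI[OF _ _ _ W])
  show "zext a b (ext_op \<sigma> a b D (T u)) \<in> Borel" if "u \<in> H0 s a b" for u
   by (intro zext_measurable ext_op_converges(1)[OF s ab D] TH that)
  show "C * K > 0" using C K by simp
  show "sq2 a b (ext_op \<sigma> a b D (T u)) \<le> ennreal (C * K) * W s a b u" if u: "u \<in> H0 s a b" for u
  proof -
   have "sq2 a b (ext_op \<sigma> a b D (T u)) \<le> ennreal C * (ennreal K * W s a b u)"
    by (rule order_trans[OF C(2)[OF TH(1)[OF u] TH(2)[OF u]] mult_left_mono[OF K(2)[OF u]]]) simp
   then show ?thesis using C(1) K(1) by (simp add: ennreal_mult mult.assoc)
  qed
  show "AE x in lborel. x \<in> {a<..<b} \<longrightarrow> ext_op \<sigma> a b D (T (\<lambda>x. u x + r * v x)) x = ext_op \<sigma> a b D (T u) x + r * ext_op \<sigma> a b D (T v) x"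
   if "u \<in> H0 s a b" "v \<in> H0 s a b" for u v r
   unfolding T by (rule ext_op_lin[OF s ab D TH(1)[OF that(1)] TH(2)[OF that(1)] TH(1)[OF that(2)] TH(2)[OF that(2)]])
 qed
qed

text \<open>A polynomial p close to m' is integrated from a, with the constant fixed so that q a = m
  a. The error of q is at most that of p times b - a, hence the choice of \<epsilon>.\<close>

lemma C1_poly_approx:
 fixes m m' :: "real \<Rightarrow> real"
 assumes ab: "a < b" and d: "\<forall>x\<in>{a..b}. (m has_real_derivative m' x) (at x within {a..b})" and c: "continuous_on {a..b} m'" and e: "0 < e"
 shows "\<exists>q. smooth q \<and> (\<forall>x\<in>{a..b}. \<bar>q x - m x\<bar> \<le> e \<and> \<bar>deriv q x - m' x\<bar> \<le> e)"
proof -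
 define \<epsilon> where "\<epsilon> = e / (1 + (b - a))"
 have \<epsilon>: "0 < \<epsilon>" "\<epsilon> * (b - a) \<le> e" "\<epsilon> \<le> e" using ab e by (auto simp: \<epsilon>_def field_simps)
 obtain p where p: "real_polynomial_function p" "\<And>x. x \<in> {a..b} \<Longrightarrow> \<bar>m' x - p x\<bar> < \<epsilon>"
  using Stone_Weierstrass_real_polynomial_function[OF _ c \<epsilon>(1)] by auto
 obtain k N where k: "p = (\<lambda>x. \<Sum>i\<le>N. k i * x ^ i)" using p(1) unfolding real_polynomial_function_iff_sum by blast
 define P where "P x = (\<Sum>i\<le>N. k i / real (Suc i) * x ^ Suc i)" for x :: real
 define q where "q x = P x + (m a - P a)" for x
 have qs: "smooth q" unfolding q_def P_def by (intro smooth_add smooth_sum smooth_mult smooth_power smooth_const)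
 have qd: "DERIV q x :> p x" for x
 proof -
  have "DERIV P x :> (\<Sum>i\<le>N. k i / real (Suc i) * (real (Suc i) * x ^ i))"
   unfolding P_def by (intro DERIV_sum DERIV_cmult) (rule DERIV_cong[OF DERIV_pow], simp)
  then have "DERIV P x :> p x" unfolding k by simp
  then show ?thesis unfolding q_def by (auto intro!: derivative_eq_intros)
 qed
 have "\<bar>q x - m x\<bar> \<le> e" if x: "x \<in> {a..b}" for x
 proof -
  have "norm ((q x - m x) - (q a - m a)) \<le> \<epsilon> * norm (x - a)"
  proof (rule field_differentiable_bound[of "{a..b}"])
   show "((\<lambda>x. q x - m x) has_field_derivative p z - m' z) (at z within {a..b})" if "z \<in> {a..b}" for z
    using d that by (intro DERIV_diff has_field_derivative_at_within[OF qd]) auto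
   show "norm (p z - m' z) \<le> \<epsilon>" if "z \<in> {a..b}" for z using p(2)[OF that] by auto
  qed (use x ab in auto)
  then have "\<bar>q x - m x\<bar> \<le> \<epsilon> * (x - a)" using x by (simp add: q_def)
  also have "... \<le> \<epsilon> * (b - a)" using x \<epsilon> by (intro mult_left_mono) auto
  finally show ?thesis using \<epsilon> by linarith
 qed
 moreover have "\<bar>deriv q x - m' x\<bar> \<le> e" if x: "x \<in> {a..b}" for x
  using p(2)[OF x] \<epsilon>(3) unfolding DERIV_imp_deriv[OF qd] by (auto simp: abs_minus_commute)
 ultimately show ?thesis using qs by blast
qed

section \<open>Multiplication by C1 functions\<close>

lemma sq2_mult_le:
 assumes [measurable]: "zext a b h \<in> Borel" and M: "\<And>x. x \<in> {a<..<b} \<Longrightarrow> \<bar>g x\<bar> \<le> M"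
 shows "sq2 a b (\<lambda>x. g x * h x) \<le> ennreal (M^2) * sq2 a b h"
proof -
 have "sq2 a b (\<lambda>x. g x * h x) \<le> (NN x. ennreal (M^2) * ennreal ((zext a b h x)^2))"
  unfolding sq2_zext
 proof (rule nn_integral_mono)
  fix x
  have "(zext a b (\<lambda>x. g x * h x) x)^2 \<le> M^2 * (zext a b h x)^2"
  proof (cases "x \<in> {a<..<b}")
   case True
   then have "(g x)^2 \<le> M^2" using M[OF True] by (metis abs_ge_zero power2_abs power_mono)
   then show ?thesis by (simp add: zext_def power_mult_distrib mult_right_mono indicator_def)
  qed (simp add: zext_def)
  then show "ennreal ((zext a b (\<lambda>x. g x * h x) x)^2) \<le> ennreal (M^2) * ennreal ((zext a b h x)^2)"
   by (simp add: ennreal_mult[symmetric])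
 qed
 then show ?thesis unfolding sq2_zext[of a b h] by (simp add: nn_integral_cmult)
qed

lemma zext_mult_measurable:
 assumes c: "continuous_on {a..b} m" and [measurable]: "zext a b v \<in> Borel"
 shows "zext a b (\<lambda>x. m x * v x) \<in> Borel"
proof -
 have "(\<lambda>x. indicator {a<..<b} x *\<^sub>R m x) \<in> Borel"
  by (rule borel_measurable_continuous_on_indicator) (auto intro: continuous_on_subset[OF c])
 then have [measurable]: "zext a b m \<in> Borel" by (simp add: zext_def)
 have "zext a b (\<lambda>x. m x * v x) = (\<lambda>x. zext a b m x * zext a b v x)" by (auto simp: zext_def indicator_def)
 then show ?thesis by simp
qed

definition C1_approx :: "real \<Rightarrow> real \<Rightarrow> (real \<Rightarrow> real) \<Rightarrow> (real \<Rightarrow> real) \<Rightarrow> (nat \<Rightarrow> real \<Rightarrow> real) \<Rightarrow> bool" where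
 "C1_approx a b m m' q \<longleftrightarrow> (\<forall>n. smooth (q n) \<and> (\<forall>x\<in>{a..b}. \<bar>q n x - m x\<bar> \<le> 1 / real (Suc n) \<and> \<bar>deriv (q n) x - m' x\<bar> \<le> 1 / real (Suc n)))"

lemma C1_approx_exists:
 assumes "a < b" "\<forall>x\<in>{a..b}. (m has_real_derivative m' x) (at x within {a..b})" "continuous_on {a..b} m'"
 shows "\<exists>q. C1_approx a b m m' q"
 unfolding C1_approx_def by (rule choice, rule allI, rule C1_poly_approx[OF assms]) simp

lemma continuous_bounded_Icc:
 fixes f :: "real \<Rightarrow> real"
 assumes "continuous_on {a..b} f" shows "\<exists>M>0. \<forall>x\<in>{a..b}. \<bar>f x\<bar> \<le> M"
proof -
 have "bounded (f ` {a..b})" by (intro compact_imp_bounded compact_continuous_image assms compact_Icc)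
 then obtain M where "M > 0" "\<forall>y\<in>f ` {a..b}. norm y \<le> M" by (auto simp: bounded_pos)
 then show ?thesis by auto
qed

text \<open>The products m * \<phi> n need not be smooth, but q n * \<phi> n are test functions. By
  \<open>W_mult_le\<close> they are Cauchy in \<open>W\<close>, as q i - q j is small together with
  its derivative, and \<open>W_limit\<close> identifies the limit m v. The order \<tau> stands for 1
  - s, which is below 1.\<close>

lemma mult_apx:
 assumes \<tau>: "0 \<le> \<tau>" "\<tau> < 1" and ab: "a < b" and q: "C1_approx a b m m' q"
  and cm: "continuous_on {a..b} m" and cm': "continuous_on {a..b} m'"
 shows "\<exists>K>0. \<forall>v \<phi>. zext a b v \<in> Borel \<longrightarrow> apx \<tau> a b v \<phi> \<longrightarrow>
  apx \<tau> a b (\<lambda>x. m x * v x) (\<lambda>n x. q n x * \<phi> n x) \<and> W \<tau> a b (\<lambda>x. m x * v x) \<le> ennreal K * W \<tau> a b v"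
proof -
 obtain M1 where M1: "M1 > 0" "\<forall>x\<in>{a..b}. \<bar>m x\<bar> \<le> M1" using continuous_bounded_Icc[OF cm] by blast
 obtain M2 where M2: "M2 > 0" "\<forall>x\<in>{a..b}. \<bar>m' x\<bar> \<le> M2" using continuous_bounded_Icc[OF cm'] by blast
 define M where "M = M1 + M2 + 1"
 have M0: "M > 0" using M1 M2 by (simp add: M_def)
 define \<epsilon> where "\<epsilon> n = 1 / real (Suc n)" for n
 have \<epsilon>: "0 \<le> \<epsilon> n" "\<epsilon> n \<le> 1" for n by (auto simp: \<epsilon>_def)
 have qs: "smooth (q n)" for n using q by (simp add: C1_approx_def)
 have qm: "\<bar>q n x - m x\<bar> \<le> \<epsilon> n" "\<bar>deriv (q n) x - m' x\<bar> \<le> \<epsilon> n" if "x \<in> {a<..<b}" for n x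
  using q that by (auto simp: C1_approx_def \<epsilon>_def)
 have qM: "\<bar>q n x\<bar> \<le> M" "\<bar>deriv (q n) x\<bar> \<le> M" if x: "x \<in> {a<..<b}" for n x
 proof -
  have "x \<in> {a..b}" using x by auto
  then have "\<bar>m x\<bar> \<le> M1" "\<bar>m' x\<bar> \<le> M2" using M1 M2 by blast+
  then show "\<bar>q n x\<bar> \<le> M" "\<bar>deriv (q n) x\<bar> \<le> M" using qm[OF x, of n] \<epsilon>[of n] M1(1) M2(1) unfolding M_def by linarith+
 qed
 obtain C where C: "C > 0" "\<And>q \<phi> M. smooth q \<Longrightarrow> test_fun a b \<phi> \<Longrightarrow> (\<forall>x\<in>{a<..<b}. \<bar>q x\<bar> \<le> M \<and> \<bar>deriv q x\<bar> \<le> M) \<Longrightarrow>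
   W \<tau> a b (\<lambda>x. q x * \<phi> x) \<le> ennreal (C * M^2) * W \<tau> a b \<phi>" using W_mult_le[OF \<tau> ab] by blast
 show ?thesis
 proof (intro exI[of _ "4 * (C * M^2)"] conjI allI impI)
  show "4 * (C * M^2) > 0" using C(1) M0 by simp
  fix v \<phi> assume v: "zext a b v \<in> Borel" and \<phi>: "apx \<tau> a b v \<phi>"
  have t: "test_fun a b (\<phi> n)" for n using \<phi> by (simp add: apx_def)
  have l: "(\<lambda>n. W \<tau> a b (\<lambda>x. v x - \<phi> n x)) \<longlonglongrightarrow> 0" using \<phi> by (simp add: apx_def)
  have tq: "test_fun a b (\<lambda>x. q n x * \<phi> n x)" for n by (rule test_fun_mult[OF qs t])
  have mv: "zext a b (\<lambda>x. m x * v x) \<in> Borel" by (rule zext_mult_measurable[OF cm v])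
  have Wv: "W \<tau> a b v < \<infinity>" by (rule W_apx_finite[OF v \<phi>]) (use \<tau> in auto)
  have Wd: "W \<tau> a b (\<lambda>x. v x - \<phi> n x) < \<infinity>" for n
   using W_diff_le[OF v zext_test_measurable[OF t], of \<tau> n] Wv W_test_finite[OF t, of \<tau> n] \<tau> by (auto simp: ennreal_mult_less_top intro: le_less_trans)
  define w where "w = enn2real (W \<tau> a b v)"
  define \<delta> where "\<delta> n = enn2real (W \<tau> a b (\<lambda>x. v x - \<phi> n x))" for n
  have w: "W \<tau> a b v = ennreal w" "w \<ge> 0" and \<delta>: "W \<tau> a b (\<lambda>x. v x - \<phi> n x) = ennreal (\<delta> n)" "\<delta> n \<ge> 0" for n
   using Wv Wd[of n] by (auto simp: w_def \<delta>_def)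
  have \<delta>l: "\<delta> \<longlonglongrightarrow> 0" unfolding \<delta>_def[abs_def] by (rule tendsto_enn2real) (use l in auto)
  have \<epsilon>l: "\<epsilon> \<longlonglongrightarrow> 0" using LIMSEQ_inverse_real_of_nat by (simp add: \<epsilon>_def[abs_def] inverse_eq_divide)
  have Wt: "W \<tau> a b (\<phi> n) \<le> ennreal (2 * w + 2 * \<delta> n)" for n
   using W_le_apx(2)[OF v t, of \<tau> n] w(2) \<delta>(2)[of n] unfolding w(1) \<delta>(1) by (simp add: ennreal_plus ennreal_mult)
  \<comment> \<open>The share of one index in the Cauchy estimate. The coefficients come from the
    squared triangle inequality, with (\<epsilon> i + \<epsilon> j)^2 bounded by 2 (\<epsilon> i)^2
    + 2 (\<epsilon> j)^2 in front of w and by 4 in front of \<delta> j.\<close>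
  define h where "h i = (4 * (C * M^2) + 16 * C) * \<delta> i + 8 * C * w * (\<epsilon> i)^2" for i
  have hl: "h \<longlonglongrightarrow> 0"
  proof -
   have "h \<longlonglongrightarrow> (4 * (C * M^2) + 16 * C) * 0 + 8 * C * w * 0^2" unfolding h_def[abs_def] by (intro tendsto_intros \<delta>l \<epsilon>l)
   then show ?thesis by simp
  qed
  have cau: "W \<tau> a b (\<lambda>x. q i x * \<phi> i x - q j x * \<phi> j x) \<le> ennreal (h i + h j)" for i j
  proof -
   \<comment> \<open>The product rule for differences, arranged so that each term is a smooth factor
     times a test function.\<close>
   have e: "(\<lambda>x. q i x * \<phi> i x - q j x * \<phi> j x) = (\<lambda>x. q i x * (\<phi> i x - \<phi> j x) - (q j x + (-1) * q i x) * \<phi> j x)" by (auto simp: algebra_simps)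
   have qq: "smooth (\<lambda>x. q j x + (-1) * q i x)" by (intro smooth_add smooth_mult smooth_const qs)
   have dq: "deriv (\<lambda>x. q j x + (-1) * q i x) x = deriv (q j) x + (-1) * deriv (q i) x" for x
    by (rule DERIV_imp_deriv) (auto intro!: derivative_eq_intros smooth_DERIV[OF qs])
   have bq: "\<bar>q j x + (-1) * q i x\<bar> \<le> \<epsilon> i + \<epsilon> j \<and> \<bar>deriv (\<lambda>x. q j x + (-1) * q i x) x\<bar> \<le> \<epsilon> i + \<epsilon> j" if "x \<in> {a<..<b}" for x
    unfolding dq using qm[OF that, of i] qm[OF that, of j] by linarith
   have 1: "W \<tau> a b (\<lambda>x. q i x * (\<phi> i x - \<phi> j x)) \<le> ennreal (C * M^2) * ennreal (2 * \<delta> j + 2 * \<delta> i)"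
   proof -
    have "W \<tau> a b (\<lambda>x. q i x * (\<phi> i x - \<phi> j x)) \<le> ennreal (C * M^2) * W \<tau> a b (\<lambda>x. \<phi> i x - \<phi> j x)"
     by (rule C(2)[OF qs test_fun_diff[OF t t]]) (use qM in auto)
    also have "(\<lambda>x. \<phi> i x - \<phi> j x) = (\<lambda>x. (v x - \<phi> j x) - (v x - \<phi> i x))" by auto
    also have "W \<tau> a b ... \<le> 2 * W \<tau> a b (\<lambda>x. v x - \<phi> j x) + 2 * W \<tau> a b (\<lambda>x. v x - \<phi> i x)"
     by (intro W_diff_le zext_diff_measurable v zext_test_measurable t)
    finally show ?thesis using \<delta>(2) by (simp add: \<delta>(1) ennreal_plus ennreal_mult mult_left_mono)
   qed
   have 2: "W \<tau> a b (\<lambda>x. (q j x + (-1) * q i x) * \<phi> j x) \<le> ennreal (C * (\<epsilon> i + \<epsilon> j)^2) * ennreal (2 * w + 2 * \<delta> j)"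
    by (rule order_trans[OF C(2)[OF qq t, of "\<epsilon> i + \<epsilon> j"] mult_left_mono[OF Wt]]) (use bq in auto)
   have "W \<tau> a b (\<lambda>x. q i x * \<phi> i x - q j x * \<phi> j x) \<le> 2 * (ennreal (C * M^2) * ennreal (2 * \<delta> j + 2 * \<delta> i)) + 2 * (ennreal (C * (\<epsilon> i + \<epsilon> j)^2) * ennreal (2 * w + 2 * \<delta> j))"
    unfolding e
    by (rule order_trans[OF W_diff_le]) (intro zext_test_measurable test_fun_mult test_fun_diff qs qq t add_mono mult_left_mono 1 2 zero_le)+
   also have "... = ennreal (2 * (C * M^2 * (2 * \<delta> j + 2 * \<delta> i)) + 2 * (C * (\<epsilon> i + \<epsilon> j)^2 * (2 * w + 2 * \<delta> j)))"
    using C(1) w \<delta>(2) by (simp add: ennreal_plus ennreal_mult)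
   also have "... \<le> ennreal (h i + h j)"
   proof (rule ennreal_leI)
    have s1: "(\<epsilon> i + \<epsilon> j)^2 \<le> 2 * (\<epsilon> i)^2 + 2 * (\<epsilon> j)^2" using sum_squares_bound[of "\<epsilon> i" "\<epsilon> j"] by (simp add: power2_sum)
    have s2: "(\<epsilon> i + \<epsilon> j)^2 \<le> 2^2" using \<epsilon>[of i] \<epsilon>[of j] by (intro power_mono) auto
    have "C * ((\<epsilon> i + \<epsilon> j)^2 * w) \<le> C * ((2 * (\<epsilon> i)^2 + 2 * (\<epsilon> j)^2) * w)" using s1 w C(1) by (intro mult_left_mono mult_right_mono) auto
    moreover have "C * ((\<epsilon> i + \<epsilon> j)^2 * \<delta> j) \<le> C * (2^2 * \<delta> j)" using s2 \<delta> C(1) by (intro mult_left_mono mult_right_mono) auto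
    moreover have "0 \<le> C * \<delta> i" using C(1) \<delta>(2)[of i] by simp
    ultimately show "2 * (C * M^2 * (2 * \<delta> j + 2 * \<delta> i)) + 2 * (C * (\<epsilon> i + \<epsilon> j)^2 * (2 * w + 2 * \<delta> j)) \<le> h i + h j"
     unfolding h_def by (simp add: algebra_simps)
   qed
   finally show ?thesis .
  qed
  have sql: "(\<lambda>n. sq2 a b (\<lambda>x. m x * v x - q n x * \<phi> n x)) \<longlonglongrightarrow> 0"
  proof (rule null_seq_le)
   fix n
   have e: "(\<lambda>x. m x * v x - q n x * \<phi> n x) = (\<lambda>x. q n x * (v x - \<phi> n x) - (q n x - m x) * v x)" by (auto simp: algebra_simps)
   have z1: "zext a b (\<lambda>x. q n x * (v x - \<phi> n x)) \<in> Borel"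
    by (intro zext_mult_measurable zext_diff_measurable v zext_test_measurable t smooth_continuous_on qs)
   have z2: "zext a b (\<lambda>x. (q n x - m x) * v x) \<in> Borel"
    by (intro zext_mult_measurable v continuous_intros smooth_continuous_on qs cm)
   have "sq2 a b (\<lambda>x. m x * v x - q n x * \<phi> n x) \<le> 2 * sq2 a b (\<lambda>x. q n x * (v x - \<phi> n x)) + 2 * sq2 a b (\<lambda>x. (q n x - m x) * v x)"
    unfolding e by (rule sq2_add_le[OF z1 z2])
   also have "... \<le> 2 * (ennreal (M^2) * W \<tau> a b (\<lambda>x. v x - \<phi> n x)) + 2 * (ennreal ((\<epsilon> n)^2) * W \<tau> a b v)"
   proof (intro add_mono mult_left_mono)
    show "sq2 a b (\<lambda>x. q n x * (v x - \<phi> n x)) \<le> ennreal (M^2) * W \<tau> a b (\<lambda>x. v x - \<phi> n x)"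
     by (rule order_trans[OF sq2_mult_le[where M=M]]) (auto intro: zext_diff_measurable v zext_test_measurable t qM mult_left_mono simp: W_def)
    show "sq2 a b (\<lambda>x. (q n x - m x) * v x) \<le> ennreal ((\<epsilon> n)^2) * W \<tau> a b v"
     by (rule order_trans[OF sq2_mult_le[where M="\<epsilon> n"]]) (auto intro: v qm mult_left_mono simp: W_def)
   qed auto
   also have "... = ennreal (2 * (M^2 * \<delta> n) + 2 * ((\<epsilon> n)^2 * w))" unfolding w(1) \<delta>(1) using w(2) \<delta>(2)[of n] by (simp add: ennreal_plus ennreal_mult)
   finally show "sq2 a b (\<lambda>x. m x * v x - q n x * \<phi> n x) \<le> ennreal (2 * (M^2 * \<delta> n) + 2 * ((\<epsilon> n)^2 * w))" .
   have "(\<lambda>n. 2 * (M^2 * \<delta> n) + 2 * ((\<epsilon> n)^2 * w)) \<longlonglongrightarrow> 2 * (M^2 * 0) + 2 * (0^2 * w)" by (intro tendsto_intros \<delta>l \<epsilon>l)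
   then show "(\<lambda>n. ennreal (2 * (M^2 * \<delta> n) + 2 * ((\<epsilon> n)^2 * w))) \<longlonglongrightarrow> 0" using tendsto_ennrealI by force
  qed
  have lim: "(\<lambda>n. W \<tau> a b (\<lambda>x. m x * v x - q n x * \<phi> n x)) \<longlonglongrightarrow> 0"
  proof (rule W_limit[OF mv zext_test_measurable[OF tq] ab sql])
   show "sq2 a b (\<lambda>x. q n x * \<phi> n x) < \<infinity>" for n by (rule sq2_test_fun(2)[OF tq])
   fix e :: real assume e: "0 < e"
   obtain N where N: "\<And>n. n \<ge> N \<Longrightarrow> h n < e / 2" using order_tendstoD(2)[OF hl, of "e/2"] e unfolding eventually_sequentially by auto
   have "W \<tau> a b (\<lambda>x. q i x * \<phi> i x - q j x * \<phi> j x) \<le> ennreal e" if "i \<ge> N" "j \<ge> N" for i j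
    by (rule order_trans[OF cau ennreal_leI]) (use N[OF that(1)] N[OF that(2)] in linarith)
   then show "\<exists>N. \<forall>i\<ge>N. \<forall>j\<ge>N. W \<tau> a b (\<lambda>x. q i x * \<phi> i x - q j x * \<phi> j x) \<le> ennreal e" by blast
  qed
  then show "apx \<tau> a b (\<lambda>x. m x * v x) (\<lambda>n x. q n x * \<phi> n x)" using tq by (simp add: apx_def)
  have nl: "(\<lambda>n. 2 * W \<tau> a b (\<lambda>x. m x * v x - q n x * \<phi> n x) + (4 * ennreal (C * M^2)) * W \<tau> a b (\<lambda>x. v x - \<phi> n x)) \<longlonglongrightarrow> 0"
   by (rule null_seq_lin[OF lim l]) (auto simp: ennreal_mult_less_top)
  show "W \<tau> a b (\<lambda>x. m x * v x) \<le> ennreal (4 * (C * M^2)) * W \<tau> a b v"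
  proof (rule ennreal_le_of_null_seq[OF _ nl])
   fix n
   let ?A = "W \<tau> a b (\<lambda>x. m x * v x - q n x * \<phi> n x)" and ?B = "W \<tau> a b (\<lambda>x. v x - \<phi> n x)"
   have "W \<tau> a b (\<lambda>x. m x * v x) \<le> 2 * ?A + 2 * W \<tau> a b (\<lambda>x. q n x * \<phi> n x)" by (rule W_le_apx(1)[OF mv tq])
   also have "... \<le> 2 * ?A + 2 * (ennreal (C * M^2) * (2 * W \<tau> a b v + 2 * ?B))"
   proof (intro add_left_mono mult_left_mono)
    have "W \<tau> a b (\<lambda>x. q n x * \<phi> n x) \<le> ennreal (C * M^2) * W \<tau> a b (\<phi> n)" by (rule C(2)[OF qs t]) (use qM in auto)
    also have "... \<le> ennreal (C * M^2) * (2 * W \<tau> a b v + 2 * ?B)" by (intro mult_left_mono W_le_apx(2)[OF v t]) auto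
    finally show "W \<tau> a b (\<lambda>x. q n x * \<phi> n x) \<le> ennreal (C * M^2) * (2 * W \<tau> a b v + 2 * ?B)" .
   qed auto
   also have "2 * (ennreal (C * M^2) * (2 * W \<tau> a b v + 2 * ?B)) = (4 * ennreal (C * M^2)) * W \<tau> a b v + (4 * ennreal (C * M^2)) * ?B"
    by (simp add: distrib_left mult.assoc[symmetric] mult.commute[of "ennreal (C * M^2)" 2])
   finally have f: "W \<tau> a b (\<lambda>x. m x * v x) \<le> 2 * ?A + ((4 * ennreal (C * M^2)) * W \<tau> a b v + (4 * ennreal (C * M^2)) * ?B)" .
   have e4: "ennreal (4 * (C * M^2)) = 4 * ennreal (C * M^2)" using C(1) by (subst ennreal_mult) auto
   show "W \<tau> a b (\<lambda>x. m x * v x) \<le> ennreal (4 * (C * M^2)) * W \<tau> a b v + ennreal 1 * (2 * ?A + (4 * ennreal (C * M^2)) * ?B)"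
    unfolding e4 using f by (simp add: add_ac)
  qed
 qed
qed

section \<open>Bounded operators and forms on the energy space\<close>

lemma apx_mono:
 assumes s: "0 \<le> s" "s \<le> \<tau>" and u: "zext a b u \<in> Borel" and A: "apx \<tau> a b u \<phi>"
 shows "apx s a b u \<phi>"
proof -
 have t: "test_fun a b (\<phi> n)" for n using A by (simp add: apx_def)
 have l: "(\<lambda>n. ennreal (1 + 2 * pi) * W \<tau> a b (\<lambda>x. u x - \<phi> n x)) \<longlonglongrightarrow> ennreal (1 + 2 * pi) * 0"
  by (rule ennreal_tendsto_cmult) (use A in \<open>auto simp: apx_def\<close>)
 have "(\<lambda>n. W s a b (\<lambda>x. u x - \<phi> n x)) \<longlonglongrightarrow> 0"
  by (rule null_seq_le[OF W_mono[OF s zext_diff_measurable[OF u zext_test_measurable[OF t]]]]) (use l in simp)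
 then show ?thesis using t by (simp add: apx_def)
qed

lemma ennreal_le_twice:
 assumes "ennreal x \<le> 2 * ennreal y + 2 * ennreal z" "0 \<le> y" "0 \<le> z" shows "x \<le> 2 * y + 2 * z"
proof -
 have "2 * ennreal y + 2 * ennreal z = ennreal (2 * y + 2 * z)" using assms by (simp add: ennreal_plus ennreal_mult)
 then show ?thesis using assms by (metis add_nonneg_nonneg ennreal_le_iff mult_nonneg_nonneg zero_le_numeral)
qed

context
 fixes a b s :: real
 assumes ab: "a < b" and s: "1/2 < s" "s \<le> 1"
begin

lemma H0_apx:
 assumes "u \<in> H0 s a b"
 obtains \<phi> where "zext a b u \<in> Borel" "apx s a b u \<phi>" "apx (1 - s) a b u \<phi>"
proof -
 have u: "u \<in> Borel" "\<exists>\<phi>. apx s a b u \<phi>" using assms H0_iff[of s a b u] s ab by auto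
 then obtain \<phi> where \<phi>: "apx s a b u \<phi>" by blast
 have z: "zext a b u \<in> Borel" by (rule zext_measurable[OF u(1)])
 show ?thesis by (rule that[OF z \<phi> apx_mono[OF _ _ z \<phi>]]) (use s in auto)
qed

lemma W_H0: "u \<in> H0 s a b \<Longrightarrow> W s a b u < \<infinity>"
 by (erule H0_apx, rule W_apx_finite) (use s in auto)

lemma zext_H0: "u \<in> H0 s a b \<Longrightarrow> zext a b u \<in> Borel"
 by (erule H0_apx)

lemma H0_closed: "u \<in> H0 s a b \<Longrightarrow> v \<in> H0 s a b \<Longrightarrow> (\<lambda>x. u x + r * v x) \<in> H0 s a b"
 by (rule H0_lin) (use s ab in auto)

lemma test_H0: "test_fun a b \<phi> \<Longrightarrow> \<phi> \<in> H0 s a b"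
 by (rule test_fun_H0) (use s ab in auto)

lemma bounded_op_mult:
 assumes c: "continuous_on {a..b} c" shows "bounded_op s a b (\<lambda>u x. c x * u x)"
proof -
 obtain M where M: "M > 0" "\<forall>x\<in>{a..b}. \<bar>c x\<bar> \<le> M" using continuous_bounded_Icc[OF c] by blast
 show ?thesis
 proof (rule bopI[OF _ _ _ W_H0])
  show "zext a b (\<lambda>x. c x * u x) \<in> Borel" if "u \<in> H0 s a b" for u by (rule zext_mult_measurable[OF c zext_H0[OF that]])
  show "0 < M^2" using M by simp
  show "sq2 a b (\<lambda>x. c x * u x) \<le> ennreal (M^2) * W s a b u" if "u \<in> H0 s a b" for u
   by (rule order_trans[OF sq2_mult_le[where M=M]]) (use M that zext_H0 in \<open>auto simp: W_def intro: mult_left_mono\<close>)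
 qed (simp_all add: algebra_simps)
qed

lemma bounded_op_ident: "bounded_op s a b (\<lambda>u. u)"
 using bounded_op_mult[of "\<lambda>x. 1"] by simp

lemma bounded_op_ext_same:
 assumes D: "bounded_test_op s a b D" shows "bounded_op s a b (ext_op s a b D)"
 by (rule bounded_op_ext[OF _ _ _ ab D, where T="\<lambda>u. u" and K=1])
  (use s W_H0 in \<open>auto intro: zext_H0 elim: H0_apx\<close>)

lemma bounded_op_ext_lower:
 assumes D: "bounded_test_op (1 - s) a b D" shows "bounded_op s a b (ext_op (1 - s) a b D)"
 by (rule bounded_op_ext[OF _ _ _ ab D, where T="\<lambda>u. u" and K="1 + 2 * pi"])
  (use s W_H0 in \<open>auto intro: zext_H0 add_pos_pos elim: H0_apx intro!: W_mono simp del: ennreal_plus\<close>)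

lemma bounded_op_ext_mult:
 assumes D: "bounded_test_op (1 - s) a b D" and q: "C1_approx a b m m' q" and cm: "continuous_on {a..b} m" "continuous_on {a..b} m'"
 shows "bounded_op s a b (\<lambda>u. ext_op (1 - s) a b D (\<lambda>x. m x * u x))"
proof -
 obtain K where K: "K > 0" "\<And>v \<phi>. zext a b v \<in> Borel \<Longrightarrow> apx (1 - s) a b v \<phi> \<Longrightarrow>
   apx (1 - s) a b (\<lambda>x. m x * v x) (\<lambda>n x. q n x * \<phi> n x) \<and> W (1 - s) a b (\<lambda>x. m x * v x) \<le> ennreal K * W (1 - s) a b v"
  using mult_apx[of "1 - s", OF _ _ ab q cm] s by auto
 show ?thesis
 proof (rule bounded_op_ext[OF _ _ _ ab D])
  show "zext a b (\<lambda>x. m x * u x) \<in> Borel" if "u \<in> H0 s a b" for u by (rule zext_mult_measurable[OF cm(1) zext_H0[OF that]])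
  show "\<exists>\<psi>. apx (1 - s) a b (\<lambda>x. m x * u x) \<psi>" if "u \<in> H0 s a b" for u using H0_apx[OF that] K(2) by blast
  show "0 < K * (1 + 2 * pi)" using K(1) by (simp add: add_pos_pos)
  show "W (1 - s) a b (\<lambda>x. m x * u x) \<le> ennreal (K * (1 + 2 * pi)) * W s a b u" if u: "u \<in> H0 s a b" for u
  proof -
   obtain \<phi> where \<phi>: "zext a b u \<in> Borel" "apx (1 - s) a b u \<phi>" using H0_apx[OF u] by blast
   have "W (1 - s) a b (\<lambda>x. m x * u x) \<le> ennreal K * W (1 - s) a b u" using K(2)[OF \<phi>] by blast
   also have "... \<le> ennreal K * (ennreal (1 + 2 * pi) * W s a b u)" by (intro mult_left_mono W_mono \<phi>) (use s in auto)
   also have "... = ennreal (K * (1 + 2 * pi)) * W s a b u" using K(1) by (simp only: ennreal_mult' mult.assoc less_imp_le)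
   finally show ?thesis .
  qed
 qed (use s W_H0 in \<open>auto simp: algebra_simps\<close>)
qed

text \<open>\<open>W\<close> is finite on \<open>H0\<close>, so \<open>enn2real\<close> loses
  nothing there; where \<open>W\<close> is infinite the value would be the default 0.\<close>

definition nW :: "(real \<Rightarrow> real) \<Rightarrow> real" where "nW u = sqrt (enn2real (W s a b u))"

lemma nW_nonneg: "0 \<le> nW u" by (simp add: nW_def)

lemma nW_square: "u \<in> H0 s a b \<Longrightarrow> W s a b u = ennreal ((nW u)^2)"
 using W_H0[of u] by (simp add: nW_def)

definition bounded_form :: "((real \<Rightarrow> real) \<Rightarrow> (real \<Rightarrow> real) \<Rightarrow> real) \<Rightarrow> bool" where
 "bounded_form B \<longleftrightarrow> (\<forall>u\<in>H0 s a b. \<forall>v\<in>H0 s a b. \<forall>w\<in>H0 s a b. \<forall>r. B (\<lambda>x. u x + r * v x) w = B u w + r * B v w) \<and>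
  (\<forall>u\<in>H0 s a b. \<forall>v\<in>H0 s a b. \<forall>w\<in>H0 s a b. \<forall>r. B w (\<lambda>x. u x + r * v x) = B w u + r * B w v) \<and>
  (\<exists>C>0. \<forall>u\<in>H0 s a b. \<forall>v\<in>H0 s a b. \<bar>B u v\<bar> \<le> C * nW u * nW v)"

lemma bounded_op_norm:
 assumes E: "bounded_op s a b E" shows "\<exists>C>0. \<forall>u\<in>H0 s a b. sqrt (L2ip a b (E u) (E u)) \<le> C * nW u"
proof -
 obtain C where C: "C > 0" "\<And>u. u \<in> H0 s a b \<Longrightarrow> sq2 a b (E u) \<le> ennreal C * W s a b u" using E unfolding bounded_op_def by blast
 have "sqrt (L2ip a b (E u) (E u)) \<le> sqrt C * nW u" if u: "u \<in> H0 s a b" for u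
 proof -
  have "L2i a b (E u)" using E u unfolding bounded_op_def by blast
  then have "ennreal (L2ip a b (E u) (E u)) \<le> ennreal C * ennreal ((nW u)^2)" using C(2)[OF u] by (simp add: L2i_square_integrable nW_square[OF u])
  then have "L2ip a b (E u) (E u) \<le> C * (nW u)^2" using C(1) by (simp add: ennreal_mult[symmetric])
  then have "sqrt (L2ip a b (E u) (E u)) \<le> sqrt (C * (nW u)^2)" by (rule real_sqrt_le_mono)
  then show ?thesis using nW_nonneg[of u] by (simp add: real_sqrt_mult)
 qed
 then show ?thesis using C(1) by (intro exI[of _ "sqrt C"]) auto
qed

text \<open>The operators are linear up to null sets, which the integral does not see, so the form
  is bilinear exactly.\<close>

lemma bounded_form_L2ip:
 assumes E: "bounded_op s a b E" and F: "bounded_op s a b F" shows "bounded_form (\<lambda>u v. L2ip a b (E u) (F v))"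
 unfolding bounded_form_def
proof (intro conjI ballI allI)
 have El: "L2i a b (E u)" and Fl: "L2i a b (F u)" if "u \<in> H0 s a b" for u using E F that unfolding bounded_op_def by blast+
 have Ea: "AE x in lborel. x \<in> {a<..<b} \<longrightarrow> E (\<lambda>x. u x + r * v x) x = E u x + r * E v x"
  and Fa: "AE x in lborel. x \<in> {a<..<b} \<longrightarrow> F (\<lambda>x. u x + r * v x) x = F u x + r * F v x" if "u \<in> H0 s a b" "v \<in> H0 s a b" for u v r
  using E F that unfolding bounded_op_def by blast+
 fix u v w r assume h: "u \<in> H0 s a b" "v \<in> H0 s a b" "w \<in> H0 s a b"
 show "L2ip a b (E (\<lambda>x. u x + r * v x)) (F w) = L2ip a b (E u) (F w) + r * L2ip a b (E v) (F w)"
  unfolding L2ip_cong_AE(1)[OF Ea[OF h(1,2)] El[OF H0_closed[OF h(1,2)]] L2i_lin[OF El[OF h(1)] El[OF h(2)]] Fl[OF h(3)]]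
  by (rule L2ip_lin_left) (intro El Fl h)+
 show "L2ip a b (E w) (F (\<lambda>x. u x + r * v x)) = L2ip a b (E w) (F u) + r * L2ip a b (E w) (F v)"
  unfolding L2ip_cong_AE(2)[OF Fa[OF h(1,2)] Fl[OF H0_closed[OF h(1,2)]] L2i_lin[OF Fl[OF h(1)] Fl[OF h(2)]] El[OF h(3)]]
  by (rule L2ip_lin_right) (intro El Fl h)+
next
 obtain C where C: "C > 0" "\<And>u. u \<in> H0 s a b \<Longrightarrow> sqrt (L2ip a b (E u) (E u)) \<le> C * nW u" using bounded_op_norm[OF E] by blast
 obtain C' where C': "C' > 0" "\<And>u. u \<in> H0 s a b \<Longrightarrow> sqrt (L2ip a b (F u) (F u)) \<le> C' * nW u" using bounded_op_norm[OF F] by blast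
 have "\<bar>L2ip a b (E u) (F v)\<bar> \<le> C * C' * nW u * nW v" if u: "u \<in> H0 s a b" and v: "v \<in> H0 s a b" for u v
 proof -
  have l: "L2i a b (E u)" "L2i a b (F v)" using E F u v unfolding bounded_op_def by blast+
  have "\<bar>L2ip a b (E u) (F v)\<bar> \<le> sqrt (L2ip a b (E u) (E u)) * sqrt (L2ip a b (F v) (F v))" by (rule L2ip_CS[OF l])
  also have "... \<le> (C * nW u) * (C' * nW v)"
   by (intro mult_mono C(2)[OF u] C'(2)[OF v]) (use C(1) nW_nonneg[of u] L2i_square_integrable(3)[OF l(2)] in auto)
  finally show ?thesis by (simp add: mult_ac)
 qed
 then show "\<exists>C>0. \<forall>u\<in>H0 s a b. \<forall>v\<in>H0 s a b. \<bar>L2ip a b (E u) (F v)\<bar> \<le> C * nW u * nW v" using C(1) C'(1) by (intro exI[of _ "C * C'"]) auto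
qed

lemma bounded_form_lin:
 assumes A: "bounded_form A" and B: "bounded_form B" shows "bounded_form (\<lambda>u v. A u v + k * B u v)"
 unfolding bounded_form_def
proof (intro conjI ballI allI)
 fix u v w r assume h: "u \<in> H0 s a b" "v \<in> H0 s a b" "w \<in> H0 s a b"
 show "A (\<lambda>x. u x + r * v x) w + k * B (\<lambda>x. u x + r * v x) w = A u w + k * B u w + r * (A v w + k * B v w)"
  "A w (\<lambda>x. u x + r * v x) + k * B w (\<lambda>x. u x + r * v x) = A w u + k * B w u + r * (A w v + k * B w v)"
  using A B h unfolding bounded_form_def by (simp_all add: algebra_simps)
next
 obtain C where C: "C > 0" "\<And>u v. u \<in> H0 s a b \<Longrightarrow> v \<in> H0 s a b \<Longrightarrow> \<bar>A u v\<bar> \<le> C * nW u * nW v" using A unfolding bounded_form_def by blast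
 obtain C' where C': "C' > 0" "\<And>u v. u \<in> H0 s a b \<Longrightarrow> v \<in> H0 s a b \<Longrightarrow> \<bar>B u v\<bar> \<le> C' * nW u * nW v" using B unfolding bounded_form_def by blast
 have "\<bar>A u v + k * B u v\<bar> \<le> (C + \<bar>k\<bar> * C') * nW u * nW v" if h: "u \<in> H0 s a b" "v \<in> H0 s a b" for u v
 proof -
  have "\<bar>k * B u v\<bar> \<le> \<bar>k\<bar> * (C' * nW u * nW v)" unfolding abs_mult by (intro mult_left_mono C' h) auto
  then show ?thesis using C(2)[OF h] by (simp add: algebra_simps)
 qed
 then show "\<exists>C>0. \<forall>u\<in>H0 s a b. \<forall>v\<in>H0 s a b. \<bar>A u v + k * B u v\<bar> \<le> C * nW u * nW v" using C(1) C'(1) by (intro exI[of _ "C + \<bar>k\<bar> * C'"]) (auto intro: add_pos_nonneg)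
qed

lemma nW_apx:
 assumes "u \<in> H0 s a b" obtains \<phi> where "\<And>n. test_fun a b (\<phi> n)" "(\<lambda>n. nW (\<lambda>x. u x - \<phi> n x)) \<longlonglongrightarrow> 0"
proof -
 obtain \<phi> where \<phi>: "apx s a b u \<phi>" using H0_apx[OF assms] by blast
 have "(\<lambda>n. enn2real (W s a b (\<lambda>x. u x - \<phi> n x))) \<longlonglongrightarrow> 0" by (rule tendsto_enn2real) (use \<phi> in \<open>auto simp: apx_def\<close>)
 then have "(\<lambda>n. nW (\<lambda>x. u x - \<phi> n x)) \<longlonglongrightarrow> sqrt 0" unfolding nW_def by (rule tendsto_real_sqrt)
 then show ?thesis using \<phi> that by (auto simp: apx_def)
qed

lemma H0_diff: "u \<in> H0 s a b \<Longrightarrow> v \<in> H0 s a b \<Longrightarrow> (\<lambda>x. u x - v x) \<in> H0 s a b"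
 using H0_closed[of u v "-1"] by simp

text \<open>The squared triangle inequality between u, u - \<phi> n and \<phi> n halves the
  constant. All remaining terms carry a factor d n, the approximation error, and vanish in the
  limit.\<close>

lemma coercive_density:
 assumes B: "bounded_form B" and c: "0 < c" and co: "\<And>\<phi>. test_fun a b \<phi> \<Longrightarrow> c * (nW \<phi>)^2 \<le> B \<phi> \<phi>" and u: "u \<in> H0 s a b"
 shows "c / 2 * (nW u)^2 \<le> B u u"
proof -
 obtain \<phi> where t: "\<And>n. test_fun a b (\<phi> n)" and l: "(\<lambda>n. nW (\<lambda>x. u x - \<phi> n x)) \<longlonglongrightarrow> 0" using nW_apx[OF u] by blast
 obtain C where C: "C > 0" "\<And>u v. u \<in> H0 s a b \<Longrightarrow> v \<in> H0 s a b \<Longrightarrow> \<bar>B u v\<bar> \<le> C * nW u * nW v" using B unfolding bounded_form_def by blast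
 define d where "d n = nW (\<lambda>x. u x - \<phi> n x)" for n
 have le: "c / 2 * (nW u)^2 \<le> B u u + (2 * C * nW u * d n + C * d n * d n + c * (d n)^2)" for n
 proof -
  define e where "e = (\<lambda>x. u x - \<phi> n x)"
  have eH: "e \<in> H0 s a b" unfolding e_def by (intro H0_diff u test_H0 t)
  have \<phi>: "\<phi> n = (\<lambda>x. u x + (-1) * e x)" by (auto simp: e_def)
  have \<phi>H: "(\<lambda>x. u x + (-1) * e x) \<in> H0 s a b" using test_H0[OF t[of n]] \<phi> by simp
  have "B (\<phi> n) (\<phi> n) = B u u - B u e - B e u + B e e"
  proof -
   have l1: "B (\<lambda>x. u x + (-1) * e x) w = B u w + (-1) * B e w" "B w (\<lambda>x. u x + (-1) * e x) = B w u + (-1) * B w e" if "w \<in> H0 s a b" for w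
    using B u eH that unfolding bounded_form_def by blast+
   show ?thesis unfolding \<phi> l1(1)[OF \<phi>H] l1(2)[OF u] l1(2)[OF eH] by simp
  qed
  also have "... \<le> B u u + (2 * C * nW u * d n + C * d n * d n)"
   using C(2)[OF u eH] C(2)[OF eH u] C(2)[OF eH eH] unfolding d_def e_def[symmetric] by (simp add: mult_ac abs_le_iff)
  finally have 1: "c * (nW (\<phi> n))^2 \<le> B u u + (2 * C * nW u * d n + C * d n * d n)" using co[OF t[of n]] by linarith
  have "(nW u)^2 \<le> 2 * (nW (\<lambda>x. u x - \<phi> n x))^2 + 2 * (nW (\<phi> n))^2"
  proof -
   have "ennreal ((nW u)^2) \<le> 2 * ennreal ((nW (\<lambda>x. u x - \<phi> n x))^2) + 2 * ennreal ((nW (\<phi> n))^2)"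
    using W_le_apx(1)[OF zext_H0[OF u] t[of n], of s] by (simp only: nW_square u H0_diff test_H0 t)
   then show ?thesis by (rule ennreal_le_twice) auto
  qed
  then have "c / 2 * (nW u)^2 \<le> c / 2 * (2 * (d n)^2 + 2 * (nW (\<phi> n))^2)" unfolding d_def using c by (intro mult_left_mono) auto
  then show ?thesis using 1 by (simp add: algebra_simps)
 qed
 have "(\<lambda>n. B u u + (2 * C * nW u * d n + C * d n * d n + c * (d n)^2)) \<longlonglongrightarrow> B u u + (2 * C * nW u * 0 + C * 0 * 0 + c * 0^2)"
  using l unfolding d_def[symmetric] by (intro tendsto_intros)
 then show ?thesis using le by (intro LIMSEQ_le_const) auto
qed

end

section \<open>The weak formulation\<close>

text \<open>The derivative of q times the square of \<phi> integrates to zero.\<close>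

lemma integral_by_parts_square:
 assumes \<phi>: "test_fun a b \<phi>" and q: "smooth q"
 shows "(LB x. deriv \<phi> x * (q x * \<phi> x)) = - (LB x. deriv q x * \<phi> x * \<phi> x) / 2" "integrable lborel (\<lambda>x. deriv q x * \<phi> x * \<phi> x)"
proof -
 have t: "test_fun a b (\<lambda>x. \<phi> x * (q x * \<phi> x))" by (intro test_fun_mult test_fun_smooth[OF \<phi>] q \<phi>)
 have i: "integrable lborel (\<lambda>x. deriv \<phi> x * (q x * \<phi> x))"
  by (intro test_fun_integrable(1)[of a b] test_fun_mult test_fun_smooth[OF test_fun_deriv[OF \<phi>]] q \<phi>)
 have "test_fun a b (\<lambda>x. \<phi> x * (deriv q x * \<phi> x))" by (intro test_fun_mult test_fun_smooth[OF \<phi>] smooth_deriv q \<phi>)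
 then have "test_fun a b (\<lambda>x. deriv q x * \<phi> x * \<phi> x)" by (simp add: mult_ac)
 then show j: "integrable lborel (\<lambda>x. deriv q x * \<phi> x * \<phi> x)" by (rule test_fun_integrable(1))
 have "deriv (\<lambda>x. \<phi> x * (q x * \<phi> x)) x = 2 * (deriv \<phi> x * (q x * \<phi> x)) + deriv q x * \<phi> x * \<phi> x" for x
  by (rule DERIV_imp_deriv) (auto intro!: derivative_eq_intros smooth_DERIV test_fun_smooth[OF \<phi>] q simp: algebra_simps)
 then have "(LB x. 2 * (deriv \<phi> x * (q x * \<phi> x)) + deriv q x * \<phi> x * \<phi> x) = 0" using test_fun_int_deriv[OF t] by simp
 then show "(LB x. deriv \<phi> x * (q x * \<phi> x)) = - (LB x. deriv q x * \<phi> x * \<phi> x) / 2"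
  using i j by simp
qed

lemma L2i_op_test:
 assumes s: "0 \<le> s" "s \<le> 1" and D: "bounded_test_op s a b D" and \<phi>: "test_fun a b \<phi>" shows "L2i a b (D \<phi>)"
proof -
 obtain C where "sq2 a b (D \<phi>) \<le> ennreal C * W s a b \<phi>" using D \<phi> unfolding bounded_test_op_def by blast
 then have "sq2 a b (D \<phi>) < \<infinity>" using W_test_finite[OF \<phi> s] by (auto simp: ennreal_mult_less_top intro: le_less_trans)
 then show ?thesis using D \<phi> unfolding L2i_def bounded_test_op_def by blast
qed

text \<open>On m \<phi> the extended derivative is known only as the L2 limit of those of q n *
  \<phi>. For these, \<open>DL_DR_convection\<close> and integration by parts give minus half the
  integral of the derivative of q n times the square of \<phi>, and that derivative is at most m' +
  1 / (n + 1). Both errors are collected in R n, which tends to 0.\<close>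

lemma mult_term_test:
 assumes ab: "a < b" and s: "1/2 < s" "s \<le> 1" and q: "C1_approx a b m m' q" and cm: "continuous_on {a..b} m" "continuous_on {a..b} m'"
  and c: "continuous_on {a..b} c" and \<kappa>: "\<And>x. x \<in> {a..b} \<Longrightarrow> \<kappa> \<le> c x - m' x / 2" and \<phi>: "test_fun a b \<phi>"
 shows "\<kappa> * L2ip a b \<phi> \<phi> \<le> L2ip a b (DL a s 0 \<phi>) (ext_op (1 - s) a b (DR b (1 - s) 0) (\<lambda>x. m x * \<phi> x)) + L2ip a b (\<lambda>x. c x * \<phi> x) \<phi>"
proof -
 define g where "g = ext_op (1 - s) a b (DR b (1 - s) 0) (\<lambda>x. m x * \<phi> x)"
 have D: "bounded_test_op (1 - s) a b (DR b (1 - s) 0)" by (rule bounded_test_op_DR[OF ab]) (use s in auto)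
 have D0: "L2i a b (DL a s 0 \<phi>)" by (rule L2i_op_test[OF _ _ bounded_test_op_DL[OF ab] \<phi>]) (use s in auto)
 have \<phi>H: "\<phi> \<in> H0 s a b" by (rule test_H0[OF ab s \<phi>])
 have gl: "L2i a b g" unfolding g_def using bounded_op_ext_mult[OF ab s D q cm] \<phi>H unfolding bounded_op_def by blast
 have qs: "smooth (q n)" for n using q by (simp add: C1_approx_def)
 have qt: "test_fun a b (\<lambda>x. q n x * \<phi> x)" for n by (rule test_fun_mult[OF qs \<phi>])
 have mz: "zext a b (\<lambda>x. m x * \<phi> x) \<in> Borel" by (rule zext_mult_measurable[OF cm(1) zext_test_measurable[OF \<phi>]])
 have A: "apx (1 - s) a b (\<lambda>x. m x * \<phi> x) (\<lambda>n x. q n x * \<phi> x)"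
  using mult_apx[of "1 - s", OF _ _ ab q cm] zext_test_measurable[OF \<phi>] apx_const[OF \<phi>, of "1 - s"] s by auto
 have l: "(\<lambda>n. sq2 a b (\<lambda>x. DR b (1 - s) 0 (\<lambda>x. q n x * \<phi> x) x - g x)) \<longlonglongrightarrow> 0"
  unfolding g_def by (rule ext_op_converges(2)[OF _ _ _ ab D mz _ A]) (use s A in auto)
 define d where "d n = (\<lambda>x. DR b (1 - s) 0 (\<lambda>x. q n x * \<phi> x) x + (-1) * g x)" for n
 have Dq: "L2i a b (DR b (1 - s) 0 (\<lambda>x. q n x * \<phi> x))" for n by (rule L2i_op_test[OF _ _ D qt]) (use s in auto)
 have dl: "L2i a b (d n)" for n unfolding d_def by (rule L2i_lin[OF Dq gl])
 have d0: "(\<lambda>n. L2ip a b (d n) (d n)) \<longlonglongrightarrow> 0"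
 proof -
  have "sq2 a b (d n) = ennreal (L2ip a b (d n) (d n))" for n by (rule L2i_square_integrable(2)[OF dl])
  moreover have "(\<lambda>n. sq2 a b (d n)) \<longlonglongrightarrow> 0" using l by (simp add: d_def)
  ultimately have "(\<lambda>n. ennreal (L2ip a b (d n) (d n))) \<longlonglongrightarrow> ennreal 0" by simp
  then show ?thesis by (subst (asm) tendsto_ennreal_iff) (auto intro: always_eventually L2i_square_integrable(3) dl)
 qed
 define R where "R n = sqrt (L2ip a b (DL a s 0 \<phi>) (DL a s 0 \<phi>)) * sqrt (L2ip a b (d n) (d n)) + 1 / real (Suc n) / 2 * L2ip a b \<phi> \<phi>" for n
 have "(\<lambda>n. 1 / real (Suc n)) \<longlonglongrightarrow> 0" using LIMSEQ_inverse_real_of_nat by (simp add: inverse_eq_divide)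
 then have "R \<longlonglongrightarrow> sqrt (L2ip a b (DL a s 0 \<phi>) (DL a s 0 \<phi>)) * sqrt 0 + 0 / 2 * L2ip a b \<phi> \<phi>"
  unfolding R_def[abs_def] by (intro tendsto_intros d0) auto
 then have R0: "R \<longlonglongrightarrow> 0" by simp
 define X where "X = L2ip a b (DL a s 0 \<phi>) g + L2ip a b (\<lambda>x. c x * \<phi> x) \<phi>"
 have "\<kappa> * L2ip a b \<phi> \<phi> \<le> X + R n" for n
 proof -
  have "L2ip a b (DL a s 0 \<phi>) (d n) = (LB x. deriv \<phi> x * (q n x * \<phi> x)) + (-1) * L2ip a b (DL a s 0 \<phi>) g"
   unfolding d_def DL_DR_convection[OF s ab \<phi> qt, symmetric] by (rule L2ip_lin_right[OF Dq gl D0])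
  moreover have "\<bar>L2ip a b (DL a s 0 \<phi>) (d n)\<bar> \<le> sqrt (L2ip a b (DL a s 0 \<phi>) (DL a s 0 \<phi>)) * sqrt (L2ip a b (d n) (d n))" by (rule L2ip_CS[OF D0 dl])
  ultimately have 1: "(LB x. deriv \<phi> x * (q n x * \<phi> x)) \<le> L2ip a b (DL a s 0 \<phi>) g + sqrt (L2ip a b (DL a s 0 \<phi>) (DL a s 0 \<phi>)) * sqrt (L2ip a b (d n) (d n))"
   unfolding abs_le_iff by simp
  have cl: "L2i a b (\<lambda>x. c x * \<phi> x)" using bounded_op_mult[OF ab s c] \<phi>H unfolding bounded_op_def by blast
  have pl: "L2i a b \<phi>" by (rule L2i_test[OF \<phi>])
  note i1 = L2i_prod_integrable[OF cl pl]
  note i2 = L2i_prod_integrable[OF pl pl]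
  note i3 = integral_by_parts_square(2)[OF \<phi> qs[of n]]
  have "(LB x. (\<kappa> - 1 / real (Suc n) / 2) * (zext a b \<phi> x * zext a b \<phi> x)) \<le> (LB x. zext a b (\<lambda>x. c x * \<phi> x) x * zext a b \<phi> x - (deriv (q n) x * \<phi> x * \<phi> x) / 2)"
  proof (rule integral_mono)
   fix x
   show "(\<kappa> - 1 / real (Suc n) / 2) * (zext a b \<phi> x * zext a b \<phi> x) \<le> zext a b (\<lambda>x. c x * \<phi> x) x * zext a b \<phi> x - (deriv (q n) x * \<phi> x * \<phi> x) / 2"
   proof (cases "x \<in> {a<..<b}")
    case True
    then have x: "x \<in> {a..b}" by auto
    have "deriv (q n) x - m' x \<le> 1 / real (Suc n)" using q x unfolding C1_approx_def abs_le_iff by blast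
    moreover have "(\<kappa> - e / 2 \<le> c x - y / 2)" if "y - m' x \<le> e" for e y using \<kappa>[OF x] that by (simp add: field_simps)
    ultimately have "\<kappa> - 1 / real (Suc n) / 2 \<le> c x - deriv (q n) x / 2" by blast
    then have "(\<kappa> - 1 / real (Suc n) / 2) * (\<phi> x * \<phi> x) \<le> (c x - deriv (q n) x / 2) * (\<phi> x * \<phi> x)" by (rule mult_right_mono) simp
    then show ?thesis using True by (simp add: zext_def left_diff_distrib mult.assoc)
   qed (simp add: zext_def test_fun_outside[OF \<phi>])
  qed (use i1 i2 i3 in auto)
  then have "(\<kappa> - 1 / real (Suc n) / 2) * L2ip a b \<phi> \<phi> \<le> L2ip a b (\<lambda>x. c x * \<phi> x) \<phi> - (LB x. deriv (q n) x * \<phi> x * \<phi> x) / 2"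
   unfolding L2ip_zext using i1 i2 i3 by (simp add: integral_divide_zero)
  then show ?thesis using 1 unfolding integral_by_parts_square(1)[OF \<phi> qs] X_def R_def by (simp add: left_diff_distrib)
 qed
 moreover have "(\<lambda>n. X + R n) \<longlonglongrightarrow> X + 0" by (intro tendsto_intros R0)
 ultimately have "\<kappa> * L2ip a b \<phi> \<phi> \<le> X" by (intro LIMSEQ_le_const[of _ X]) auto
 then show ?thesis by (simp add: X_def g_def)
qed

lemma Aform_bform:
 assumes ab: "a < b" and s: "1/2 < s" "s \<le> 1" and q: "C1_approx a b m m' q" and cm: "continuous_on {a..b} m" "continuous_on {a..b} m'"
  and c: "continuous_on {a..b} c"
 shows "bounded_form a b s (Aform a b (2 * s) p lam m c)"
proof -
 have L: "bounded_test_op s a b (DL a s lam)" "bounded_test_op s a b (DL a s 0)" "bounded_test_op s a b (DR b s lam)" and R: "bounded_test_op (1 - s) a b (DR b (1 - s) 0)"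
  using s by (auto intro!: bounded_test_op_DL bounded_test_op_DR ab)
 note E = bounded_op_ext_same[OF ab s L(1)] bounded_op_ext_same[OF ab s L(2)] bounded_op_ext_same[OF ab s L(3)] bounded_op_ext_lower[OF ab s R] bounded_op_ext_mult[OF ab s R q cm]
  bounded_op_ident[OF ab s] bounded_op_mult[OF ab s c]
 note B = bounded_form_L2ip[OF ab s]
 \<comment> \<open>The seven terms of the form, nested to the left so that each application of
   \<open>bounded_form_lin\<close> adds a scalar multiple of one inner product.\<close>
 have "bounded_form a b s (\<lambda>u v. ((((((L2ip a b (\<lambda>x. c x * u x) v + - (1 - p) * L2ip a b (ext_op s a b (DL a s lam) u) (ext_op s a b (DR b s lam) v))
   + - p * L2ip a b (ext_op s a b (DR b s lam) u) (ext_op s a b (DL a s lam) v)) + (1 - p) * lam powr (2 * s) * L2ip a b u v) + p * lam powr (2 * s) * L2ip a b u v)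
   + 2 * s * (1 - 2 * p) * lam powr (2 * s - 1) * L2ip a b (ext_op s a b (DL a s 0) u) (ext_op (1 - s) a b (DR b (1 - s) 0) v))
   + 1 * L2ip a b (ext_op s a b (DL a s 0) u) (ext_op (1 - s) a b (DR b (1 - s) 0) (\<lambda>x. m x * v x))))"
  by (intro bounded_form_lin[OF ab s] B E)
 then show ?thesis unfolding Aform_def by (rule back_subst[of "bounded_form a b s"]) (simp add: fun_eq_iff)
qed

text \<open>On the diagonal the two diffusion terms coincide by symmetry of the inner product, so
  the weights 1 - p and p add up to 1. The convection term with lam powr (\<alpha> - 1) is a
  multiple of the integral of \<phi> times its derivative, which is 0.\<close>

lemma Aform_coercive_test:
 assumes ab: "a < b" and s: "1/2 < s" "s \<le> 1" and q: "C1_approx a b m m' q" and cm: "continuous_on {a..b} m" "continuous_on {a..b} m'"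
  and c: "continuous_on {a..b} c" and \<kappa>: "0 < \<kappa>" "\<And>x. x \<in> {a..b} \<Longrightarrow> \<kappa> \<le> c x - m' x / 2" and lam: "0 \<le> lam"
 shows "\<exists>k>0. \<forall>\<phi>. test_fun a b \<phi> \<longrightarrow> k * (nW a b s \<phi>)^2 \<le> Aform a b (2 * s) p lam m c \<phi> \<phi>"
proof -
 obtain k where k: "k > 0" "\<And>\<phi>. test_fun a b \<phi> \<Longrightarrow> ennreal k * W s a b \<phi> \<le> ennreal (- L2ip a b (DL a s lam \<phi>) (DR b s lam \<phi>) + lam powr (2 * s) * L2ip a b \<phi> \<phi> + \<kappa> * L2ip a b \<phi> \<phi>)"
  using form_coercive[OF s ab lam \<kappa>(1)] by blast
 have "k * (nW a b s \<phi>)^2 \<le> Aform a b (2 * s) p lam m c \<phi> \<phi>" if \<phi>: "test_fun a b \<phi>" for \<phi>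
 \<comment> \<open>\<open>ennreal\<close> truncates negative reals to 0, so the inequality of
   \<open>form_coercive\<close> transfers to the reals when its left side is positive. If
   \<open>nW\<close> is 0, boundedness makes the form vanish.\<close>
 proof (cases "nW a b s \<phi> = 0")
  case False
  have L: "bounded_test_op s a b (DL a s lam)" "bounded_test_op s a b (DL a s 0)" "bounded_test_op s a b (DR b s lam)" and R: "bounded_test_op (1 - s) a b (DR b (1 - s) 0)"
   using s by (auto intro!: bounded_test_op_DL bounded_test_op_DR ab)
  have \<phi>H: "\<phi> \<in> H0 s a b" by (rule test_H0[OF ab s \<phi>])
  have s': "0 \<le> s" "s \<noteq> 1/2" "0 \<le> 1 - s" "1 - s \<le> 1" "1 - s \<noteq> 1/2" using s by auto
  have lE: "L2i a b (ext_op s a b D \<phi>)" if "bounded_test_op s a b D" for D using bounded_op_ext_same[OF ab s that] \<phi>H unfolding bounded_op_def by blast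
  have lE': "L2i a b (ext_op (1 - s) a b (DR b (1 - s) 0) \<phi>)" using bounded_op_ext_lower[OF ab s R] \<phi>H unfolding bounded_op_def by blast
  have lD: "L2i a b (D \<phi>)" if "bounded_test_op s a b D" for D by (rule L2i_op_test[OF s'(1) s(2) that \<phi>])
  have lD': "L2i a b (DR b (1 - s) 0 \<phi>)" by (rule L2i_op_test[OF s'(3,4) R \<phi>])
  have lM: "L2i a b (ext_op (1 - s) a b (DR b (1 - s) 0) (\<lambda>x. m x * \<phi> x))" using bounded_op_ext_mult[OF ab s R q cm] \<phi>H unfolding bounded_op_def by blast
  have left: "L2ip a b (ext_op s a b D \<phi>) h = L2ip a b (D \<phi>) h" if D: "bounded_test_op s a b D" and h: "L2i a b h" for D h
   by (rule L2ip_cong_AE(1)[OF ext_op_test[OF s'(1) s(2) s'(2) ab D \<phi>] lE[OF D] lD[OF D] h])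
  have right: "L2ip a b h (ext_op (1 - s) a b (DR b (1 - s) 0) \<phi>) = L2ip a b h (DR b (1 - s) 0 \<phi>)" if h: "L2i a b h" for h
   by (rule L2ip_cong_AE(2)[OF ext_op_test[OF s'(3,4,5) ab R \<phi>] lE' lD' h])
  have LR: "L2ip a b (ext_op s a b (DL a s lam) \<phi>) (ext_op s a b (DR b s lam) \<phi>) = L2ip a b (DL a s lam \<phi>) (DR b s lam \<phi>)"
   unfolding left[OF L(1) lE[OF L(3)]] L2ip_sym[of a b "DL a s lam \<phi>"] by (rule left[OF L(3) lD[OF L(1)]])
  have cv: "L2ip a b (ext_op s a b (DL a s 0) \<phi>) (ext_op (1 - s) a b (DR b (1 - s) 0) \<phi>) = 0"
   unfolding left[OF L(2) lE'] right[OF lD[OF L(2)]] DL_DR_convection[OF s ab \<phi> \<phi>] using integral_self_deriv[OF \<phi>] by (simp add: mult.commute)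
  have A: "Aform a b (2 * s) p lam m c \<phi> \<phi> = - L2ip a b (DL a s lam \<phi>) (DR b s lam \<phi>) + lam powr (2 * s) * L2ip a b \<phi> \<phi>
    + (L2ip a b (DL a s 0 \<phi>) (ext_op (1 - s) a b (DR b (1 - s) 0) (\<lambda>x. m x * \<phi> x)) + L2ip a b (\<lambda>x. c x * \<phi> x) \<phi>)"
   unfolding Aform_def left[OF L(2) lM, symmetric]
   using LR cv L2ip_sym[of a b "ext_op s a b (DR b s lam) \<phi>" "ext_op s a b (DL a s lam) \<phi>"] by (simp add: algebra_simps)
  have "ennreal (k * (nW a b s \<phi>)^2) \<le> ennreal (- L2ip a b (DL a s lam \<phi>) (DR b s lam \<phi>) + lam powr (2 * s) * L2ip a b \<phi> \<phi> + \<kappa> * L2ip a b \<phi> \<phi>)"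
   using k(2)[OF \<phi>] k(1) by (simp add: nW_square[OF ab s \<phi>H] ennreal_mult)
  moreover have "0 < k * (nW a b s \<phi>)^2" using k(1) False by simp
  ultimately have "k * (nW a b s \<phi>)^2 \<le> - L2ip a b (DL a s lam \<phi>) (DR b s lam \<phi>) + lam powr (2 * s) * L2ip a b \<phi> \<phi> + \<kappa> * L2ip a b \<phi> \<phi>"
   by (auto simp: ennreal_le_iff2)
  then show ?thesis using mult_term_test[OF ab s q cm c \<kappa>(2) \<phi>] unfolding A by linarith
 next
  case True
  obtain C where "\<bar>Aform a b (2 * s) p lam m c \<phi> \<phi>\<bar> \<le> C * nW a b s \<phi> * nW a b s \<phi>"
   using Aform_bform[OF ab s q cm c, of p lam] test_H0[OF ab s \<phi>] unfolding bounded_form_def[OF ab s] by blast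
  then show ?thesis using True by simp
 qed
 then show ?thesis using k(1) by blast
qed

text \<open>The L2 limit g is also the limit in \<open>W\<close>, by \<open>W_limit\<close>.
  Replacing each x n by a test function within 1 / (n + 1) in \<open>W\<close> shows that g again
  belongs to the closure.\<close>

lemma H0_complete:
 assumes ab: "a < b" and s: "1/2 < s" "s \<le> 1" and x: "\<And>n::nat. x n \<in> H0 s a b"
  and C: "\<And>e. 0 < e \<Longrightarrow> \<exists>N. \<forall>m\<ge>N. \<forall>n\<ge>N. (nW a b s (\<lambda>t. x m t - x n t))^2 \<le> e"
 shows "\<exists>u\<in>H0 s a b. (\<lambda>n. nW a b s (\<lambda>t. u t - x n t)) \<longlonglongrightarrow> 0"
proof -
 note z = zext_H0[OF ab s x]
 have C': "\<exists>N. \<forall>m\<ge>N. \<forall>n\<ge>N. W s a b (\<lambda>t. x m t - x n t) \<le> ennreal e" if "0 < e" for e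
  using C[OF that] unfolding nW_square[OF ab s H0_diff[OF ab s x x]] by (meson ennreal_leI)
 have "\<exists>g\<in>Borel. (\<lambda>n. sq2 a b (\<lambda>t. x n t - g t)) \<longlonglongrightarrow> 0"
 proof (rule L2ab_complete[OF z])
  fix e :: real assume "0 < e"
  from C'[OF this] obtain N where N: "\<And>m n. m \<ge> N \<Longrightarrow> n \<ge> N \<Longrightarrow> W s a b (\<lambda>t. x m t - x n t) \<le> ennreal e" by blast
  have "sq2 a b (\<lambda>t. x m t - x n t) \<le> W s a b (\<lambda>t. x m t - x n t)" for m n by (simp add: W_def)
  then have "sq2 a b (\<lambda>t. x m t - x n t) \<le> ennreal e" if "m \<ge> N" "n \<ge> N" for m n using N[OF that] by (rule order_trans)
  then show "\<exists>N. \<forall>m\<ge>N. \<forall>n\<ge>N. sq2 a b (\<lambda>t. x m t - x n t) \<le> ennreal e" by blast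
 qed
 then obtain g where g: "g \<in> Borel" "(\<lambda>n. sq2 a b (\<lambda>t. x n t - g t)) \<longlonglongrightarrow> 0" by blast
 note gz = zext_measurable[OF g(1), of a b]
 have sw: "sq2 a b (\<lambda>t. x n t - g t) = sq2 a b (\<lambda>t. g t - x n t)" for n unfolding sq2_def by (simp add: power2_commute)
 have fin: "sq2 a b (x n) < \<infinity>" for n using W_H0[OF ab s x[of n]] by (simp add: W_def)
 have Wl: "(\<lambda>n. W s a b (\<lambda>t. g t - x n t)) \<longlonglongrightarrow> 0"
  by (rule W_limit[OF gz z ab g(2)[unfolded sw] fin C'])
 have "\<exists>\<phi>. test_fun a b \<phi> \<and> W s a b (\<lambda>t. x n t - \<phi> t) \<le> ennreal (1 / real (Suc n))" for n
 proof -
  obtain \<psi> where \<psi>: "apx s a b (x n) \<psi>" using H0_apx[OF ab s x[of n]] by blast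
  then obtain N where "\<And>j. j \<ge> N \<Longrightarrow> W s a b (\<lambda>t. x n t - \<psi> j t) \<le> ennreal (1 / real (Suc n))"
   using ennreal_null_seqD[of "\<lambda>j. W s a b (\<lambda>t. x n t - \<psi> j t)" "1 / real (Suc n)"] by (auto simp: apx_def)
  then show ?thesis using \<psi> by (auto simp: apx_def)
 qed
 then obtain \<phi> where \<phi>: "\<And>n. test_fun a b (\<phi> n)" "\<And>n. W s a b (\<lambda>t. x n t - \<phi> n t) \<le> ennreal (1 / real (Suc n))" by metis
 have "apx s a b g \<phi>" unfolding apx_def
 proof (intro conjI allI \<phi>(1))
  show "(\<lambda>n. W s a b (\<lambda>t. g t - \<phi> n t)) \<longlonglongrightarrow> 0"
  proof (rule null_seq_le)
   fix n
   have e: "(\<lambda>t. g t - \<phi> n t) = (\<lambda>t. (g t - x n t) + 1 * (x n t - \<phi> n t))" by auto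
   have "W s a b (\<lambda>t. g t - \<phi> n t) \<le> 2 * W s a b (\<lambda>t. g t - x n t) + 2 * (ennreal (1^2) * W s a b (\<lambda>t. x n t - \<phi> n t))"
    unfolding e by (intro W_lin_le zext_diff_measurable gz z zext_test_measurable \<phi>)
   also have "... \<le> 2 * W s a b (\<lambda>t. g t - x n t) + 2 * ennreal (1 / real (Suc n))"
    using \<phi>(2)[of n] by (simp add: add_left_mono mult_left_mono)
   finally show "W s a b (\<lambda>t. g t - \<phi> n t) \<le> 2 * W s a b (\<lambda>t. g t - x n t) + 2 * ennreal (1 / real (Suc n))" .
   have "(\<lambda>n. 1 / real (Suc n)) \<longlonglongrightarrow> 0" using LIMSEQ_inverse_real_of_nat by (simp add: inverse_eq_divide)
   then have "(\<lambda>n. ennreal (1 / real (Suc n))) \<longlonglongrightarrow> 0" using tendsto_ennrealI by force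
   then show "(\<lambda>n. 2 * W s a b (\<lambda>t. g t - x n t) + 2 * ennreal (1 / real (Suc n))) \<longlonglongrightarrow> 0" by (intro null_seq_lin Wl) auto
  qed
 qed
 then have gH: "g \<in> H0 s a b" using H0_iff[of s a b g] s ab g(1) by auto
 have "(\<lambda>n. enn2real (W s a b (\<lambda>t. g t - x n t))) \<longlonglongrightarrow> 0" by (rule tendsto_enn2real) (use Wl in auto)
 then have "(\<lambda>n. nW a b s (\<lambda>t. g t - x n t)) \<longlonglongrightarrow> sqrt 0" unfolding nW_def[OF ab s] by (rule tendsto_real_sqrt)
 then show ?thesis using gH by auto
qed

lemma Hnorm_le_nW:
 assumes ab: "a < b" and s: "1/2 < s" "s \<le> 1" and u: "u \<in> H0 s a b" shows "Hnorm s a b u \<le> nW a b s u"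
 unfolding Hnorm_def nW_def[OF ab s]
 by (intro real_sqrt_le_mono enn2real_mono Hnorm2_le_W zext_H0[OF ab s u]) (use W_H0[OF ab s u] in auto)

text \<open>Boundedness of f makes the supremum finite, and scaling v to unit norm gives the
  estimate. For v of norm 0 scaling is impossible, and the constant K from \<open>Hdual\<close>
  shows that f v = 0.\<close>

lemma dual_norm_bound:
 assumes ab: "a < b" and s: "1/2 < s" "s \<le> 1" and f: "f \<in> Hdual s a b"
 shows "0 \<le> dual_norm s a b f" "\<And>v. v \<in> H0 s a b \<Longrightarrow> \<bar>f v\<bar> \<le> dual_norm s a b f * Hnorm s a b v"
  "\<And>u v r. u \<in> H0 s a b \<Longrightarrow> v \<in> H0 s a b \<Longrightarrow> f (\<lambda>x. u x + r * v x) = f u + r * f v"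
proof -
 have zH: "(\<lambda>x. 0) \<in> H0 s a b" by (rule test_H0[OF ab s test_fun_zero[OF ab]])
 have rH: "(\<lambda>x. r * v x) \<in> H0 s a b" if "v \<in> H0 s a b" for r v using H0_closed[OF ab s zH that, of r] by simp
 have N0: "0 \<le> Hnorm s a b v" for v by (simp add: Hnorm_def)
 have add: "\<And>u v. u \<in> H0 s a b \<Longrightarrow> v \<in> H0 s a b \<Longrightarrow> f (\<lambda>x. u x + v x) = f u + f v" and sc: "\<And>v r. v \<in> H0 s a b \<Longrightarrow> f (\<lambda>x. r * v x) = r * f v"
  using f unfolding Hdual_def by blast+
 obtain K where K: "\<And>v. v \<in> H0 s a b \<Longrightarrow> \<bar>f v\<bar> \<le> K * Hnorm s a b v" using f unfolding Hdual_def by blast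
 show "f (\<lambda>x. u x + r * v x) = f u + r * f v" if "u \<in> H0 s a b" "v \<in> H0 s a b" for u v r
  using add[OF that(1) rH[OF that(2), of r]] sc[OF that(2)] by simp
 have bd: "bdd_above {\<bar>f v\<bar> | v. v \<in> H0 s a b \<and> Hnorm s a b v \<le> 1}"
 proof (rule bdd_aboveI[of _ "\<bar>K\<bar>"])
  fix y assume "y \<in> {\<bar>f v\<bar> | v. v \<in> H0 s a b \<and> Hnorm s a b v \<le> 1}"
  then obtain v where v: "y = \<bar>f v\<bar>" "v \<in> H0 s a b" "Hnorm s a b v \<le> 1" by blast
  have "K * Hnorm s a b v \<le> \<bar>K\<bar> * 1" by (intro mult_mono v) (use N0 in auto)
  then show "y \<le> \<bar>K\<bar>" using K[OF v(2)] v(1) by simp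
 qed
 have up: "\<bar>f v\<bar> \<le> dual_norm s a b f" if "v \<in> H0 s a b" "Hnorm s a b v \<le> 1" for v
  unfolding dual_norm_def by (rule cSup_upper[OF _ bd]) (use that in blast)
 have "Hnorm s a b (\<lambda>x. 0) \<le> nW a b s (\<lambda>x. 0)" by (rule Hnorm_le_nW[OF ab s zH])
 also have "... = 0" by (simp add: nW_def[OF ab s] W_def sq2_def zext_def FN_def fourier_def)
 finally have "\<bar>f (\<lambda>x. 0)\<bar> \<le> dual_norm s a b f" by (intro up zH) simp
 then show "0 \<le> dual_norm s a b f" by simp
 show "\<bar>f v\<bar> \<le> dual_norm s a b f * Hnorm s a b v" if v: "v \<in> H0 s a b" for v
 proof (cases "Hnorm s a b v = 0")
  case True
  then show ?thesis using K[OF v] by simp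
 next
  case False
  define h where "h = Hnorm s a b v"
  have h: "h > 0" using False N0[of v] by (simp add: h_def)
  have fin: "Hnorm2 s a b v < \<infinity>" using Hnorm2_le_W[OF zext_H0[OF ab s v], of s] W_H0[OF ab s v] by (rule le_less_trans)
  have h2: "Hnorm2 s a b v = ennreal (h^2)" using fin by (simp add: h_def Hnorm_def)
  have "Hnorm2 s a b (\<lambda>x. (1/h) * v x) \<le> ennreal ((1/h)^2) * Hnorm2 s a b v" by (rule Hnorm2_cmult_le[OF zext_H0[OF ab s v]]) (use h in simp)
  also have "... = ennreal 1" unfolding h2 using h by (subst ennreal_mult[symmetric]) (auto simp: power_divide)
  finally have "Hnorm s a b (\<lambda>x. (1/h) * v x) \<le> 1" unfolding Hnorm_def by (simp add: enn2real_leI)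
  then have "\<bar>f (\<lambda>x. (1/h) * v x)\<bar> \<le> dual_norm s a b f" by (rule up[OF rH[OF v]])
  then show ?thesis unfolding sc[OF v] h_def[symmetric] using h by (simp add: abs_mult field_simps)
 qed
qed

text \<open>Elements of \<open>H0\<close> are functions rather than classes, so uniqueness is meant
  almost everywhere on (a,b). The constant C is the inverse of the coercivity constant and is fixed
  before f.\<close>

theorem theorem5:
 fixes a b \<alpha> p lam :: real and m m' c :: "real \<Rightarrow> real"
 assumes "a < b" and "1 < \<alpha>" and "\<alpha> \<le> 2" and "0 \<le> p" and "p \<le> 1" and "0 \<le> lam"
  and "\<forall>x\<in>{a..b}. (m has_real_derivative m' x) (at x within {a..b})"
  and "continuous_on {a..b} m'"
  and "continuous_on {a..b} c"
  and "\<forall>x\<in>{a..b}. c x - m' x / 2 > 0"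
 shows "\<exists>C. \<forall>f \<in> Hdual (\<alpha>/2) a b.
      \<exists>u \<in> H0 (\<alpha>/2) a b.
       (\<forall>v \<in> H0 (\<alpha>/2) a b. Aform a b \<alpha> p lam m c u v = f v) \<and>
       (\<forall>w \<in> H0 (\<alpha>/2) a b. (\<forall>v \<in> H0 (\<alpha>/2) a b. Aform a b \<alpha> p lam m c w v = f v)
         \<longrightarrow> (AE x in lborel. x \<in> {a<..<b} \<longrightarrow> w x = u x)) \<and>
       Hnorm (\<alpha>/2) a b u \<le> C * dual_norm (\<alpha>/2) a b f"
proof -
 define s where "s = \<alpha> / 2"
 have \<alpha>: "\<alpha> = 2 * s" by (simp add: s_def)
 have ab: "a < b" and s: "1/2 < s" "s \<le> 1" using assms(1-3) by (auto simp: s_def)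
 have cm: "continuous_on {a..b} m" by (rule DERIV_continuous_on) (use assms(7) in blast)
 obtain q where q: "C1_approx a b m m' q" using C1_approx_exists[OF ab assms(7,8)] by blast
 \<comment> \<open>Compactness of [a,b] makes the strict inequality uniform; this \<kappa> is the
   reserve spent on the L2 part in \<open>form_coercive\<close>.\<close>
 obtain \<kappa> where \<kappa>: "0 < \<kappa>" "\<And>x. x \<in> {a..b} \<Longrightarrow> \<kappa> \<le> c x - m' x / 2"
 proof -
  have "\<exists>x\<in>{a..b}. \<forall>y\<in>{a..b}. c x - m' x / 2 \<le> c y - m' y / 2"
   by (rule continuous_attains_inf) (use ab assms(8,9) in \<open>auto intro!: continuous_intros\<close>)
  then show ?thesis using that assms(10) by blast
 qed
 define A where "A = Aform a b (2 * s) p lam m c"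
 have Ab: "bounded_form a b s A" unfolding A_def by (rule Aform_bform[OF ab s q cm assms(8,9)])
 obtain k0 where k0: "k0 > 0" "\<And>\<phi>. test_fun a b \<phi> \<Longrightarrow> k0 * (nW a b s \<phi>)^2 \<le> A \<phi> \<phi>"
  using Aform_coercive_test[OF ab s q cm assms(8,9) \<kappa> assms(6)] unfolding A_def by blast
 define k where "k = k0 / 2"
 have k: "k > 0" "\<And>u. u \<in> H0 s a b \<Longrightarrow> k * (nW a b s u)^2 \<le> A u u"
  unfolding k_def using k0(1) coercive_density[OF ab s Ab k0] by auto
 obtain C where C: "C > 0" "\<And>u v. u \<in> H0 s a b \<Longrightarrow> v \<in> H0 s a b \<Longrightarrow> \<bar>A u v\<bar> \<le> C * nW a b s u * nW a b s v"
  using Ab unfolding bounded_form_def[OF ab s] by blast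
 have A1: "A (\<lambda>x. u x + r * v x) w = A u w + r * A v w" and A2: "A w (\<lambda>x. u x + r * v x) = A w u + r * A w v"
  if "u \<in> H0 s a b" "v \<in> H0 s a b" "w \<in> H0 s a b" for u v w r using Ab that unfolding bounded_form_def[OF ab s] by blast+
 have zH: "(\<lambda>x. 0) \<in> H0 s a b" by (rule test_H0[OF ab s test_fun_zero[OF ab]])
 have "\<exists>u\<in>H0 s a b. (\<forall>v\<in>H0 s a b. A u v = f v) \<and>
   (\<forall>w\<in>H0 s a b. (\<forall>v\<in>H0 s a b. A w v = f v) \<longrightarrow> (AE x in lborel. x \<in> {a<..<b} \<longrightarrow> w x = u x)) \<and>
   Hnorm s a b u \<le> 1 / k * dual_norm s a b f" if f: "f \<in> Hdual s a b" for f
 proof -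
  note d = dual_norm_bound[OF ab s f]
  \<comment> \<open>\<open>Hnorm\<close> is dominated by \<open>nW\<close>, so f is also bounded in
    the norm in which Lax--Milgram is applied, with the same constant.\<close>
  have fN: "\<bar>f v\<bar> \<le> dual_norm s a b f * nW a b s v" if "v \<in> H0 s a b" for v
   using d(2)[OF that] mult_left_mono[OF Hnorm_le_nW[OF ab s that] d(1)] by linarith
  obtain u where u: "u \<in> H0 s a b" "\<And>v. v \<in> H0 s a b \<Longrightarrow> A u v = f v"
   using lax_milgram[where V="H0 s a b" and A=A and q="nW a b s" and f=f, OF zH H0_closed[OF ab s] A1 A2 C(2,1) k(2,1) nW_nonneg[OF ab s] H0_complete[OF ab s] d(3) fN]
   by blast
  have "AE x in lborel. x \<in> {a<..<b} \<longrightarrow> w x = u x" if w: "w \<in> H0 s a b" "\<And>v. v \<in> H0 s a b \<Longrightarrow> A w v = f v" for w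
  proof -
   \<comment> \<open>Coercivity is applied to the difference of two solutions, on which the form
     vanishes.\<close>
   define e where "e = (\<lambda>x. w x + (-1) * u x)"
   have eH: "e \<in> H0 s a b" unfolding e_def by (rule H0_closed[OF ab s w(1) u(1)])
   have "A e e = A w e + (-1) * A u e" unfolding e_def by (rule A1[OF w(1) u(1) eH[unfolded e_def]])
   then have "k * (nW a b s e)^2 \<le> 0" using k(2)[OF eH] u(2)[OF eH] w(2)[OF eH] by simp
   then have "(nW a b s e)^2 = 0" using k(1) by (simp add: mult_le_0_iff)
   then have "sq2 a b e = 0" using nW_square[OF ab s eH] by (simp add: W_def)
   from sq2_zero_AE[OF zext_H0[OF ab s eH] this] show ?thesis by eventually_elim (simp add: e_def)
  qed
  moreover have "Hnorm s a b u \<le> 1 / k * dual_norm s a b f"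
  proof -
   \<comment> \<open>The equation is tested with v = u; one factor \<open>nW\<close> then cancels
     unless it is 0.\<close>
   have "nW a b s u * (k * nW a b s u) \<le> nW a b s u * dual_norm s a b f"
    using k(2)[OF u(1)] u(2)[OF u(1)] fN[OF u(1)] by (simp add: power2_eq_square mult_ac)
   then have "k * nW a b s u \<le> dual_norm s a b f"
    using d(1) nW_nonneg[OF ab s, of u] by (cases "nW a b s u = 0") (auto simp: mult_le_cancel_left)
   then have "nW a b s u \<le> 1 / k * dual_norm s a b f" using k(1) by (simp add: field_simps)
   then show ?thesis using Hnorm_le_nW[OF ab s u(1)] by linarith
  qed
  ultimately show ?thesis using u by blast
 qed
 then show ?thesis unfolding A_def \<alpha>[symmetric] s_def[symmetric] by (intro exI[of _ "1 / k"] ballI)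
qed

end
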